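(* Let $\Sigma$ be a disk with $n$ punctures and $L\subset\Sigma\times I$ a link. Let $h:\mathbb ZC(\Sigma)\to H_1(\Sigma;\mathbb Z)$ be the linear map with $h(c)=[c]$ for $c\in C(\Sigma)$. Then $h$ induces a ring homomorphism $\chi_h:\mathbb Z[q^{\pm1},x^{\pm1}]\to\mathbb Z[q^{\pm1},y^{\pm1}]$, given by $\chi_h(q)=q$ and $\chi_h(x_c)=y^{h(c)}$ for $c\in C(\Sigma)$, and $$\chi_h\big(\chi(\widetilde{\mathrm{APS}}(L))\big)=\chi(\mathrm{MKh}(L)).$$
   Context: Setting. All links are oriented and considered up to ambient isotopy. $I=[0,1]$ and $\Sigma=\mathbb D^2\setminus\{p_1,\dots,p_n\}$ is an oriented disk with $n$ punctures. A diagram $D\subset\Sigma$ of a link $L\subset\Sigma\times I$ is a generic projection of $L$ to $\Sigma$ with crossing data; it is also a diagram in $\mathbb R^2$ via $\Sigma\hookrightarrow\mathbb R^2$. Khovanov complex over $\mathbb Q$. Order the crossings $c_1,\dots,c_N$ of $D$. The $0$-resolution (resp. $1$-resolution) of a crossing joins the two regions swept out when the overstrand is rotated counterclockwise (resp. clockwise) until it meets the understrand. For $S\in\{0,1\}^N$, $D(S)$ is the collection of circles obtained by replacing each $c_i$ by its $S_i$-resolution. Let $V=\mathbb Q\langle v_+,v_-\rangle$, with quantum degrees $+1,-1$. If $D(S)$ has $k$ circles put $\mathrm{CKh}(D(S))=V^{\otimes k}$; its generators are enhanced states $\{(C_i,s_i)\}_i$, labelings of the circles $C_i$ by signs $s_i\in\{+,-\}$.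 With $n_\pm$ the numbers of positive/negative crossings, $\mathrm{wr}(D)=n_+-n_-$, $|S|=\sum_iS_i$, $$\mathrm{CKh}(D)=\bigoplus_{S}\mathrm{CKh}(D(S))[|S|-n_-]\{|S|-n_-+\mathrm{wr}(D)\},$$ where $[\cdot]$ and $\{\cdot\}$ are shifts of the homological and quantum gradings, $M[i]_m=M_{m-i}$, $M\{i\}_m=M_{m-i}$. If $S'$ is obtained from $S$ by changing one $0$ (in position $j$) to $1$, then $\partial_{S,S'}$ is the merge map ($v_+\otimes v_+\mapsto v_+$, $v_+\otimes v_-,\,v_-\otimes v_+\mapsto v_-$, $v_-\otimes v_-\mapsto 0$) or the split map ($v_+\mapsto v_+\otimes v_-+v_-\otimes v_+$, $v_-\mapsto v_-\otimes v_-$) on the affected factors and the identity on the others; $\partial=\sum(-1)^{\sum_{i<j}S_i}\partial_{S,S'}$. For a filtration $\mathcal F$ of a complex $C$ by a poset, $\mathrm{gr}(C)=\bigoplus_a\mathcal F_aC/\sum_{b<a}\mathcal F_bC$ with the induced differential. $\mathrm{MKh}$. For an enhanced state $x=\{(C_i,s_i)\}_i$ set $g^\Sigma(x)=\sum_is_i[C_i]\in H_1(\Sigma;\mathbb Z)$, circles oriented counterclockwise. Identify $H_1(\Sigma;\mathbb Z)\cong\mathbb Z^n$ via the basis $v_1,\dots,v_n$ of positively oriented loops around the punctures, with the product partial order. $\mathcal F^\Sigma_a$ is the span of generators $x$ with $g^\Sigma(x)\le a$, and $\mathrm{MKh}(L)=H^*(\mathrm{gr}(\mathrm{CKh}(D),\partial,\mathcal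 F^\Sigma))$, with gradings $\mathrm{MKh}^{i,j,v}(L)$ ($i$ homological, $j$ quantum, $v\in H_1(\Sigma;\mathbb Z)$ from $g^\Sigma$). $\widetilde{\mathrm{APS}}$. $C(\Sigma)$ is the set of homotopy classes of unoriented non-trivial simple closed curves in $\Sigma$, and $\mathbb ZC(\Sigma)$ the free abelian group on it. For an enhanced state put $\Phi(x)=\sum_is_i[C_i]\in\mathbb ZC(\Sigma)$, where trivial circles contribute $0$. Let $\epsilon:\mathbb ZC(\Sigma)\to\mathbb Z$ be the sum of coefficients, and let $\alpha\trianglelefteq\beta$ iff $\alpha=\beta$ or $\epsilon(\alpha)<\epsilon(\beta)$. $\mathcal F^\Phi_\alpha$ is the span of generators $x$ with $\Phi(x)\trianglelefteq\alpha$; $\partial$ preserves this filtration, and $\widetilde{\mathrm{APS}}(L)=H^*(\mathrm{gr}^\Phi(\mathrm{CKh}(D)))$, with gradings $\widetilde{\mathrm{APS}}^{i,j,v}(L)$ ($i$ homological, $j$ quantum, $v\in\mathbb ZC(\Sigma)$ from $\Phi$). Euler characteristics. $\mathbb Z[q^{\pm1},x^{\pm1}]$ is the Laurent polynomial ring in $q$ and variables $x_c$, $c\in C(\Sigma)$; $x^v=\prod_cx_c^{v_c}$ for $v=\sum_cv_cc$. $\mathbb Z[q^{\pm1},y^{\pm1}]$ is the Laurent polynomial ring in $q$ and variables $y_1,\dots,y_n$ indexed by the basis $v_1,\dots,v_n$; $y^v=\prod_iy_i^{a_i}$ for $v=\sum_ia_iv_i$. Then $$\chi(\widetilde{\mathrm{APS}}(L))=\sum_{i,j,v}(-1)^iq^jx^v\,\mathrm{rk}\,\widetilde{\mathrm{APS}}^{i,j,v}(L),\qquad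 \chi(\mathrm{MKh}(L))=\sum_{i,j,v}(-1)^iq^jy^v\,\mathrm{rk}\,\mathrm{MKh}^{i,j,v}(L).$$ In $h(c)=[c]$ the curve $c$ is oriented counterclockwise. *)

theory Defs
  imports
    "HOL-Complex_Analysis.Complex_Analysis"
    "HOL-Homology.Homology"
    "HOL-Library.Product_Plus"
    "HOL-Library.Poly_Mapping"
begin

section \<open>The punctured disk, its curves and its first homology\<close>

definition punctures :: "nat \<Rightarrow> (nat \<Rightarrow> complex) \<Rightarrow> bool" where
  "punctures n p \<longleftrightarrow> inj_on p {..<n} \<and> p ` {..<n} \<subseteq> ball 0 1"

definition Sig :: "nat \<Rightarrow> (nat \<Rightarrow> complex) \<Rightarrow> complex set" where
  "Sig n p = cball 0 1 - p ` {..<n}"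

definition parametrizes :: "(real \<Rightarrow> complex) \<Rightarrow> complex set \<Rightarrow> bool" where
  "parametrizes \<gamma> C \<longleftrightarrow> simple_path \<gamma> \<and> pathfinish \<gamma> = pathstart \<gamma> \<and> path_image \<gamma> = C"

text \<open>Unoriented simple closed curves are represented by their images. Both parametrizations
  in the definition of a homotopy class may be chosen freely, so orientations are ignored.\<close>

definition scc :: "complex set \<Rightarrow> complex set \<Rightarrow> bool" where
  "scc X C \<longleftrightarrow> C \<subseteq> X \<and> (\<exists>\<gamma>. parametrizes \<gamma> C)"

definition trivial_curve :: "complex set \<Rightarrow> complex set \<Rightarrow> bool" where
  "trivial_curve X C \<longleftrightarrow> (\<exists>\<gamma> z. parametrizes \<gamma> C \<and> homotopic_loops X \<gamma> (\<lambda>_. z))"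

definition curve_class :: "complex set \<Rightarrow> complex set \<Rightarrow> complex set set" where
  "curve_class X C =
     {C'. scc X C' \<and> (\<exists>\<gamma> \<gamma>'. parametrizes \<gamma> C \<and> parametrizes \<gamma>' C' \<and> homotopic_loops X \<gamma> \<gamma>')}"

definition curve_classes :: "complex set \<Rightarrow> complex set set set" where
  "curve_classes X = curve_class X ` {C. scc X C \<and> \<not> trivial_curve X C}"

definition loop_class :: "complex set \<Rightarrow> (real \<Rightarrow> complex) \<Rightarrow> complex chain set" where
  "loop_class X \<gamma> =
     homologous_rel_set 1 (top_of_set X) {} (frag_of (\<lambda>x\<in>standard_simplex 1. \<gamma> (x 1)))"

definition puncture_radius :: "nat \<Rightarrow> (nat \<Rightarrow> complex) \<Rightarrow> real" where
  "puncture_radius n p =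
     (SOME r. 0 < r \<and> (\<forall>i<n. cball (p i) r \<subseteq> ball 0 1 \<and> cball (p i) r \<inter> p ` {..<n} = {p i}))"

definition puncture_loop :: "nat \<Rightarrow> (nat \<Rightarrow> complex) \<Rightarrow> nat \<Rightarrow> real \<Rightarrow> complex" where
  "puncture_loop n p i = circlepath (p i) (puncture_radius n p)"

text \<open>The identification of the first homology group with the integer vectors of length \<open>n\<close>
  (finitely supported functions with support in \<open>{..<n}\<close>): coordinates with respect to the
  classes of the puncture loops. Homology groups are written multiplicatively in the library.\<close>

definition H1_coords :: "nat \<Rightarrow> (nat \<Rightarrow> complex) \<Rightarrow> complex chain set \<Rightarrow> (nat \<Rightarrow>\<^sub>0 int)" where
  "H1_coords n p \<xi> =
     (let H = homology_group 1 (top_of_set (Sig n p))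
      in THE a. Poly_Mapping.keys a \<subseteq> {..<n} \<and>
           \<xi> = finprod H
             (\<lambda>i. loop_class (Sig n p) (puncture_loop n p i) [^]\<^bsub>H\<^esub> Poly_Mapping.lookup a i) {..<n})"

definition counterclockwise :: "(real \<Rightarrow> complex) \<Rightarrow> bool" where
  "counterclockwise \<gamma> \<longleftrightarrow> (\<forall>z\<in>inside (path_image \<gamma>). winding_number \<gamma> z = 1)"

definition circle_H1 :: "nat \<Rightarrow> (nat \<Rightarrow> complex) \<Rightarrow> complex set \<Rightarrow> (nat \<Rightarrow>\<^sub>0 int)" where
  "circle_H1 n p C =
     H1_coords n p (loop_class (Sig n p) (SOME \<gamma>. parametrizes \<gamma> C \<and> counterclockwise \<gamma>))"

definition class_H1 :: "nat \<Rightarrow> (nat \<Rightarrow> complex) \<Rightarrow> complex set set \<Rightarrow> (nat \<Rightarrow>\<^sub>0 int)" where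
  "class_H1 n p c = circle_H1 n p (SOME C. C \<in> c)"

text \<open>\<open>frag_extend\<close> is the extension of a map on a basis to a linear map on the free abelian
  group.\<close>

definition h_map :: "nat \<Rightarrow> (nat \<Rightarrow> complex) \<Rightarrow> (complex set set \<Rightarrow>\<^sub>0 int) \<Rightarrow> (nat \<Rightarrow>\<^sub>0 int)" where
  "h_map n p = frag_extend (class_H1 n p)"


section \<open>Links and their diagrams\<close>

text \<open>An oriented link is given by parametrizations of its components by the unit circle, the
  orientation being the counterclockwise one of the unit circle.\<close>

record link =
  ncomp :: nat
  lcomp :: "nat \<Rightarrow> complex \<Rightarrow> complex \<times> real"

definition link_points :: "link \<Rightarrow> (nat \<times> complex) set" where
  "link_points L = {..<ncomp L} \<times> sphere 0 1"

definition is_link :: "nat \<Rightarrow> (nat \<Rightarrow> complex) \<Rightarrow> link \<Rightarrow> bool" where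
  "is_link n p L \<longleftrightarrow>
     (\<forall>k<ncomp L. continuous_on (sphere 0 1) (lcomp L k)) \<and>
     inj_on (\<lambda>(k, z). lcomp L k z) (link_points L) \<and>
     (\<lambda>(k, z). lcomp L k z) ` link_points L \<subseteq> Sig n p \<times> {0..1}"

definition ambient_isotopic :: "nat \<Rightarrow> (nat \<Rightarrow> complex) \<Rightarrow> link \<Rightarrow> link \<Rightarrow> bool" where
  "ambient_isotopic n p L L' \<longleftrightarrow>
     ncomp L = ncomp L' \<and>
     (\<exists>F :: real \<Rightarrow> complex \<times> real \<Rightarrow> complex \<times> real.
        let M = Sig n p \<times> {0..1} in
        continuous_on ({0..1} \<times> M) (\<lambda>(t, x). F t x) \<and>
        (\<forall>t\<in>{0..1}. \<exists>G. homeomorphism M M (F t) G) \<and>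
        (\<forall>x\<in>M. F 0 x = x) \<and>
        (\<forall>(k, z)\<in>link_points L. lcomp L' k z = F 1 (lcomp L k z)))"

text \<open>A diagram consists of a link in generic position together with its ordered crossings. The
  crossing \<open>c\<close> is described by a disk neighbourhood of it in \<open>Sig n p\<close>, the image of the closed
  unit disk under the orientation preserving embedding \<open>cdisk c\<close>. Inside this neighbourhood
  the overstrand is the image of the real diameter and the understrand is the image of the
  imaginary diameter. The strands are the arcs of the components \<open>ocomp c\<close> and \<open>ucomp c\<close> that are
  traced out by the angles \<open>oangle c t\<close> and \<open>uangle c t\<close> for \<open>t\<close> in \<open>{-1..1}\<close>.\<close>

record diagram =
  dlink :: link
  ncross :: nat
  cdisk :: "nat \<Rightarrow> complex \<Rightarrow> complex"
  ocomp :: "nat \<Rightarrow> nat"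
  oangle :: "nat \<Rightarrow> real \<Rightarrow> real"
  ucomp :: "nat \<Rightarrow> nat"
  uangle :: "nat \<Rightarrow> real \<Rightarrow> real"

definition dproj :: "diagram \<Rightarrow> nat \<times> complex \<Rightarrow> complex" where
  "dproj D = (\<lambda>(k, z). fst (lcomp (dlink D) k z))"

definition dheight :: "diagram \<Rightarrow> nat \<times> complex \<Rightarrow> real" where
  "dheight D = (\<lambda>(k, z). snd (lcomp (dlink D) k z))"

definition dcurve :: "diagram \<Rightarrow> complex set" where
  "dcurve D = dproj D ` link_points (dlink D)"

definition over_pt :: "diagram \<Rightarrow> nat \<Rightarrow> real \<Rightarrow> nat \<times> complex" where
  "over_pt D c t = (ocomp D c, cis (oangle D c t))"

definition under_pt :: "diagram \<Rightarrow> nat \<Rightarrow> real \<Rightarrow> nat \<times> complex" where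
  "under_pt D c t = (ucomp D c, cis (uangle D c t))"

definition crossing_disks :: "nat \<Rightarrow> (nat \<Rightarrow> complex) \<Rightarrow> diagram \<Rightarrow> bool" where
  "crossing_disks n p D \<longleftrightarrow>
     (\<forall>c<ncross D.
        continuous_on (cball 0 1) (cdisk D c) \<and> inj_on (cdisk D c) (cball 0 1) \<and>
        cdisk D c ` cball 0 1 \<subseteq> Sig n p \<and>
        winding_number (cdisk D c \<circ> circlepath 0 1) (cdisk D c 0) = 1 \<and>
        dcurve D \<inter> cdisk D c ` cball 0 1 =
          cdisk D c ` (closed_segment (-1) 1 \<union> closed_segment (-\<i>) \<i>)) \<and>
     disjoint_family_on (\<lambda>c. cdisk D c ` cball 0 1) {..<ncross D}"

definition crossing_strands :: "diagram \<Rightarrow> bool" where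
  "crossing_strands D \<longleftrightarrow>
     (\<forall>c<ncross D.
        ocomp D c < ncomp (dlink D) \<and> ucomp D c < ncomp (dlink D) \<and>
        continuous_on {-1..1} (oangle D c) \<and> continuous_on {-1..1} (uangle D c) \<and>
        (\<forall>t\<in>{-1..1}. dproj D (over_pt D c t) = cdisk D c (complex_of_real t) \<and>
                     dproj D (under_pt D c t) = cdisk D c (\<i> * complex_of_real t)) \<and>
        dheight D (under_pt D c 0) < dheight D (over_pt D c 0))"

definition double_points :: "diagram \<Rightarrow> bool" where
  "double_points D \<longleftrightarrow>
     (\<forall>x\<in>link_points (dlink D). \<forall>y\<in>link_points (dlink D).
        x \<noteq> y \<and> dproj D x = dproj D y \<longrightarrow> (\<exists>c<ncross D. {x, y} = {over_pt D c 0, under_pt D c 0}))"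

definition is_diagram_of :: "nat \<Rightarrow> (nat \<Rightarrow> complex) \<Rightarrow> link \<Rightarrow> diagram \<Rightarrow> bool" where
  "is_diagram_of n p L D \<longleftrightarrow>
     is_link n p (dlink D) \<and> ambient_isotopic n p L (dlink D) \<and>
     crossing_disks n p D \<and> crossing_strands D \<and> double_points D"

text \<open>A crossing is positive iff the directions of the over- and the understrand form a positive
  basis, i.e. iff both strands follow the directions \<open>1\<close> and \<open>\<i>\<close> in the crossing disk or both
  are opposite to them.\<close>

definition positive_crossing :: "diagram \<Rightarrow> nat \<Rightarrow> bool" where
  "positive_crossing D c \<longleftrightarrow>
     (oangle D c (-1) < oangle D c 1 \<longleftrightarrow> uangle D c (-1) < uangle D c 1)"

definition n_plus :: "diagram \<Rightarrow> int" where
  "n_plus D = int (card {c. c < ncross D \<and> positive_crossing D c})"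

definition n_minus :: "diagram \<Rightarrow> int" where
  "n_minus D = int (card {c. c < ncross D \<and> \<not> positive_crossing D c})"

definition writhe :: "diagram \<Rightarrow> int" where
  "writhe D = n_plus D - n_minus D"


section \<open>Resolutions and the Khovanov complex\<close>

text \<open>Rotated counterclockwise, the overstrand (the real diameter) sweeps out the first and the
  third quadrant. The 0-resolution joins these two, so its arcs cut off the second and the fourth
  quadrant.\<close>

definition res_arcs :: "nat \<Rightarrow> complex set" where
  "res_arcs b = (if b = 0 then closed_segment 1 (-\<i>) \<union> closed_segment \<i> (-1)
                 else closed_segment 1 \<i> \<union> closed_segment (-1) (-\<i>))"

definition resolution :: "diagram \<Rightarrow> (nat \<Rightarrow> nat) \<Rightarrow> complex set" where
  "resolution D S = (dcurve D - (\<Union>c<ncross D. cdisk D c ` cball 0 1))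
                    \<union> (\<Union>c<ncross D. cdisk D c ` res_arcs (S c))"

definition circles :: "diagram \<Rightarrow> (nat \<Rightarrow> nat) \<Rightarrow> complex set set" where
  "circles D S = components (resolution D S)"

type_synonym state = "(nat \<Rightarrow> nat) \<times> (complex set \<Rightarrow> int)"

definition labelings :: "diagram \<Rightarrow> (nat \<Rightarrow> nat) \<Rightarrow> (complex set \<Rightarrow> int) set" where
  "labelings D S = circles D S \<rightarrow>\<^sub>E {-1, 1}"

definition states :: "diagram \<Rightarrow> state set" where
  "states D = (SIGMA S:({..<ncross D} \<rightarrow>\<^sub>E {0, 1}). labelings D S)"

definition weight :: "diagram \<Rightarrow> (nat \<Rightarrow> nat) \<Rightarrow> int" where
  "weight D S = (\<Sum>c<ncross D. int (S c))"

definition hdeg :: "diagram \<Rightarrow> state \<Rightarrow> int" where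
  "hdeg D = (\<lambda>(S, s). weight D S - n_minus D)"

definition qdeg :: "diagram \<Rightarrow> state \<Rightarrow> int" where
  "qdeg D = (\<lambda>(S, s). (\<Sum>C\<in>circles D S. s C) + (weight D S - n_minus D + writhe D))"

text \<open>The matrix entry, for the generators labelled by \<open>s\<close> and \<open>s'\<close>, of the merge or split map of
  an edge of the cube from \<open>S\<close> to \<open>S'\<close>. The circles not touched by the edge are those common to
  both resolutions.\<close>

definition edge_coeff ::
  "diagram \<Rightarrow> (nat \<Rightarrow> nat) \<Rightarrow> (nat \<Rightarrow> nat) \<Rightarrow> (complex set \<Rightarrow> int) \<Rightarrow> (complex set \<Rightarrow> int) \<Rightarrow> rat"
where
  "edge_coeff D S S' s s' =
     (let old = circles D S - circles D S'; new = circles D S' - circles D S in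
      if (\<forall>C\<in>circles D S \<inter> circles D S'. s C = s' C) \<and>
         ((\<exists>A B C. A \<noteq> B \<and> old = {A, B} \<and> new = {C} \<and>
             (s A, s B, s' C) \<in> {(1, 1, 1), (1, -1, -1), (-1, 1, -1)}) \<or>
          (\<exists>A B C. B \<noteq> C \<and> old = {A} \<and> new = {B, C} \<and>
             (s A, s' B, s' C) \<in> {(1, 1, -1), (1, -1, 1), (-1, -1, -1)}))
      then 1 else 0)"

definition scale :: "rat \<Rightarrow> (state \<Rightarrow>\<^sub>0 rat) \<Rightarrow> (state \<Rightarrow>\<^sub>0 rat)" where
  "scale r z = Poly_Mapping.map (\<lambda>t. r * t) z"

definition bd_state :: "diagram \<Rightarrow> state \<Rightarrow> (state \<Rightarrow>\<^sub>0 rat)" where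
  "bd_state D = (\<lambda>(S, s). \<Sum>j\<in>{j. j < ncross D \<and> S j = 0}. \<Sum>s'\<in>labelings D (S(j := 1)).
     Poly_Mapping.single (S(j := 1), s')
       ((-1) ^ (\<Sum>i<j. S i) * edge_coeff D S (S(j := 1)) s s'))"

definition bd :: "diagram \<Rightarrow> (state \<Rightarrow>\<^sub>0 rat) \<Rightarrow> (state \<Rightarrow>\<^sub>0 rat)" where
  "bd D z = (\<Sum>x\<in>Poly_Mapping.keys z. scale (Poly_Mapping.lookup z x) (bd_state D x))"


section \<open>Quotient spaces, dimension and the homology of the associated graded complex\<close>

text \<open>Rational vector spaces are represented by the module records of HOL-Algebra, whose
  multiplicative fields are irrelevant.\<close>

definition chain_space :: "(state \<Rightarrow>\<^sub>0 rat) set \<Rightarrow> (rat, state \<Rightarrow>\<^sub>0 rat) module" where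
  "chain_space W = \<lparr>carrier = W, mult = undefined, one = undefined, zero = 0, add = (+),
                    smult = scale\<rparr>"

definition quotient_space :: "(rat, 'v) module \<Rightarrow> 'v set \<Rightarrow> (rat, 'v set) module" where
  "quotient_space M U = \<lparr>carrier = a_rcosets\<^bsub>M\<^esub> U, mult = undefined, one = undefined,
                         zero = U, add = set_add M,
                         smult = (\<lambda>r X. U <+>\<^bsub>M\<^esub> (\<lambda>x. r \<odot>\<^bsub>M\<^esub> x) ` X)\<rparr>"

definition is_basis :: "(rat, 'v) module \<Rightarrow> 'v set \<Rightarrow> bool" where
  "is_basis M E \<longleftrightarrow> finite E \<and> E \<subseteq> carrier M \<and>
     (\<forall>x\<in>carrier M. \<exists>!c. c \<in> E \<rightarrow>\<^sub>E UNIV \<and> x = (\<Oplus>\<^bsub>M\<^esub>e\<in>E. c e \<odot>\<^bsub>M\<^esub> e))"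

definition dimension_of :: "(rat, 'v) module \<Rightarrow> nat" where
  "dimension_of M = (THE d. \<exists>E. is_basis M E \<and> card E = d)"

text \<open>In the following definitions \<open>(A, leq)\<close> is the poset indexing the filtration and \<open>g\<close> is the
  map from enhanced states to \<open>A\<close> defining it. Everything is restricted to homological degree
  \<open>i\<close> and quantum degree \<open>j\<close>.\<close>

definition filt ::
  "diagram \<Rightarrow> ('a \<Rightarrow> 'a \<Rightarrow> bool) \<Rightarrow> (state \<Rightarrow> 'a) \<Rightarrow> int \<Rightarrow> int \<Rightarrow> 'a \<Rightarrow> (state \<Rightarrow>\<^sub>0 rat) set"
where
  "filt D leq g i j a = Modules.module.span scale
     ((\<lambda>x. Poly_Mapping.single x 1) ` {x\<in>states D. hdeg D x = i \<and> qdeg D x = j \<and> leq (g x) a})"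

definition filt_below ::
  "diagram \<Rightarrow> 'a set \<Rightarrow> ('a \<Rightarrow> 'a \<Rightarrow> bool) \<Rightarrow> (state \<Rightarrow> 'a) \<Rightarrow> int \<Rightarrow> int \<Rightarrow> 'a \<Rightarrow>
   (state \<Rightarrow>\<^sub>0 rat) set"
where
  "filt_below D A leq g i j a =
     Modules.module.span scale (\<Union>b\<in>{b\<in>A. leq b a \<and> b \<noteq> a}. filt D leq g i j b)"

definition gr ::
  "diagram \<Rightarrow> 'a set \<Rightarrow> ('a \<Rightarrow> 'a \<Rightarrow> bool) \<Rightarrow> (state \<Rightarrow> 'a) \<Rightarrow> int \<Rightarrow> int \<Rightarrow> 'a \<Rightarrow>
   (rat, (state \<Rightarrow>\<^sub>0 rat) set) module"
where
  "gr D A leq g i j a =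
     quotient_space (chain_space (filt D leq g i j a)) (filt_below D A leq g i j a)"

text \<open>The induced differential from degree \<open>i\<close> to degree \<open>i + 1\<close>: the coset of \<open>z\<close> is mapped to the
  coset of the boundary of \<open>z\<close>.\<close>

definition gr_bd ::
  "diagram \<Rightarrow> 'a set \<Rightarrow> ('a \<Rightarrow> 'a \<Rightarrow> bool) \<Rightarrow> (state \<Rightarrow> 'a) \<Rightarrow> int \<Rightarrow> int \<Rightarrow> 'a \<Rightarrow>
   (state \<Rightarrow>\<^sub>0 rat) set \<Rightarrow> (state \<Rightarrow>\<^sub>0 rat) set"
where
  "gr_bd D A leq g i j a X =
     filt_below D A leq g (i + 1) j a <+>\<^bsub>chain_space (filt D leq g (i + 1) j a)\<^esub> bd D ` X"

definition gr_homology ::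
  "diagram \<Rightarrow> 'a set \<Rightarrow> ('a \<Rightarrow> 'a \<Rightarrow> bool) \<Rightarrow> (state \<Rightarrow> 'a) \<Rightarrow> int \<Rightarrow> int \<Rightarrow> 'a \<Rightarrow>
   (rat, (state \<Rightarrow>\<^sub>0 rat) set set) module"
where
  "gr_homology D A leq g i j a =
     quotient_space
       (gr D A leq g i j a
          \<lparr>carrier := {X \<in> carrier (gr D A leq g i j a).
                         gr_bd D A leq g i j a X = \<zero>\<^bsub>gr D A leq g (i + 1) j a\<^esub>}\<rparr>)
       (gr_bd D A leq g (i - 1) j a ` carrier (gr D A leq g (i - 1) j a))"


section \<open>The two homology theories and their Euler characteristics\<close>

definition g_Sigma :: "nat \<Rightarrow> (nat \<Rightarrow> complex) \<Rightarrow> diagram \<Rightarrow> state \<Rightarrow> (nat \<Rightarrow>\<^sub>0 int)" where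
  "g_Sigma n p D = (\<lambda>(S, s). \<Sum>C\<in>circles D S. frag_cmul (s C) (circle_H1 n p C))"

definition int_vectors :: "nat \<Rightarrow> (nat \<Rightarrow>\<^sub>0 int) set" where
  "int_vectors n = {a. Poly_Mapping.keys a \<subseteq> {..<n}}"

definition product_le :: "(nat \<Rightarrow>\<^sub>0 int) \<Rightarrow> (nat \<Rightarrow>\<^sub>0 int) \<Rightarrow> bool" where
  "product_le a b \<longleftrightarrow> (\<forall>i. Poly_Mapping.lookup a i \<le> Poly_Mapping.lookup b i)"

definition MKh ::
  "nat \<Rightarrow> (nat \<Rightarrow> complex) \<Rightarrow> diagram \<Rightarrow> int \<Rightarrow> int \<Rightarrow> (nat \<Rightarrow>\<^sub>0 int) \<Rightarrow>
   (rat, (state \<Rightarrow>\<^sub>0 rat) set set) module"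
where
  "MKh n p D = gr_homology D (int_vectors n) product_le (g_Sigma n p D)"

definition Phi :: "nat \<Rightarrow> (nat \<Rightarrow> complex) \<Rightarrow> diagram \<Rightarrow> state \<Rightarrow> (complex set set \<Rightarrow>\<^sub>0 int)" where
  "Phi n p D = (\<lambda>(S, s). \<Sum>C\<in>{C\<in>circles D S. \<not> trivial_curve (Sig n p) C}.
     frag_cmul (s C) (frag_of (curve_class (Sig n p) C)))"

definition curve_group :: "nat \<Rightarrow> (nat \<Rightarrow> complex) \<Rightarrow> (complex set set \<Rightarrow>\<^sub>0 int) set" where
  "curve_group n p = {v. Poly_Mapping.keys v \<subseteq> curve_classes (Sig n p)}"

definition coeff_sum :: "('c \<Rightarrow>\<^sub>0 int) \<Rightarrow> int" where
  "coeff_sum v = (\<Sum>c\<in>Poly_Mapping.keys v. Poly_Mapping.lookup v c)"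

definition coeff_sum_le :: "('c \<Rightarrow>\<^sub>0 int) \<Rightarrow> ('c \<Rightarrow>\<^sub>0 int) \<Rightarrow> bool" where
  "coeff_sum_le a b \<longleftrightarrow> a = b \<or> coeff_sum a < coeff_sum b"

definition APS ::
  "nat \<Rightarrow> (nat \<Rightarrow> complex) \<Rightarrow> diagram \<Rightarrow> int \<Rightarrow> int \<Rightarrow> (complex set set \<Rightarrow>\<^sub>0 int) \<Rightarrow>
   (rat, (state \<Rightarrow>\<^sub>0 rat) set set) module"
where
  "APS n p D = gr_homology D (curve_group n p) coeff_sum_le (Phi n p D)"

text \<open>The Laurent polynomial ring in \<open>q\<close> and variables indexed by the set \<open>V\<close> is the group ring
  of the direct sum of the integers and the free abelian group on \<open>V\<close>. The monomial with
  exponent \<open>j\<close> of \<open>q\<close> and exponent vector \<open>v\<close> is \<open>lmonom j v\<close>.\<close>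

type_synonym 'c laurent = "(int \<times> ('c \<Rightarrow>\<^sub>0 int)) \<Rightarrow>\<^sub>0 int"

definition laurent_ring :: "'c set \<Rightarrow> 'c laurent ring" where
  "laurent_ring V =
     \<lparr>carrier = {f. \<forall>(j, v)\<in>Poly_Mapping.keys f. Poly_Mapping.keys v \<subseteq> V},
      mult = (*), one = 1, zero = 0, add = (+)\<rparr>"

definition lmonom :: "int \<Rightarrow> ('c \<Rightarrow>\<^sub>0 int) \<Rightarrow> 'c laurent" where
  "lmonom j v = Poly_Mapping.single (j, v) 1"

definition qvar :: "'c laurent" where
  "qvar = lmonom 1 0"

definition lvar :: "'c \<Rightarrow> 'c laurent" where
  "lvar c = lmonom 0 (frag_of c)"

definition euler_char ::
  "'c set \<Rightarrow> (int \<Rightarrow> int \<Rightarrow> ('c \<Rightarrow>\<^sub>0 int) \<Rightarrow> (rat, 'v) module) \<Rightarrow> 'c laurent"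
where
  "euler_char V H =
     (\<Sum>(i, j, v)\<in>{(i, j, v). Poly_Mapping.keys v \<subseteq> V \<and> dimension_of (H i j v) \<noteq> 0}.
        frag_cmul ((if even i then 1 else -1) * int (dimension_of (H i j v))) (lmonom j v))"

end

theory Submission
  imports Defs
begin

text \<open>
  The Euler characteristic of the homology of the associated graded complex is the graded count of its
  generators, the enhanced states. So \<open>\<chi>(APS)\<close> is the signed sum over all enhanced states \<open>x\<close> of the monomials
  \<open>q^j x^\<Phi>(x)\<close>, and \<open>\<chi>(MKh)\<close> is the one of \<open>q^j y^g(x)\<close>. Since \<open>h\<close> maps the class of a circle
  (or \<open>0\<close>, if the circle is trivial) to its homology class, \<open>h(\<Phi>(x)) = g(x)\<close>, and the substitution \<open>\<chi>_h\<close> matches the two sums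
  term by term.

  This count needs that \<open>\<partial>\<partial> = 0\<close> and that \<open>\<partial>\<close> respects both filtrations.
  Changing the smoothing at a crossing replaces two circles \<open>A\<close>, \<open>B\<close> by one circle \<open>C\<close> or conversely, because the
  boundary points of two arcs joining opposite corners of the crossing disk would be interlaced.
  The three circles bound a pair of pants: \<open>C\<close> is freely homotopic to a product of conjugates of
  \<open>A\<close> and \<open>B\<close>. Hence their winding numbers about the punctures satisfy \<open>w_C = w_A + w_B\<close>, and if one of the circles is
  trivial, then the other two are homotopic; these are the facts behind the two filtrations.
  The identification of the first homology of the punctured disk with integer vectors is by winding numbers about the punctures;
  that the puncture loops generate follows by adding the punctures one at a time, using excision.
\<close>

section \<open>Arcs, closed curves and one-manifolds\<close>

text \<open>The crossing disks are merely topological embeddings, so the planar pictures have to be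
  replaced by point-set statements: circles arise as finite families of arcs and closed curves that
  are cut and glued along arcs. The cutting is done on the embedded link, where the strands are
  disjoint, and only the remainder is projected. For \<partial>\<partial> = 0 the obstacle is the
  number of ways in which two crossings can interact in the plane. It is avoided by transposing: on
  functions of finite sets of points outside the crossing disks every merge is the identity and
  every split is a sum of two insertions. Of the geometry there remains a count of circles around a
  square, with a connectivity check in two exceptional patterns. Orientations are the other
  difficulty. Circles are unoriented sets, so a winding number of a circle is known only up to sign.
  This is harmless, because both filtrations ask for no more than the triangle inequalities between
  the three circles of a pair of pants.\<close>

lemma homeomorphism_image2_eq:
  assumes "homeomorphism S K g h" "A \<subseteq> K"
  shows "g ` h ` A = A"
proof -
  have "g (h x) = x" if "x \<in> A" for x using homeomorphism_apply2[OF assms(1)] assms(2) that by blast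
  then show ?thesis by (simp add: image_image)
qed

text \<open>Arcs are recorded as point sets with their ends, because \<open>circles\<close> are
  connected components, that is, sets; the parametrization is hidden in the existential.\<close>

definition arc_between :: "'a::real_normed_vector set \<Rightarrow> 'a \<Rightarrow> 'a \<Rightarrow> bool" where
  "arc_between K u v \<longleftrightarrow> (\<exists>g. arc g \<and> path_image g = K \<and> pathstart g = u \<and> pathfinish g = v)"

definition closed_curve :: "'a::real_normed_vector set \<Rightarrow> bool" where
  "closed_curve K \<longleftrightarrow> (\<exists>g. simple_path g \<and> pathfinish g = pathstart g \<and> path_image g = K)"

lemma arc_between_sym: "arc_between K u v \<Longrightarrow> arc_between K v u"
  unfolding arc_between_def by (metis arc_reversepath path_image_reversepath pathfinish_reversepath pathstart_reversepath)

lemma arc_between_props: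
  assumes "arc_between K u v"
  shows "compact K" "closed K" "connected K" "u \<in> K" "v \<in> K" "u \<noteq> v" "connected (K - {u, v})" "K - {u, v} \<noteq> {}"
proof -
  obtain g where g: "arc g" "path_image g = K" "pathstart g = u" "pathfinish g = v"
    using assms unfolding arc_between_def by blast
  show "compact K" "connected K" "u \<in> K" "v \<in> K" "u \<noteq> v" "closed K"
    using g compact_arc_image connected_arc_image closed_arc_image arc_distinct_ends by (blast, blast, blast, blast, metis, blast)
  show "connected (K - {u, v})" "K - {u, v} \<noteq> {}"
    using connected_simple_path_endless[of g] nonempty_simple_path_endless[of g] g arc_imp_simple_path by auto
qed

lemma closed_curve_props:
  assumes "closed_curve K"
  shows "compact K" "closed K" "connected K" "K \<noteq> {}"
  using assms unfolding closed_curve_def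
  by (metis compact_simple_path_image, metis closed_simple_path_image,
      metis connected_simple_path_image, metis path_image_nonempty)

text \<open>Through a homeomorphism of the arc with the unit interval, a connected set containing
  both ends becomes a connected set containing 0 and 1, hence the whole interval.\<close>

lemma connected_subset_arc_eq:
  assumes "arc_between K u v" "connected A" "A \<subseteq> K" "u \<in> A" "v \<in> A"
  shows "A = K"
proof -
  obtain g where g: "arc g" "path_image g = K" "pathstart g = u" "pathfinish g = v"
    using assms unfolding arc_between_def by blast
  then obtain h where h: "homeomorphism {0..1} K g h"
    by (meson homeomorphism_arc)
  then have "connected (h ` A)"
    using assms by (meson connected_continuous_image continuous_on_subset homeomorphism_def)
  moreover have "0 \<in> h ` A" "1 \<in> h ` A"
    using h assms g unfolding pathstart_def pathfinish_def homeomorphism_def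
    by (metis atLeastAtMost_iff image_eqI order_refl zero_le_one)+
  ultimately have "{0..1} \<subseteq> h ` A"
    using connected_contains_Icc by blast
  then have "K \<subseteq> g ` h ` A"
    using h unfolding homeomorphism_def by blast
  also have "\<dots> = A" using homeomorphism_image2_eq[OF h assms(3)] .
  finally show ?thesis using assms by blast
qed

text \<open>The points \<open>u\<close> and \<open>v\<close> divide the closed curve into two arcs.
  The interior of \<open>A\<close> is connected and avoids their common ends, so it lies in one of
  the two arcs and \<open>A\<close> equals that arc; the complement is the other one.\<close>

lemma closed_curve_cut:
  assumes K: "closed_curve K" and A: "arc_between A u v" "A \<subseteq> K"
  shows "arc_between (K - (A - {u, v})) u v"
proof -
  note Ap = arc_between_props[OF A(1)]
  obtain g where g: "simple_path g" "pathfinish g = pathstart g" "path_image g = K"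
    using K unfolding closed_curve_def by blast
  obtain c d where cd: "arc c" "arc d" "pathstart c = u" "pathfinish c = v"
       "pathstart d = v" "pathfinish d = u" "path_image c \<inter> path_image d = {u, v}"
       "path_image c \<union> path_image d = path_image g"
    using exists_double_arc[OF g(1,2), of u v] A(2) g(3) Ap(4,5,6) by auto
  define C where "C = path_image c"
  define E where "E = path_image d"
  have CE: "arc_between C u v" "arc_between E u v" "C \<inter> E = {u, v}" "C \<union> E = K"
    using cd g(3) arc_between_sym[of "path_image d" v u] unfolding C_def E_def arc_between_def by auto
  have cl: "closed C" "closed E" using CE arc_between_props by auto
  have "A - {u, v} \<subseteq> C \<or> A - {u, v} \<subseteq> E"
  proof (rule ccontr)
    assume "\<not> ?thesis"
    then have 1: "(A - {u, v}) \<inter> C \<noteq> {}" "(A - {u, v}) \<inter> E \<noteq> {}" using A(2) CE(4) by blast+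
    have "C \<inter> E \<inter> (A - {u, v}) = {}" using CE by blast
    then show False
      using 1 Ap(7) cl A(2) CE(4) connected_closedD[of "A - {u, v}" C E] by blast
  qed
  then have "A \<subseteq> C \<or> A \<subseteq> E" using CE by blast
  then consider "A = C" | "A = E"
    using connected_subset_arc_eq[OF _ Ap(3) _ Ap(4,5)] CE by blast
  then show ?thesis
  proof cases
    case 1 then have "K - (A - {u, v}) = E" using CE by auto
    then show ?thesis using CE by simp
  next
    case 2 then have "K - (A - {u, v}) = C" using CE by auto
    then show ?thesis using CE by simp
  qed
qed

lemma arc_between_subpath:
  assumes "arc g" "s \<in> {0..1}" "t \<in> {0..1}" "s < t"
  shows "arc_between (g ` {s..t}) (g s) (g t)"
proof -
  have "arc (subpath s t g)" using assms by (simp add: arc_subpath_arc)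
  moreover have "path_image (subpath s t g) = g ` {s..t}" using assms by (simp add: path_image_subpath)
  ultimately show ?thesis unfolding arc_between_def by (metis pathstart_subpath pathfinish_subpath)
qed

text \<open>As the ends of \<open>g\<close> lie off \<open>A\<close>, the parameters satisfy
  \<open>0 < s\<close> and \<open>t < 1\<close>, so both remaining pieces are nondegenerate
  arcs.\<close>

lemma arc_cut_aux:
  assumes g: "arc g" and A: "arc_between A (g s) (g t)" "A \<subseteq> path_image g" and "s < t"
    and st: "s \<in> {0..1}" "t \<in> {0..1}" and nin: "g 0 \<notin> A" "g 1 \<notin> A"
  shows "\<exists>K1 K2. arc_between K1 (g 0) (g s) \<and> arc_between K2 (g t) (g 1) \<and> K1 \<inter> K2 = {} \<and>
           K1 \<union> K2 = path_image g - (A - {g s, g t})"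
proof -
  obtain h where h: "homeomorphism {0..1} (path_image g) g h"
    using g by (meson homeomorphism_arc)
  have inj: "inj_on g {0..1}" using g arc_imp_inj_on by blast
  note Ap = arc_between_props[OF A(1)]
  have "connected (h ` A)"
    using A(2) h Ap by (meson connected_continuous_image continuous_on_subset homeomorphism_def)
  moreover have "s \<in> h ` A" "t \<in> h ` A"
    using h Ap(4,5) st unfolding homeomorphism_def by (metis image_eqI)+
  ultimately have "{s..t} \<subseteq> h ` A" using connected_contains_Icc by blast
  then have "g ` {s..t} \<subseteq> g ` h ` A" by blast
  also have "\<dots> = A" using homeomorphism_image2_eq[OF h A(2)] .
  finally have sub: "g ` {s..t} \<subseteq> A" .
  have sa: "arc_between (g ` {s..t}) (g s) (g t)" using arc_between_subpath g st \<open>s < t\<close> by blast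
  have Aeq: "A = g ` {s..t}"
    using connected_subset_arc_eq[OF A(1) arc_between_props(3)[OF sa] sub] arc_between_props(4,5)[OF sa] by blast
  have "0 < s" "t < 1" using nin Ap(4,5) st by (metis atLeastAtMost_iff less_eq_real_def)+
  then have K: "arc_between (g ` {0..s}) (g 0) (g s)" "arc_between (g ` {t..1}) (g t) (g 1)"
    using arc_between_subpath[OF g] st by auto
  have "g ` {0..s} \<inter> g ` {t..1} = {}"
    using inj_on_image_Int[OF inj, of "{0..s}" "{t..1}"] st \<open>s < t\<close> by auto
  moreover have "g ` {0..s} \<union> g ` {t..1} = path_image g - (A - {g s, g t})"
  proof -
    have e: "A - {g s, g t} = g ` {s<..<t}"
    proof -
      have "{s<..<t} = {s..t} - {s,t}" by auto
      moreover have "{s..t} - {s,t} \<subseteq> {0..1}" "{s,t} \<subseteq> {0..1}" using st by auto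
      ultimately have "g ` {s<..<t} = g ` {s..t} - g ` {s,t}"
        using inj_on_image_set_diff[OF inj] by metis
      then show ?thesis using Aeq by simp
    qed
    have "{0..s} \<union> {t..1} = {0..1} - {s<..<t}" using st \<open>s < t\<close> by auto
    moreover have "{0..1} - {s<..<t} \<subseteq> {0..1}" "{s<..<t} \<subseteq> {0..1}" using st by auto
    ultimately have "g ` ({0..s} \<union> {t..1}) = path_image g - g ` {s<..<t}"
      using inj_on_image_set_diff[OF inj] unfolding path_image_def by metis
    then show ?thesis unfolding e image_Un .
  qed
  ultimately show ?thesis using K by (intro exI[of _ "g ` {0..s}"] exI[of _ "g ` {t..1}"] conjI)
qed

text \<open>Which end of \<open>A\<close> is met first along \<open>K\<close> is unknown; hence
  \<open>x\<close> and \<open>y\<close> are determined only up to order.\<close>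

lemma arc_cut:
  assumes K: "arc_between K a b" and A: "arc_between A u v" "A \<subseteq> K" and nin: "a \<notin> A" "b \<notin> A"
  shows "\<exists>K1 K2 x y. {x, y} = {u, v} \<and> arc_between K1 a x \<and> arc_between K2 y b \<and> K1 \<inter> K2 = {} \<and>
           K1 \<union> K2 = K - (A - {u, v})"
proof -
  obtain g where g: "arc g" "path_image g = K" "pathstart g = a" "pathfinish g = b"
    using K unfolding arc_between_def by blast
  note Ap = arc_between_props[OF A(1)]
  obtain s t where st: "s \<in> {0..1}" "t \<in> {0..1}" "u = g s" "v = g t"
    using A(2) Ap(4,5) g(2) unfolding path_image_def by blast
  have ab: "a = g 0" "b = g 1" using g unfolding pathstart_def pathfinish_def by auto
  consider "s < t" | "t < s" using Ap(6) st by fastforce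
  then show ?thesis
  proof cases
    case 1
    show ?thesis
      using arc_cut_aux[OF g(1), of A s t] A st 1 nin ab g(2) by blast
  next
    case 2
    have "arc_between A (g t) (g s)" using A st arc_between_sym by blast
    then show ?thesis
      using arc_cut_aux[OF g(1), of A t s] A st 2 nin ab g(2) insert_commute[of u v "{}"] by simp blast
  qed
qed

lemma arc_close:
  assumes "arc_between K u v" "arc_between A u v" "K \<inter> A \<subseteq> {u, v}"
  shows "closed_curve (K \<union> A)"
proof -
  obtain g where g: "arc g" "path_image g = K" "pathstart g = u" "pathfinish g = v"
    using assms unfolding arc_between_def by blast
  obtain h where h: "arc h" "path_image h = A" "pathstart h = v" "pathfinish h = u"
    using arc_between_sym[OF assms(2)] unfolding arc_between_def by blast
  have "simple_path (g +++ h)" using g h assms(3) by (intro simple_path_join_loop) auto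
  then show ?thesis unfolding closed_curve_def using g h
    by (metis path_image_join pathfinish_join pathstart_join)
qed

lemma arc_concat:
  assumes "arc_between K a u" "arc_between A u v" "K \<inter> A \<subseteq> {u}"
  shows "arc_between (K \<union> A) a v"
proof -
  obtain g where g: "arc g" "path_image g = K" "pathstart g = a" "pathfinish g = u"
    using assms unfolding arc_between_def by blast
  obtain h where h: "arc h" "path_image h = A" "pathstart h = u" "pathfinish h = v"
    using assms unfolding arc_between_def by blast
  have "arc (g +++ h)" using g h assms(3) by (intro arc_join) auto
  then show ?thesis unfolding arc_between_def using g h
    by (metis path_image_join pathfinish_join pathstart_join)
qed

lemma arc_between_image:
  fixes f :: "'a::real_normed_vector \<Rightarrow> 'b::real_normed_vector"
  assumes "arc_between K u v" "continuous_on K f" "inj_on f K"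
  shows "arc_between (f ` K) (f u) (f v)"
proof -
  obtain g where g: "arc g" "path_image g = K" "pathstart g = u" "pathfinish g = v"
    using assms unfolding arc_between_def by blast
  have "arc (f \<circ> g)"
    using g assms unfolding arc_def path_def
    by (metis comp_inj_on continuous_on_compose path_image_def)
  then show ?thesis unfolding arc_between_def using g
    by (metis path_image_compose pathfinish_compose pathstart_compose)
qed

lemma closed_curve_image:
  fixes f :: "'a::real_normed_vector \<Rightarrow> 'b::real_normed_vector"
  assumes "closed_curve K" "continuous_on K f" "inj_on f K"
  shows "closed_curve (f ` K)"
proof -
  obtain g where g: "simple_path g" "path_image g = K" "pathfinish g = pathstart g"
    using assms unfolding closed_curve_def by blast
  have "simple_path (f \<circ> g)"
    using g assms by (metis simple_path_continuous_image)
  then show ?thesis unfolding closed_curve_def using g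
    by (metis path_image_compose pathfinish_compose pathstart_compose)
qed

text \<open>A compact one-dimensional manifold, given by its components; \<open>U\<close> is its boundary.\<close>

definition curve_family :: "'a::real_normed_vector set set \<Rightarrow> 'a set \<Rightarrow> bool" where
  "curve_family \<K> U \<longleftrightarrow> finite \<K> \<and> disjoint \<K> \<and> U \<subseteq> \<Union>\<K> \<and>
     (\<forall>K\<in>\<K>. closed_curve K \<and> K \<inter> U = {} \<or> (\<exists>u v. arc_between K u v \<and> K \<inter> U = {u, v}))"

lemma curve_family_member:
  assumes "curve_family \<K> U" "K \<in> \<K>"
  shows "compact K" "closed K" "connected K" "K \<noteq> {}"
proof -
  have *: "compact K \<and> closed K \<and> connected K \<and> K \<noteq> {}"
    using assms unfolding curve_family_def using closed_curve_props[of K] arc_between_props[of K]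
    by (metis empty_iff)
  show "compact K" "closed K" "connected K" "K \<noteq> {}" using * by auto
qed

lemma connected_in_disjoint_closed:
  assumes "finite \<K>" "disjoint \<K>" "\<And>K. K \<in> \<K> \<Longrightarrow> closed K" "connected A" "A \<subseteq> \<Union>\<K>"
    "K \<in> \<K>" "A \<inter> K \<noteq> {}"
  shows "A \<subseteq> K"
proof -
  have "closed (\<Union>(\<K> - {K}))" using assms by (intro closed_Union) auto
  moreover have "K \<inter> \<Union>(\<K> - {K}) = {}" using assms(2,6) unfolding pairwise_def disjnt_def by fast
  moreover have "A \<subseteq> K \<union> \<Union>(\<K> - {K})" using assms by auto
  ultimately have "A \<inter> \<Union>(\<K> - {K}) = {}"
    using connected_closedD[of A K "\<Union>(\<K> - {K})"] assms by blast
  then show ?thesis using assms(5) by blast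
qed

text \<open>Finitely many disjoint closed connected sets are the components of their union. This
  identifies \<open>circles\<close>, defined as components, with any family obtained by cutting and
  gluing.\<close>

lemma components_curve_family:
  assumes "curve_family \<K> U"
  shows "components (\<Union>\<K>) = \<K>"
proof -
  have f: "finite \<K>" "disjoint \<K>" using assms unfolding curve_family_def by auto
  have comp: "K \<in> components (\<Union>\<K>)" if "K \<in> \<K>" for K
    unfolding in_components_maximal
    using connected_in_disjoint_closed[OF f curve_family_member(2)[OF assms] _ _ that]
      curve_family_member[OF assms that] that by blast
  moreover have "C \<in> \<K>" if C: "C \<in> components (\<Union>\<K>)" for C
  proof -
    obtain x where "x \<in> C" using C in_components_nonempty by blast
    then obtain K where "K \<in> \<K>" "x \<in> K" using C in_components_subset by blast
    then show ?thesis using comp components_eq[OF C, of K] \<open>x \<in> C\<close> by blast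
  qed
  ultimately show ?thesis by blast
qed

section \<open>Cutting and gluing one-manifolds along arcs\<close>

text \<open>By connectedness \<open>A\<close> lies in a single member. A closed curve without the
  interior of \<open>A\<close> is one arc; an arc, whose ends are off \<open>A\<close> because
  \<open>A\<close> avoids \<open>U\<close>, falls into two arcs. In both cases the ends of
  \<open>A\<close> become boundary points.\<close>

lemma curve_family_cut:
  assumes F: "curve_family \<K> U" and A: "arc_between A u v" "A \<subseteq> \<Union>\<K>" "A \<inter> U = {}"
  shows "\<exists>\<K>'. curve_family \<K>' (U \<union> {u, v}) \<and> \<Union>\<K>' = \<Union>\<K> - (A - {u, v})"
proof -
  note Ap = arc_between_props[OF A(1)]
  have f: "finite \<K>" "disjoint \<K>" "U \<subseteq> \<Union>\<K>" using F unfolding curve_family_def by auto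
  obtain K where K: "K \<in> \<K>" "u \<in> K" using A Ap by blast
  have AK: "A \<subseteq> K"
    using connected_in_disjoint_closed[OF f(1,2) curve_family_member(2)[OF F] Ap(3) A(2) K(1)] K Ap by blast
  have dis: "K' \<inter> K = {}" if "K' \<in> \<K> - {K}" for K'
    using f(2) K that unfolding pairwise_def disjnt_def by auto
  have U: "\<Union>\<K> - (A - {u, v}) = \<Union>(\<K> - {K}) \<union> (K - (A - {u,v}))" 
    using K AK dis by blast
  have old: "closed_curve K' \<and> K' \<inter> (U \<union> {u,v}) = {} \<or> (\<exists>x y. arc_between K' x y \<and> K' \<inter> (U \<union> {u,v}) = {x, y})"
    if K': "K' \<in> \<K> - {K}" for K'
  proof -
    have "K' \<inter> (U \<union> {u,v}) = K' \<inter> U" using dis[OF K'] AK Ap(4,5) by blast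
    then show ?thesis using F K' unfolding curve_family_def by auto
  qed
  have old_dis: "disjoint (\<K> - {K})" using f(2) by (simp add: pairwise_def)
  consider (loop) "closed_curve K" "K \<inter> U = {}" | (arc) a b where "arc_between K a b" "K \<inter> U = {a, b}"
    using F K unfolding curve_family_def by blast
  then show ?thesis
  proof cases
    case loop
    define K1 where "K1 = K - (A - {u, v})"
    have K1: "arc_between K1 u v" using closed_curve_cut loop A AK unfolding K1_def by blast
    have "K1 \<inter> (U \<union> {u,v}) = {u,v}" using loop(2) AK Ap(4,5) unfolding K1_def by blast
    moreover have UU: "\<Union>(insert K1 (\<K> - {K})) = \<Union>\<K> - (A - {u, v})" using U unfolding K1_def by auto
    moreover have "disjoint (insert K1 (\<K> - {K}))"
      unfolding pairwise_insert using old_dis dis by (auto simp: disjnt_def K1_def)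
    moreover have "U \<union> {u, v} \<subseteq> \<Union>\<K> - (A - {u, v})" using f(3) Ap(4,5) A(2,3) by blast
    ultimately have "curve_family (insert K1 (\<K> - {K})) (U \<union> {u, v})"
      unfolding curve_family_def using old K1 f(1) by (simp del: Union_insert Union_iff) blast
    then show ?thesis using UU by blast
  next
    case arc
    have nin: "a \<notin> A" "b \<notin> A" using arc(2) A(3) by auto
    obtain K1 K2 x y where K12: "{x, y} = {u, v}" "arc_between K1 a x" "arc_between K2 y b" "K1 \<inter> K2 = {}"
           "K1 \<union> K2 = K - (A - {u, v})"
      using arc_cut[OF arc(1) A(1) AK nin] by blast
    note p1 = arc_between_props[OF K12(2)] and p2 = arc_between_props[OF K12(3)]
    have ab: "a \<in> U" "b \<in> U" "a \<in> K" "b \<in> K" using arc by auto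
    have sub: "K1 \<subseteq> K" "K2 \<subseteq> K" using K12(5) by auto
    have xy: "x \<in> {u,v}" "y \<in> {u,v}" "U \<inter> {u,v} = {}" using K12(1) A(3) Ap by auto
    have 1: "K1 \<inter> (U \<union> {u,v}) = {a, x}"
    proof -
      have "b \<notin> K1" "a \<in> U" using p2(5) K12(4) ab by auto
      then have "K1 \<inter> U = {a}" using sub(1) arc(2) p1(4) by auto
      moreover have "K1 \<inter> {u,v} = {x}" unfolding K12(1)[symmetric] using K12(4) p1(5) p2(4) by auto
      ultimately show ?thesis by blast
    qed
    have 2: "K2 \<inter> (U \<union> {u,v}) = {y, b}"
    proof -
      have "a \<notin> K2" "b \<in> U" using p1(4) K12(4) ab by auto
      then have "K2 \<inter> U = {b}" using sub(2) arc(2) p2(5) by auto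
      moreover have "K2 \<inter> {u,v} = {y}" unfolding K12(1)[symmetric] using K12(4) p1(5) p2(4) by auto
      ultimately show ?thesis by blast
    qed
    have UU: "\<Union>(insert K1 (insert K2 (\<K> - {K}))) = \<Union>\<K> - (A - {u, v})" using U K12(5) by auto
    moreover have "disjoint (insert K1 (insert K2 (\<K> - {K})))"
      unfolding pairwise_insert using old_dis dis sub K12(4) by (auto simp: disjnt_def)
    moreover have "U \<union> {u, v} \<subseteq> \<Union>\<K> - (A - {u, v})" using f(3) Ap(4,5) A(2,3) by blast
    ultimately have "curve_family (insert K1 (insert K2 (\<K> - {K}))) (U \<union> {u, v})"
      unfolding curve_family_def using old 1 2 K12(2,3) f(1) by (simp del: Union_insert Union_iff) blast
    then show ?thesis using UU by blast
  qed
qed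

text \<open>Either both boundary points lie on one arc, which \<open>A\<close> closes up to a loop,
  or they lie on two different arcs, which \<open>A\<close> joins to a single one. Which case occurs
  depends on the global position of the arcs.\<close>

lemma curve_family_glue:
  assumes F: "curve_family \<K> U" and A: "arc_between A u v" "A \<inter> \<Union>\<K> = {u, v}" and uv: "u \<in> U" "v \<in> U"
  shows "\<exists>\<K>'. curve_family \<K>' (U - {u, v}) \<and> \<Union>\<K>' = \<Union>\<K> \<union> A"
proof -
  note Ap = arc_between_props[OF A(1)]
  have f: "finite \<K>" "disjoint \<K>" "U \<subseteq> \<Union>\<K>" using F unfolding curve_family_def by auto
  have disj: "K \<inter> K' = {}" if "K \<in> \<K>" "K' \<in> \<K>" "K \<noteq> K'" for K K'
    using f(2) that unfolding pairwise_def disjnt_def by auto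
  \<comment> \<open>The arc through \<open>z\<close> is turned around if necessary, so that
    \<open>z\<close> is its final end.\<close>
  have ex: "\<exists>K w. K \<in> \<K> \<and> arc_between K w z \<and> K \<inter> U = {w, z}" if z: "z \<in> U" for z
  proof -
    obtain K where K: "K \<in> \<K>" "z \<in> K" using z f(3) by blast
    then obtain a b where ab: "arc_between K a b" "K \<inter> U = {a, b}"
      using F z unfolding curve_family_def by blast
    then have "z = a \<or> z = b" using K z by auto
    then show ?thesis
    proof
      assume "z = b" then show ?thesis using ab K by auto
    next
      assume "z = a"
      then have "arc_between K b z" "K \<inter> U = {b, z}" using ab arc_between_sym[OF ab(1)] by auto
      then show ?thesis using K by blast
    qed
  qed
  obtain K a where K: "K \<in> \<K>" "arc_between K a u" "K \<inter> U = {a, u}" using ex[OF uv(1)] by blast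
  obtain K' b where K': "K' \<in> \<K>" "arc_between K' b v" "K' \<inter> U = {b, v}" using ex[OF uv(2)] by blast
  note Kp = arc_between_props[OF K(2)] and Kp' = arc_between_props[OF K'(2)]
  have old: "closed_curve L \<and> L \<inter> (U - {u,v}) = {} \<or> (\<exists>x y. arc_between L x y \<and> L \<inter> (U - {u,v}) = {x, y})"
    if L: "L \<in> \<K> - {K, K'}" for L
  proof -
    have "L \<inter> K = {}" "L \<inter> K' = {}" using disj[of L K] disj[of L K'] L K(1) K'(1) by auto
    then have "u \<notin> L" "v \<notin> L" using Kp(5) Kp'(5) by auto
    then have "L \<inter> (U - {u,v}) = L \<inter> U" by blast
    then show ?thesis using F L unfolding curve_family_def by auto
  qed
  have AL: "A \<inter> L = {}" if L: "L \<in> \<K> - {K, K'}" for L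
  proof -
    have "L \<inter> K = {}" "L \<inter> K' = {}" using disj[of L K] disj[of L K'] L K(1) K'(1) by auto
    then have "u \<notin> L" "v \<notin> L" using Kp(5) Kp'(5) by auto
    moreover have "A \<inter> L \<subseteq> {u, v}" using A(2) L by auto
    ultimately show ?thesis by blast
  qed
  define N where "N = K \<union> A \<union> K'"
  have UN: "\<Union>(insert N (\<K> - {K, K'})) = \<Union>\<K> \<union> A" using K(1) K'(1) unfolding N_def by blast
  have Ndis: "N \<inter> L = {}" if "L \<in> \<K> - {K, K'}" for L
    using AL[OF that] disj[of L K] disj[of L K'] that K(1) K'(1) unfolding N_def by blast
  have AU: "A \<inter> U \<subseteq> {u, v}" using A(2) f(3) by blast
  have "curve_family (insert N (\<K> - {K, K'})) (U - {u, v})" 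
    if N: "closed_curve N \<and> N \<inter> (U - {u,v}) = {} \<or> (\<exists>x y. arc_between N x y \<and> N \<inter> (U - {u,v}) = {x, y})"
  proof -
    have "disjoint (insert N (\<K> - {K, K'}))"
      unfolding pairwise_insert using Ndis f(2) by (auto simp: disjnt_def pairwise_def)
    moreover have "U - {u, v} \<subseteq> \<Union>\<K> \<union> A" using f(3) by blast
    ultimately show ?thesis unfolding curve_family_def UN using old N f(1) by simp
  qed
  moreover have "closed_curve N \<and> N \<inter> (U - {u,v}) = {} \<or> (\<exists>x y. arc_between N x y \<and> N \<inter> (U - {u,v}) = {x, y})"
  proof (cases "K = K'")
    case True
    then have "{a, u} = {b, v}" using K(3) K'(3) by simp
    then have "a = v" using Ap(6) by (auto simp: doubleton_eq_iff)
    then have "arc_between K u v" "K \<inter> A \<subseteq> {u,v}" using arc_between_sym[OF K(2)] A(2) K(1) by blast+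
    then have "closed_curve (K \<union> A)" using arc_close[OF _ A(1)] by blast
    moreover have "N = K \<union> A" using True unfolding N_def by blast
    ultimately have "closed_curve N" by simp
    moreover have "N \<inter> (U - {u,v}) = {}" 
      using K(3) AU \<open>a = v\<close> True unfolding N_def by auto
    ultimately show ?thesis by blast
  next
    case False
    have d: "K \<inter> K' = {}" using disj False K K' by blast
    have KA: "K \<inter> A \<subseteq> {u, v}" "K' \<inter> A \<subseteq> {u, v}" using A(2) K(1) K'(1) by auto
    have "v \<notin> K" "u \<notin> K'" using d Kp'(5) Kp(5) by auto
    then have "K \<inter> A \<subseteq> {u}" using KA by auto
    then have 1: "arc_between (K \<union> A) a v" using arc_concat[OF K(2) A(1)] by blast
    have "(K \<union> A) \<inter> K' \<subseteq> {v}" using KA(2) d \<open>u \<notin> K'\<close> by auto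
    then have 2: "arc_between N a b" using arc_concat[OF 1 arc_between_sym[OF K'(2)]] unfolding N_def by blast
    have "N \<inter> (U - {u,v}) = {a, b}"
    proof -
      have "N \<inter> (U - {u,v}) = (K \<inter> U \<union> K' \<inter> U) - {u,v}" using AU unfolding N_def by blast
      also have "\<dots> = {a, u, b, v} - {u, v}" using K(3) K'(3) by auto
      also have "\<dots> = {a, b}"
      proof -
        have "a \<notin> K'" "b \<notin> K" using d Kp(4) Kp'(4) by auto
        then have "a \<noteq> v" "b \<noteq> u" using Kp(5) Kp'(5) by auto
        then show ?thesis using Kp(6) Kp'(6) by auto
      qed
      finally show ?thesis .
    qed
    then show ?thesis using 2 by blast
  qed
  ultimately show ?thesis using UN by blast
qed

lemma curve_family_image:
  fixes f :: "'a::real_normed_vector \<Rightarrow> 'b::real_normed_vector"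
  assumes F: "curve_family \<K> U" and f: "continuous_on (\<Union>\<K>) f" "inj_on f (\<Union>\<K>)"
  shows "curve_family ((`) f ` \<K>) (f ` U)"
  unfolding curve_family_def
proof (intro conjI ballI)
  show "finite ((`) f ` \<K>)" using F unfolding curve_family_def by auto
  have U: "U \<subseteq> \<Union>\<K>" using F unfolding curve_family_def by auto
  then show "f ` U \<subseteq> \<Union> ((`) f ` \<K>)" by blast
  show "disjoint ((`) f ` \<K>)"
  proof (rule pairwiseI)
    fix x y assume "x \<in> (`) f ` \<K>" "y \<in> (`) f ` \<K>" "x \<noteq> y"
    then obtain K L where KL: "K \<in> \<K>" "L \<in> \<K>" "x = f ` K" "y = f ` L" "K \<noteq> L" by blast
    then have "K \<inter> L = {}" using F unfolding curve_family_def pairwise_def disjnt_def by blast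
    then show "disjnt x y"
      using inj_on_image_Int[OF f(2), of K L] KL unfolding disjnt_def by auto
  qed
  fix x assume "x \<in> (`) f ` \<K>"
  then obtain K where K: "K \<in> \<K>" "x = f ` K" by blast
  have *: "f ` K \<inter> f ` U = f ` (K \<inter> U)" using inj_on_image_Int[OF f(2), of K U] K U by auto
  have c: "continuous_on K f" "inj_on f K"
    using f K by (meson Union_upper continuous_on_subset inj_on_subset)+
  show "closed_curve x \<and> x \<inter> f ` U = {} \<or> (\<exists>u v. arc_between x u v \<and> x \<inter> f ` U = {u, v})"
  proof (cases "closed_curve K \<and> K \<inter> U = {}")
    case True then show ?thesis using closed_curve_image c K * by auto
  next
    case False
    then obtain u v where uv: "arc_between K u v" "K \<inter> U = {u, v}"
      using F K unfolding curve_family_def by blast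
    then show ?thesis using arc_between_image[OF uv(1) c] * K(2) by auto
  qed
qed

section \<open>Resolutions of a diagram\<close>

text \<open>The real diameter closes \<open>K\<close> to a Jordan curve \<open>J\<close>. If
  \<open>K'\<close> missed \<open>K\<close>, it would connect the images of the open upper and lower
  half disks in the complement of \<open>J\<close>. But the centre \<open>\<phi> 0\<close> is a
  frontier point of both the inside and the outside of \<open>J\<close>, so the connected union of
  the half disks and \<open>K'\<close> would meet both.\<close>

lemma interlaced_arcs_meet:
  fixes \<phi> :: "complex \<Rightarrow> complex"
  assumes c: "continuous_on (cball 0 1) \<phi>" and inj: "inj_on \<phi> (cball 0 1)"
    and K: "arc_between K (\<phi> 1) (\<phi> (-1))" "K \<inter> \<phi> ` cball 0 1 \<subseteq> {\<phi> 1, \<phi> (-1)}"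
    and K': "connected K'" "\<phi> \<i> \<in> K'" "\<phi> (-\<i>) \<in> K'" "K' \<inter> \<phi> ` cball 0 1 \<subseteq> {\<phi> \<i>, \<phi> (-\<i>)}"
  shows "K \<inter> K' \<noteq> {}"
proof
  assume disj: "K \<inter> K' = {}"
  define s where "s = closed_segment (-1) (1::complex)"
  have s_iff: "z \<in> s \<longleftrightarrow> Im z = 0 \<and> -1 \<le> Re z \<and> Re z \<le> 1" for z
    unfolding s_def by (simp add: closed_segment_same_Im)
       (auto simp: closed_segment_eq_real_ivl)
  have s_sub: "s \<subseteq> cball 0 1"
  proof
    fix z assume "z \<in> s" then show "z \<in> cball 0 1" 
      using s_iff[of z] cmod_eq_Re[of z] by auto
  qed
  define J where "J = K \<union> \<phi> ` s"
  have "arc_between s (-1) (1::complex)"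
    unfolding arc_between_def s_def by (intro exI[of _ "linepath (-1) 1"]) auto
  then have "arc_between (\<phi> ` s) (\<phi> (-1)) (\<phi> 1)"
    using arc_between_image continuous_on_subset[OF c s_sub] inj_on_subset[OF inj s_sub] by blast
  then have "closed_curve J"
    using arc_close[OF K(1) arc_between_sym] K(2) s_sub unfolding J_def by blast
  then obtain g where g: "simple_path g" "pathfinish g = pathstart g" "path_image g = J"
    unfolding closed_curve_def by blast
  note Jordan = Jordan_inside_outside[OF g(1,2), unfolded g(3)]
  define Hp where "Hp = \<phi> ` (cball 0 1 \<inter> {z. Im z > 0})"
  define Hm where "Hm = \<phi> ` (cball 0 1 \<inter> {z. Im z < 0})"
  have conv: "convex (cball 0 1 \<inter> {z. Im z > 0})" "convex (cball 0 1 \<inter> {z. Im z < 0})"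
    using convex_Int[OF convex_cball] convex_halfspace_Im_gt[of 0] convex_halfspace_Im_lt[of 0] by blast+
  have conn: "connected Hp" "connected Hm"
    unfolding Hp_def Hm_def
    by (intro connected_continuous_image continuous_on_subset[OF c] convex_connected conv; blast)+
  have i_in: "\<phi> \<i> \<in> Hp" "\<phi> (-\<i>) \<in> Hm" unfolding Hp_def Hm_def by auto
  define T where "T = (Hp \<union> K') \<union> Hm"
  have "connected T" unfolding T_def
    using conn K'(1,2,3) i_in by (intro connected_Un) auto
  have off: "\<phi> z \<notin> J" if "z \<in> cball 0 1" "Im z \<noteq> 0" for z
  proof
    assume "\<phi> z \<in> J"
    then consider "\<phi> z \<in> K" | "\<phi> z \<in> \<phi> ` s" unfolding J_def by blast
    then show False
    proof cases
      case 1
      then have "\<phi> z = \<phi> 1 \<or> \<phi> z = \<phi> (-1)" using K(2) that by blast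
      then have "z = 1 \<or> z = -1" using inj_onD[OF inj] that by fastforce
      then show False using that by auto
    next
      case 2
      then obtain y where y: "y \<in> s" "\<phi> z = \<phi> y" by blast
      then have "z = y" using inj_onD[OF inj y(2)] that s_sub by blast
      then show False using s_iff y that by auto
    qed
  qed
  have K'J: "K' \<inter> J = {}"
  proof -
    have "y \<notin> J" if "y \<in> K'" for y
    proof
      assume y: "y \<in> J"
      then have "y \<in> \<phi> ` s" using disj that unfolding J_def by blast
      then have "y = \<phi> \<i> \<or> y = \<phi> (-\<i>)" using K'(4) s_sub that by blast
      then show False using y off[of \<i>] off[of "-\<i>"] by auto
    qed
    then show ?thesis by blast
  qed
  have TJ: "T \<inter> J = {}" using off K'J unfolding T_def Hp_def Hm_def by auto
  \<comment> \<open>Invariance of domain: a neighbourhood of \<open>\<phi> 0\<close> is covered by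
    the image of the open disk, whose points off \<open>J\<close> belong to the two half disks and
    hence to \<open>T\<close>.\<close>
  have op: "open (\<phi> ` ball 0 1)"
    using invariance_of_domain[of "ball 0 1" \<phi>] c inj
    by (meson ball_subset_cball continuous_on_subset inj_on_subset open_ball)
  have "\<phi> 0 \<in> J" using s_iff[of 0] unfolding J_def by auto
  then have fr: "\<phi> 0 \<in> closure (inside J)" "\<phi> 0 \<in> closure (outside J)"
    using Jordan unfolding frontier_def by blast+
  have "\<phi> 0 \<in> \<phi> ` ball 0 1" by auto
  then obtain x y where xy: "x \<in> \<phi> ` ball 0 1" "x \<in> inside J" "y \<in> \<phi> ` ball 0 1" "y \<in> outside J"
    using fr op unfolding closure_iff_nhds_not_empty by (metis disjoint_iff subset_refl)
  have inT: "u \<in> T" if u: "u \<in> \<phi> ` ball 0 1" "u \<notin> J" for u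
  proof -
    obtain z where z: "z \<in> ball 0 1" "u = \<phi> z" using u by blast
    have "Im z \<noteq> 0"
    proof
      assume "Im z = 0"
      then have "z \<in> s" using s_iff[of z] z abs_Re_le_cmod[of z] by (auto simp: dist_norm)
      then show False using u z unfolding J_def by blast
    qed
    then show ?thesis using z unfolding T_def Hp_def Hm_def by (cases "Im z > 0") auto
  qed
  have "x \<in> T" "y \<in> T" using inT xy inside_no_overlap[of J] outside_no_overlap[of J] by blast+
  then show False
    using connectedD[OF \<open>connected T\<close>, of "inside J" "outside J"] Jordan TJ xy by blast
qed

text \<open>The corner which a smoothing arc joins to 1; the other arc joins -1 to the opposite
  corner. Both smoothings are thereby treated at once, with a parameter \<open>w\<close> equal to
  \<open>\<i>\<close> or \<open>-\<i>\<close>.\<close>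

definition smoothing_dir :: "nat \<Rightarrow> complex" where
  "smoothing_dir b = (if b = 0 then -\<i> else \<i>)"

lemma res_arcs_eq:
  "res_arcs b = closed_segment 1 (smoothing_dir b) \<union> closed_segment (-1) (- smoothing_dir b)"
  unfolding res_arcs_def smoothing_dir_def by (auto simp: closed_segment_commute)

lemma segment_corner:
  assumes "e \<in> {1, -1}" "w \<in> {\<i>, -\<i>}"
  shows "closed_segment e w \<subseteq> cball 0 1" "closed_segment e w \<inter> sphere 0 1 = {e, w}"
    "e \<noteq> w"
proof -
  show "closed_segment e w \<subseteq> cball 0 1"
    using assms by (intro closed_segment_subset) auto
  show "e \<noteq> w" using assms by (auto simp: complex_eq_iff)
  have "z \<in> {e, w}" if z: "z \<in> closed_segment e w" "norm z = 1" for z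
  proof -
    obtain t where t: "0 \<le> t" "t \<le> 1" "z = (1 - t) *\<^sub>R e + t *\<^sub>R w"
      using z unfolding closed_segment_def by blast
    \<comment> \<open>\<open>e\<close> is real and \<open>w\<close> imaginary, both of norm 1, so
      the two summands are orthogonal.\<close>
    have "(norm z)\<^sup>2 = (1 - t)\<^sup>2 + t\<^sup>2"
using assms unfolding t(3) cmod_power2 by (auto simp: power2_eq_square algebra_simps)
    then have "2 * (t * (1 - t)) = 0" using z by (simp add: power2_eq_square algebra_simps)
    then have "t = 0 \<or> t = 1" by simp
    then show ?thesis using t by auto
  qed
  then have "closed_segment e w \<inter> sphere 0 1 \<subseteq> {e, w}" unfolding subset_iff Int_iff mem_sphere_0 by blast
  moreover have "{e, w} \<subseteq> closed_segment e w \<inter> sphere 0 1" using assms by auto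
  ultimately show "closed_segment e w \<inter> sphere 0 1 = {e, w}" by blast
qed

lemma segments_disjoint:
  assumes "w \<in> {\<i>, -\<i>}"
  shows "closed_segment 1 w \<inter> closed_segment (-1) (-w) = {}"
proof -
  have "Re z + \<bar>Im z\<bar> = 1 \<and> Re z \<ge> 0" if "z \<in> closed_segment 1 w" for z
    using that assms unfolding closed_segment_def by auto
  moreover have "Re z - \<bar>Im z\<bar> = -1 \<and> Re z \<le> 0" if "z \<in> closed_segment (-1) (-w)" for z
    using that assms unfolding closed_segment_def by auto
  moreover have "Im z = 0 \<longrightarrow> z = -1" if "z \<in> closed_segment (-1) (-w)" for z
    using that assms unfolding closed_segment_def by auto
  moreover have "z = w" if "Re z = 0" "z \<in> closed_segment 1 w" for z
    using that assms unfolding closed_segment_def by auto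
  moreover have "z = -w" if "Re z = 0" "z \<in> closed_segment (-1) (-w)" for z
    using that assms unfolding closed_segment_def by auto
  moreover have "w \<noteq> -w" using assms by auto
  ultimately show ?thesis by (metis disjoint_iff order_antisym)
qed

section \<open>The diagram outside its crossing disks\<close>

locale link_diagram =
  fixes n :: nat and p :: "nat \<Rightarrow> complex" and L :: link and D :: diagram
  assumes punct: "punctures n p" and diag: "is_diagram_of n p L D"
begin

abbreviation "N \<equiv> ncross D"
abbreviation "E c \<equiv> cdisk D c ` cball 0 1"

text \<open>The link in the thickened disk, before projection. Overstrand and understrand are
  disjoint here, so that arcs can be cut out at a crossing independently of each other.\<close>

definition emb :: "nat \<times> complex \<Rightarrow> complex \<times> real" where
  "emb = (\<lambda>(k, z). lcomp (dlink D) k z)"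

lemma emb_pair [simp]: "emb (k, z) = lcomp (dlink D) k z"
  by (simp add: emb_def)

definition strand :: "(real \<Rightarrow> nat \<times> complex) \<Rightarrow> (complex \<times> real) set" where
  "strand s = (emb \<circ> s) ` {-1..1}"

definition corners :: "nat \<Rightarrow> complex set" where
  "corners c = cdisk D c ` {1, -1, \<i>, -\<i>}"

text \<open>The part of the diagram shared by all resolutions. The corners on the boundaries of the
  crossing disks are retained; they are the ends to which the smoothing arcs attach.\<close>

definition outer :: "complex set" where
  "outer = (dcurve D - (\<Union>c<N. E c)) \<union> (\<Union>c<N. corners c)"

lemma link: "is_link n p (dlink D)" and disks: "crossing_disks n p D"
  and strands: "crossing_strands D" and dpts: "double_points D"
  using diag unfolding is_diagram_of_def by auto

lemma disk:
  assumes "c < N"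
  shows "continuous_on (cball 0 1) (cdisk D c)" "inj_on (cdisk D c) (cball 0 1)" "E c \<subseteq> Sig n p"
    "dcurve D \<inter> E c = cdisk D c ` (closed_segment (-1) 1 \<union> closed_segment (-\<i>) \<i>)"
  using disks assms unfolding crossing_disks_def by auto

lemma disks_disjoint: "c < N \<Longrightarrow> c' < N \<Longrightarrow> c \<noteq> c' \<Longrightarrow> E c \<inter> E c' = {}"
  using disks unfolding crossing_disks_def disjoint_family_on_def by auto

lemma strand_props:
  assumes "c < N"
  shows "ocomp D c < ncomp (dlink D)" "ucomp D c < ncomp (dlink D)"
    "continuous_on {-1..1} (oangle D c)" "continuous_on {-1..1} (uangle D c)"
    "t \<in> {-1..1} \<Longrightarrow> dproj D (over_pt D c t) = cdisk D c (complex_of_real t)"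
    "t \<in> {-1..1} \<Longrightarrow> dproj D (under_pt D c t) = cdisk D c (\<i> * complex_of_real t)"
    "dheight D (under_pt D c 0) < dheight D (over_pt D c 0)"
  using strands assms unfolding crossing_strands_def by auto

lemma emb_inj: "inj_on emb (link_points (dlink D))"
  and emb_cont: "k < ncomp (dlink D) \<Longrightarrow> continuous_on (sphere 0 1) (lcomp (dlink D) k)"
  and emb_range: "emb ` link_points (dlink D) \<subseteq> Sig n p \<times> {0..1}"
  using link unfolding is_link_def emb_def by auto

lemma fst_emb: "fst (emb x) = dproj D x" and snd_emb: "snd (emb x) = dheight D x"
  unfolding emb_def dproj_def dheight_def by (auto split: prod.splits)

lemma pts_in: "c < N \<Longrightarrow> over_pt D c t \<in> link_points (dlink D)" "c < N \<Longrightarrow> under_pt D c t \<in> link_points (dlink D)"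
  using strand_props[of c] unfolding over_pt_def under_pt_def link_points_def by auto

lemma dcurve_Sig: "dcurve D \<subseteq> Sig n p"
proof -
  have "fst (emb x) \<in> Sig n p" if "x \<in> link_points (dlink D)" for x
    using emb_range that by (auto simp: image_subset_iff mem_Times_iff)
  then show ?thesis unfolding dcurve_def fst_emb by blast
qed

lemma arc_real: "arc_between {-1..1::real} (-1) 1"
  unfolding arc_between_def
  by (intro exI[of _ "linepath (-1) 1"]) (auto simp: closed_segment_eq_real_ivl)

text \<open>Injectivity is inherited from the projection, which maps the strands to the images of
  the real and the imaginary diameter under the injective \<open>cdisk D c\<close>.\<close>

lemma strand_arc:
  assumes c: "c < N"
  shows "arc_between (strand (over_pt D c)) (emb (over_pt D c (-1))) (emb (over_pt D c 1))"
    and "arc_between (strand (under_pt D c)) (emb (under_pt D c (-1))) (emb (under_pt D c 1))"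
proof -
  note sp = strand_props[OF c]
  have cont: "continuous_on {-1..1} (emb \<circ> over_pt D c)"
  proof -
    have "continuous_on {-1..1} (lcomp (dlink D) (ocomp D c) \<circ> (\<lambda>t. cis (oangle D c t)))"
      by (intro continuous_on_compose continuous_intros sp continuous_on_subset[OF emb_cont]) auto
    then show ?thesis unfolding over_pt_def comp_def by simp
  qed
  have cont': "continuous_on {-1..1} (emb \<circ> under_pt D c)"
  proof -
    have "continuous_on {-1..1} (lcomp (dlink D) (ucomp D c) \<circ> (\<lambda>t. cis (uangle D c t)))"
      by (intro continuous_on_compose continuous_intros sp continuous_on_subset[OF emb_cont]) auto
    then show ?thesis unfolding under_pt_def comp_def by simp
  qed
  have inj: "inj_on (emb \<circ> over_pt D c) {-1..1}"
  proof (rule inj_onI)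
    fix s t assume st: "s \<in> {-1..1}" "t \<in> {-1..1}" "(emb \<circ> over_pt D c) s = (emb \<circ> over_pt D c) t"
    then have "dproj D (over_pt D c s) = dproj D (over_pt D c t)" by (metis comp_apply fst_emb)
    then have "cdisk D c (complex_of_real s) = cdisk D c (complex_of_real t)" using sp(5) st by auto
    moreover have "complex_of_real s \<in> cball 0 1" "complex_of_real t \<in> cball 0 1" using st by auto
    ultimately have "complex_of_real s = complex_of_real t" using inj_onD[OF disk(2)[OF c]] by blast
    then show "s = t" by simp
  qed
  have inj': "inj_on (emb \<circ> under_pt D c) {-1..1}"
  proof (rule inj_onI)
    fix s t assume st: "s \<in> {-1..1}" "t \<in> {-1..1}" "(emb \<circ> under_pt D c) s = (emb \<circ> under_pt D c) t"
    then have "dproj D (under_pt D c s) = dproj D (under_pt D c t)" by (metis comp_apply fst_emb)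
    then have "cdisk D c (\<i> * complex_of_real s) = cdisk D c (\<i> * complex_of_real t)" using sp(6) st by auto
    moreover have "\<i> * complex_of_real s \<in> cball 0 1" "\<i> * complex_of_real t \<in> cball 0 1"
      using st by (auto simp: norm_mult)
    ultimately have "\<i> * complex_of_real s = \<i> * complex_of_real t" using inj_onD[OF disk(2)[OF c]] by blast
    then show "s = t" by simp
  qed
  show "arc_between (strand (over_pt D c)) (emb (over_pt D c (-1))) (emb (over_pt D c 1))"
    using arc_between_image[OF arc_real cont inj] unfolding strand_def by simp
  show "arc_between (strand (under_pt D c)) (emb (under_pt D c (-1))) (emb (under_pt D c 1))"
    using arc_between_image[OF arc_real cont' inj'] unfolding strand_def by simp
qed

lemma strand_sub:
  assumes "c < N"
  shows "strand (over_pt D c) \<subseteq> emb ` link_points (dlink D)" "strand (under_pt D c) \<subseteq> emb ` link_points (dlink D)"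
    "fst ` strand (over_pt D c) \<subseteq> E c" "fst ` strand (under_pt D c) \<subseteq> E c"
proof -
  show "strand (over_pt D c) \<subseteq> emb ` link_points (dlink D)" "strand (under_pt D c) \<subseteq> emb ` link_points (dlink D)"
    using pts_in[OF assms] unfolding strand_def by auto
  show "fst ` strand (over_pt D c) \<subseteq> E c"
  proof
    fix x assume "x \<in> fst ` strand (over_pt D c)"
    then obtain t where t: "t \<in> {-1..1}" "x = dproj D (over_pt D c t)"
      unfolding strand_def by (auto simp: fst_emb)
    then show "x \<in> E c" using strand_props(5)[OF assms t(1)] by auto
  qed
  show "fst ` strand (under_pt D c) \<subseteq> E c"
  proof
    fix x assume "x \<in> fst ` strand (under_pt D c)"
    then obtain t where t: "t \<in> {-1..1}" "x = dproj D (under_pt D c t)"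
      unfolding strand_def by (auto simp: fst_emb)
    then show "x \<in> E c" using strand_props(6)[OF assms t(1)] by (auto simp: norm_mult)
  qed
qed

text \<open>Different crossings have disjoint disks. At a single crossing the two diameters meet
  only in the centre, and there the understrand is strictly lower.\<close>

lemma strands_disjoint:
  assumes "c < N" "c' < N" "s \<in> {over_pt D c, under_pt D c}" "s' \<in> {over_pt D c', under_pt D c'}"
    "s \<noteq> s' \<or> c \<noteq> c'" 
  shows "strand s \<inter> strand s' = {}"
proof (cases "c = c'")
  case False
  then show ?thesis using strand_sub[OF assms(1)] strand_sub[OF assms(2)] disks_disjoint[OF assms(1,2)] assms(3,4)
  proof -
    have "fst ` strand s \<subseteq> E c" "fst ` strand s' \<subseteq> E c'"
      using strand_sub(3,4)[OF assms(1)] strand_sub(3,4)[OF assms(2)] assms(3,4) by auto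
    then have "fst ` strand s \<inter> fst ` strand s' = {}" using disks_disjoint[OF assms(1,2) False] by blast
    then show ?thesis by blast
  qed
next
  case True
  have "strand (over_pt D c) \<inter> strand (under_pt D c) = {}"
  proof (rule ccontr)
    assume "\<not> ?thesis"
    then obtain s t where st: "s \<in> {-1..1}" "t \<in> {-1..1}" "emb (over_pt D c s) = emb (under_pt D c t)"
      unfolding strand_def by (auto simp del: atLeastAtMost_iff) metis
    then have "dproj D (over_pt D c s) = dproj D (under_pt D c t)" by (metis fst_emb)
    then have "cdisk D c (complex_of_real s) = cdisk D c (\<i> * complex_of_real t)"
      using strand_props(5,6)[OF assms(1)] st by auto
    moreover have "complex_of_real s \<in> cball 0 1" "\<i> * complex_of_real t \<in> cball 0 1"
      using st by (auto simp: norm_mult)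
    ultimately have "complex_of_real s = \<i> * complex_of_real t" using inj_onD[OF disk(2)[OF assms(1)]] by blast
    then have "s = 0" "t = 0" by (auto simp: complex_eq_iff)
    then have "dheight D (over_pt D c 0) = dheight D (under_pt D c 0)" using st(3) by (metis snd_emb)
    then show False using strand_props(7)[OF assms(1)] by simp
  qed
  then show ?thesis using assms True by auto
qed

lemma link_family:
  "curve_family ((\<lambda>k. lcomp (dlink D) k ` sphere 0 1) ` {..<ncomp (dlink D)}) {}"
  "(\<Union>k<ncomp (dlink D). lcomp (dlink D) k ` sphere 0 1) = emb ` link_points (dlink D)"
proof -
  have cs: "closed_curve (sphere 0 (1::real) :: complex set)"
    unfolding closed_curve_def by (intro exI[of _ "circlepath 0 1"]) (auto simp: simple_path_circlepath)
  have inj: "inj_on (lcomp (dlink D) k) (sphere 0 1)" if "k < ncomp (dlink D)" for k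
    using emb_inj that unfolding inj_on_def link_points_def by (auto split: prod.splits) 
  show "curve_family ((\<lambda>k. lcomp (dlink D) k ` sphere 0 1) ` {..<ncomp (dlink D)}) {}"
    unfolding curve_family_def
  proof (intro conjI ballI)
    show "disjoint ((\<lambda>k. lcomp (dlink D) k ` sphere 0 1) ` {..<ncomp (dlink D)})"
    proof (rule pairwiseI)
      fix x y assume "x \<in> (\<lambda>k. lcomp (dlink D) k ` sphere 0 1) ` {..<ncomp (dlink D)}"
        "y \<in> (\<lambda>k. lcomp (dlink D) k ` sphere 0 1) ` {..<ncomp (dlink D)}" "x \<noteq> y"
      then obtain k l where kl: "k < ncomp (dlink D)" "l < ncomp (dlink D)" "k \<noteq> l"
        "x = lcomp (dlink D) k ` sphere 0 1" "y = lcomp (dlink D) l ` sphere 0 1" by blast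
      show "disjnt x y" unfolding disjnt_iff
      proof (intro allI notI)
        fix a assume "a \<in> x \<and> a \<in> y"
        then obtain u v where uv: "u \<in> sphere 0 1" "v \<in> sphere 0 1" "emb (k, u) = a" "emb (l, v) = a"
          using kl by auto
        then have "(k, u) = (l, v)"
          using inj_onD[OF emb_inj, of "(k,u)" "(l,v)"] kl unfolding link_points_def by auto
        then show False using kl by simp
      qed
    qed
  qed (auto intro!: closed_curve_image[OF cs] emb_cont inj)
  show "(\<Union>k<ncomp (dlink D). lcomp (dlink D) k ` sphere 0 1) = emb ` link_points (dlink D)"
    unfolding link_points_def by force
qed

definition strand_ends :: "nat \<Rightarrow> (complex \<times> real) set" where
  "strand_ends c = {emb (over_pt D c (-1)), emb (over_pt D c 1), emb (under_pt D c (-1)), emb (under_pt D c 1)}"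

text \<open>Induction over the crossings, cutting both strands out of the embedded link. All strands
  are disjoint, so every cut takes place away from the ends left by the earlier ones.\<close>

lemma cut_family:
  assumes "m \<le> N"
  shows "\<exists>\<K>. curve_family \<K> (\<Union>c<m. strand_ends c) \<and>
      \<Union>\<K> = emb ` link_points (dlink D) -
         (\<Union>c<m. (strand (over_pt D c) \<union> strand (under_pt D c)) - strand_ends c)"
  using assms
proof (induction m)
  case 0
  show ?case using link_family by auto
next
  case (Suc m)
  then obtain \<K> where \<K>: "curve_family \<K> (\<Union>c<m. strand_ends c)" 
      "\<Union>\<K> = emb ` link_points (dlink D) - (\<Union>c<m. (strand (over_pt D c) \<union> strand (under_pt D c)) - strand_ends c)"
    by auto
  have m: "m < N" using Suc by simp
  define Ov where "Ov = strand (over_pt D m)"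
  define Uv where "Uv = strand (under_pt D m)"
  have ends: "strand_ends c \<subseteq> strand (over_pt D c) \<union> strand (under_pt D c)" for c
    unfolding strand_ends_def strand_def by auto
  have dis: "Ov \<inter> strand (over_pt D c) = {}" "Ov \<inter> strand (under_pt D c) = {}"
     "Uv \<inter> strand (over_pt D c) = {}" "Uv \<inter> strand (under_pt D c) = {}" if "c < m" for c
    unfolding Ov_def Uv_def using that m by (intro strands_disjoint[OF m, of c]; simp)+
  have OU: "Ov \<inter> Uv = {}"
  proof -
    have "over_pt D m \<noteq> under_pt D m" using strand_props(7)[OF m] by auto
    then show ?thesis unfolding Ov_def Uv_def using strands_disjoint[OF m m] by blast
  qed
  have sub: "Ov \<subseteq> \<Union>\<K>" "Uv \<subseteq> \<Union>\<K>"
    unfolding \<K>(2) using dis strand_sub(1,2)[OF m] unfolding Ov_def Uv_def by blast+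
  have sube: "Ov \<inter> (\<Union>c<m. strand_ends c) = {}" "Uv \<inter> (\<Union>c<m. strand_ends c) = {}"
    using dis ends by blast+
  note ao = strand_arc(1)[OF m, folded Ov_def] and au = strand_arc(2)[OF m, folded Uv_def]
  obtain \<K>1 where \<K>1: "curve_family \<K>1 ((\<Union>c<m. strand_ends c) \<union> {emb (over_pt D m (-1)), emb (over_pt D m 1)})"
     "\<Union>\<K>1 = \<Union>\<K> - (Ov - {emb (over_pt D m (-1)), emb (over_pt D m 1)})"
    using curve_family_cut[OF \<K>(1) ao sub(1) sube(1)] by blast
  have "Uv \<subseteq> \<Union>\<K>1" using \<K>1(2) sub OU by blast
  moreover have "Uv \<inter> ((\<Union>c<m. strand_ends c) \<union> {emb (over_pt D m (-1)), emb (over_pt D m 1)}) = {}"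
    using sube OU arc_between_props(4,5)[OF ao] by blast
  ultimately obtain \<K>2 where \<K>2: "curve_family \<K>2 ((\<Union>c<m. strand_ends c) \<union> {emb (over_pt D m (-1)), emb (over_pt D m 1)}
       \<union> {emb (under_pt D m (-1)), emb (under_pt D m 1)})"
     "\<Union>\<K>2 = \<Union>\<K>1 - (Uv - {emb (under_pt D m (-1)), emb (under_pt D m 1)})"
    using curve_family_cut[OF \<K>1(1) au] by blast
  have 1: "(\<Union>c<m. strand_ends c) \<union> {emb (over_pt D m (-1)), emb (over_pt D m 1)}
       \<union> {emb (under_pt D m (-1)), emb (under_pt D m 1)} = (\<Union>c<Suc m. strand_ends c)"
    unfolding strand_ends_def lessThan_Suc by auto
  have 3: "(Ov - {emb (over_pt D m (-1)), emb (over_pt D m 1)}) \<union> (Uv - {emb (under_pt D m (-1)), emb (under_pt D m 1)})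
      = (Ov \<union> Uv) - strand_ends m"
    using OU arc_between_props(4,5)[OF ao] arc_between_props(4,5)[OF au] unfolding strand_ends_def by blast
  have "\<Union>\<K>2 = \<Union>\<K> - ((Ov - {emb (over_pt D m (-1)), emb (over_pt D m 1)}) \<union> (Uv - {emb (under_pt D m (-1)), emb (under_pt D m 1)}))"
    unfolding \<K>2(2) \<K>1(2) by blast
  also have "\<dots> = \<Union>\<K> - ((Ov \<union> Uv) - strand_ends m)" unfolding 3 ..
  also have "\<dots> = emb ` link_points (dlink D) - (\<Union>c<Suc m. (strand (over_pt D c) \<union> strand (under_pt D c)) - strand_ends c)"
    unfolding \<K>(2) lessThan_Suc Ov_def Uv_def UN_insert by blast
  finally show ?case using \<K>2(1) 1 by auto
qed

lemma over_end: 
  assumes "c < N"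
  shows "fst (emb (over_pt D c 1)) = cdisk D c 1" "fst (emb (over_pt D c (-1))) = cdisk D c (-1)"
    "fst (emb (under_pt D c 1)) = cdisk D c \<i>" "fst (emb (under_pt D c (-1))) = cdisk D c (-\<i>)"
  using strand_props(5)[OF assms, of 1] strand_props(5)[OF assms, of "-1"]
    strand_props(6)[OF assms, of 1] strand_props(6)[OF assms, of "-1"] by (auto simp: fst_emb)

lemma corners_eq: "c < N \<Longrightarrow> fst ` strand_ends c = corners c"
  unfolding strand_ends_def corners_def by (auto simp: over_end)

lemma corners_sub: "corners c \<subseteq> E c" unfolding corners_def by auto

text \<open>A link point over the crossing disk has the same projection as some point
  \<open>y\<close> of a strand, because the diagram inside the disk consists of the two diameters.
  If the points differ, they form a double point; it is the centre of the same crossing, since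
  crossing disks are disjoint, and both of its preimages lie on the strands.\<close>

lemma dcurve_mem_disk:
  assumes c: "c < N" and x: "x \<in> link_points (dlink D)" "dproj D x \<in> E c"
  shows "emb x \<in> strand (over_pt D c) \<union> strand (under_pt D c)"
proof -
  have "dproj D x \<in> cdisk D c ` (closed_segment (-1) 1 \<union> closed_segment (-\<i>) \<i>)"
    using x disk(4)[OF c] unfolding dcurve_def by blast
  then obtain z where z: "dproj D x = cdisk D c z" "z \<in> closed_segment (-1) 1 \<union> closed_segment (-\<i>) \<i>" by blast
  have "\<exists>t\<in>{-1..1}. z = complex_of_real t \<or> z = \<i> * complex_of_real t"
  proof (cases "z \<in> closed_segment (-1) 1")
    case True
    then have "Im z = 0" "-1 \<le> Re z" "Re z \<le> 1"
      by (auto simp: closed_segment_same_Im closed_segment_eq_real_ivl)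
    then show ?thesis by (intro bexI[of _ "Re z"]) (auto simp: complex_eq_iff)
  next
    case False
    then have "z \<in> closed_segment (-\<i>) \<i>" using z by blast
    then have "Re z = 0" "-1 \<le> Im z" "Im z \<le> 1"
      by (auto simp: closed_segment_same_Re closed_segment_eq_real_ivl)
    then show ?thesis by (intro bexI[of _ "Im z"]) (auto simp: complex_eq_iff)
  qed
  then obtain t where t: "t \<in> {-1..1}" "dproj D x = dproj D (over_pt D c t) \<or> dproj D x = dproj D (under_pt D c t)"
    using z strand_props(5,6)[OF c] by auto
  then obtain y where y: "y \<in> {over_pt D c t, under_pt D c t}" "dproj D x = dproj D y" by blast
  show ?thesis
  proof (cases "x = y")
    case True then show ?thesis using y t unfolding strand_def by auto
  next
    case False
    have "y \<in> link_points (dlink D)" using y pts_in[OF c] by auto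
    then obtain c' where c': "c' < N" "{x, y} = {over_pt D c' 0, under_pt D c' 0}"
      using dpts x(1) y(2) False unfolding double_points_def by blast
    then have xx: "x = over_pt D c' 0 \<or> x = under_pt D c' 0" by (auto simp: doubleton_eq_iff)
    then have "dproj D x = cdisk D c' 0" using strand_props(5,6)[OF c'(1), of 0] by auto
    then have "c' = c" using x(2) disks_disjoint[OF c c'(1)] by fastforce
    then show ?thesis using xx unfolding strand_def by force
  qed
qed

lemma outer_disk: 
  assumes "c < N" shows "outer \<inter> E c = corners c"
proof
  show "corners c \<subseteq> outer \<inter> E c" using assms corners_sub unfolding outer_def by blast
  show "outer \<inter> E c \<subseteq> corners c"
  proof
    fix x assume x: "x \<in> outer \<inter> E c"
    then obtain c' where c': "c' < N" "x \<in> corners c'" using assms unfolding outer_def by blast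
    then have "c = c'" using disks_disjoint[OF assms c'(1)] corners_sub[of c'] x by blast
    then show "x \<in> corners c" using c' by blast
  qed
qed

text \<open>Every double point is the centre of a crossing disk, and a centre is not a corner. On
  the link without the interiors of the strands the projection is therefore injective, and it
  carries arcs to arcs and closed curves to closed curves.\<close>

lemma outer_family: "\<exists>\<K>. curve_family \<K> (\<Union>c<N. corners c) \<and> \<Union>\<K> = outer"
proof -
  obtain \<K> where \<K>: "curve_family \<K> (\<Union>c<N. strand_ends c)"
      "\<Union>\<K> = emb ` link_points (dlink D) - (\<Union>c<N. (strand (over_pt D c) \<union> strand (under_pt D c)) - strand_ends c)"
    using cut_family[of N] by auto
  have mem: "emb x \<in> \<Union>\<K> \<longleftrightarrow> (\<forall>c<N. dproj D x \<in> E c \<longrightarrow> emb x \<in> strand_ends c)" if "x \<in> link_points (dlink D)" for x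
  proof -
    have "emb x \<in> strand (over_pt D c) \<union> strand (under_pt D c) \<longleftrightarrow> dproj D x \<in> E c" if c: "c < N" for c
      using dcurve_mem_disk[OF c \<open>x \<in> _\<close>] strand_sub(3,4)[OF c] fst_emb[of x] by (metis UnE image_subset_iff)
    then show ?thesis unfolding \<K>(2) using that by auto
  qed
  have img: "fst ` \<Union>\<K> = outer"
  proof
    show "fst ` \<Union>\<K> \<subseteq> outer"
    proof
      fix a assume "a \<in> fst ` \<Union>\<K>"
      then obtain x where x: "x \<in> link_points (dlink D)" "emb x \<in> \<Union>\<K>" "a = dproj D x"
        using \<K>(2) fst_emb by auto
      show "a \<in> outer"
      proof (cases "\<exists>c<N. a \<in> E c")
        case True
        then obtain c where c: "c < N" "a \<in> E c" by blast
        then have "emb x \<in> strand_ends c" using mem[OF x(1)] x by auto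
        then have "a \<in> corners c" using corners_eq[OF c(1)] x(3) fst_emb[of x] by (metis image_eqI)
        then show ?thesis using c unfolding outer_def by blast
      next
        case False
        then show ?thesis using x unfolding outer_def dcurve_def by blast
      qed
    qed
    show "outer \<subseteq> fst ` \<Union>\<K>"
    proof
      fix a assume a: "a \<in> outer"
      show "a \<in> fst ` \<Union>\<K>"
      proof (cases "\<exists>c<N. a \<in> corners c")
        case True
        then obtain c where c: "c < N" "a \<in> corners c" by blast
        then obtain b where b: "b \<in> strand_ends c" "a = fst b" using corners_eq by blast
        then show ?thesis using c(1) \<K>(1) unfolding curve_family_def by blast
      next
        case False
        then have "a \<in> dcurve D" "\<forall>c<N. a \<notin> E c" using a unfolding outer_def by auto
        then obtain x where x: "x \<in> link_points (dlink D)" "a = dproj D x" unfolding dcurve_def by blast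
        then have "emb x \<in> \<Union>\<K>" using mem[OF x(1)] \<open>\<forall>c<N. a \<notin> E c\<close> by blast
        then show ?thesis using x(2) fst_emb[of x] by (metis image_eqI)
      qed
    qed
  qed
  have K_sub: "\<Union>\<K> \<subseteq> emb ` link_points (dlink D)" unfolding \<K>(2) by blast
  have inj: "inj_on fst (\<Union>\<K>)"
  proof (rule inj_onI)
    fix a b assume ab: "a \<in> \<Union>\<K>" "b \<in> \<Union>\<K>" "fst a = fst b"
    then have "a \<in> emb ` link_points (dlink D)" "b \<in> emb ` link_points (dlink D)" using K_sub by auto
    then obtain x y where xy: "x \<in> link_points (dlink D)" "a = emb x" "y \<in> link_points (dlink D)" "b = emb y"
      by (elim imageE) 
    show "a = b"
    proof (rule ccontr)
      assume "a \<noteq> b"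
      then have "x \<noteq> y" "dproj D x = dproj D y" using ab xy fst_emb by auto
      then obtain c where c: "c < N" "{x, y} = {over_pt D c 0, under_pt D c 0}"
        using dpts xy unfolding double_points_def by blast
      then have "x = over_pt D c 0 \<or> x = under_pt D c 0" by (auto simp: doubleton_eq_iff)
      then have z: "dproj D x = cdisk D c 0" using strand_props(5,6)[OF c(1), of 0] by auto
      then have "emb x \<in> strand_ends c" using mem[OF xy(1)] ab(1) xy(2) c(1) by auto
      then have "cdisk D c 0 \<in> corners c" using corners_eq[OF c(1)] z fst_emb[of x] by (metis image_eqI)
      then obtain w where w: "w \<in> {1, -1, \<i>, -\<i>}" "cdisk D c 0 = cdisk D c w" unfolding corners_def by blast
      then have "0 = w" using inj_onD[OF disk(2)[OF c(1)] w(2)] by auto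
      then show False using w by auto
    qed
  qed
  have "fst ` (\<Union>c<N. strand_ends c) = (\<Union>c<N. corners c)"
    unfolding image_UN using corners_eq by simp
  moreover have "continuous_on (\<Union>\<K>) fst" by (intro continuous_intros)
  ultimately have "curve_family ((`) fst ` \<K>) (\<Union>c<N. corners c)"
    using curve_family_image[OF \<K>(1) _ inj] by simp
  moreover have "\<Union>((`) fst ` \<K>) = outer" using img by blast
  ultimately show ?thesis by blast
qed

lemma corners_distinct:
  assumes "c < N" "u \<in> {1, -1, \<i>, -\<i>}" "v \<in> {1, -1, \<i>, -\<i>}"
  shows "cdisk D c u = cdisk D c v \<longleftrightarrow> u = v"
  using inj_onD[OF disk(2)[OF assms(1)], of u v] assms(2,3) by auto

lemma inner_arc:
  assumes c: "c < N" and "e \<in> {1, -1}" "w \<in> {\<i>, -\<i>}"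
  shows "arc_between (cdisk D c ` closed_segment e w) (cdisk D c e) (cdisk D c w)"
    "cdisk D c ` closed_segment e w \<subseteq> E c"
    "cdisk D c ` closed_segment e w \<inter> corners c = {cdisk D c e, cdisk D c w}"
proof -
  note s = segment_corner[OF assms(2,3)]
  have "arc_between (closed_segment e w) e w"
    unfolding arc_between_def by (intro exI[of _ "linepath e w"]) (use s in auto)
  then show "arc_between (cdisk D c ` closed_segment e w) (cdisk D c e) (cdisk D c w)"
    using arc_between_image continuous_on_subset[OF disk(1)[OF c] s(1)] inj_on_subset[OF disk(2)[OF c] s(1)] by blast
  show "cdisk D c ` closed_segment e w \<subseteq> E c" using s by blast
  have "cdisk D c ` closed_segment e w \<inter> corners c = cdisk D c ` (closed_segment e w \<inter> {1, -1, \<i>, -\<i>})"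
    unfolding corners_def using s(1)
    by (intro inj_on_image_Int[OF disk(2)[OF c], symmetric]) auto
  moreover have "closed_segment e w \<inter> {1, -1, \<i>, -\<i>} = {e, w}"
  proof -
    have "{1, -1, \<i>, -\<i>} \<subseteq> sphere 0 (1::real)" by auto
    then have "closed_segment e w \<inter> {1, -1, \<i>, -\<i>} \<subseteq> {e, w}" using s(2) by blast
    then show ?thesis using assms(2,3) by auto
  qed
  ultimately show "cdisk D c ` closed_segment e w \<inter> corners c = {cdisk D c e, cdisk D c w}" by simp
qed

lemma inner_arcs_disjoint:
  assumes c: "c < N" and w: "w \<in> {\<i>, -\<i>}"
  shows "cdisk D c ` closed_segment 1 w \<inter> cdisk D c ` closed_segment (-1) (-w) = {}"
proof -
  have w': "-w \<in> {\<i>, -\<i>}" using w by auto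
  have "closed_segment 1 w \<subseteq> cball 0 1" "closed_segment (-1) (-w) \<subseteq> cball 0 1"
    using segment_corner(1)[OF _ w, of 1] segment_corner(1)[OF _ w', of "-1"] by auto
  then show ?thesis
    using inj_on_image_Int[OF disk(2)[OF c], of "closed_segment 1 w" "closed_segment (-1) (-w)"]
      segments_disjoint[OF w] by simp
qed

lemma smoothing_dir_cases: "smoothing_dir b \<in> {\<i>, -\<i>}" "- smoothing_dir b \<in> {\<i>, -\<i>}"
  unfolding smoothing_dir_def by auto

section \<open>Resolving the crossings one at a time\<close>

text \<open>Crossings outside \<open>M\<close> stay open and contribute their corners as boundary
  points. Taking all crossings gives \<open>resolution\<close>; omitting a single one isolates the
  local picture there.\<close>

definition partial_resolution :: "(nat \<Rightarrow> nat) \<Rightarrow> nat set \<Rightarrow> complex set" where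
  "partial_resolution S M = outer \<union> (\<Union>c\<in>M. cdisk D c ` res_arcs (S c))"

lemma partial_resolution_disk:
  assumes "M \<subseteq> {..<N}" "c < N" "c \<notin> M"
  shows "partial_resolution S M \<inter> E c = corners c"
proof -
  have "cdisk D c' ` res_arcs (S c') \<inter> E c = {}" if "c' \<in> M" for c'
  proof -
    have c': "c' < N" "c' \<noteq> c" using that assms by auto
    have "cdisk D c' ` res_arcs (S c') \<subseteq> E c'"
      unfolding res_arcs_eq image_Un using inner_arc(2)[OF c'(1)] smoothing_dir_cases by auto
    then show ?thesis using disks_disjoint[OF c'(1) assms(2) c'(2)] by blast
  qed
  then show ?thesis using outer_disk[OF assms(2)] unfolding partial_resolution_def by blast
qed

text \<open>The two smoothing arcs are disjoint and meet the rest only in corners. Gluing in the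
  first one leaves the corners of the second one free, so \<open>curve_family_glue\<close> can be
  applied twice.\<close>

lemma glue_crossing:
  assumes F: "curve_family \<K> U" and c: "c < N" and U: "corners c \<subseteq> U" and dj: "\<Union>\<K> \<inter> E c = corners c"
  shows "\<exists>\<K>'. curve_family \<K>' (U - corners c) \<and> \<Union>\<K>' = \<Union>\<K> \<union> cdisk D c ` res_arcs b"
proof -
  define w where "w = smoothing_dir b"
  have w: "w \<in> {\<i>, -\<i>}" "-w \<in> {\<i>, -\<i>}" unfolding w_def using smoothing_dir_cases by auto
  define A B where "A = cdisk D c ` closed_segment 1 w" and "B = cdisk D c ` closed_segment (-1) (-w)"
  note a = inner_arc[OF c, of 1 w, folded A_def, OF _ w(1)] and b = inner_arc[OF c, of "-1" "-w", folded B_def, OF _ w(2)]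
  have AB: "A \<inter> B = {}" unfolding A_def B_def by (rule inner_arcs_disjoint[OF c w(1)])
  have cor: "corners c = {cdisk D c 1, cdisk D c w} \<union> {cdisk D c (-1), cdisk D c (-w)}"
    using w unfolding corners_def by auto
  have "A \<inter> \<Union>\<K> = A \<inter> corners c" "B \<inter> \<Union>\<K> = B \<inter> corners c" using a(2) b(2) dj by auto
  then have int: "A \<inter> \<Union>\<K> = {cdisk D c 1, cdisk D c w}" "B \<inter> \<Union>\<K> = {cdisk D c (-1), cdisk D c (-w)}"
    using a(3) b(3) by auto
  have inU: "cdisk D c 1 \<in> U" "cdisk D c w \<in> U" "cdisk D c (-1) \<in> U" "cdisk D c (-w) \<in> U" using U cor by auto
  obtain \<K>1 where \<K>1: "curve_family \<K>1 (U - {cdisk D c 1, cdisk D c w})" "\<Union>\<K>1 = \<Union>\<K> \<union> A"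
    using curve_family_glue[OF F a(1) int(1) inU(1,2)] by auto
  have "B \<inter> \<Union>\<K>1 = {cdisk D c (-1), cdisk D c (-w)}" using \<K>1(2) int(2) AB by auto
  moreover have "cdisk D c (-1) \<in> U - {cdisk D c 1, cdisk D c w}" "cdisk D c (-w) \<in> U - {cdisk D c 1, cdisk D c w}"
    using inU AB arc_between_props(4,5)[OF a(1)] arc_between_props(4,5)[OF b(1)] by auto
  ultimately obtain \<K>2 where \<K>2: "curve_family \<K>2 (U - {cdisk D c 1, cdisk D c w} - {cdisk D c (-1), cdisk D c (-w)})"
     "\<Union>\<K>2 = \<Union>\<K>1 \<union> B"
    using curve_family_glue[OF \<K>1(1) b(1)] by auto
  have "\<Union>\<K>2 = \<Union>\<K> \<union> cdisk D c ` res_arcs b"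
    unfolding \<K>2(2) \<K>1(2) res_arcs_eq A_def B_def w_def by auto
  moreover have "U - {cdisk D c 1, cdisk D c w} - {cdisk D c (-1), cdisk D c (-w)} = U - corners c"
    unfolding cor by blast
  ultimately show ?thesis using \<K>2(1) by auto
qed

lemma partial_resolution_family:
  assumes "M \<subseteq> {..<N}"
  shows "\<exists>\<K>. curve_family \<K> (\<Union>c\<in>{..<N} - M. corners c) \<and> \<Union>\<K> = partial_resolution S M"
  using finite_subset[OF assms finite_lessThan] assms
proof (induction M rule: finite_induct)
  case empty
  then show ?case using outer_family unfolding partial_resolution_def by auto
next
  case (insert c M)
  then have c: "c < N" "c \<notin> M" "M \<subseteq> {..<N}" by auto
  obtain \<K> where \<K>: "curve_family \<K> (\<Union>c\<in>{..<N} - M. corners c)" "\<Union>\<K> = partial_resolution S M"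
    using insert by auto
  have "corners c \<subseteq> (\<Union>c\<in>{..<N} - M. corners c)" using c by auto
  moreover have "\<Union>\<K> \<inter> E c = corners c" using partial_resolution_disk[OF c(3,1,2)] \<K>(2) by simp
  ultimately obtain \<K>' where \<K>': "curve_family \<K>' ((\<Union>c\<in>{..<N} - M. corners c) - corners c)"
      "\<Union>\<K>' = \<Union>\<K> \<union> cdisk D c ` res_arcs (S c)"
    using glue_crossing[OF \<K>(1) c(1)] by blast
  have "(\<Union>c\<in>{..<N} - M. corners c) - corners c = (\<Union>c\<in>{..<N} - insert c M. corners c)"
  proof -
    have "corners c' \<inter> corners c = {}" if "c' < N" "c' \<noteq> c" for c'
      using disks_disjoint[OF that(1) c(1) that(2)] corners_sub[of c] corners_sub[of c'] by blast
    then show ?thesis using c by auto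
  qed
  moreover have "\<Union>\<K>' = partial_resolution S (insert c M)"
    unfolding \<K>'(2) \<K>(2) partial_resolution_def by auto
  ultimately show ?case using \<K>'(1) by auto
qed

lemma resolution_eq: "resolution D S = partial_resolution S {..<N}"
proof -
  have "corners c \<subseteq> cdisk D c ` res_arcs (S c)" for c
    unfolding corners_def res_arcs_eq smoothing_dir_def by auto
  then show ?thesis unfolding resolution_def partial_resolution_def outer_def by blast
qed

end

section \<open>The three circles at a crossing\<close>

context link_diagram
begin

text \<open>The arcs \<open>K\<close> and \<open>K'\<close> are what remains outside the crossing disk of the circles through a crossing: one
  smoothing closes them up to the two circles \<open>leg1\<close> and \<open>leg2\<close>, the other one to the single circle \<open>waist\<close>.\<close>

definition pants :: "nat \<Rightarrow> complex set \<Rightarrow> complex set \<Rightarrow> complex \<Rightarrow> bool" where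
  "pants c K K' w \<longleftrightarrow> c < N \<and> w \<in> {\<i>, -\<i>} \<and> K \<inter> K' = {} \<and>
     arc_between K (cdisk D c 1) (cdisk D c w) \<and> arc_between K' (cdisk D c (-1)) (cdisk D c (-w)) \<and>
     K \<inter> E c = {cdisk D c 1, cdisk D c w} \<and> K' \<inter> E c = {cdisk D c (-1), cdisk D c (-w)}"

definition leg1 :: "nat \<Rightarrow> complex set \<Rightarrow> complex \<Rightarrow> complex set" where
  "leg1 c K w = K \<union> cdisk D c ` closed_segment 1 w"

definition leg2 :: "nat \<Rightarrow> complex set \<Rightarrow> complex \<Rightarrow> complex set" where
  "leg2 c K' w = K' \<union> cdisk D c ` closed_segment (-1) (-w)"

definition waist :: "nat \<Rightarrow> complex set \<Rightarrow> complex set \<Rightarrow> complex \<Rightarrow> complex set" where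
  "waist c K K' w = K \<union> K' \<union> cdisk D c ` closed_segment 1 (-w) \<union> cdisk D c ` closed_segment (-1) w"

lemma pantsD:
  assumes "pants c K K' w"
  shows "c < N" "w \<in> {\<i>, -\<i>}" "-w \<in> {\<i>, -\<i>}" "K \<inter> K' = {}"
    "arc_between K (cdisk D c 1) (cdisk D c w)" "arc_between K' (cdisk D c (-1)) (cdisk D c (-w))"
    "K \<inter> E c = {cdisk D c 1, cdisk D c w}" "K' \<inter> E c = {cdisk D c (-1), cdisk D c (-w)}"
    "corners c = {cdisk D c 1, cdisk D c w, cdisk D c (-1), cdisk D c (-w)}"
  using assms unfolding pants_def corners_def by auto

text \<open>The waist runs through \<open>K\<close>, a smoothing arc, \<open>K'\<close> and the
  other smoothing arc. Outer and smoothing arcs can meet only in corners, so all intersections are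
  read off from the four corners being distinct.\<close>

lemma pants_curves:
  assumes P: "pants c K K' w"
  shows "closed_curve (leg1 c K w)" "closed_curve (leg2 c K' w)" "closed_curve (waist c K K' w)"
    "leg1 c K w \<inter> leg2 c K' w = {}"
proof -
  note P = pantsD[OF P]
  note a = inner_arc[OF P(1), of 1 w, OF _ P(2)] and b = inner_arc[OF P(1), of "-1" "-w", OF _ P(3)]
    and a' = inner_arc[OF P(1), of 1 "-w", OF _ P(3)] and b' = inner_arc[OF P(1), of "-1" w, OF _ P(2)]
  have d: "cdisk D c ` closed_segment 1 w \<inter> cdisk D c ` closed_segment (-1) (-w) = {}"
    using inner_arcs_disjoint[OF P(1,2)] .
  have d': "cdisk D c ` closed_segment 1 (-w) \<inter> cdisk D c ` closed_segment (-1) w = {}"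
    using inner_arcs_disjoint[OF P(1,3)] by simp
  note Kp = arc_between_props[OF P(5)] and K'p = arc_between_props[OF P(6)]
  define p1 pm pw pn where pp: "p1 = cdisk D c 1" "pm = cdisk D c (-1)" "pw = cdisk D c w" "pn = cdisk D c (-w)"
  have dist: "p1 \<noteq> pm" "p1 \<noteq> pw" "p1 \<noteq> pn" "pm \<noteq> pw" "pm \<noteq> pn" "pw \<noteq> pn"
    unfolding pp using Kp(4,5,6) K'p(4,5,6) P(4) by auto
  show "closed_curve (leg1 c K w)" unfolding leg1_def
    using arc_close[OF P(5) a(1)] P(7) a(2) by blast
  show "closed_curve (leg2 c K' w)" unfolding leg2_def
    using arc_close[OF P(6) b(1)] P(8) b(2) by blast
  show "leg1 c K w \<inter> leg2 c K' w = {}"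
  proof -
    have "K \<inter> cdisk D c ` closed_segment (-1) (-w) \<subseteq> {p1, pw} \<inter> {pm, pn}"
      using P(7) b(2,3) P(9) unfolding pp by blast
    moreover have "K' \<inter> cdisk D c ` closed_segment 1 w \<subseteq> {p1, pw} \<inter> {pm, pn}"
      using P(8) a(2,3) P(9) unfolding pp by blast
    moreover have "{p1, pw} \<inter> {pm, pn} = {}" using dist by auto
    ultimately show ?thesis using P(4) d unfolding leg1_def leg2_def by blast
  qed
  define A' B' where AB': "A' = cdisk D c ` closed_segment 1 (-w)" "B' = cdisk D c ` closed_segment (-1) w"
  have KA: "K \<inter> A' \<subseteq> {p1, pw} \<inter> {p1, pn}" 
    using P(7) a'(2,3) P(9) unfolding pp AB' by blast
  have KB: "K \<inter> B' \<subseteq> {p1, pw} \<inter> {pm, pw}" 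
    using P(7) b'(2,3) P(9) unfolding pp AB' by blast
  have K'A: "K' \<inter> A' \<subseteq> {pm, pn} \<inter> {p1, pn}" 
    using P(8) a'(2,3) P(9) unfolding pp AB' by blast
  have K'B: "K' \<inter> B' \<subseteq> {pm, pn} \<inter> {pm, pw}" 
    using P(8) b'(2,3) P(9) unfolding pp AB' by blast
  have "K \<inter> A' \<subseteq> {p1}" using KA dist by auto
  then have 1: "arc_between (K \<union> A') pw pn" using arc_concat[OF arc_between_sym[OF P(5)] a'(1)] unfolding pp AB' by simp
  have "(K \<union> A') \<inter> K' \<subseteq> {pn}" using P(4) K'A dist by auto
  then have 2: "arc_between (K \<union> A' \<union> K') pw pm"
    using arc_concat[OF 1] arc_between_sym[OF P(6)] unfolding pp by simp
  have "(K \<union> A' \<union> K') \<inter> B' \<subseteq> {pw, pm}" using KB K'B d' unfolding AB'[symmetric] by auto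
  then have "closed_curve (K \<union> A' \<union> K' \<union> B')"
    using arc_close[OF 2] arc_between_sym[OF b'(1)] unfolding pp AB' by simp
  moreover have "K \<union> A' \<union> K' \<union> B' = waist c K K' w" unfolding waist_def AB' by blast
  ultimately show "closed_curve (waist c K K' w)" by simp
qed

text \<open>Legs and waist differ only inside the crossing disk and both contain all four corners,
  so they have the same points in \<open>outer\<close>. The images of 1 and -1 serve as markers of
  the two legs.\<close>

lemma pants_outer:
  assumes P: "pants c K K' w"
  shows "waist c K K' w \<inter> outer = (leg1 c K w \<union> leg2 c K' w) \<inter> outer"
    "cdisk D c 1 \<in> leg1 c K w" "cdisk D c (-1) \<in> leg2 c K' w" "cdisk D c 1 \<in> waist c K K' w" "cdisk D c (-1) \<in> waist c K K' w"
    "cdisk D c 1 \<in> outer" "cdisk D c (-1) \<in> outer"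
    "leg1 c K w \<noteq> leg2 c K' w" "leg1 c K w \<noteq> waist c K K' w" "leg2 c K' w \<noteq> waist c K K' w"
proof -
  note P' = pantsD[OF P]
  note a = inner_arc[OF P'(1), of 1 w, OF _ P'(2)] and b = inner_arc[OF P'(1), of "-1" "-w", OF _ P'(3)]
    and a' = inner_arc[OF P'(1), of 1 "-w", OF _ P'(3)] and b' = inner_arc[OF P'(1), of "-1" w, OF _ P'(2)]
  have KK: "corners c \<subseteq> K \<union> K'" using P'(7,8,9) by blast
  have o: "Z \<inter> outer \<subseteq> K \<union> K'" if "Z \<subseteq> E c" for Z
    using that KK outer_disk[OF P'(1)] by blast
  show "waist c K K' w \<inter> outer = (leg1 c K w \<union> leg2 c K' w) \<inter> outer"
    using o[OF a(2)] o[OF a'(2)] o[OF b(2)] o[OF b'(2)] unfolding waist_def leg1_def leg2_def by blast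
  show l: "cdisk D c 1 \<in> leg1 c K w" "cdisk D c (-1) \<in> leg2 c K' w" "cdisk D c 1 \<in> waist c K K' w" "cdisk D c (-1) \<in> waist c K K' w"
    unfolding leg1_def leg2_def waist_def by auto
  show "cdisk D c 1 \<in> outer" "cdisk D c (-1) \<in> outer"
    using P'(1) unfolding outer_def corners_def by auto
  show "leg1 c K w \<noteq> leg2 c K' w" "leg1 c K w \<noteq> waist c K K' w" "leg2 c K' w \<noteq> waist c K K' w"
    using l pants_curves(4)[OF P] by auto
qed

text \<open>With all other crossings resolved, the four corners of \<open>c\<close> are the ends of
  two arcs. Planarity excludes that the arc from 1 ends in -1, so it ends in some \<open>w\<close>
  equal to \<open>\<i>\<close> or \<open>-\<i>\<close>. The smoothing in direction \<open>w\<close>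
  closes each arc separately, the opposite one joins them. The remaining closed curves are untouched
  and do not depend on the smoothing at \<open>c\<close>.\<close>

lemma local_structure:
  assumes c: "c < N"
  shows "\<exists>\<K> K K' w. pants c K K' w \<and> finite \<K> \<and>
     (\<forall>X\<in>\<K>. closed_curve X \<and> X \<inter> E c = {} \<and> X \<inter> leg1 c K w = {} \<and> X \<inter> leg2 c K' w = {} \<and> X \<inter> waist c K K' w = {}) \<and>
     (\<forall>b. circles D (S(c := b)) = \<K> \<union> (if smoothing_dir b = w then {leg1 c K w, leg2 c K' w} else {waist c K K' w}))"
proof -
  define M where "M = {..<N} - {c}"
  have M: "M \<subseteq> {..<N}" "c \<notin> M" "{..<N} - M = {c}" "insert c M = {..<N}" using c unfolding M_def by auto
  obtain \<K> where \<K>: "curve_family \<K> (corners c)" "\<Union>\<K> = partial_resolution S M"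
    using partial_resolution_family[OF M(1), of S] M(3) by auto
  have f: "finite \<K>" "disjoint \<K>" "corners c \<subseteq> \<Union>\<K>" using \<K>(1) unfolding curve_family_def by auto
  have disj: "X \<inter> Y = {}" if "X \<in> \<K>" "Y \<in> \<K>" "X \<noteq> Y" for X Y
    using f(2) that unfolding pairwise_def disjnt_def by auto
  have KE: "X \<inter> E c = X \<inter> corners c" if "X \<in> \<K>" for X
    using partial_resolution_disk[OF M(1) c M(2), of S] \<K>(2) that corners_sub[of c] by blast
  let ?V = "{1, -1, \<i>, -\<i>}"
  have arc: "\<exists>K v. K \<in> \<K> \<and> v \<in> ?V \<and> arc_between K (cdisk D c u) (cdisk D c v) \<and> K \<inter> corners c = {cdisk D c u, cdisk D c v} \<and> v \<noteq> u"
    if u: "u \<in> ?V" for u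
  proof -
    have "cdisk D c u \<in> corners c" using u unfolding corners_def by blast
    then obtain K where K: "K \<in> \<K>" "cdisk D c u \<in> K" using f(3) by blast
    then have "K \<inter> corners c \<noteq> {}" using \<open>cdisk D c u \<in> corners c\<close> by blast
    then obtain x y where xy: "arc_between K x y" "K \<inter> corners c = {x, y}"
      using \<K>(1) K(1) unfolding curve_family_def by blast
    have "x = cdisk D c u \<or> y = cdisk D c u" 
    proof -
      have "cdisk D c u \<in> {x, y}" unfolding xy(2)[symmetric] using K(2) \<open>cdisk D c u \<in> corners c\<close> by (rule IntI)
      then show ?thesis by auto
    qed
    then obtain z where z: "arc_between K (cdisk D c u) z" "K \<inter> corners c = {cdisk D c u, z}"
      using xy arc_between_sym[OF xy(1)] insert_commute[of x y "{}"] by metis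
    then have "z \<in> corners c" by blast
    then obtain v where v: "v \<in> ?V" "z = cdisk D c v" unfolding corners_def by blast
    then have "v \<noteq> u" using arc_between_props(6)[OF z(1)] by blast
    then show ?thesis using z v K(1) by blast
  qed
  obtain K v where K: "K \<in> \<K>" "v \<in> ?V" "arc_between K (cdisk D c 1) (cdisk D c v)" "K \<inter> corners c = {cdisk D c 1, cdisk D c v}" "v \<noteq> 1"
    using arc[of 1] by blast
  have sep: "v' \<noteq> v" "u' \<noteq> v" "v' \<noteq> 1"
    if K': "K' \<in> \<K>" "v' \<in> ?V" "u' \<in> ?V" "K' \<inter> corners c = {cdisk D c u', cdisk D c v'}" "u' \<noteq> 1" "cdisk D c u' \<notin> K" for K' u' v'
  proof -
    have "K' \<noteq> K" using K' by blast
    then have "K \<inter> K' = {}" using disj K(1) K'(1) by blast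
    then show "v' \<noteq> v" "u' \<noteq> v" "v' \<noteq> 1" using K' K(4) by blast+
  qed
  \<comment> \<open>Otherwise the other arc would have to join the two remaining corners,
    \<open>\<i>\<close> and \<open>-\<i>\<close>, against
    \<open>interlaced_arcs_meet\<close>.\<close>
  have "v \<noteq> -1"
  proof
    assume v: "v = -1"
    have iK: "cdisk D c \<i> \<notin> K"
    proof
      assume "cdisk D c \<i> \<in> K"
      then have "cdisk D c \<i> \<in> {cdisk D c 1, cdisk D c (-1)}" using K(4) v unfolding corners_def by blast
      then show False using corners_distinct[OF c, of \<i> 1] corners_distinct[OF c, of \<i> "-1"] by (auto simp: complex_eq_iff)
    qed
    obtain K' v' where K': "K' \<in> \<K>" "v' \<in> ?V" "arc_between K' (cdisk D c \<i>) (cdisk D c v')"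
        "K' \<inter> corners c = {cdisk D c \<i>, cdisk D c v'}" "v' \<noteq> \<i>"
      using arc[of \<i>] by blast
    have "v' \<noteq> v" "v' \<noteq> 1" using sep[OF K'(1,2) _ K'(4) _ iK] by (auto simp: complex_eq_iff)
    then have v': "v' = -\<i>" using K'(2,5) v by auto
    have "K \<noteq> K'" using iK K'(4) by blast
    then have "K \<inter> K' = {}" using disj K(1) K'(1) by blast
    moreover have "K \<inter> K' \<noteq> {}"
      using interlaced_arcs_meet[OF disk(1,2)[OF c], of K K'] K(3,4) K'(3,4) v v' KE[OF K(1)] KE[OF K'(1)]
        arc_between_props[OF K'(3)] by simp
    ultimately show False by blast
  qed
  then have v: "v \<in> {\<i>, -\<i>}" using K(2,5) by auto
  have cor: "corners c = {cdisk D c 1, cdisk D c v, cdisk D c (-1), cdisk D c (-v)}"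
    using v unfolding corners_def by auto
  have mK: "cdisk D c (-1) \<notin> K"
  proof
    assume "cdisk D c (-1) \<in> K"
    then have "cdisk D c (-1) \<in> {cdisk D c 1, cdisk D c v}" using K(4) unfolding corners_def by blast
    then show False using corners_distinct[OF c, of "-1" 1] corners_distinct[OF c, of "-1" v] v by (auto simp: complex_eq_iff)
  qed
  obtain K' v' where K': "K' \<in> \<K>" "v' \<in> ?V" "arc_between K' (cdisk D c (-1)) (cdisk D c v')"
      "K' \<inter> corners c = {cdisk D c (-1), cdisk D c v'}" "v' \<noteq> -1"
    using arc[of "-1"] by blast
  have "v' \<noteq> v" "v' \<noteq> 1" using sep[OF K'(1,2) _ K'(4) _ mK] by (auto simp: complex_eq_iff)
  then have v': "v' = -v" using K'(2,5) v by auto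
  have KK': "K \<noteq> K'" using mK K'(4) by blast
  have P: "pants c K K' v"
    unfolding pants_def using c v K K' v' disj[OF K(1) K'(1) KK'] KE[OF K(1)] KE[OF K'(1)] by simp
  define R where "R = \<K> - {K, K'}"
  have RE: "X \<inter> E c = {}" if X: "X \<in> R" for X
  proof -
    have "X \<inter> K = {}" "X \<inter> K' = {}" using X disj[of X K] disj[of X K'] K(1) K'(1) unfolding R_def by auto
    moreover have "corners c \<subseteq> K \<union> K'" unfolding cor using K(4) K'(4) v' by blast
    ultimately have "X \<inter> corners c = {}" by blast
    then show ?thesis using KE[of X] X unfolding R_def by blast
  qed
  have Rc: "closed_curve X" if X: "X \<in> R" for X
  proof -
    have "X \<inter> corners c = {}" using RE[OF X] corners_sub by blast
    then show ?thesis using \<K>(1) X unfolding curve_family_def R_def by blast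
  qed
  note a = inner_arc[OF c, of 1 v, OF _ v] and b = inner_arc[OF c, of "-1" "-v"]
    and a' = inner_arc[OF c, of 1 "-v"] and b' = inner_arc[OF c, of "-1" v, OF _ v]
  have v2: "-v \<in> {\<i>, -\<i>}" using v by auto
  have Rd: "X \<inter> leg1 c K v = {} \<and> X \<inter> leg2 c K' v = {} \<and> X \<inter> waist c K K' v = {}" if X: "X \<in> R" for X
  proof -
    have "X \<inter> K = {}" "X \<inter> K' = {}" using X disj[of X K] disj[of X K'] K(1) K'(1) unfolding R_def by auto
    moreover have "X \<inter> Z = {}" if "Z \<subseteq> E c" for Z using RE[OF X] that by blast
    then have "X \<inter> cdisk D c ` closed_segment 1 v = {}" "X \<inter> cdisk D c ` closed_segment (-1) (-v) = {}"
      "X \<inter> cdisk D c ` closed_segment 1 (-v) = {}" "X \<inter> cdisk D c ` closed_segment (-1) v = {}"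
      using a(2) b(2)[OF _ v2] a'(2)[OF _ v2] b'(2) by auto
    ultimately show ?thesis unfolding leg1_def leg2_def waist_def Int_Un_distrib by simp
  qed
  have "circles D (S(c := b)) = R \<union> (if smoothing_dir b = v then {leg1 c K v, leg2 c K' v} else {waist c K K' v})" for b
  proof -
    define Q where "Q = (if smoothing_dir b = v then {leg1 c K v, leg2 c K' v} else {waist c K K' v})"
    have "partial_resolution (S(c := b)) {..<N} = partial_resolution S M \<union> cdisk D c ` res_arcs b"
    proof -
      have "(\<Union>c'\<in>M. cdisk D c' ` res_arcs ((S(c := b)) c')) = (\<Union>c'\<in>M. cdisk D c' ` res_arcs (S c'))"
        using M(2) by (intro SUP_cong) auto
      then show ?thesis unfolding partial_resolution_def M(4)[symmetric] UN_insert by auto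
    qed
    then have "resolution D (S(c := b)) = \<Union>\<K> \<union> cdisk D c ` res_arcs b" unfolding resolution_eq \<K>(2) .
    also have "\<dots> = \<Union>R \<union> (K \<union> K' \<union> cdisk D c ` res_arcs b)" unfolding R_def using K(1) K'(1) by blast
    also have "K \<union> K' \<union> cdisk D c ` res_arcs b = \<Union>Q"
    proof (cases "smoothing_dir b = v")
      case True
      then show ?thesis unfolding Q_def res_arcs_eq image_Un leg1_def leg2_def by auto
    next
      case False
      then have "smoothing_dir b = -v" using smoothing_dir_cases(1)[of b] v by auto
      then show ?thesis using False unfolding Q_def res_arcs_eq image_Un waist_def by auto
    qed
    finally have res: "resolution D (S(c := b)) = \<Union>(R \<union> Q)" unfolding Union_Un_distrib .
    have "curve_family (R \<union> Q) {}"
      unfolding curve_family_def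
    proof (intro conjI ballI)
      show "finite (R \<union> Q)" using f(1) unfolding R_def Q_def by auto
      have "disjoint R" using f(2) unfolding R_def by (simp add: pairwise_def)
      moreover have "disjoint Q" unfolding Q_def using pants_curves(4)[OF P] by (auto simp: pairwise_insert disjnt_def)
      moreover have "X \<inter> Y = {}" if "X \<in> R" "Y \<in> Q" for X Y using Rd[OF that(1)] that(2) unfolding Q_def by (auto split: if_splits)
      ultimately show "disjoint (R \<union> Q)" unfolding pairwise_def disjnt_def by blast
      fix X assume "X \<in> R \<union> Q"
      then have "closed_curve X" using Rc pants_curves(1,2,3)[OF P] unfolding Q_def by (auto split: if_splits)
      then show "closed_curve X \<and> X \<inter> {} = {} \<or> (\<exists>u v. arc_between X u v \<and> X \<inter> {} = {u, v})" by blast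
    qed simp
    then show ?thesis unfolding circles_def res Q_def[symmetric] by (rule components_curve_family)
  qed
  moreover have "finite R" using f(1) unfolding R_def by simp
  ultimately show ?thesis using P RE Rc Rd
    by (intro exI[of _ R] exI[of _ K] exI[of _ K'] exI[of _ v] conjI allI ballI) simp_all
qed

lemma resolution_Sig: "resolution D S \<subseteq> Sig n p"
proof -
  have "cdisk D c ` res_arcs (S c) \<subseteq> E c" if "c < N" for c
    unfolding res_arcs_eq image_Un using inner_arc(2)[OF that] smoothing_dir_cases by auto
  then have "cdisk D c ` res_arcs (S c) \<subseteq> Sig n p" if "c < N" for c using disk(3)[OF that] that by blast
  then show ?thesis using dcurve_Sig unfolding resolution_def by blast
qed

lemma resolution_family: "\<exists>\<K>. curve_family \<K> {} \<and> \<Union>\<K> = resolution D S"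
  using partial_resolution_family[of "{..<N}" S] unfolding resolution_eq by auto

lemma circles_props:
  shows "finite (circles D S)" "C \<in> circles D S \<Longrightarrow> closed_curve C" "C \<in> circles D S \<Longrightarrow> C \<subseteq> Sig n p"
    "disjoint (circles D S)"
proof -
  obtain \<K> where \<K>: "curve_family \<K> {}" "\<Union>\<K> = resolution D S" using resolution_family by blast
  then have e: "circles D S = \<K>" using components_curve_family unfolding circles_def by metis
  show "finite (circles D S)" "disjoint (circles D S)" using \<K>(1) unfolding e curve_family_def by auto
  show "C \<in> circles D S \<Longrightarrow> closed_curve C" using \<K>(1) unfolding e curve_family_def by auto
  show "C \<in> circles D S \<Longrightarrow> C \<subseteq> Sig n p"
    using resolution_Sig[of S] in_components_subset unfolding circles_def by blast
qed

text \<open>Supplies on every circle a point that can be compared across resolutions. A circle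
  meeting a crossing disk contains a corner of it; any other circle lies in \<open>outer\<close>
  altogether.\<close>

lemma circle_meets_outer:
  assumes "C \<in> circles D S"
  shows "C \<inter> outer \<noteq> {}"
proof (cases "\<exists>c<N. C \<inter> E c \<noteq> {}")
  case True
  then obtain c where c: "c < N" "C \<inter> E c \<noteq> {}" by blast
  obtain \<K> K K' w where *: "pants c K K' w" "\<forall>X\<in>\<K>. X \<inter> E c = {}"
     "\<forall>b. circles D (S(c := b)) = \<K> \<union> (if smoothing_dir b = w then {leg1 c K w, leg2 c K' w} else {waist c K K' w})"
    using local_structure[OF c(1), of S] by meson
  have "circles D S = \<K> \<union> (if smoothing_dir (S c) = w then {leg1 c K w, leg2 c K' w} else {waist c K K' w})"
    using *(3)[rule_format, of "S c"] by simp
  then have "C \<in> {leg1 c K w, leg2 c K' w, waist c K K' w}" using assms *(2) c(2) by (auto split: if_splits)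
  then show ?thesis using pants_outer(2-7)[OF *(1)] by auto
next
  case False
  have "C \<subseteq> resolution D S" using assms in_components_subset unfolding circles_def by blast
  moreover have "cdisk D c ` res_arcs (S c) \<subseteq> E c" if "c < N" for c
    unfolding res_arcs_eq image_Un using inner_arc(2)[OF that] smoothing_dir_cases by auto
  ultimately have "C \<subseteq> outer" using False unfolding resolution_eq partial_resolution_def by blast
  moreover have "C \<noteq> {}" using assms in_components_nonempty unfolding circles_def by blast
  ultimately show ?thesis by blast
qed

end

section \<open>The Khovanov complex\<close>

context link_diagram
begin

abbreviation "pt c \<equiv> cdisk D c 1"
abbreviation "qt c \<equiv> cdisk D c (-1)"

text \<open>The 0-smoothing has direction \<open>-\<i>\<close>, the 1-smoothing \<open>\<i>\<close>.
  So the edge is a merge if the outer arc from 1 ends in the corner \<open>-\<i>\<close> and a split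
  otherwise; one circle never turns into one circle.\<close>

lemma edge_cases:
  assumes c: "c < N" and Sc: "S c = 0"
  obtains (merge) \<K> K K' w where "pants c K K' w" "finite \<K>"
      "leg1 c K w \<notin> \<K>" "leg2 c K' w \<notin> \<K>" "waist c K K' w \<notin> \<K>"
      "circles D S = \<K> \<union> {leg1 c K w, leg2 c K' w}" "circles D (S(c := 1)) = \<K> \<union> {waist c K K' w}"
    | (split) \<K> K K' w where "pants c K K' w" "finite \<K>"
      "leg1 c K w \<notin> \<K>" "leg2 c K' w \<notin> \<K>" "waist c K K' w \<notin> \<K>"
      "circles D S = \<K> \<union> {waist c K K' w}" "circles D (S(c := 1)) = \<K> \<union> {leg1 c K w, leg2 c K' w}"
proof -
  obtain \<K> K K' w where *: "pants c K K' w" "finite \<K>"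
     "\<forall>X\<in>\<K>. closed_curve X \<and> X \<inter> E c = {} \<and> X \<inter> leg1 c K w = {} \<and> X \<inter> leg2 c K' w = {} \<and> X \<inter> waist c K K' w = {}"
     "\<forall>b. circles D (S(c := b)) = \<K> \<union> (if smoothing_dir b = w then {leg1 c K w, leg2 c K' w} else {waist c K K' w})"
    using local_structure[OF c, of S] by meson
  have n: "leg1 c K w \<notin> \<K>" "leg2 c K' w \<notin> \<K>" "waist c K K' w \<notin> \<K>"
  proof -
    have "Y \<notin> \<K>" if "Y \<in> {leg1 c K w, leg2 c K' w, waist c K K' w}" for Y
    proof
      assume "Y \<in> \<K>"
      then have "Y \<inter> leg1 c K w = {}" "Y \<inter> leg2 c K' w = {}" "Y \<inter> waist c K K' w = {}"
        using bspec[OF *(3), of Y] by simp_all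
      then have "Y = {}" using that by auto
      then show False using that pants_outer(2,3,4)[OF *(1)] by auto
    qed
    then show "leg1 c K w \<notin> \<K>" "leg2 c K' w \<notin> \<K>" "waist c K K' w \<notin> \<K>" by auto
  qed
  have S0: "S(c := 0) = S" using Sc by auto
  have c0: "circles D S = \<K> \<union> (if smoothing_dir 0 = w then {leg1 c K w, leg2 c K' w} else {waist c K K' w})"
    using *(4)[rule_format, of 0] S0 by simp
  have c1: "circles D (S(c := 1)) = \<K> \<union> (if smoothing_dir 1 = w then {leg1 c K w, leg2 c K' w} else {waist c K K' w})"
    using *(4) by blast
  have w: "w = \<i> \<or> w = -\<i>" using pantsD(2)[OF *(1)] by auto
  have d: "smoothing_dir 0 = -\<i>" "smoothing_dir 1 = \<i>" "\<i> \<noteq> -\<i>" unfolding smoothing_dir_def by (auto simp: complex_eq_iff)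
  show ?thesis
  proof (cases "w = -\<i>")
    case True
    then have "smoothing_dir 0 = w" "smoothing_dir 1 \<noteq> w" using d by auto
    then show ?thesis using merge[OF *(1,2) n] c0 c1 by simp
  next
    case False
    then have "smoothing_dir 0 \<noteq> w" "smoothing_dir 1 = w" using d w by auto
    then show ?thesis using split[OF *(1,2) n] c0 c1 by simp
  qed
qed

section \<open>Outer points on a common circle\<close>

text \<open>Circles of different resolutions are different sets, so resolutions are compared through
  this relation on the points of \<open>outer\<close>, which all of them contain.\<close>

definition conn :: "(nat \<Rightarrow> nat) \<Rightarrow> complex \<Rightarrow> complex \<Rightarrow> bool" where
  "conn S x y \<longleftrightarrow> (\<exists>C\<in>circles D S. x \<in> C \<and> y \<in> C)"

lemma circle_unique: "C \<in> circles D S \<Longrightarrow> C' \<in> circles D S \<Longrightarrow> x \<in> C \<Longrightarrow> x \<in> C' \<Longrightarrow> C = C'"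
  using circles_props(4)[of S] unfolding pairwise_def disjnt_def by blast

lemma pt_outer: "c < N \<Longrightarrow> pt c \<in> outer" "c < N \<Longrightarrow> qt c \<in> outer"
  unfolding outer_def corners_def by auto

text \<open>On \<open>outer\<close> the waist is the union of the two legs. Passing from
  \<open>S\<close> to \<open>S'\<close> thus identifies the classes of \<open>pt c\<close> and
  \<open>qt c\<close> and nothing else.\<close>

lemma conn_aux:
  assumes P: "pants c K K' w" and S: "circles D S = \<K> \<union> {leg1 c K w, leg2 c K' w}"
    and S': "circles D S' = \<K> \<union> {waist c K K' w}"
  shows "\<not> conn S (pt c) (qt c)" "conn S' (pt c) (qt c)"
    "x \<in> outer \<Longrightarrow> y \<in> outer \<Longrightarrow>
      conn S' x y \<longleftrightarrow> conn S x y \<or> conn S (pt c) x \<and> conn S (qt c) y \<or> conn S (qt c) x \<and> conn S (pt c) y"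
proof -
  note o = pants_outer[OF P] 
  have A: "leg1 c K w \<in> circles D S" and B: "leg2 c K' w \<in> circles D S" and C: "waist c K K' w \<in> circles D S'"
    using S S' by auto
  have p: "conn S (pt c) x \<longleftrightarrow> x \<in> leg1 c K w" and q: "conn S (qt c) x \<longleftrightarrow> x \<in> leg2 c K' w" for x
    using circle_unique[OF A] circle_unique[OF B] A B o(2,3) unfolding conn_def by blast+
  show "\<not> conn S (pt c) (qt c)" using p o(3) pants_curves(4)[OF P] by blast
  show "conn S' (pt c) (qt c)" using C o(4,5) unfolding conn_def by blast
  assume xy: "x \<in> outer" "y \<in> outer"
  have W: "x \<in> waist c K K' w \<longleftrightarrow> x \<in> leg1 c K w \<or> x \<in> leg2 c K' w" if "x \<in> outer" for x
    using o(1) that by blast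
  have "conn S' x y \<longleftrightarrow> (\<exists>X\<in>\<K>. x \<in> X \<and> y \<in> X) \<or> x \<in> waist c K K' w \<and> y \<in> waist c K K' w"
    unfolding conn_def S' by blast
  moreover have "conn S x y \<longleftrightarrow> (\<exists>X\<in>\<K>. x \<in> X \<and> y \<in> X) \<or> x \<in> leg1 c K w \<and> y \<in> leg1 c K w \<or> x \<in> leg2 c K' w \<and> y \<in> leg2 c K' w"
    unfolding conn_def S by blast
  ultimately show "conn S' x y \<longleftrightarrow> conn S x y \<or> conn S (pt c) x \<and> conn S (qt c) y \<or> conn S (qt c) x \<and> conn S (pt c) y"
    unfolding p q W[OF xy(1)] W[OF xy(2)] by blast
qed

lemma conn_merge:
  assumes "c < N" "S c = 0" "\<not> conn S (pt c) (qt c)"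
  shows "conn (S(c := 1)) (pt c) (qt c)"
    "x \<in> outer \<Longrightarrow> y \<in> outer \<Longrightarrow> conn (S(c := 1)) x y \<longleftrightarrow>
       conn S x y \<or> conn S (pt c) x \<and> conn S (qt c) y \<or> conn S (qt c) x \<and> conn S (pt c) y"
    "card (circles D S) = card (circles D (S(c := 1))) + 1"
proof -
  have "conn (S(c := 1)) (pt c) (qt c) \<and> (x \<in> outer \<longrightarrow> y \<in> outer \<longrightarrow> (conn (S(c := 1)) x y \<longleftrightarrow>
       conn S x y \<or> conn S (pt c) x \<and> conn S (qt c) y \<or> conn S (qt c) x \<and> conn S (pt c) y)) \<and>
     card (circles D S) = card (circles D (S(c := 1))) + 1"
    using assms(1,2)
  proof (cases rule: edge_cases)
    case (merge \<K> K K' w)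
    then show ?thesis using conn_aux[OF merge(1,6,7)] pants_outer(8)[OF merge(1)] by auto
  next
    case (split \<K> K K' w)
    then show ?thesis using conn_aux(2)[OF split(1,7,6)] assms(3) by blast
  qed
  then show "conn (S(c := 1)) (pt c) (qt c)"
    "x \<in> outer \<Longrightarrow> y \<in> outer \<Longrightarrow> conn (S(c := 1)) x y \<longleftrightarrow>
       conn S x y \<or> conn S (pt c) x \<and> conn S (qt c) y \<or> conn S (qt c) x \<and> conn S (pt c) y"
    "card (circles D S) = card (circles D (S(c := 1))) + 1" by auto
qed

lemma conn_split:
  assumes "c < N" "S c = 0" "conn S (pt c) (qt c)"
  shows "\<not> conn (S(c := 1)) (pt c) (qt c)"
    "x \<in> outer \<Longrightarrow> y \<in> outer \<Longrightarrow> conn S x y \<longleftrightarrow> conn (S(c := 1)) x y \<or>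
       conn (S(c := 1)) (pt c) x \<and> conn (S(c := 1)) (qt c) y \<or> conn (S(c := 1)) (qt c) x \<and> conn (S(c := 1)) (pt c) y"
    "card (circles D (S(c := 1))) = card (circles D S) + 1"
proof -
  have "\<not> conn (S(c := 1)) (pt c) (qt c) \<and> (x \<in> outer \<longrightarrow> y \<in> outer \<longrightarrow> (conn S x y \<longleftrightarrow> conn (S(c := 1)) x y \<or>
       conn (S(c := 1)) (pt c) x \<and> conn (S(c := 1)) (qt c) y \<or> conn (S(c := 1)) (qt c) x \<and> conn (S(c := 1)) (pt c) y)) \<and>
     card (circles D (S(c := 1))) = card (circles D S) + 1"
    using assms(1,2)
  proof (cases rule: edge_cases)
    case (merge \<K> K K' w)
    then show ?thesis using conn_aux(1)[OF merge(1,6,7)] assms(3) by blast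
  next
    case (split \<K> K K' w)
    then show ?thesis using conn_aux[OF split(1,7,6)] pants_outer(8)[OF split(1)] by auto
  qed
  then show "\<not> conn (S(c := 1)) (pt c) (qt c)"
    "x \<in> outer \<Longrightarrow> y \<in> outer \<Longrightarrow> conn S x y \<longleftrightarrow> conn (S(c := 1)) x y \<or>
       conn (S(c := 1)) (pt c) x \<and> conn (S(c := 1)) (qt c) y \<or> conn (S(c := 1)) (qt c) x \<and> conn (S(c := 1)) (pt c) y"
    "card (circles D (S(c := 1))) = card (circles D S) + 1" by auto
qed

text \<open>\<open>edge_coeff\<close> quantifies over both orders of the two merged circles. The
  list of admissible triples is symmetric in them, so a single order decides.\<close>

lemma edge_coeff_merge:
  assumes P: "A \<noteq> B" "A \<noteq> C" "B \<noteq> C" "A \<notin> \<K>" "B \<notin> \<K>" "C \<notin> \<K>"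
    and S: "circles D S = \<K> \<union> {A, B}" "circles D S' = \<K> \<union> {C}"
  shows "edge_coeff D S S' s s' = (if (\<forall>X\<in>\<K>. s X = s' X) \<and> (s A, s B, s' C) \<in> {(1, 1, 1), (1, -1, -1), (-1, 1, -1)} then 1 else 0)"
proof -
  have o: "circles D S - circles D S' = {A, B}" "circles D S' - circles D S = {C}" "circles D S \<inter> circles D S' = \<K>"
    using P S by auto
  have "(\<exists>A' B' C'. A' \<noteq> B' \<and> {A, B} = {A', B'} \<and> {C} = {C'} \<and> (s A', s B', s' C') \<in> {(1, 1, 1), (1, -1, -1), (-1, 1, -1)})
      \<longleftrightarrow> (s A, s B, s' C) \<in> {(1, 1, 1), (1, -1, -1), (-1, 1, -1)}" (is "?l \<longleftrightarrow> ?r")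
  proof
    assume ?l
    then obtain A' B' C' where *: "{A, B} = {A', B'}" "C = C'" "(s A', s B', s' C') \<in> {(1, 1, 1), (1, -1, -1), (-1, 1, -1)}" by auto
    then have "A = A' \<and> B = B' \<or> A = B' \<and> B = A'" by (simp add: doubleton_eq_iff)
    then show ?r using *(2,3) by auto
  next
    assume ?r
    then show ?l using P(1) by (intro exI[of _ A] exI[of _ B] exI[of _ C]) simp
  qed
  moreover have "{A, B} \<noteq> {A'}" for A' using P(1) by (metis insert_iff singleton_iff)
  ultimately show ?thesis unfolding edge_coeff_def Let_def o by simp
qed

lemma edge_coeff_split:
  assumes P: "A \<noteq> B" "A \<noteq> C" "B \<noteq> C" "A \<notin> \<K>" "B \<notin> \<K>" "C \<notin> \<K>"
    and S: "circles D S = \<K> \<union> {C}" "circles D S' = \<K> \<union> {A, B}"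
  shows "edge_coeff D S S' s s' = (if (\<forall>X\<in>\<K>. s X = s' X) \<and> (s C, s' A, s' B) \<in> {(1, 1, -1), (1, -1, 1), (-1, -1, -1)} then 1 else 0)"
proof -
  have o: "circles D S - circles D S' = {C}" "circles D S' - circles D S = {A, B}" "circles D S \<inter> circles D S' = \<K>"
    using P S by auto
  have "(\<exists>A' B' C'. B' \<noteq> C' \<and> {C} = {A'} \<and> {A, B} = {B', C'} \<and> (s A', s' B', s' C') \<in> {(1, 1, -1), (1, -1, 1), (-1, -1, -1)})
      \<longleftrightarrow> (s C, s' A, s' B) \<in> {(1, 1, -1), (1, -1, 1), (-1, -1, -1)}" (is "?l \<longleftrightarrow> ?r")
  proof
    assume ?l
    then obtain A' B' C' where *: "{A, B} = {B', C'}" "C = A'" "(s A', s' B', s' C') \<in> {(1, 1, -1), (1, -1, 1), (-1, -1, -1)}" by auto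
    then have "A = B' \<and> B = C' \<or> A = C' \<and> B = B'" by (simp add: doubleton_eq_iff)
    then show ?r using *(2,3) by auto
  next
    assume ?r
    then show ?l using P(1) by (intro exI[of _ C] exI[of _ A] exI[of _ B]) simp
  qed
  moreover have "{A, B} \<noteq> {A'}" for A' using P(1) by (metis insert_iff singleton_iff)
  ultimately show ?thesis unfolding edge_coeff_def Let_def o by simp
qed

text \<open>Writing \<open>v_-\<close> as a nilpotent variable \<open>x\<close>, the chain group of a resolution is the quotient of the polynomial ring
  with one variable for each point of \<open>outer\<close> in which points on a common circle are identified. On the dual
  spaces, realised as functions of finite sets of points (monomials), merging is an inclusion and
  splitting is multiplication by the sum of the two variables at the crossing. \<open>dual_state\<close> is the dual basis.\<close>

definition dual_state :: "(nat \<Rightarrow> nat) \<Rightarrow> (complex set \<Rightarrow> int) \<Rightarrow> complex set \<Rightarrow> rat" where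
  "dual_state S s T = (if \<forall>C\<in>circles D S. card (T \<inter> C) = (if s C = -1 then 1 else 0) then 1 else 0)"

text \<open>A summand vanishes if its point is already in \<open>T\<close>, because the variable has
  square zero.\<close>

definition dual_split :: "nat \<Rightarrow> (complex set \<Rightarrow> rat) \<Rightarrow> complex set \<Rightarrow> rat" where
  "dual_split c f T = (if pt c \<in> T then 0 else f (insert (pt c) T)) + (if qt c \<in> T then 0 else f (insert (qt c) T))"

definition dual_edge :: "bool \<Rightarrow> nat \<Rightarrow> (complex set \<Rightarrow> rat) \<Rightarrow> complex set \<Rightarrow> rat" where
  "dual_edge b c f = (if b then dual_split c f else f)"

lemma finite_labelings: "finite (labelings D S)"
  unfolding labelings_def using circles_props(1) by (intro finite_PiE) auto

lemma sum_indicator_set: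
  assumes "finite F" "G \<subseteq> F" "\<And>s. s \<in> F \<Longrightarrow> e s = (if s \<in> G then 1 else (0::rat))"
  shows "(\<Sum>s\<in>F. e s * f s) = (\<Sum>s\<in>G. f s)"
proof -
  have "(\<Sum>s\<in>F. e s * f s) = (\<Sum>s\<in>F. if s \<in> G then f s else 0)"
    by (intro sum.cong) (auto simp: assms(3))
  also have "\<dots> = (\<Sum>s\<in>G. f s)"
    using assms(1,2) by (simp add: sum.inter_restrict[symmetric] Int_absorb1)
  finally show ?thesis .
qed

lemma dual_state_factor:
  assumes "circles D S = \<K> \<union> \<M>"
  shows "dual_state S s T = (if \<forall>C\<in>\<K>. card (T \<inter> C) = (if s C = -1 then 1 else 0) then 1 else 0) *
       (if \<forall>C\<in>\<M>. card (T \<inter> C) = (if s C = -1 then 1 else 0) then 1 else 0)"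
  unfolding dual_state_def assms by auto

lemma labelings_eqI:
  assumes "s \<in> labelings D S" "t \<in> labelings D S" "\<And>X. X \<in> circles D S \<Longrightarrow> s X = t X"
  shows "s = t"
  using assms unfolding labelings_def by (metis PiE_ext)

lemma label_cases: "s \<in> labelings D S \<Longrightarrow> X \<in> circles D S \<Longrightarrow> s X = 1 \<or> s X = -1"
  unfolding labelings_def by fastforce

section \<open>Merge and split on the dual spaces\<close>

text \<open>A set of outer points meets \<open>C\<close> in as many points as \<open>A\<close> and
  \<open>B\<close> together. So multiplying the factors of \<open>A\<close> and \<open>B\<close>
  turns the class of the monomial \<open>T\<close> in the first resolution into its class in the
  second; this is the transposed statement.\<close>

lemma dual_merge:
  assumes P: "A \<noteq> B" "A \<noteq> C" "B \<noteq> C" "A \<notin> \<K>" "B \<notin> \<K>" "C \<notin> \<K>" "A \<inter> B = {}" "C \<inter> outer = (A \<union> B) \<inter> outer"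
    and S: "circles D S = \<K> \<union> {A, B}" "circles D S' = \<K> \<union> {C}"
    and s': "s' \<in> labelings D S'" and T: "finite T" "T \<subseteq> outer"
  shows "(\<Sum>s\<in>labelings D S. edge_coeff D S S' s s' * dual_state S s T) = dual_state S' s' T"
proof -
  define ext where "ext = (\<lambda>a b. \<lambda>X\<in>circles D S. if X = A then a else if X = B then b else s' X :: int)"
  have s'K: "s' X = 1 \<or> s' X = -1" if "X \<in> \<K> \<union> {C}" for X using label_cases[OF s'] S that by auto
  have extL: "ext a b \<in> labelings D S" if ab: "a \<in> {1,-1}" "b \<in> {1,-1}" for a b
  proof -
    have "(if X = A then a else if X = B then b else s' X) \<in> {-1, 1}" if "X \<in> circles D S" for X
      using s'K[of X] that S(1) ab by auto
    then show ?thesis unfolding labelings_def ext_def restrict_PiE_iff by blast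
  qed
  have extv: "ext a b A = a" "ext a b B = b" "X \<in> \<K> \<Longrightarrow> ext a b X = s' X" for a b X
    unfolding ext_def using S P by auto
  have ext_iff: "s = ext a b \<longleftrightarrow> (\<forall>X\<in>\<K>. s X = s' X) \<and> s A = a \<and> s B = b"
    if st: "s \<in> labelings D S" "a \<in> {1,-1}" "b \<in> {1,-1}" for s a b
  proof
    assume "(\<forall>X\<in>\<K>. s X = s' X) \<and> s A = a \<and> s B = b"
    then have "s X = ext a b X" if "X \<in> circles D S" for X using that extv S(1) by auto
    then show "s = ext a b" by (rule labelings_eqI[OF st(1) extL[OF st(2,3)]])
  qed (use extv in simp)
  \<comment> \<open>The labelings that the merge sends to \<open>s'\<close>: the label + arises only
    from two labels +, the label - in two ways.\<close>
  define G where "G = (if s' C = 1 then {ext 1 1} else {ext 1 (-1), ext (-1) 1})"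
  have "(\<Sum>s\<in>labelings D S. edge_coeff D S S' s s' * dual_state S s T) = (\<Sum>s\<in>G. dual_state S s T)"
  proof (rule sum_indicator_set[OF finite_labelings])
    show "G \<subseteq> labelings D S" using extL unfolding G_def by auto
    fix s assume s: "s \<in> labelings D S"
    have "s A = 1 \<or> s A = -1" "s B = 1 \<or> s B = -1" "s' C = 1 \<or> s' C = -1"
      using label_cases[OF s] label_cases[OF s'] S by auto
    then show "edge_coeff D S S' s s' = (if s \<in> G then 1 else 0)"
      unfolding edge_coeff_merge[OF P(1-6) S] G_def using ext_iff[OF s] by auto
  qed
  also have "\<dots> = dual_state S' s' T"
  proof -
    have "T \<inter> C = (T \<inter> A) \<union> (T \<inter> B)" using P(8) T(2) by blast
    moreover have "(T \<inter> A) \<inter> (T \<inter> B) = {}" using P(7) by blast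
    ultimately have cd: "card (T \<inter> C) = card (T \<inter> A) + card (T \<inter> B)"
      using card_Un_disjoint T(1) by (metis finite_Int)
    have ne: "ext 1 (-1) \<noteq> ext (-1) 1" using extv(1)[of 1 "-1"] extv(1)[of "-1" 1] by auto
    define Q where "Q \<longleftrightarrow> (\<forall>X\<in>\<K>. card (T \<inter> X) = (if s' X = -1 then 1 else 0))"
    have f0: "dual_state S (ext a b) T = (if Q \<and> card (T \<inter> A) = (if a = -1 then 1 else 0) \<and> card (T \<inter> B) = (if b = -1 then 1 else 0) then 1 else 0)" for a b
      unfolding dual_state_factor[OF S(1)] Q_def using extv by simp
    have f1: "dual_state S' s' T = (if Q \<and> card (T \<inter> A) + card (T \<inter> B) = (if s' C = -1 then 1 else 0) then 1 else 0)"
      unfolding dual_state_factor[OF S(2)] Q_def using cd by simp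
    show ?thesis
    proof (cases "s' C = 1")
      case True
      then show ?thesis unfolding f1 G_def by (simp add: f0)
    next
      case False
      then have C: "s' C = -1" using s'K by blast
      then have "(\<Sum>s\<in>G. dual_state S s T) = dual_state S (ext 1 (-1)) T + dual_state S (ext (-1) 1) T"
        using ne unfolding G_def by simp
      then show ?thesis unfolding f1 C f0
        by (cases Q; cases "card (T \<inter> A)"; cases "card (T \<inter> B)") auto
    qed
  qed
  finally show ?thesis .
qed

text \<open>With \<open>v_-\<close> as a variable of square zero, the split sends 1 to
  \<open>x_A + x_B\<close> and \<open>x_C\<close> to \<open>x_A x_B\<close>. It is multiplication by
  the sum of the variables of the two new circles, which are represented by the points
  \<open>pt c\<close> and \<open>qt c\<close>.\<close>

lemma dual_split_eq:
  assumes P: "A \<noteq> B" "A \<noteq> C" "B \<noteq> C" "A \<notin> \<K>" "B \<notin> \<K>" "C \<notin> \<K>" "A \<inter> B = {}" "C \<inter> outer = (A \<union> B) \<inter> outer"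
    and pq: "pt c \<in> A" "qt c \<in> B" "\<And>X. X \<in> \<K> \<Longrightarrow> pt c \<notin> X \<and> qt c \<notin> X"
    and S: "circles D S = \<K> \<union> {C}" "circles D S' = \<K> \<union> {A, B}"
    and s': "s' \<in> labelings D S'" and T: "finite T" "T \<subseteq> outer"
  shows "(\<Sum>s\<in>labelings D S. edge_coeff D S S' s s' * dual_state S s T) = dual_split c (dual_state S' s') T"
proof -
  define ext where "ext = (\<lambda>a. \<lambda>X\<in>circles D S. if X = C then a else s' X :: int)"
  have s'K: "s' X = 1 \<or> s' X = -1" if "X \<in> \<K> \<union> {A,B}" for X using label_cases[OF s'] S that by auto
  have extL: "ext a \<in> labelings D S" if ab: "a \<in> {1,-1}" for a
  proof -
    have "(if X = C then a else s' X) \<in> {-1, 1}" if "X \<in> circles D S" for X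
      using s'K[of X] that S(1) ab by auto
    then show ?thesis unfolding labelings_def ext_def restrict_PiE_iff by blast
  qed
  have extv: "ext a C = a" "X \<in> \<K> \<Longrightarrow> ext a X = s' X" for a X
    unfolding ext_def using S P by auto
  have ext_iff: "s = ext a \<longleftrightarrow> (\<forall>X\<in>\<K>. s X = s' X) \<and> s C = a"
    if st: "s \<in> labelings D S" "a \<in> {1,-1}" for s a
  proof
    assume "(\<forall>X\<in>\<K>. s X = s' X) \<and> s C = a"
    then have "s X = ext a X" if "X \<in> circles D S" for X using that extv S(1) by auto
    then show "s = ext a" by (rule labelings_eqI[OF st(1) extL[OF st(2)]])
  qed (use extv in simp)
  define G where "G = (if s' A = 1 \<and> s' B = 1 then {} else if s' A = -1 \<and> s' B = -1 then {ext (-1)} else {ext 1})"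
  have "(\<Sum>s\<in>labelings D S. edge_coeff D S S' s s' * dual_state S s T) = (\<Sum>s\<in>G. dual_state S s T)"
  proof (rule sum_indicator_set[OF finite_labelings])
    show "G \<subseteq> labelings D S" using extL unfolding G_def by auto
    fix s assume s: "s \<in> labelings D S"
    have "s C = 1 \<or> s C = -1" "s' A = 1 \<or> s' A = -1" "s' B = 1 \<or> s' B = -1"
      using label_cases[OF s] label_cases[OF s'] S by auto
    then show "edge_coeff D S S' s s' = (if s \<in> G then 1 else 0)"
      unfolding edge_coeff_split[OF P(1-6) S] G_def using ext_iff[OF s] by auto
  qed
  also have "\<dots> = dual_split c (dual_state S' s') T"
  proof -
    have "T \<inter> C = (T \<inter> A) \<union> (T \<inter> B)" using P(8) T(2) by blast
    moreover have "(T \<inter> A) \<inter> (T \<inter> B) = {}" using P(7) by blast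
    ultimately have cd: "card (T \<inter> C) = card (T \<inter> A) + card (T \<inter> B)"
      using card_Un_disjoint T(1) by (metis finite_Int)
    define Q where "Q \<longleftrightarrow> (\<forall>X\<in>\<K>. card (T \<inter> X) = (if s' X = -1 then 1 else 0))"
    have f0: "dual_state S (ext a) T = (if Q \<and> card (T \<inter> A) + card (T \<inter> B) = (if a = -1 then 1 else 0) then 1 else 0)" for a
      unfolding dual_state_factor[OF S(1)] Q_def using extv cd by simp
    have qA: "qt c \<notin> A" "pt c \<notin> B" using pq P(7) by auto
    have i1: "insert (pt c) T \<inter> A = insert (pt c) (T \<inter> A)" "insert (pt c) T \<inter> B = T \<inter> B"
      "insert (qt c) T \<inter> A = T \<inter> A" "insert (qt c) T \<inter> B = insert (qt c) (T \<inter> B)"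
      using pq(1,2) qA by auto
    have c1: "card (insert (pt c) T \<inter> A) = Suc (card (T \<inter> A))" if "pt c \<notin> T"
      unfolding i1 using that T(1) by simp
    have c2: "card (insert (qt c) T \<inter> B) = Suc (card (T \<inter> B))" if "qt c \<notin> T"
      unfolding i1 using that T(1) by simp
    have KK: "insert (pt c) T \<inter> X = T \<inter> X" "insert (qt c) T \<inter> X = T \<inter> X" if "X \<in> \<K>" for X
      using pq(3)[OF that] by auto
    have f1: "dual_state S' s' (insert (pt c) T) = (if Q \<and> Suc (card (T \<inter> A)) = (if s' A = -1 then 1 else 0) \<and> card (T \<inter> B) = (if s' B = -1 then 1 else 0) then 1 else 0)"
      if "pt c \<notin> T"
      unfolding dual_state_factor[OF S(2)] Q_def using c1[OF that] KK i1(2) by simp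
    have f2: "dual_state S' s' (insert (qt c) T) = (if Q \<and> card (T \<inter> A) = (if s' A = -1 then 1 else 0) \<and> Suc (card (T \<inter> B)) = (if s' B = -1 then 1 else 0) then 1 else 0)"
      if "qt c \<notin> T"
      unfolding dual_state_factor[OF S(2)] Q_def using c2[OF that] KK i1(3) by simp
    have z: "pt c \<in> T \<Longrightarrow> card (T \<inter> A) > 0" "qt c \<in> T \<Longrightarrow> card (T \<inter> B) > 0"
      using pq T(1) by (auto simp: card_gt_0_iff)
    have "s' A = 1 \<or> s' A = -1" "s' B = 1 \<or> s' B = -1" using s'K by auto
    moreover have "dual_split c (dual_state S' s') T = 
       (if Q \<and> Suc (card (T \<inter> A)) = (if s' A = -1 then 1 else 0) \<and> card (T \<inter> B) = (if s' B = -1 then 1 else 0) then 1 else 0)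
       + (if Q \<and> card (T \<inter> A) = (if s' A = -1 then 1 else 0) \<and> Suc (card (T \<inter> B)) = (if s' B = -1 then 1 else 0) then 1 else 0)"
      unfolding dual_split_def using f1 f2 z by (cases "pt c \<in> T"; cases "qt c \<in> T") simp_all
    moreover have "(\<Sum>s\<in>G. dual_state S s T) = (if s' A = 1 \<and> s' B = 1 then 0 else if s' A = -1 \<and> s' B = -1 then dual_state S (ext (-1)) T else dual_state S (ext 1) T)"
      unfolding G_def by simp
    ultimately show ?thesis unfolding f0
      by (elim disjE; cases Q; cases "card (T \<inter> A)"; cases "card (T \<inter> B)") simp_all
  qed
  finally show ?thesis .
qed

lemma dual_edge_eq:
  assumes c: "c < N" "S c = 0" and s': "s' \<in> labelings D (S(c := 1))" and T: "finite T" "T \<subseteq> outer"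
  shows "(\<Sum>s\<in>labelings D S. edge_coeff D S (S(c := 1)) s s' * dual_state S s T)
     = dual_edge (conn S (pt c) (qt c)) c (dual_state (S(c := 1)) s') T"
  using c
proof (cases rule: edge_cases)
  case (merge \<K> K K' w)
  have "\<not> conn S (pt c) (qt c)" using conn_aux(1)[OF merge(1,6,7)] .
  then show ?thesis
    using dual_merge[OF pants_outer(8,9,10)[OF merge(1)] merge(3,4,5) pants_curves(4)[OF merge(1)] pants_outer(1)[OF merge(1)] merge(6,7) s' T]
    unfolding dual_edge_def by simp
next
  case (split \<K> K K' w)
  have "conn S (pt c) (qt c)" using conn_aux(2)[OF split(1,7,6)] .
  moreover have "pt c \<notin> X \<and> qt c \<notin> X" if "X \<in> \<K>" for X
    using circle_unique[of X "S(c := 1)"] split(3,4,7) pants_outer(2,3)[OF split(1)] that by blast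
  ultimately show ?thesis
    using dual_split_eq[OF pants_outer(8,9,10)[OF split(1)] split(3,4,5) pants_curves(4)[OF split(1)] pants_outer(1)[OF split(1)]
      pants_outer(2,3)[OF split(1)] _ split(6,7) s' T]
    unfolding dual_edge_def by simp
qed

lemma dual_split_commute: "dual_split c (dual_split k f) T = dual_split k (dual_split c f) T"
  unfolding dual_split_def by (auto simp: insert_commute)

text \<open>Two points of one circle stand for the same variable, so multiplying by either of them
  has the same effect. If one of them is already in \<open>T\<close>, both sides vanish, since the
  circle would carry two points.\<close>

lemma dual_state_move:
  assumes X: "X \<in> circles D S" "x \<in> X" "y \<in> X" and T: "finite T"
  shows "(if x \<in> T then 0 else dual_state S s (insert x T)) = (if y \<in> T then 0 else dual_state S s (insert y T))"
proof -
  have oth: "insert z T \<inter> C = T \<inter> C" if "C \<in> circles D S" "C \<noteq> X" "z \<in> X" for z C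
    using circle_unique[OF that(1) X(1)] that by blast
  have eq: "(if z \<in> T then 0 else dual_state S s (insert z T)) =
     (if T \<inter> X = {} \<and> s X = -1 \<and> (\<forall>C\<in>circles D S - {X}. card (T \<inter> C) = (if s C = -1 then 1 else 0)) then 1 else 0)"
    if z: "z \<in> X" for z
  proof (cases "z \<in> T")
    case True
    then show ?thesis using z by auto
  next
    case False
    have cX: "card (insert z T \<inter> X) = Suc (card (T \<inter> X))" using z False T by simp
    have "circles D S = insert X (circles D S - {X})" using X(1) by blast
    then have "(\<forall>C\<in>circles D S. card (insert z T \<inter> C) = (if s C = -1 then 1 else 0)) \<longleftrightarrow>
       card (insert z T \<inter> X) = (if s X = -1 then 1 else 0) \<and> (\<forall>C\<in>circles D S - {X}. card (insert z T \<inter> C) = (if s C = -1 then 1 else 0))"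
      using ball_simps(7)[of X "circles D S - {X}" "\<lambda>C. card (insert z T \<inter> C) = (if s C = -1 then 1 else 0)"]
      by (simp only:)
    also have "(\<forall>C\<in>circles D S - {X}. card (insert z T \<inter> C) = (if s C = -1 then 1 else 0)) \<longleftrightarrow>
       (\<forall>C\<in>circles D S - {X}. card (T \<inter> C) = (if s C = -1 then 1 else 0))"
      using oth[OF _ _ z] by (intro ball_cong) auto
    finally have "(\<forall>C\<in>circles D S. card (insert z T \<inter> C) = (if s C = -1 then 1 else 0)) \<longleftrightarrow>
       Suc (card (T \<inter> X)) = (if s X = -1 then 1 else 0) \<and> (\<forall>C\<in>circles D S - {X}. card (T \<inter> C) = (if s C = -1 then 1 else 0))"
      unfolding cX .
    moreover have "Suc (card (T \<inter> X)) = (if s X = -1 then 1 else 0) \<longleftrightarrow> T \<inter> X = {} \<and> s X = -1"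
      using T by simp
    ultimately show ?thesis using False unfolding dual_state_def by simp
  qed
  show ?thesis unfolding eq[OF X(2)] eq[OF X(3)] ..
qed

lemma dual_state_conn:
  assumes "conn S x y" "finite T"
  shows "(if x \<in> T then 0 else dual_state S s (insert x T)) = (if y \<in> T then 0 else dual_state S s (insert y T))"
  using assms(1) dual_state_move[OF _ _ _ assms(2)] unfolding conn_def by blast

lemma dual_split_cong:
  assumes "conn S (pt c) (pt k) \<and> conn S (qt c) (qt k) \<or> conn S (pt c) (qt k) \<and> conn S (qt c) (pt k)" "finite T"
  shows "dual_split c (dual_state S s) T = dual_split k (dual_state S s) T"
proof -
  define F where "F z = (if z \<in> T then 0 else dual_state S s (insert z T))" for z
  have F: "F x = F y" if "conn S x y" for x y
    unfolding F_def by (rule dual_state_conn[OF that assms(2)])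
  have "F (pt c) + F (qt c) = F (pt k) + F (qt k)"
    using assms(1)
  proof
    assume "conn S (pt c) (pt k) \<and> conn S (qt c) (qt k)"
    then show ?thesis using F[of "pt c" "pt k"] F[of "qt c" "qt k"] by simp
  next
    assume "conn S (pt c) (qt k) \<and> conn S (qt c) (pt k)"
    then show ?thesis using F[of "pt c" "qt k"] F[of "qt c" "pt k"] by simp
  qed
  then show ?thesis unfolding dual_split_def F_def .
qed

section \<open>Commuting squares of the cube\<close>

text \<open>Both ways around the square change the number of circles by the same total. Hence either
  each crossing is of the same kind on both ways, and the operations commute, or each way is a split
  followed by a merge, or each way is a merge followed by a split. In the last two patterns each way
  amounts to a single split, one at \<open>j\<close> and one at \<open>k\<close>, and connectivity
  shows that both multiply by the same element.\<close>

lemma dual_square: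
  assumes j: "j < N" "S j = 0" and k: "k < N" "S k = 0" and jk: "j \<noteq> k" and T: "finite T"
  defines "S11 \<equiv> S(j := 1, k := 1)"
  shows "dual_edge (conn S (pt j) (qt j)) j (dual_edge (conn (S(j := 1)) (pt k) (qt k)) k (dual_state S11 s)) T
    = dual_edge (conn S (pt k) (qt k)) k (dual_edge (conn (S(k := 1)) (pt j) (qt j)) j (dual_state S11 s)) T"
proof -
  define S10 where "S10 = S(j := 1)"
  define S01 where "S01 = S(k := 1)"
  have e: "S10(k := 1) = S11" "S01(j := 1) = S11" "S10 k = 0" "S01 j = 0"
    unfolding S10_def S01_def S11_def using j k jk by auto
  note oj = pt_outer[OF j(1)] and ok = pt_outer[OF k(1)]
  note mj = conn_merge[where c=j and S=S, OF j, folded S10_def] and sj = conn_split[where c=j and S=S, OF j, folded S10_def]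
    and mk = conn_merge[where c=k and S=S, OF k, folded S01_def] and sk = conn_split[where c=k and S=S, OF k, folded S01_def]
    and mk' = conn_merge[where c=k and S=S10, OF k(1) e(3), unfolded e(1)] and sk' = conn_split[where c=k and S=S10, OF k(1) e(3), unfolded e(1)]
    and mj' = conn_merge[where c=j and S=S01, OF j(1) e(4), unfolded e(2)] and sj' = conn_split[where c=j and S=S01, OF j(1) e(4), unfolded e(2)]
  define t1 t2 t1' t2' where t: "t1 = conn S (pt j) (qt j)" "t2 = conn S (pt k) (qt k)"
     "t1' = conn S01 (pt j) (qt j)" "t2' = conn S10 (pt k) (qt k)"
  have cj: "int (card (circles D S10)) = int (card (circles D S)) + (if t1 then 1 else -1)"
    using mj(3) sj(3) unfolding t by auto
  have ck: "int (card (circles D S01)) = int (card (circles D S)) + (if t2 then 1 else -1)"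
    using mk(3) sk(3) unfolding t by auto
  have ck': "int (card (circles D S11)) = int (card (circles D S10)) + (if t2' then 1 else -1)"
    using mk'(3) sk'(3) unfolding t by auto
  have cj': "int (card (circles D S11)) = int (card (circles D S01)) + (if t1' then 1 else -1)"
    using mj'(3) sj'(3) unfolding t by auto
  have "(if t1 then 1 else -1) + (if t2' then 1 else -1) = (if t2 then 1 else -1) + (if t1' then 1 else (-1::int))"
    using cj ck cj' ck' by linarith
  then consider (same) "t1 = t1'" "t2 = t2'" | (a) t1 "\<not> t2'" t2 "\<not> t1'" | (b) "\<not> t1" t2' "\<not> t2" t1'
    by (auto split: if_splits)
  then have "dual_edge t1 j (dual_edge t2' k (dual_state S11 s)) T = dual_edge t2 k (dual_edge t1' j (dual_state S11 s)) T"
  proof cases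
    case same
    then show ?thesis unfolding dual_edge_def using dual_split_commute by auto
  next
    case a
    have n2: "\<not> conn S10 (pt k) (qt k)" using a(2) t by simp
    \<comment> \<open>The points \<open>pt k\<close> and \<open>qt k\<close> share a circle in
      \<open>S\<close> but not after the split at \<open>j\<close>, so each of them lies with a
      different one of \<open>pt j\<close> and \<open>qt j\<close>. The merge at \<open>k\<close>
      keeps these connections.\<close>
    have "conn S10 (pt j) (pt k) \<and> conn S10 (qt j) (qt k) \<or> conn S10 (qt j) (pt k) \<and> conn S10 (pt j) (qt k)"
      using sj(2)[OF _ ok] a(1,3) n2 unfolding t by blast
    moreover have "conn S11 x y" if "conn S10 x y" "x \<in> outer" "y \<in> outer" for x y
      using mk'(2)[OF n2 that(2,3)] that(1) by blast
    ultimately have "conn S11 (pt j) (pt k) \<and> conn S11 (qt j) (qt k) \<or> conn S11 (qt j) (pt k) \<and> conn S11 (pt j) (qt k)"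
      using oj ok by blast
    then show ?thesis using dual_split_cong[of S11 j k T s] T a unfolding dual_edge_def by auto
  next
    case b
    have c1: "conn S10 (pt j) (qt j)" using mj(1) b(1) unfolding t by blast
    have c2: "conn S10 (pt k) (qt k)" using b(2) t by simp
    have n1: "\<not> conn S11 (pt j) (qt j)" using sj'(1) b(4) unfolding t by blast
    have "conn S11 (pt k) (pt j) \<and> conn S11 (qt k) (qt j) \<or> conn S11 (qt k) (pt j) \<and> conn S11 (pt k) (qt j)"
      using sk'(2)[OF c2 oj] c1 n1 by blast
    then show ?thesis using dual_split_cong[of S11 k j T s] T b unfolding dual_edge_def by auto
  qed
  then show ?thesis unfolding t S10_def S01_def .
qed

text \<open>One outer point is chosen on each circle labelled -1 by \<open>s0\<close>; this is a
  monomial representing the generator \<open>s0\<close>.\<close>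

lemma dual_state_separates:
  assumes s0: "s0 \<in> labelings D S"
  shows "\<exists>T. finite T \<and> T \<subseteq> outer \<and> (\<forall>s\<in>labelings D S. dual_state S s T = (if s = s0 then 1 else 0))"
proof -
  define r where "r = (\<lambda>C. SOME x. x \<in> C \<inter> outer)"
  have r: "r C \<in> C" "r C \<in> outer" if "C \<in> circles D S" for C
    using someI_ex[of "\<lambda>x. x \<in> C \<inter> outer"] circle_meets_outer[OF that] unfolding r_def by blast+
  define T where "T = r ` {C\<in>circles D S. s0 C = -1}"
  have TC: "T \<inter> C = (if s0 C = -1 then {r C} else {})" if C: "C \<in> circles D S" for C
    using r circle_unique[OF C] C unfolding T_def by (auto 4 3)
  have "dual_state S s T = (if s = s0 then 1 else 0)" if s: "s \<in> labelings D S" for s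
  proof -
    have "(\<forall>C\<in>circles D S. card (T \<inter> C) = (if s C = -1 then 1 else 0)) \<longleftrightarrow> (\<forall>C\<in>circles D S. s C = s0 C)"
      using TC label_cases[OF s] label_cases[OF s0] by (auto split: if_splits) fastforce+
    also have "\<dots> \<longleftrightarrow> s = s0" using labelings_eqI[OF s s0] by blast
    finally show ?thesis unfolding dual_state_def by simp
  qed
  moreover have "finite T" "T \<subseteq> outer" using circles_props(1)[of S] r unfolding T_def by auto
  ultimately show ?thesis by blast
qed

lemma dual_edge_sum: "dual_edge b c (\<lambda>T. \<Sum>s\<in>F. a s * f s T) T = (\<Sum>s\<in>F. a s * dual_edge b c (f s) T)"
  unfolding dual_edge_def dual_split_def by (auto simp: sum.distrib distrib_left)

lemma dual_edge_cong:
  assumes "c < N" "T \<subseteq> outer" "finite T" "\<And>T'. finite T' \<Longrightarrow> T' \<subseteq> outer \<Longrightarrow> f T' = g T'"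
  shows "dual_edge b c f T = dual_edge b c g T"
  unfolding dual_edge_def dual_split_def using assms pt_outer[OF assms(1)] by simp

text \<open>The two compositions are compared after pairing with the functions
  \<open>dual_state\<close>, where they become the two sides of \<open>dual_square\<close>. A set of
  points that separates \<open>s\<close> from the other labelings recovers the single
  coefficient.\<close>

lemma square_commutes:
  assumes j: "j < N" "S j = 0" and k: "k < N" "S k = 0" and jk: "j \<noteq> k"
    and s: "s \<in> labelings D S" and s'': "s'' \<in> labelings D (S(j := 1, k := 1))"
  shows "(\<Sum>s'\<in>labelings D (S(j := 1)). edge_coeff D S (S(j := 1)) s s' * edge_coeff D (S(j := 1)) (S(j := 1, k := 1)) s' s'')
    = (\<Sum>s'\<in>labelings D (S(k := 1)). edge_coeff D S (S(k := 1)) s s' * edge_coeff D (S(k := 1)) (S(j := 1, k := 1)) s' s'')"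
proof -
  have path: "(\<Sum>s\<in>labelings D S. (\<Sum>s'\<in>labelings D (S(j := 1)). edge_coeff D S (S(j := 1)) s s' * edge_coeff D (S(j := 1)) (S(j := 1, k := 1)) s' s'') * dual_state S s T)
     = dual_edge (conn S (pt j) (qt j)) j (dual_edge (conn (S(j := 1)) (pt k) (qt k)) k (dual_state (S(j := 1, k := 1)) s'')) T"
    if j: "j < N" "S j = 0" and k: "k < N" "S k = 0" and jk: "j \<noteq> k" and s'': "s'' \<in> labelings D (S(j := 1, k := 1))"
      and T: "finite T" "T \<subseteq> outer" for j k T
  proof -
    define S10 where "S10 = S(j := 1)"
    have S10k: "S10 k = 0" unfolding S10_def using k jk by simp
    have "(\<Sum>s\<in>labelings D S. (\<Sum>s'\<in>labelings D S10. edge_coeff D S S10 s s' * edge_coeff D S10 (S10(k := 1)) s' s'') * dual_state S s T)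
       = (\<Sum>s\<in>labelings D S. \<Sum>s'\<in>labelings D S10. edge_coeff D S10 (S10(k := 1)) s' s'' * (edge_coeff D S S10 s s' * dual_state S s T))"
      unfolding sum_distrib_right by (intro sum.cong refl) (simp only: mult_ac)
    also have "\<dots> = (\<Sum>s'\<in>labelings D S10. edge_coeff D S10 (S10(k := 1)) s' s'' * (\<Sum>s\<in>labelings D S. edge_coeff D S S10 s s' * dual_state S s T))"
      by (subst sum.swap) (simp add: sum_distrib_left)
    also have "\<dots> = (\<Sum>s'\<in>labelings D S10. edge_coeff D S10 (S10(k := 1)) s' s'' * dual_edge (conn S (pt j) (qt j)) j (dual_state S10 s') T)"
      unfolding S10_def by (intro sum.cong refl arg_cong2[where f="(*)"] dual_edge_eq j T)
    also have "\<dots> = dual_edge (conn S (pt j) (qt j)) j (\<lambda>T. \<Sum>s'\<in>labelings D S10. edge_coeff D S10 (S10(k := 1)) s' s'' * dual_state S10 s' T) T"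
      by (rule dual_edge_sum[symmetric])
    also have "\<dots> = dual_edge (conn S (pt j) (qt j)) j (dual_edge (conn S10 (pt k) (qt k)) k (dual_state (S10(k := 1)) s'')) T"
      using s'' unfolding S10_def[symmetric] by (intro dual_edge_cong j T dual_edge_eq[where S=S10] k S10k)
    finally show ?thesis unfolding S10_def .
  qed
  have tw: "S(k := 1, j := 1) = S(j := 1, k := 1)" using jk by (simp add: fun_upd_twist)
  have eq: "(\<Sum>s\<in>labelings D S. (\<Sum>s'\<in>labelings D (S(j := 1)). edge_coeff D S (S(j := 1)) s s' * edge_coeff D (S(j := 1)) (S(j := 1, k := 1)) s' s'') * dual_state S s T)
    = (\<Sum>s\<in>labelings D S. (\<Sum>s'\<in>labelings D (S(k := 1)). edge_coeff D S (S(k := 1)) s s' * edge_coeff D (S(k := 1)) (S(j := 1, k := 1)) s' s'') * dual_state S s T)"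
    if T: "finite T" "T \<subseteq> outer" for T
    using path[OF j k jk s'' T] path[OF k j jk[symmetric] _ T] s'' dual_square[OF j k jk T(1), of s''] unfolding tw by simp
  obtain T where T: "finite T" "T \<subseteq> outer" "\<And>t. t \<in> labelings D S \<Longrightarrow> dual_state S t T = (if t = s then 1 else 0)"
    using dual_state_separates[OF s] by blast
  have pick: "(\<Sum>t\<in>labelings D S. F t * dual_state S t T) = F s" for F
  proof -
    have "(\<Sum>t\<in>labelings D S. F t * dual_state S t T) = (\<Sum>t\<in>labelings D S. if t = s then F t else 0)"
      by (intro sum.cong) (auto simp: T(3))
    then show ?thesis using s finite_labelings by simp
  qed
  show ?thesis using eq[OF T(1,2)] unfolding pick .
qed

end

section \<open>The boundary map and its square\<close>

lemma lookup_scale [simp]: "Poly_Mapping.lookup (scale r z) x = r * Poly_Mapping.lookup z x"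
  unfolding scale_def by (simp add: Poly_Mapping.map.rep_eq when_def)

interpretation scale: vector_space scale
  by unfold_locales (auto intro!: poly_mapping_eqI simp: lookup_add algebra_simps)

lemma scale_single [simp]: "scale r (Poly_Mapping.single x a) = Poly_Mapping.single x (r * a)"
  by (rule poly_mapping_eqI) (simp add: lookup_single when_def)

lemma bd_eq_sum:
  assumes "finite F" "Poly_Mapping.keys z \<subseteq> F"
  shows "bd D z = (\<Sum>x\<in>F. scale (Poly_Mapping.lookup z x) (bd_state D x))"
  unfolding bd_def using assms
  by (intro sum.mono_neutral_left) (auto simp: in_keys_iff)

lemma linear_bd: "Vector_Spaces.linear scale scale (bd D)"
proof
  fix x y :: "state \<Rightarrow>\<^sub>0 rat" and r :: rat
  let ?F = "Poly_Mapping.keys x \<union> Poly_Mapping.keys y \<union> Poly_Mapping.keys (x + y) \<union> Poly_Mapping.keys (scale r x)"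
  have f: "finite ?F" by simp
  have "bd D (x + y) = (\<Sum>u\<in>?F. scale (Poly_Mapping.lookup (x + y) u) (bd_state D u))" by (rule bd_eq_sum[OF f]) blast
  also have "\<dots> = (\<Sum>u\<in>?F. scale (Poly_Mapping.lookup x u) (bd_state D u)) + (\<Sum>u\<in>?F. scale (Poly_Mapping.lookup y u) (bd_state D u))"
    by (simp add: lookup_add scale.scale_left_distrib sum.distrib)
  also have "(\<Sum>u\<in>?F. scale (Poly_Mapping.lookup x u) (bd_state D u)) = bd D x" by (rule bd_eq_sum[OF f, symmetric]) blast
  also have "(\<Sum>u\<in>?F. scale (Poly_Mapping.lookup y u) (bd_state D u)) = bd D y" by (rule bd_eq_sum[OF f, symmetric]) blast
  finally show "bd D (x + y) = bd D x + bd D y" .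
  have "bd D (scale r x) = (\<Sum>u\<in>?F. scale (Poly_Mapping.lookup (scale r x) u) (bd_state D u))" by (rule bd_eq_sum[OF f]) blast
  also have "\<dots> = scale r (\<Sum>u\<in>?F. scale (Poly_Mapping.lookup x u) (bd_state D u))"
    by (simp add: scale.scale_sum_right)
  also have "(\<Sum>u\<in>?F. scale (Poly_Mapping.lookup x u) (bd_state D u)) = bd D x" by (rule bd_eq_sum[OF f, symmetric]) blast
  finally show "bd D (scale r x) = scale r (bd D x)" .
qed

interpretation bd: Vector_Spaces.linear scale scale "bd D" for D
  by (rule linear_bd)

lemma bd_single: "bd D (Poly_Mapping.single x r) = scale r (bd_state D x)"
  using bd_eq_sum[of "{x}" "Poly_Mapping.single x r" D] by simp

context link_diagram
begin

definition zeros :: "(nat \<Rightarrow> nat) \<Rightarrow> nat set" where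
  "zeros S = {j. j < N \<and> S j = 0}"

definition cube_sign :: "(nat \<Rightarrow> nat) \<Rightarrow> nat \<Rightarrow> rat" where
  "cube_sign S j = (-1) ^ (\<Sum>i<j. S i)"

lemma finite_zeros: "finite (zeros S)" unfolding zeros_def by simp

lemma bd_state_eq: "bd_state D (S, s) = (\<Sum>j\<in>zeros S. \<Sum>s'\<in>labelings D (S(j := 1)).
     Poly_Mapping.single (S(j := 1), s') (cube_sign S j * edge_coeff D S (S(j := 1)) s s'))"
  unfolding bd_state_def zeros_def cube_sign_def by simp

lemma bd_state_keys:
  assumes "y \<in> Poly_Mapping.keys (bd_state D (S, s))"
  obtains j s' where "j < N" "S j = 0" "y = (S(j := 1), s')" "s' \<in> labelings D (S(j := 1))" "edge_coeff D S (S(j := 1)) s s' \<noteq> 0"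
proof -
  have "Poly_Mapping.lookup (bd_state D (S, s)) y \<noteq> 0" using assms by (simp add: in_keys_iff)
  then have "(\<Sum>j\<in>zeros S. \<Sum>s'\<in>labelings D (S(j := 1)).
     Poly_Mapping.lookup (Poly_Mapping.single (S(j := 1), s') (cube_sign S j * edge_coeff D S (S(j := 1)) s s')) y) \<noteq> 0"
    unfolding bd_state_eq lookup_sum .
  then obtain j where j: "j \<in> zeros S" "(\<Sum>s'\<in>labelings D (S(j := 1)).
     Poly_Mapping.lookup (Poly_Mapping.single (S(j := 1), s') (cube_sign S j * edge_coeff D S (S(j := 1)) s s')) y) \<noteq> 0"
    by (meson sum.not_neutral_contains_not_neutral)
  then obtain s' where s': "s' \<in> labelings D (S(j := 1))"
     "Poly_Mapping.lookup (Poly_Mapping.single (S(j := 1), s') (cube_sign S j * edge_coeff D S (S(j := 1)) s s')) y \<noteq> 0"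
    by (meson sum.not_neutral_contains_not_neutral)
  then have "y = (S(j := 1), s')" "edge_coeff D S (S(j := 1)) s s' \<noteq> 0"
    by (auto simp: lookup_single when_def split: if_splits)
  then show ?thesis using that j(1) s'(1) unfolding zeros_def by blast
qed

text \<open>For \<open>j < k\<close>, raising coordinate \<open>j\<close> adds 1 to the exponent of
  the sign at \<open>k\<close>, while raising coordinate \<open>k\<close> leaves the sign at
  \<open>j\<close> alone.\<close>

lemma cube_sign_anti:
  assumes "j \<noteq> k" "S j = 0" "S k = 0"
  shows "cube_sign S j * cube_sign (S(j := 1)) k = - (cube_sign S k * cube_sign (S(k := 1)) j)"
proof -
  have *: "cube_sign S j * cube_sign (S(j := 1)) k = - (cube_sign S k * cube_sign (S(k := 1)) j)"
    if "j < k" "S j = 0" for j k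
  proof -
    have "(\<Sum>i<k. (S(j := 1)) i) = (\<Sum>i\<in>{..<k} - {j}. S i) + 1"
      using that by (subst sum.remove[of _ j]) auto
    also have "(\<Sum>i\<in>{..<k} - {j}. S i) = (\<Sum>i<k. S i)"
      using that by (subst (2) sum.remove[of _ j]) auto
    finally have 1: "(\<Sum>i<k. (S(j := 1)) i) = (\<Sum>i<k. S i) + 1" .
    have 2: "(\<Sum>i<j. (S(k := 1)) i) = (\<Sum>i<j. S i)" using that by (intro sum.cong) auto
    show ?thesis unfolding cube_sign_def 1 2 by simp
  qed
  show ?thesis using *[of j k] *[of k j] assms by (cases "j < k") auto
qed

text \<open>The sum runs over ordered pairs of distinct crossings. Exchanging the two crossings
  reverses the sign and, by \<open>square_commutes\<close>, keeps the coefficients; so the sum is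
  its own negative and vanishes over the rationals.\<close>

lemma bd_bd_state:
  assumes s: "s \<in> labelings D S"
  shows "bd D (bd_state D (S, s)) = 0"
proof -
  define F where "F j k = (\<Sum>s''\<in>labelings D (S(j := 1, k := 1)). Poly_Mapping.single (S(j := 1, k := 1), s'')
      (cube_sign S j * cube_sign (S(j := 1)) k * (\<Sum>s'\<in>labelings D (S(j := 1)).
          edge_coeff D S (S(j := 1)) s s' * edge_coeff D (S(j := 1)) (S(j := 1, k := 1)) s' s'')))" for j k
  have z: "zeros (S(j := 1)) = zeros S - {j}" for j unfolding zeros_def by auto
  have "bd D (bd_state D (S, s)) = (\<Sum>j\<in>zeros S. \<Sum>s'\<in>labelings D (S(j := 1)).
      scale (cube_sign S j * edge_coeff D S (S(j := 1)) s s') (bd_state D (S(j := 1), s')))"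
    unfolding bd_state_eq[of S s] by (simp add: bd.sum bd_single)
  also have "\<dots> = (\<Sum>j\<in>zeros S. \<Sum>k\<in>zeros S - {j}. F j k)"
  proof (intro sum.cong refl)
    fix j assume "j \<in> zeros S"
    have "(\<Sum>s'\<in>labelings D (S(j := 1)). scale (cube_sign S j * edge_coeff D S (S(j := 1)) s s') (bd_state D (S(j := 1), s')))
      = (\<Sum>s'\<in>labelings D (S(j := 1)). \<Sum>k\<in>zeros S - {j}. \<Sum>s''\<in>labelings D (S(j := 1, k := 1)).
          Poly_Mapping.single (S(j := 1, k := 1), s'') (cube_sign S j * edge_coeff D S (S(j := 1)) s s' * (cube_sign (S(j := 1)) k * edge_coeff D (S(j := 1)) (S(j := 1, k := 1)) s' s'')))"
      unfolding bd_state_eq[of "S(j := 1)"] z scale.scale_sum_right scale_single ..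
    also have "\<dots> = (\<Sum>k\<in>zeros S - {j}. \<Sum>s'\<in>labelings D (S(j := 1)). \<Sum>s''\<in>labelings D (S(j := 1, k := 1)).
          Poly_Mapping.single (S(j := 1, k := 1), s'') (cube_sign S j * edge_coeff D S (S(j := 1)) s s' * (cube_sign (S(j := 1)) k * edge_coeff D (S(j := 1)) (S(j := 1, k := 1)) s' s'')))"
      by (rule sum.swap)
    also have "\<dots> = (\<Sum>k\<in>zeros S - {j}. F j k)"
    proof (rule sum.cong[OF refl])
      fix k
      have "(\<Sum>s'\<in>labelings D (S(j := 1)). \<Sum>s''\<in>labelings D (S(j := 1, k := 1)).
          Poly_Mapping.single (S(j := 1, k := 1), s'') (cube_sign S j * edge_coeff D S (S(j := 1)) s s' * (cube_sign (S(j := 1)) k * edge_coeff D (S(j := 1)) (S(j := 1, k := 1)) s' s'')))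
        = (\<Sum>s''\<in>labelings D (S(j := 1, k := 1)). \<Sum>s'\<in>labelings D (S(j := 1)).
          Poly_Mapping.single (S(j := 1, k := 1), s'') (cube_sign S j * edge_coeff D S (S(j := 1)) s s' * (cube_sign (S(j := 1)) k * edge_coeff D (S(j := 1)) (S(j := 1, k := 1)) s' s'')))"
        by (rule sum.swap)
      also have "\<dots> = F j k" unfolding F_def
      proof (rule sum.cong[OF refl], rule poly_mapping_eqI)
        fix s'' x
        show "Poly_Mapping.lookup (\<Sum>s'\<in>labelings D (S(j := 1)).
          Poly_Mapping.single (S(j := 1, k := 1), s'') (cube_sign S j * edge_coeff D S (S(j := 1)) s s' * (cube_sign (S(j := 1)) k * edge_coeff D (S(j := 1)) (S(j := 1, k := 1)) s' s''))) x
          = Poly_Mapping.lookup (Poly_Mapping.single (S(j := 1, k := 1), s'')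
      (cube_sign S j * cube_sign (S(j := 1)) k * (\<Sum>s'\<in>labelings D (S(j := 1)).
          edge_coeff D S (S(j := 1)) s s' * edge_coeff D (S(j := 1)) (S(j := 1, k := 1)) s' s''))) x"
          unfolding lookup_sum lookup_single by (simp add: when_def sum_distrib_left mult_ac)
      qed
      finally show "(\<Sum>s'\<in>labelings D (S(j := 1)). \<Sum>s''\<in>labelings D (S(j := 1, k := 1)).
          Poly_Mapping.single (S(j := 1, k := 1), s'') (cube_sign S j * edge_coeff D S (S(j := 1)) s s' * (cube_sign (S(j := 1)) k * edge_coeff D (S(j := 1)) (S(j := 1, k := 1)) s' s''))) = F j k" .
    qed
    finally show "(\<Sum>s'\<in>labelings D (S(j := 1)). scale (cube_sign S j * edge_coeff D S (S(j := 1)) s s') (bd_state D (S(j := 1), s')))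
       = (\<Sum>k\<in>zeros S - {j}. F j k)" .
  qed
  also have "\<dots> = (\<Sum>(j, k)\<in>(SIGMA j:zeros S. zeros S - {j}). F j k)"
    using finite_zeros by (subst sum.Sigma) auto
  finally have bb: "bd D (bd_state D (S, s)) = (\<Sum>(j, k)\<in>(SIGMA j:zeros S. zeros S - {j}). F j k)" .
  have anti: "F k j = - F j k" if jk: "j \<in> zeros S" "k \<in> zeros S" "j \<noteq> k" for j k
  proof -
    have tw: "S(k := 1, j := 1) = S(j := 1, k := 1)" using jk(3) by (simp add: fun_upd_twist)
    have sg: "cube_sign S k * cube_sign (S(k := 1)) j = - (cube_sign S j * cube_sign (S(j := 1)) k)"
      using cube_sign_anti[of k j S] jk unfolding zeros_def by auto
    have "F k j = (\<Sum>s''\<in>labelings D (S(j := 1, k := 1)). - Poly_Mapping.single (S(j := 1, k := 1), s'')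
      (cube_sign S j * cube_sign (S(j := 1)) k * (\<Sum>s'\<in>labelings D (S(j := 1)).
          edge_coeff D S (S(j := 1)) s s' * edge_coeff D (S(j := 1)) (S(j := 1, k := 1)) s' s'')))"
      unfolding F_def tw sg
    proof (rule sum.cong[OF refl])
      fix s'' assume s'': "s'' \<in> labelings D (S(j := 1, k := 1))"
      have "(\<Sum>s'\<in>labelings D (S(k := 1)). edge_coeff D S (S(k := 1)) s s' * edge_coeff D (S(k := 1)) (S(j := 1, k := 1)) s' s'')
        = (\<Sum>s'\<in>labelings D (S(j := 1)). edge_coeff D S (S(j := 1)) s s' * edge_coeff D (S(j := 1)) (S(j := 1, k := 1)) s' s'')"
        using square_commutes[of j S k s s''] jk s s'' unfolding zeros_def by simp
      then show "Poly_Mapping.single (S(j := 1, k := 1), s'') (- (cube_sign S j * cube_sign (S(j := 1)) k) *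
         (\<Sum>s'\<in>labelings D (S(k := 1)). edge_coeff D S (S(k := 1)) s s' * edge_coeff D (S(k := 1)) (S(j := 1, k := 1)) s' s''))
         = - Poly_Mapping.single (S(j := 1, k := 1), s'')
      (cube_sign S j * cube_sign (S(j := 1)) k * (\<Sum>s'\<in>labelings D (S(j := 1)).
          edge_coeff D S (S(j := 1)) s s' * edge_coeff D (S(j := 1)) (S(j := 1, k := 1)) s' s''))"
        by (simp add: single_uminus)
    qed
    then show ?thesis unfolding F_def sum_negf .
  qed
  define X where "X = (\<Sum>(j, k)\<in>(SIGMA j:zeros S. zeros S - {j}). F j k)"
  have "X = (\<Sum>(j, k)\<in>(SIGMA j:zeros S. zeros S - {j}). F k j)"
    unfolding X_def by (rule sum.reindex_bij_witness[of _ prod.swap prod.swap]) auto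
  also have "\<dots> = (\<Sum>(j, k)\<in>(SIGMA j:zeros S. zeros S - {j}). - F j k)"
    by (intro sum.cong refl) (auto intro!: anti)
  also have "\<dots> = - X" unfolding X_def by (simp add: sum_negf split_def)
  finally have "X = - X" .
  then have "Poly_Mapping.lookup X x = - Poly_Mapping.lookup X x" for x by (metis lookup_uminus)
  then have "Poly_Mapping.lookup X x = 0" for x by (metis equal_neg_zero)
  then have "X = 0" by (intro poly_mapping_eqI) simp
  then show ?thesis using bb X_def by simp
qed

section \<open>Behaviour of degrees and filtrations along an edge\<close>

text \<open>The common form of \<open>g_Sigma\<close> and \<open>Phi\<close>, with
  \<open>\<kappa>\<close> the homology class or the curve class of a circle. It allows one argument
  for both filtrations.\<close>

definition weighted_state :: "(complex set \<Rightarrow> ('c \<Rightarrow>\<^sub>0 int)) \<Rightarrow> state \<Rightarrow> ('c \<Rightarrow>\<^sub>0 int)" where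
  "weighted_state \<kappa> = (\<lambda>(S, s). \<Sum>C\<in>circles D S. frag_cmul (s C) (\<kappa> C))"

lemma edge_coeff_local:
  assumes c: "c < N" "S c = 0" and e: "edge_coeff D S (S(c := 1)) s s' \<noteq> 0"
  obtains \<K> K K' w where "pants c K K' w" "finite \<K>"
    "leg1 c K w \<notin> \<K>" "leg2 c K' w \<notin> \<K>" "waist c K K' w \<notin> \<K>" "\<And>X. X \<in> \<K> \<Longrightarrow> s X = s' X"
    "circles D S = \<K> \<union> {leg1 c K w, leg2 c K' w} \<and> circles D (S(c := 1)) = \<K> \<union> {waist c K K' w} \<and>
       (s (leg1 c K w), s (leg2 c K' w), s' (waist c K K' w)) \<in> {(1, 1, 1), (1, -1, -1), (-1, 1, -1)} \<or>
     circles D S = \<K> \<union> {waist c K K' w} \<and> circles D (S(c := 1)) = \<K> \<union> {leg1 c K w, leg2 c K' w} \<and>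
       (s (waist c K K' w), s' (leg1 c K w), s' (leg2 c K' w)) \<in> {(1, 1, -1), (1, -1, 1), (-1, -1, -1)}"
  using c
proof (cases rule: edge_cases)
  case (merge \<K> K K' w)
  note ec = edge_coeff_merge[OF pants_outer(8,9,10)[OF merge(1)] merge(3,4,5,6,7), of s s']
  have "(\<forall>X\<in>\<K>. s X = s' X) \<and> (s (leg1 c K w), s (leg2 c K' w), s' (waist c K K' w)) \<in> {(1, 1, 1), (1, -1, -1), (-1, 1, -1)}"
    using e unfolding ec by (meson)
  then show ?thesis using that[OF merge(1-5)] merge(6,7) by blast
next
  case (split \<K> K K' w)
  note ec = edge_coeff_split[OF pants_outer(8,9,10)[OF split(1)] split(3,4,5,6,7), of s s']
  have "(\<forall>X\<in>\<K>. s X = s' X) \<and> (s (waist c K K' w), s' (leg1 c K w), s' (leg2 c K' w)) \<in> {(1, 1, -1), (1, -1, 1), (-1, -1, -1)}"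
    using e unfolding ec by (meson)
  then show ?thesis using that[OF split(1-5)] split(6,7) by blast
qed

text \<open>\<open>R\<close> collects the circles that the edge does not touch. The function
  \<open>f\<close> is arbitrary, so that one case distinction serves the quantum degree and the two
  filtrations.\<close>

lemma edge_sums:
  fixes f :: "int \<Rightarrow> complex set \<Rightarrow> 'g::ab_group_add"
  assumes c: "c < N" "S c = 0" and e: "edge_coeff D S (S(c := 1)) s s' \<noteq> 0"
  obtains K K' w R where "pants c K K' w"
    "waist c K K' w \<in> circles D S \<union> circles D (S(c := 1))"
    "leg1 c K w \<in> circles D S \<union> circles D (S(c := 1))" "leg2 c K' w \<in> circles D S \<union> circles D (S(c := 1))"
    "\<exists>a b d. (a, b, d) \<in> {(1, 1, 1), (1, -1, -1), (-1, 1, -1)} \<and> 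
        (\<Sum>X\<in>circles D S. f (s X) X) = R + f a (leg1 c K w) + f b (leg2 c K' w) \<and>
        (\<Sum>X\<in>circles D (S(c := 1)). f (s' X) X) = R + f d (waist c K K' w)
     \<or> (d, a, b) \<in> {(1, 1, -1), (1, -1, 1), (-1, -1, -1)} \<and>
        (\<Sum>X\<in>circles D S. f (s X) X) = R + f d (waist c K K' w) \<and>
        (\<Sum>X\<in>circles D (S(c := 1)). f (s' X) X) = R + f a (leg1 c K w) + f b (leg2 c K' w)"
proof -
  obtain \<K> K K' w where *: "pants c K K' w" "finite \<K>"
    "leg1 c K w \<notin> \<K>" "leg2 c K' w \<notin> \<K>" "waist c K K' w \<notin> \<K>" "\<And>X. X \<in> \<K> \<Longrightarrow> s X = s' X"
    "circles D S = \<K> \<union> {leg1 c K w, leg2 c K' w} \<and> circles D (S(c := 1)) = \<K> \<union> {waist c K K' w} \<and>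
       (s (leg1 c K w), s (leg2 c K' w), s' (waist c K K' w)) \<in> {(1, 1, 1), (1, -1, -1), (-1, 1, -1)} \<or>
     circles D S = \<K> \<union> {waist c K K' w} \<and> circles D (S(c := 1)) = \<K> \<union> {leg1 c K w, leg2 c K' w} \<and>
       (s (waist c K K' w), s' (leg1 c K w), s' (leg2 c K' w)) \<in> {(1, 1, -1), (1, -1, 1), (-1, -1, -1)}"
    using edge_coeff_local[OF c e] by metis
  note d = pants_outer(8,9,10)[OF *(1)]
  define R where "R = (\<Sum>X\<in>\<K>. f (s X) X)"
  have R': "(\<Sum>X\<in>\<K>. f (s' X) X) = R" unfolding R_def using *(6) by simp
  have two: "(\<Sum>X\<in>\<K> \<union> {leg1 c K w, leg2 c K' w}. f (t X) X) = (\<Sum>X\<in>\<K>. f (t X) X) + f (t (leg1 c K w)) (leg1 c K w) + f (t (leg2 c K' w)) (leg2 c K' w)" for t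
    using *(2,3,4) d by (simp add: sum.union_disjoint add.assoc)
  have one: "(\<Sum>X\<in>\<K> \<union> {waist c K K' w}. f (t X) X) = (\<Sum>X\<in>\<K>. f (t X) X) + f (t (waist c K K' w)) (waist c K K' w)" for t
    using *(2,5) by (simp add: add.commute)
  show ?thesis
  proof (rule that[OF *(1)])
    show "waist c K K' w \<in> circles D S \<union> circles D (S(c := 1))"
      "leg1 c K w \<in> circles D S \<union> circles D (S(c := 1))" "leg2 c K' w \<in> circles D S \<union> circles D (S(c := 1))"
      using *(7) by auto
    show "\<exists>a b d. (a, b, d) \<in> {(1, 1, 1), (1, -1, -1), (-1, 1, -1)} \<and> 
        (\<Sum>X\<in>circles D S. f (s X) X) = R + f a (leg1 c K w) + f b (leg2 c K' w) \<and>
        (\<Sum>X\<in>circles D (S(c := 1)). f (s' X) X) = R + f d (waist c K K' w)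
     \<or> (d, a, b) \<in> {(1, 1, -1), (1, -1, 1), (-1, -1, -1)} \<and>
        (\<Sum>X\<in>circles D S. f (s X) X) = R + f d (waist c K K' w) \<and>
        (\<Sum>X\<in>circles D (S(c := 1)). f (s' X) X) = R + f a (leg1 c K w) + f b (leg2 c K' w)"
      using *(7)
    proof (elim disjE conjE)
      assume a: "circles D S = \<K> \<union> {leg1 c K w, leg2 c K' w}" "circles D (S(c := 1)) = \<K> \<union> {waist c K K' w}"
       "(s (leg1 c K w), s (leg2 c K' w), s' (waist c K K' w)) \<in> {(1, 1, 1), (1, -1, -1), (-1, 1, -1)}"
      show ?thesis unfolding a(1,2) two one R' R_def[symmetric]
        by (intro exI[of _ "s (leg1 c K w)"] exI[of _ "s (leg2 c K' w)"] exI[of _ "s' (waist c K K' w)"] disjI1 conjI a(3) refl)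
    next
      assume a: "circles D S = \<K> \<union> {waist c K K' w}" "circles D (S(c := 1)) = \<K> \<union> {leg1 c K w, leg2 c K' w}"
       "(s (waist c K K' w), s' (leg1 c K w), s' (leg2 c K' w)) \<in> {(1, 1, -1), (1, -1, 1), (-1, -1, -1)}"
      show ?thesis unfolding a(1,2) two one R' R_def[symmetric]
        by (intro exI[of _ "s' (leg1 c K w)"] exI[of _ "s' (leg2 c K' w)"] exI[of _ "s (waist c K K' w)"] disjI2 conjI a(3) refl)
    qed
  qed
qed

lemma states_edge:
  assumes x: "(S, s) \<in> states D" and j: "j < N" "S j = 0" and s': "s' \<in> labelings D (S(j := 1))"
  shows "(S(j := 1), s') \<in> states D" "hdeg D (S(j := 1), s') = hdeg D (S, s) + 1"
    "weight D (S(j := 1)) = weight D S + 1"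
proof -
  have S: "S \<in> {..<N} \<rightarrow>\<^sub>E {0, 1}" using x unfolding states_def by auto
  then have "S(j := 1) \<in> {..<N} \<rightarrow>\<^sub>E {0, 1}" using j by (auto simp: PiE_iff extensional_def)
  then show "(S(j := 1), s') \<in> states D" using s' unfolding states_def by auto
  have "(\<Sum>i<N. int ((S(j := 1)) i)) = (\<Sum>i\<in>{..<N} - {j}. int (S i)) + 1"
    using j by (subst sum.remove[of _ j]) auto
  also have "(\<Sum>i\<in>{..<N} - {j}. int (S i)) = (\<Sum>i<N. int (S i))"
    using j by (subst (2) sum.remove[of _ j]) auto
  finally show "weight D (S(j := 1)) = weight D S + 1" unfolding weight_def .
  then show "hdeg D (S(j := 1), s') = hdeg D (S, s) + 1" unfolding hdeg_def by simp
qed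

text \<open>Along every edge the sum of the labels drops by 1 and the weight rises by 1, whence the
  quantum degree is preserved.\<close>

lemma bd_state_graded:
  assumes x: "x \<in> states D" and y: "y \<in> Poly_Mapping.keys (bd_state D x)"
  shows "y \<in> states D" "hdeg D y = hdeg D x + 1" "qdeg D y = qdeg D x"
proof -
  obtain S s where Ss: "x = (S, s)" by (cases x)
  obtain j s' where *: "j < N" "S j = 0" "y = (S(j := 1), s')" "s' \<in> labelings D (S(j := 1))" "edge_coeff D S (S(j := 1)) s s' \<noteq> 0"
    using bd_state_keys y unfolding Ss by blast
  note se = states_edge[OF x[unfolded Ss] *(1,2,4)]
  show "y \<in> states D" "hdeg D y = hdeg D x + 1" using se *(3) Ss by auto
  have "(\<Sum>X\<in>circles D S. s X) = (\<Sum>X\<in>circles D (S(j := 1)). s' X) + 1"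
    by (rule edge_sums[OF *(1,2,5), of "\<lambda>a X. a"]) auto
  then show "qdeg D y = qdeg D x" unfolding *(3) Ss qdeg_def using se(3) by simp
qed

text \<open>Merge and split have six nonzero entries. As the order is translation invariant, moving
  terms across reduces all of them to the three inequalities in \<open>local\<close>, the triangle
  inequalities for the weights of the two legs and the waist.\<close>

lemma bd_state_filtered:
  fixes le :: "('c \<Rightarrow>\<^sub>0 int) \<Rightarrow> ('c \<Rightarrow>\<^sub>0 int) \<Rightarrow> bool"
  assumes x: "x \<in> states D" and y: "y \<in> Poly_Mapping.keys (bd_state D x)"
    and trl: "\<And>a b d. le a b \<Longrightarrow> le (a + d) (b + d)"
    and local: "\<And>c K K' w. pants c K K' w \<Longrightarrow> leg1 c K w \<subseteq> Sig n p \<Longrightarrow> leg2 c K' w \<subseteq> Sig n p \<Longrightarrow> waist c K K' w \<subseteq> Sig n p \<Longrightarrow>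
      le (\<kappa> (waist c K K' w)) (\<kappa> (leg1 c K w) + \<kappa> (leg2 c K' w)) \<and> le (\<kappa> (leg1 c K w) - \<kappa> (leg2 c K' w)) (\<kappa> (waist c K K' w))
      \<and> le (\<kappa> (leg2 c K' w) - \<kappa> (leg1 c K w)) (\<kappa> (waist c K K' w))"
  shows "le (weighted_state \<kappa> y) (weighted_state \<kappa> x)"
proof -
  obtain S s where Ss: "x = (S, s)" by (cases x)
  obtain j s' where *: "j < N" "S j = 0" "y = (S(j := 1), s')" "s' \<in> labelings D (S(j := 1))" "edge_coeff D S (S(j := 1)) s s' \<noteq> 0"
    using bd_state_keys y unfolding Ss by blast
  show ?thesis
  proof (rule edge_sums[OF *(1,2,5), of "\<lambda>a X. frag_cmul a (\<kappa> X)"])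
    fix K K' w R assume P: "pants j K K' w"
      "waist j K K' w \<in> circles D S \<union> circles D (S(j := 1))"
      "leg1 j K w \<in> circles D S \<union> circles D (S(j := 1))" "leg2 j K' w \<in> circles D S \<union> circles D (S(j := 1))"
      and ex: "\<exists>a b d. (a, b, d) \<in> {(1, 1, 1), (1, -1, -1), (-1, 1, -1)} \<and> 
        (\<Sum>X\<in>circles D S. frag_cmul (s X) (\<kappa> X)) = R + frag_cmul a (\<kappa> (leg1 j K w)) + frag_cmul b (\<kappa> (leg2 j K' w)) \<and>
        (\<Sum>X\<in>circles D (S(j := 1)). frag_cmul (s' X) (\<kappa> X)) = R + frag_cmul d (\<kappa> (waist j K K' w))
     \<or> (d, a, b) \<in> {(1, 1, -1), (1, -1, 1), (-1, -1, -1)} \<and>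
        (\<Sum>X\<in>circles D S. frag_cmul (s X) (\<kappa> X)) = R + frag_cmul d (\<kappa> (waist j K K' w)) \<and>
        (\<Sum>X\<in>circles D (S(j := 1)). frag_cmul (s' X) (\<kappa> X)) = R + frag_cmul a (\<kappa> (leg1 j K w)) + frag_cmul b (\<kappa> (leg2 j K' w))"
    define A B C where "A = \<kappa> (leg1 j K w)" and "B = \<kappa> (leg2 j K' w)" and "C = \<kappa> (waist j K K' w)"
    have l: "le C (A + B)" "le (A - B) C" "le (B - A) C"
      using local[OF P(1)] P(2-4) circles_props(3) unfolding A_def B_def C_def by blast+
    have "le (R + C) (R + A + B)" using trl[OF l(1), of R] by (simp add: algebra_simps)
    moreover have "le (R + (- C)) (R + A + (- B))" using trl[OF l(3), of "R + A - B - C"] by (simp add: algebra_simps)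
    moreover have "le (R + (- C)) (R + (- A) + B)" using trl[OF l(2), of "R + B - A - C"] by (simp add: algebra_simps)
    moreover have "le (R + A + (- B)) (R + C)" using trl[OF l(2), of R] by (simp add: algebra_simps)
    moreover have "le (R + (- A) + B) (R + C)" using trl[OF l(3), of R] by (simp add: algebra_simps)
    moreover have "le (R + (- A) + (- B)) (R + (- C))" using trl[OF l(1), of "R - A - B - C"] by (simp add: algebra_simps)
    ultimately show ?thesis using ex unfolding *(3) Ss weighted_state_def A_def[symmetric] B_def[symmetric] C_def[symmetric]
      by auto
  qed
qed

lemma finite_states: "finite (states D)"
  unfolding states_def by (intro finite_SigmaI finite_PiE finite_labelings) auto

end

section \<open>Homology of the associated graded complex\<close>

context
  fixes M :: "(rat, 'v) module" and W :: "(state \<Rightarrow>\<^sub>0 rat) set" and \<rho> :: "(state \<Rightarrow>\<^sub>0 rat) \<Rightarrow> 'v"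
  assumes W: "scale.subspace W"
    and carr: "carrier M = \<rho> ` W"
    and add: "\<And>x y. x \<in> W \<Longrightarrow> y \<in> W \<Longrightarrow> \<rho> (x + y) = \<rho> x \<oplus>\<^bsub>M\<^esub> \<rho> y"
    and smult: "\<And>r x. x \<in> W \<Longrightarrow> \<rho> (scale r x) = r \<odot>\<^bsub>M\<^esub> \<rho> x"
    and zero: "\<rho> 0 = \<zero>\<^bsub>M\<^esub>"
begin

text \<open>Finite sums in \<open>M\<close> require this structure; it is transported from the chain
  space \<open>W\<close> along the surjection \<open>\<rho>\<close>.\<close>

lemma abelian_monoid_image: "abelian_monoid M"
proof (rule abelian_monoidI)
  show "\<zero>\<^bsub>M\<^esub> \<in> carrier M" unfolding carr zero[symmetric] using scale.subspace_0[OF W] by blast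
  fix x y z assume "x \<in> carrier M" "y \<in> carrier M"
  then obtain a b where ab: "a \<in> W" "b \<in> W" "x = \<rho> a" "y = \<rho> b" unfolding carr by blast
  note s = scale.subspace_add[OF W]
  show "x \<oplus>\<^bsub>M\<^esub> y \<in> carrier M" unfolding carr ab(3,4) add[OF ab(1,2), symmetric] using s ab by blast
  show "x \<oplus>\<^bsub>M\<^esub> y = y \<oplus>\<^bsub>M\<^esub> x" unfolding ab(3,4) using add[OF ab(1,2)] add[OF ab(2,1)] by (simp add: add.commute)
  show "\<zero>\<^bsub>M\<^esub> \<oplus>\<^bsub>M\<^esub> x = x" using add[OF scale.subspace_0[OF W] ab(1)] unfolding ab(3) zero[symmetric] by simp
  assume "z \<in> carrier M"
  then obtain c where c: "c \<in> W" "z = \<rho> c" unfolding carr by blast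
  show "x \<oplus>\<^bsub>M\<^esub> y \<oplus>\<^bsub>M\<^esub> z = x \<oplus>\<^bsub>M\<^esub> (y \<oplus>\<^bsub>M\<^esub> z)"
    unfolding ab(3,4) c(2) by (simp add: add[symmetric] ab(1,2) c(1) s add.assoc)
qed

lemma finsum_image:
  assumes "finite I" "\<And>i. i \<in> I \<Longrightarrow> f i \<in> W"
  shows "finsum M (\<lambda>i. \<rho> (f i)) I = \<rho> (sum f I)"
  using assms
proof (induction I rule: finite_induct)
  case empty
  interpret abelian_monoid M by (rule abelian_monoid_image)
  show ?case using zero by simp
next
  case (insert x F)
  interpret abelian_monoid M by (rule abelian_monoid_image)
  have "finsum M (\<lambda>i. \<rho> (f i)) (insert x F) = \<rho> (f x) \<oplus>\<^bsub>M\<^esub> finsum M (\<lambda>i. \<rho> (f i)) F"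
    using insert by (intro finsum_insert) (auto simp: carr)
  also have "\<dots> = \<rho> (f x + sum f F)"
    using insert add[of "f x" "sum f F"] scale.subspace_sum[OF W, of F f] by simp
  finally show ?case using insert by simp
qed

text \<open>The inverse \<open>l\<close> of \<open>\<rho>\<close> translates the bases of the record
  \<open>M\<close>, given by unique coordinates, into bases of \<open>W\<close> in the usual sense,
  and back. So all of them have the same cardinality and the description in
  \<open>dimension_of\<close> denotes it.\<close>

lemma dimension_of_injective_image:
  assumes inj: "inj_on \<rho> W" and fin: "finite X" "W \<subseteq> scale.span X"
  shows "dimension_of M = scale.dim W"
proof -
  define l where "l = inv_into W \<rho>"
  have l: "l e \<in> W" "\<rho> (l e) = e" if "e \<in> carrier M" for e
    using that unfolding carr l_def by (simp_all add: inv_into_into f_inv_into_f)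
  have lr: "l (\<rho> w) = w" if "w \<in> W" for w unfolding l_def using inj that by simp
  have comb: "(\<Oplus>\<^bsub>M\<^esub>e\<in>E. c e \<odot>\<^bsub>M\<^esub> e) = \<rho> (\<Sum>e\<in>E. scale (c e) (l e))"
    if E: "finite E" "E \<subseteq> carrier M" for E c
  proof -
    interpret abelian_monoid M by (rule abelian_monoid_image)
    have m: "scale (c e) (l e) \<in> W" if "e \<in> E" for e using l that E scale.subspace_scale[OF W] by blast
    have "(\<Oplus>\<^bsub>M\<^esub>e\<in>E. c e \<odot>\<^bsub>M\<^esub> e) = (\<Oplus>\<^bsub>M\<^esub>e\<in>E. \<rho> (scale (c e) (l e)))"
    proof (rule finsum_cong')
      show "(\<lambda>e. \<rho> (scale (c e) (l e))) \<in> E \<rightarrow> carrier M" using m carr by auto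
      fix e assume "e \<in> E"
      then show "c e \<odot>\<^bsub>M\<^esub> e = \<rho> (scale (c e) (l e))" using smult[OF l(1)] l(2) E by auto
    qed simp
    then show ?thesis using finsum_image[OF E(1) m] by simp
  qed
  have cW: "(\<Sum>e\<in>E. scale (c e) (l e)) \<in> W" if "E \<subseteq> carrier M" for E c
    using l that scale.subspace_scale[OF W] by (intro scale.subspace_sum[OF W]) blast
  have dim: "card E = scale.dim W" if E: "is_basis M E" for E
  proof -
    have E': "finite E" "E \<subseteq> carrier M" using E unfolding is_basis_def by auto
    have injl: "inj_on l E" using l(2) E'(2) by (metis inj_on_inverseI subsetD)
    have ind: "scale.independent (l ` E)"
    proof (rule ccontr)
      assume "\<not> scale.independent (l ` E)"
      then obtain u v where u: "v \<in> l ` E" "u v \<noteq> 0" "(\<Sum>v\<in>l ` E. scale (u v) v) = 0"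
        using scale.dependent_finite[of "l ` E"] E'(1) by auto
      have "(\<Sum>e\<in>E. scale (u (l e)) (l e)) = 0" using u(3) by (simp add: sum.reindex[OF injl] o_def)
      then have 1: "\<zero>\<^bsub>M\<^esub> = (\<Oplus>\<^bsub>M\<^esub>e\<in>E. (restrict (u \<circ> l) E) e \<odot>\<^bsub>M\<^esub> e)"
        unfolding comb[OF E'] using zero by simp
      have 2: "\<zero>\<^bsub>M\<^esub> = (\<Oplus>\<^bsub>M\<^esub>e\<in>E. (\<lambda>e\<in>E. 0) e \<odot>\<^bsub>M\<^esub> e)"
        unfolding comb[OF E'] using zero by simp
      have "\<zero>\<^bsub>M\<^esub> \<in> carrier M" using zero scale.subspace_0[OF W] carr by (metis image_eqI)
      then have "\<exists>!c. c \<in> E \<rightarrow>\<^sub>E UNIV \<and> \<zero>\<^bsub>M\<^esub> = (\<Oplus>\<^bsub>M\<^esub>e\<in>E. c e \<odot>\<^bsub>M\<^esub> e)"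
        using E unfolding is_basis_def by blast
      moreover have "restrict (u \<circ> l) E \<in> E \<rightarrow>\<^sub>E UNIV" "(\<lambda>e\<in>E. 0::rat) \<in> E \<rightarrow>\<^sub>E UNIV" by auto
      ultimately have "restrict (u \<circ> l) E = (\<lambda>e\<in>E. 0)" using 1 2 by blast
      then have "u (l e) = 0" if "e \<in> E" for e using that by (metis comp_apply restrict_apply')
      then show False using u by auto
    qed
    have "W \<subseteq> scale.span (l ` E)"
    proof
      fix w assume w: "w \<in> W"
      then obtain c where "\<rho> w = (\<Oplus>\<^bsub>M\<^esub>e\<in>E. c e \<odot>\<^bsub>M\<^esub> e)" using E carr unfolding is_basis_def by blast
      then have "\<rho> w = \<rho> (\<Sum>e\<in>E. scale (c e) (l e))" using comb[OF E'] by simp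
      then have "w = (\<Sum>e\<in>E. scale (c e) (l e))" using inj_onD[OF inj] w cW[OF E'(2)] by blast
      also have "\<dots> \<in> scale.span (l ` E)"
        by (intro scale.span_sum scale.span_scale scale.span_base imageI)
      finally show "w \<in> scale.span (l ` E)" .
    qed
    then have "card (l ` E) = scale.dim W"
      using scale.basis_card_eq_dim[of "l ` E" W] l(1) E'(2) ind by blast
    then show ?thesis using card_image[OF injl] by simp
  qed
  moreover have "\<exists>E. is_basis M E"
  proof -
    obtain B where B: "B \<subseteq> W" "scale.independent B" "W \<subseteq> scale.span B" "card B = scale.dim W"
      using scale.basis_exists by blast
    have Bf: "finite B"
      using scale.independent_span_bound[OF fin(1) B(2)] B(1) fin(2) by blast
    define E where "E = \<rho> ` B"
    have injB: "inj_on \<rho> B" using inj B(1) inj_on_subset by blast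
    have E': "finite E" "E \<subseteq> carrier M" unfolding E_def carr using Bf B by auto
    have "\<exists>!c. c \<in> E \<rightarrow>\<^sub>E UNIV \<and> x = (\<Oplus>\<^bsub>M\<^esub>e\<in>E. c e \<odot>\<^bsub>M\<^esub> e)" if x: "x \<in> carrier M" for x
    proof -
      obtain w where w: "w \<in> W" "x = \<rho> w" using x carr by blast
      have sumB: "(\<Sum>e\<in>E. scale (c e) (l e)) = (\<Sum>b\<in>B. scale (c (\<rho> b)) b)" for c
        unfolding E_def sum.reindex[OF injB] o_def using lr B(1) by (intro sum.cong) auto
      obtain r where r: "w = (\<Sum>b\<in>B. scale (r b) b)" using w B(3) scale.span_finite[OF Bf] by auto
      have ex: "x = (\<Oplus>\<^bsub>M\<^esub>e\<in>E. (restrict (r \<circ> l) E) e \<odot>\<^bsub>M\<^esub> e)"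
        unfolding comb[OF E'] sumB w(2) r
        by (intro arg_cong[where f=\<rho>] sum.cong) (use lr B(1) in \<open>auto simp: E_def\<close>)
      have uniq: "c = c'" if c: "c \<in> E \<rightarrow>\<^sub>E UNIV" "x = (\<Oplus>\<^bsub>M\<^esub>e\<in>E. c e \<odot>\<^bsub>M\<^esub> e)"
          and c': "c' \<in> E \<rightarrow>\<^sub>E UNIV" "x = (\<Oplus>\<^bsub>M\<^esub>e\<in>E. c' e \<odot>\<^bsub>M\<^esub> e)" for c c'
      proof -
        have "\<rho> (\<Sum>e\<in>E. scale (c e) (l e)) = \<rho> (\<Sum>e\<in>E. scale (c' e) (l e))"
          using c(2) c'(2) unfolding comb[OF E'] by simp
        then have "(\<Sum>e\<in>E. scale (c e) (l e)) = (\<Sum>e\<in>E. scale (c' e) (l e))"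
          using inj_onD[OF inj] cW[OF E'(2)] by blast
        then have "(\<Sum>b\<in>B. scale (c (\<rho> b)) b) - (\<Sum>b\<in>B. scale (c' (\<rho> b)) b) = 0" unfolding sumB by simp
        then have z: "(\<Sum>b\<in>B. scale (c (\<rho> b) - c' (\<rho> b)) b) = 0"
          by (simp add: scale.scale_left_diff_distrib sum_subtractf)
        have "c (\<rho> b) - c' (\<rho> b) = 0" if "b \<in> B" for b
        proof (rule ccontr)
          assume "c (\<rho> b) - c' (\<rho> b) \<noteq> 0"
          then have "scale.dependent B"
            unfolding scale.dependent_finite[OF Bf] using that z by (intro exI[of _ "\<lambda>b. c (\<rho> b) - c' (\<rho> b)"]) auto
          then show False using B(2) by blast
        qed
        then show ?thesis using c(1) c'(1) unfolding E_def by (intro PiE_ext) auto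
      qed
      have "restrict (r \<circ> l) E \<in> E \<rightarrow>\<^sub>E UNIV" by auto
      then show ?thesis using ex uniq by (intro ex1I[of _ "restrict (r \<circ> l) E"]) blast+
    qed
    then have "is_basis M E" unfolding is_basis_def using E' by blast
    then show ?thesis by blast
  qed
  ultimately show ?thesis unfolding dimension_of_def
    by (intro the_equality) blast+
qed

end

text \<open>A basis of \<open>U\<close> is extended to a basis of \<open>W\<close>. The added
  vectors span a complement \<open>V\<close> of \<open>U\<close>, on which \<open>\<rho>\<close> is
  injective and still onto, so that the case of an injective image applies.\<close>

lemma dimension_of_quotient:
  fixes M :: "(rat, 'v) module" and W U :: "(state \<Rightarrow>\<^sub>0 rat) set"
  assumes W: "scale.subspace W" and U: "scale.subspace U" "U \<subseteq> W" and fin: "finite X" "W \<subseteq> scale.span X"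
    and carr: "carrier M = \<rho> ` W"
    and add: "\<And>x y. x \<in> W \<Longrightarrow> y \<in> W \<Longrightarrow> \<rho> (x + y) = \<rho> x \<oplus>\<^bsub>M\<^esub> \<rho> y"
    and smult: "\<And>r x. x \<in> W \<Longrightarrow> \<rho> (scale r x) = r \<odot>\<^bsub>M\<^esub> \<rho> x"
    and zero: "\<rho> 0 = \<zero>\<^bsub>M\<^esub>"
    and ker: "\<And>x y. x \<in> W \<Longrightarrow> y \<in> W \<Longrightarrow> \<rho> x = \<rho> y \<longleftrightarrow> x - y \<in> U"
  shows "scale.dim W = dimension_of M + scale.dim U"
proof -
  obtain BU where BU: "BU \<subseteq> U" "scale.independent BU" "U \<subseteq> scale.span BU" "card BU = scale.dim U"
    using scale.basis_exists by blast
  obtain BW where BW: "BU \<subseteq> BW" "BW \<subseteq> W" "scale.independent BW" "W \<subseteq> scale.span BW"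
    using scale.maximal_independent_subset_extend[of BU W] BU U by (metis dual_order.trans)
  have BWf: "finite BW"
    using scale.independent_span_bound[OF fin(1) BW(3)] BW(2) fin(2) by blast
  then have BUf: "finite BU" using BW(1) finite_subset by blast
  have spU: "scale.span BU = U" using BU scale.span_minimal[OF BU(1) U(1)] by blast
  define V where "V = scale.span (BW - BU)"
  have V: "scale.subspace V" "V \<subseteq> W"
    unfolding V_def using scale.span_minimal[OF _ W, of "BW - BU"] BW(2) by (auto simp: scale.subspace_span)
  have VU: "v = 0" if v: "v \<in> V" "v \<in> U" for v
  proof -
    obtain a where a: "v = (\<Sum>b\<in>BW - BU. scale (a b) b)"
      using v(1) scale.span_finite[of "BW - BU"] BWf unfolding V_def by auto
    obtain d where d: "v = (\<Sum>b\<in>BU. scale (d b) b)"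
      using v(2) scale.span_finite[OF BUf] spU by auto
    have "(\<Sum>b\<in>BW. scale (if b \<in> BU then - d b else a b) b)
       = (\<Sum>b\<in>BW - BU. scale (if b \<in> BU then - d b else a b) b) + (\<Sum>b\<in>BU. scale (if b \<in> BU then - d b else a b) b)"
      using sum.subset_diff[OF BW(1) BWf] by blast
    also have "\<dots> = v - v" unfolding a[symmetric]
      using a d by (simp add: sum_negf scale.scale_minus_left)
    finally have z: "(\<Sum>b\<in>BW. scale (if b \<in> BU then - d b else a b) b) = 0" by simp
    have "(if b \<in> BU then - d b else a b) = 0" if "b \<in> BW" for b
    proof (rule ccontr)
      assume "(if b \<in> BU then - d b else a b) \<noteq> 0"
      then have "scale.dependent BW"
        unfolding scale.dependent_finite[OF BWf] using that z
        by (intro exI[of _ "\<lambda>b. if b \<in> BU then - d b else a b"] conjI bexI[of _ b])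
      then show False using BW(3) by blast
    qed
    then have "d b = 0" if "b \<in> BU" for b using that BW(1) by fastforce
    then show "v = 0" unfolding d by simp
  qed
  have split: "\<exists>v\<in>V. w - v \<in> U" if w: "w \<in> W" for w
  proof -
    obtain a where a: "w = (\<Sum>b\<in>BW. scale (a b) b)" using w BW(4) scale.span_finite[OF BWf] by auto
    then have "w = (\<Sum>b\<in>BW - BU. scale (a b) b) + (\<Sum>b\<in>BU. scale (a b) b)"
      using sum.subset_diff[OF BW(1) BWf, of "\<lambda>b. scale (a b) b"] by simp
    moreover have "(\<Sum>b\<in>BW - BU. scale (a b) b) \<in> V"
      unfolding V_def by (intro scale.span_sum scale.span_scale scale.span_base)
    moreover have "(\<Sum>b\<in>BU. scale (a b) b) \<in> U"
      unfolding spU[symmetric] by (intro scale.span_sum scale.span_scale scale.span_base)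
    ultimately show ?thesis by (intro bexI[of _ "\<Sum>b\<in>BW - BU. scale (a b) b"]) auto
  qed
  have "dimension_of M = scale.dim V"
  proof (rule dimension_of_injective_image[of V M \<rho> X])
    show "carrier M = \<rho> ` V"
    proof
      show "carrier M \<subseteq> \<rho> ` V"
      proof
        fix x assume "x \<in> carrier M"
        then obtain w where w: "w \<in> W" "x = \<rho> w" using carr by blast
        obtain v where v: "v \<in> V" "w - v \<in> U" using split[OF w(1)] by blast
        then have "\<rho> w = \<rho> v" using ker[OF w(1)] V(2) by blast
        then show "x \<in> \<rho> ` V" using w v by blast
      qed
      show "\<rho> ` V \<subseteq> carrier M" using V(2) carr by blast
    qed
    show "inj_on \<rho> V"
    proof (rule inj_onI)
      fix x y assume xy: "x \<in> V" "y \<in> V" "\<rho> x = \<rho> y"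
      then have "x - y \<in> U" "x - y \<in> V" using ker V scale.subspace_diff by blast+
      then show "x = y" using VU[of "x - y"] by simp
    qed
    show "V \<subseteq> scale.span X" using V(2) fin(2) by blast
    show "\<rho> (x + y) = \<rho> x \<oplus>\<^bsub>M\<^esub> \<rho> y" if "x \<in> V" "y \<in> V" for x y using add V(2) that by blast
    show "\<rho> (scale r x) = r \<odot>\<^bsub>M\<^esub> \<rho> x" if "x \<in> V" for r x using smult V(2) that by blast
  qed (fact V(1) zero fin(1))+
  moreover have "scale.dim V = card (BW - BU)"
    unfolding V_def scale.dim_span
    using scale.dim_eq_card_independent scale.independent_mono[OF BW(3)] by blast
  moreover have "scale.dim W = card BW"
    using scale.basis_card_eq_dim[OF BW(2,4,3)] by simp
  moreover have "card BW = card (BW - BU) + card BU"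
    using card_Diff_subset[OF BUf BW(1)] card_mono[OF BWf BW(1)] by simp
  ultimately show ?thesis using BU(4) by simp
qed

text \<open>The image is regarded as a quotient of \<open>W\<close> by the kernel, with
  \<open>f\<close> itself as the quotient map.\<close>

lemma rank_nullity:
  assumes f: "Vector_Spaces.linear scale scale (f :: (state \<Rightarrow>\<^sub>0 rat) \<Rightarrow> (state \<Rightarrow>\<^sub>0 rat))"
    and W: "scale.subspace W" and fin: "finite X" "W \<subseteq> scale.span X"
  shows "scale.dim W = scale.dim (f ` W) + scale.dim {x\<in>W. f x = 0}"
proof -
  interpret f: Vector_Spaces.linear scale scale f by (rule f)
  let ?M = "chain_space (f ` W)"
  have sub: "scale.subspace (f ` W)" using f.subspace_image[OF W] .
  have "scale.dim W = dimension_of ?M + scale.dim {x\<in>W. f x = 0}"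
  proof (rule dimension_of_quotient[OF W _ _ fin])
    show "scale.subspace {x \<in> W. f x = 0}"
      using W by (auto simp: scale.subspace_def f.add f.scale)
    show "\<And>x y. x \<in> W \<Longrightarrow> y \<in> W \<Longrightarrow> (f x = f y) = (x - y \<in> {x \<in> W. f x = 0})"
      using scale.subspace_diff[OF W] by (simp add: f.diff)
  qed (auto simp: chain_space_def f.add f.scale)
  moreover have "dimension_of ?M = scale.dim (f ` W)"
  proof (rule dimension_of_injective_image[of "f ` W" _ "\<lambda>x. x" "f ` X"])
    show "f ` W \<subseteq> scale.span (f ` X)" using fin(2) f.span_image[of X] by blast
  qed (use sub fin in \<open>auto simp: chain_space_def\<close>)
  ultimately show ?thesis by simp
qed

definition chains_on :: "state set \<Rightarrow> (state \<Rightarrow>\<^sub>0 rat) set" where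
  "chains_on X = {z. Poly_Mapping.keys z \<subseteq> X}"

lemma subspace_chains_on: "scale.subspace (chains_on X)"
proof (rule scale.subspaceI)
  fix x y assume "x \<in> chains_on X" "y \<in> chains_on X"
  then show "x + y \<in> chains_on X" using Poly_Mapping.keys_add[of x y] unfolding chains_on_def by blast
next
  fix c x assume "x \<in> chains_on X"
  moreover have "Poly_Mapping.keys (scale c x) \<subseteq> Poly_Mapping.keys x" by (simp add: subset_iff in_keys_iff)
  ultimately show "scale c x \<in> chains_on X" unfolding chains_on_def by blast
qed (simp add: chains_on_def)

lemma span_singles: "scale.span ((\<lambda>x. Poly_Mapping.single x 1) ` X) = chains_on X"
proof
  show "scale.span ((\<lambda>x. Poly_Mapping.single x 1) ` X) \<subseteq> chains_on X"
    by (rule scale.span_minimal[OF _ subspace_chains_on]) (auto simp: chains_on_def)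
  show "chains_on X \<subseteq> scale.span ((\<lambda>x. Poly_Mapping.single x 1) ` X)"
  proof
    fix z :: "state \<Rightarrow>\<^sub>0 rat" assume z: "z \<in> chains_on X"
    have "z = (\<Sum>x\<in>Poly_Mapping.keys z. scale (Poly_Mapping.lookup z x) (Poly_Mapping.single x 1))"
      by (rule poly_mapping_eqI) (simp add: lookup_sum lookup_single when_def in_keys_iff)
    also have "\<dots> \<in> scale.span ((\<lambda>x. Poly_Mapping.single x 1) ` X)"
      using z unfolding chains_on_def by (intro scale.span_sum scale.span_scale scale.span_base) auto
    finally show "z \<in> scale.span ((\<lambda>x. Poly_Mapping.single x 1) ` X)" .
  qed
qed

lemma dim_chains_on:
  assumes "finite X"
  shows "scale.dim (chains_on X) = card X"
proof -
  have inj: "inj_on (\<lambda>x::state. Poly_Mapping.single x (1::rat)) X"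
    by (rule inj_onI) (metis keys_single singleton_inject zero_neq_one)
  have "scale.independent ((\<lambda>x. Poly_Mapping.single x 1) ` X)"
    unfolding scale.dependent_finite[OF finite_imageI[OF assms]]
  proof (rule notI, elim exE conjE bexE)
    fix u v assume u: "v \<in> (\<lambda>x. Poly_Mapping.single x 1) ` X" "u v \<noteq> 0" "(\<Sum>v\<in>(\<lambda>x. Poly_Mapping.single x 1) ` X. scale (u v) v) = 0"
    then obtain x where x: "x \<in> X" "v = Poly_Mapping.single x 1" by blast
    have "(\<Sum>y\<in>X. Poly_Mapping.lookup (scale (u (Poly_Mapping.single y 1)) (Poly_Mapping.single y 1)) x) = 0"
      using arg_cong[OF u(3), of "\<lambda>z. Poly_Mapping.lookup z x"] unfolding sum.reindex[OF inj] lookup_sum by simp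
    then have "u v = 0" using x assms by (simp add: lookup_single when_def)
    then show False using u by simp
  qed
  then show ?thesis
    unfolding span_singles[symmetric] scale.dim_span scale.dim_eq_card_independent using card_image[OF inj] 
    by (simp add: scale.dim_eq_card_independent)
qed

text \<open>The projection to the coordinates in \<open>X\<close>; it selects the part of a boundary
  that stays in a given filtration level.\<close>

definition restrict_chain :: "state set \<Rightarrow> (state \<Rightarrow>\<^sub>0 rat) \<Rightarrow> (state \<Rightarrow>\<^sub>0 rat)" where
  "restrict_chain X z = (\<Sum>x\<in>X. Poly_Mapping.single x (Poly_Mapping.lookup z x))"

lemma lookup_restrict_chain: "finite X \<Longrightarrow> Poly_Mapping.lookup (restrict_chain X z) x = (if x \<in> X then Poly_Mapping.lookup z x else 0)"
  unfolding restrict_chain_def by (simp add: lookup_sum lookup_single when_def)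

lemma linear_restrict_chain: "finite X \<Longrightarrow> Vector_Spaces.linear scale scale (restrict_chain X)"
  by unfold_locales (auto intro!: poly_mapping_eqI simp: lookup_restrict_chain lookup_add)

lemma restrict_chain_in: "finite X \<Longrightarrow> restrict_chain X z \<in> chains_on X"
  unfolding chains_on_def mem_Collect_eq
proof
  fix x assume "finite X" "x \<in> Poly_Mapping.keys (restrict_chain X z)"
  then show "x \<in> X" using lookup_restrict_chain[of X z x] by (cases "x \<in> X") (auto simp: in_keys_iff)
qed

section \<open>The associated graded complex\<close>

locale graded_filtration =
  fixes D :: diagram and A :: "'a set" and leq :: "'a \<Rightarrow> 'a \<Rightarrow> bool" and g :: "state \<Rightarrow> 'a"
  assumes finite_states: "finite (states D)"
    and graded: "\<And>x y. x \<in> states D \<Longrightarrow> y \<in> Poly_Mapping.keys (bd_state D x) \<Longrightarrow>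
        y \<in> states D \<and> hdeg D y = hdeg D x + 1 \<and> qdeg D y = qdeg D x \<and> leq (g y) (g x)"
    and bd_bd: "\<And>x. x \<in> states D \<Longrightarrow> bd D (bd_state D x) = 0"
    and refl: "\<And>a. leq a a" and trans: "\<And>a b c. leq a b \<Longrightarrow> leq b c \<Longrightarrow> leq a c"
    and antisym: "\<And>a b. leq a b \<Longrightarrow> leq b a \<Longrightarrow> a = b"
    and index: "\<And>x. x \<in> states D \<Longrightarrow> g x \<in> A"
begin

text \<open>Generators of filtration degree exactly \<open>a\<close>. Modulo the span of
  \<open>below\<close> they form a basis of the graded piece, so chains on a level are canonical
  representatives of the cosets.\<close>

definition level :: "int \<Rightarrow> int \<Rightarrow> 'a \<Rightarrow> state set" where
  "level i j a = {x\<in>states D. hdeg D x = i \<and> qdeg D x = j \<and> g x = a}"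

definition below :: "int \<Rightarrow> int \<Rightarrow> 'a \<Rightarrow> state set" where
  "below i j a = {x\<in>states D. hdeg D x = i \<and> qdeg D x = j \<and> leq (g x) a \<and> g x \<noteq> a}"

lemma finite_level: "finite (level i j a)" unfolding level_def using finite_states by simp

lemma level_below: "level i j a \<inter> below i j a = {}" unfolding level_def below_def by auto

lemma filt_eq: "filt D leq g i j a = chains_on (level i j a \<union> below i j a)"
  unfolding filt_def span_singles level_def below_def using refl by (intro arg_cong[where f=chains_on]) auto

text \<open>A generator strictly below \<open>a\<close> occurs in the filtration step of index
  \<open>g x\<close>, which is in \<open>A\<close>. Conversely, transitivity and antisymmetry keep
  all smaller steps away from level \<open>a\<close>.\<close>

lemma filt_below_eq: "filt_below D A leq g i j a = chains_on (below i j a)"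
proof
  have "filt D leq g i j b \<subseteq> chains_on (below i j a)" if "leq b a" "b \<noteq> a" for b
    unfolding filt_eq chains_on_def level_def below_def using that trans antisym by blast
  then show "filt_below D A leq g i j a \<subseteq> chains_on (below i j a)"
    unfolding filt_below_def by (intro scale.span_minimal[OF _ subspace_chains_on]) blast
  have "Poly_Mapping.single x 1 \<in> (\<Union>b\<in>{b\<in>A. leq b a \<and> b \<noteq> a}. filt D leq g i j b)" if x: "x \<in> below i j a" for x
  proof -
    have "Poly_Mapping.single x 1 \<in> filt D leq g i j (g x)"
      using x unfolding filt_eq chains_on_def level_def below_def by simp
    then show ?thesis using x index unfolding below_def by blast
  qed
  then show "chains_on (below i j a) \<subseteq> filt_below D A leq g i j a"
    unfolding filt_below_def span_singles[symmetric] by (intro scale.span_mono) blast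
qed

lemma bd_chains:
  assumes "z \<in> chains_on X" "\<And>x. x \<in> X \<Longrightarrow> Poly_Mapping.keys (bd_state D x) \<subseteq> Y"
  shows "bd D z \<in> chains_on Y"
  unfolding bd_def using assms(1)
  by (intro scale.subspace_sum[OF subspace_chains_on] scale.subspace_scale[OF subspace_chains_on])
     (use assms(2) in \<open>auto simp: chains_on_def\<close>)

lemma bd_below: "z \<in> chains_on (below i j a) \<Longrightarrow> bd D z \<in> chains_on (below (i + 1) j a)"
proof (rule bd_chains)
  fix x assume x: "x \<in> below i j a"
  show "Poly_Mapping.keys (bd_state D x) \<subseteq> below (i + 1) j a"
  proof
    fix y assume "y \<in> Poly_Mapping.keys (bd_state D x)"
    then have y: "y \<in> states D" "hdeg D y = i + 1" "qdeg D y = j" "leq (g y) (g x)" "leq (g x) a" "g x \<noteq> a"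
      using graded[of x y] x unfolding below_def by auto
    then have "leq (g y) a" "g y \<noteq> a" using trans antisym by blast+
    then show "y \<in> below (i + 1) j a" using y unfolding below_def by blast
  qed
qed

lemma bd_filt: "z \<in> chains_on (level i j a \<union> below i j a) \<Longrightarrow> bd D z \<in> chains_on (level (i + 1) j a \<union> below (i + 1) j a)"
proof (rule bd_chains)
  fix x assume x: "x \<in> level i j a \<union> below i j a"
  show "Poly_Mapping.keys (bd_state D x) \<subseteq> level (i + 1) j a \<union> below (i + 1) j a"
  proof
    fix y assume "y \<in> Poly_Mapping.keys (bd_state D x)"
    then have y: "y \<in> states D" "hdeg D y = i + 1" "qdeg D y = j" "leq (g y) (g x)" "leq (g x) a"
      using graded[of x y] x refl unfolding below_def level_def by auto
    then have "leq (g y) a" using trans by blast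
    then show "y \<in> level (i + 1) j a \<union> below (i + 1) j a" using y unfolding below_def level_def by blast
  qed
qed

lemma bd_bd_filt:
  assumes "z \<in> chains_on (level i j a)"
  shows "bd D (bd D z) = 0"
proof -
  have "bd D (bd D z) = (\<Sum>x\<in>Poly_Mapping.keys z. scale (Poly_Mapping.lookup z x) (bd D (bd_state D x)))"
    unfolding bd_def[of D z] by (simp add: bd.sum bd.scale)
  also have "\<dots> = 0"
    using assms bd_bd unfolding chains_on_def level_def by (intro sum.neutral) auto
  finally show ?thesis .
qed

text \<open>The differential of the associated graded complex, expressed on representatives
  supported on a level: the components of the boundary that drop in the filtration are cut
  off.\<close>

definition gr_diff :: "int \<Rightarrow> int \<Rightarrow> 'a \<Rightarrow> (state \<Rightarrow>\<^sub>0 rat) \<Rightarrow> (state \<Rightarrow>\<^sub>0 rat)" where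
  "gr_diff i j a z = restrict_chain (level (i + 1) j a) (bd D z)"

lemma linear_gr_diff: "Vector_Spaces.linear scale scale (gr_diff i j a)"
  unfolding gr_diff_def[abs_def]
  using Vector_Spaces.linear_compose[OF linear_bd linear_restrict_chain[OF finite_level]] by (simp add: o_def)

lemma filt_split:
  assumes "z \<in> chains_on (level i j a \<union> below i j a)"
  shows "z - restrict_chain (level i j a) z \<in> chains_on (below i j a)"
  using assms unfolding chains_on_def
  by (auto simp: in_keys_iff lookup_minus lookup_restrict_chain[OF finite_level] split: if_splits)

text \<open>The part \<open>l\<close> of the boundary that \<open>gr_diff\<close> discards lies
  strictly below \<open>a\<close>, and so does its boundary; it contributes nothing to level
  \<open>a\<close>. What is left vanishes by \<partial>\<partial> = 0.\<close>

lemma gr_diff_diff: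
  assumes "z \<in> chains_on (level i j a)"
  shows "gr_diff (i + 1) j a (gr_diff i j a z) = 0"
proof -
  define l where "l = bd D z - gr_diff i j a z"
  have "z \<in> chains_on (level i j a \<union> below i j a)" using assms unfolding chains_on_def by auto
  then have "l \<in> chains_on (below (i + 1) j a)"
    unfolding l_def gr_diff_def using filt_split[OF bd_filt] by blast
  then have "bd D l \<in> chains_on (below (i + 1 + 1) j a)" by (rule bd_below)
  then have "restrict_chain (level (i + 1 + 1) j a) (bd D l) = 0"
    using level_below[of "i + 1 + 1" j a] unfolding chains_on_def
    by (intro poly_mapping_eqI) (auto simp: lookup_restrict_chain[OF finite_level] in_keys_iff)
  moreover have "bd D (gr_diff i j a z) = - bd D l"
    unfolding l_def bd.diff bd_bd_filt[OF assms] by simp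
  moreover have "restrict_chain X (- y) = - restrict_chain X y" for X y
    unfolding restrict_chain_def by (simp add: single_uminus sum_negf)
  ultimately show ?thesis unfolding gr_diff_def[of "i + 1"] by simp
qed

definition coset :: "int \<Rightarrow> int \<Rightarrow> 'a \<Rightarrow> (state \<Rightarrow>\<^sub>0 rat) \<Rightarrow> (state \<Rightarrow>\<^sub>0 rat) set" where
  "coset i j a z = {h + z | h. h \<in> chains_on (below i j a)}"

lemma coset_eq_iff: "coset i j a z = coset i j a z' \<longleftrightarrow> z - z' \<in> chains_on (below i j a)"
proof
  note s = subspace_chains_on[of "below i j a"]
  assume "coset i j a z = coset i j a z'"
  moreover have "z \<in> coset i j a z" unfolding coset_def using scale.subspace_0[OF s] by force
  ultimately obtain h where "z = h + z'" "h \<in> chains_on (below i j a)" unfolding coset_def by blast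
  then show "z - z' \<in> chains_on (below i j a)" by simp
next
  note s = subspace_chains_on[of "below i j a"]
  assume d: "z - z' \<in> chains_on (below i j a)"
  have "h + z \<in> coset i j a z'" if "h \<in> chains_on (below i j a)" for h
    unfolding coset_def using scale.subspace_add[OF s that d] by force
  moreover have "h + z' \<in> coset i j a z" if "h \<in> chains_on (below i j a)" for h
    unfolding coset_def using scale.subspace_diff[OF s that d] by force
  ultimately show "coset i j a z = coset i j a z'" unfolding coset_def by blast
qed

lemma coset_add: "{x + y | x y. x \<in> coset i j a z \<and> y \<in> coset i j a z'} = coset i j a (z + z')"
proof -
  note s = subspace_chains_on[of "below i j a"]
  have "x + y \<in> coset i j a (z + z')" if xy: "x \<in> coset i j a z" "y \<in> coset i j a z'" for x y
  proof -
    obtain h h' where "x = h + z" "y = h' + z'" "h \<in> chains_on (below i j a)" "h' \<in> chains_on (below i j a)"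
      using xy unfolding coset_def by blast
    then show ?thesis unfolding coset_def using scale.subspace_add[OF s, of h h']
      by (intro CollectI exI[of _ "h + h'"]) (simp add: algebra_simps)
  qed
  moreover have "\<exists>x y. u = x + y \<and> x \<in> coset i j a z \<and> y \<in> coset i j a z'" if u: "u \<in> coset i j a (z + z')" for u
  proof -
    obtain h where h: "u = h + (z + z')" "h \<in> chains_on (below i j a)" using u unfolding coset_def by blast
    have "z' \<in> coset i j a z'" unfolding coset_def using scale.subspace_0[OF s] by force
    moreover have "h + z \<in> coset i j a z" unfolding coset_def using h by blast
    moreover have "u = (h + z) + z'" using h by (simp add: algebra_simps)
    ultimately show ?thesis by blast
  qed
  ultimately show ?thesis by blast
qed

lemma gr_sel:
  "carrier (gr D A leq g i j a) = coset i j a ` chains_on (level i j a \<union> below i j a)"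
  "\<zero>\<^bsub>gr D A leq g i j a\<^esub> = chains_on (below i j a)"
  "X \<oplus>\<^bsub>gr D A leq g i j a\<^esub> Y = {x + y | x y. x \<in> X \<and> y \<in> Y}"
  "r \<odot>\<^bsub>gr D A leq g i j a\<^esub> X = {x + y | x y. x \<in> chains_on (below i j a) \<and> y \<in> scale r ` X}"
  unfolding gr_def quotient_space_def filt_eq filt_below_eq
  by (auto simp: A_RCOSETS_def RCOSETS_def r_coset_def chain_space_def set_add_def set_mult_def coset_def)

lemma coset_zero: "coset i j a 0 = chains_on (below i j a)"
  unfolding coset_def by simp

text \<open>\<open>bd D z\<close> and its part on the level differ only by terms below
  \<open>a\<close>, hence have the same coset.\<close>

lemma gr_bd_coset:
  assumes "z \<in> chains_on (level i j a \<union> below i j a)"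
  shows "gr_bd D A leq g i j a (coset i j a z) = coset (i + 1) j a (gr_diff i j a z)"
proof -
  have "gr_bd D A leq g i j a (coset i j a z) = {x + y | x y. x \<in> chains_on (below (i + 1) j a) \<and> y \<in> bd D ` coset i j a z}"
    unfolding gr_bd_def filt_below_eq by (auto simp: chain_space_def set_add_def set_mult_def)
  also have "\<dots> = coset (i + 1) j a (bd D z)"
  proof -
    note s = subspace_chains_on
    have fst: "x + bd D (h + z) \<in> coset (i + 1) j a (bd D z)" if "x \<in> chains_on (below (i + 1) j a)" "h \<in> chains_on (below i j a)" for x h
      unfolding coset_def bd.add using scale.subspace_add[OF s that(1) bd_below[OF that(2)]]
      by (intro CollectI exI[of _ "x + bd D h"]) (simp add: add.assoc)
    have sup: "\<exists>x y. x \<in> chains_on (below (i + 1) j a) \<and> y \<in> bd D ` coset i j a z \<and> u = x + y"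
      if u: "u \<in> coset (i + 1) j a (bd D z)" for u
    proof -
      have "z \<in> coset i j a z" unfolding coset_def using scale.subspace_0[OF s] by force
      then show ?thesis using u unfolding coset_def[of "i + 1"] by blast
    qed
    have inf: "u \<in> coset (i + 1) j a (bd D z)"
      if u: "u \<in> {x + y | x y. x \<in> chains_on (below (i + 1) j a) \<and> y \<in> bd D ` coset i j a z}" for u
    proof -
      obtain x y where xy: "u = x + y" "x \<in> chains_on (below (i + 1) j a)" "y \<in> bd D ` coset i j a z"
        using u by blast
      obtain h where h: "y = bd D (h + z)" "h \<in> chains_on (below i j a)"
        using xy(3) unfolding coset_def by blast
      show ?thesis unfolding xy(1) h(1) by (rule fst[OF xy(2) h(2)])
    qed
    show ?thesis
    proof (intro equalityI subsetI)
      fix u assume "u \<in> coset (i + 1) j a (bd D z)"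
      then show "u \<in> {x + y | x y. x \<in> chains_on (below (i + 1) j a) \<and> y \<in> bd D ` coset i j a z}"
        unfolding mem_Collect_eq using sup by metis
    qed (rule inf)
  qed
  also have "\<dots> = coset (i + 1) j a (gr_diff i j a z)"
    unfolding coset_eq_iff gr_diff_def using filt_split[OF bd_filt[OF assms]] .
  finally show ?thesis .
qed

definition cycles :: "int \<Rightarrow> int \<Rightarrow> 'a \<Rightarrow> (state \<Rightarrow>\<^sub>0 rat) set" where
  "cycles i j a = {z \<in> chains_on (level i j a). gr_diff i j a z = 0}"

definition boundaries :: "int \<Rightarrow> int \<Rightarrow> 'a \<Rightarrow> (state \<Rightarrow>\<^sub>0 rat) set" where
  "boundaries i j a = gr_diff (i - 1) j a ` chains_on (level (i - 1) j a)"

lemma chains_level_below: 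
  assumes "z \<in> chains_on (level i j a)" "z \<in> chains_on (below i j a)" shows "z = 0"
proof -
  have "Poly_Mapping.keys z = {}" using assms level_below[of i j a] unfolding chains_on_def by blast
  then show ?thesis by simp
qed

text \<open>The homology record consists of cosets of cosets. Sending a cycle to the coset of its
  coset respects the operations, is onto, and identifies two cycles exactly if they differ by a
  boundary, so \<open>dimension_of_quotient\<close> applies.\<close>

lemma gr_homology_dim:
  "scale.dim (cycles i j a) = dimension_of (gr_homology D A leq g i j a) + scale.dim (boundaries i j a)"
proof -
  interpret d: Vector_Spaces.linear scale scale "gr_diff k j a" for k by (rule linear_gr_diff)
  have Zs: "scale.subspace (cycles i j a)"
    using subspace_chains_on[of "level i j a"] unfolding cycles_def scale.subspace_def by (auto simp: d.add d.scale)
  have Us: "scale.subspace (boundaries i j a)"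
    unfolding boundaries_def by (rule d.subspace_image[OF subspace_chains_on])
  have UZ: "boundaries i j a \<subseteq> cycles i j a"
    using gr_diff_diff[of _ "i - 1" j a] restrict_chain_in[OF finite_level, of i j a]
    unfolding boundaries_def cycles_def gr_diff_def[of "i - 1"] by auto
  define Im where "Im = gr_bd D A leq g (i - 1) j a ` carrier (gr D A leq g (i - 1) j a)"
  have in_union: "z \<in> chains_on (level i j a \<union> below i j a)" if "z \<in> chains_on (level i j a)" for z i
    using that unfolding chains_on_def by auto
  have rep: "coset i j a z = coset i j a (restrict_chain (level i j a) z)" if "z \<in> chains_on (level i j a \<union> below i j a)" for z i
    unfolding coset_eq_iff by (rule filt_split[OF that])
  have carr': "carrier (gr D A leq g i j a) = coset i j a ` chains_on (level i j a)" for i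
    unfolding gr_sel using rep in_union restrict_chain_in[OF finite_level] by blast
  have Im: "Im = coset i j a ` boundaries i j a"
  proof -
    have "Im = (\<lambda>z. gr_bd D A leq g (i - 1) j a (coset (i - 1) j a z)) ` chains_on (level (i - 1) j a)"
      unfolding Im_def carr' image_image ..
    also have "\<dots> = (\<lambda>z. coset i j a (gr_diff (i - 1) j a z)) ` chains_on (level (i - 1) j a)"
      using gr_bd_coset[OF in_union, of _ "i - 1"] by (intro image_cong) auto
    finally show ?thesis unfolding boundaries_def image_image .
  qed
  define K where "K = {X \<in> carrier (gr D A leq g i j a). gr_bd D A leq g i j a X = \<zero>\<^bsub>gr D A leq g (i + 1) j a\<^esub>}"
  have K: "K = coset i j a ` cycles i j a"
  proof -
    have "gr_bd D A leq g i j a (coset i j a z) = \<zero>\<^bsub>gr D A leq g (i + 1) j a\<^esub> \<longleftrightarrow> gr_diff i j a z = 0"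
      if "z \<in> chains_on (level i j a)" for z
    proof -
      have "gr_diff i j a z \<in> chains_on (below (i + 1) j a) \<longleftrightarrow> gr_diff i j a z = 0"
        using chains_level_below[of "gr_diff i j a z"] restrict_chain_in[OF finite_level] scale.subspace_0[OF subspace_chains_on]
        unfolding gr_diff_def by metis
      then show ?thesis
        unfolding gr_bd_coset[OF in_union[OF that]] gr_sel coset_zero[symmetric] coset_eq_iff by simp
    qed
    then show ?thesis unfolding K_def carr' cycles_def by auto
  qed
  \<comment> \<open>The homology class of \<open>z\<close>, as the set of cosets of all chains that
    differ from \<open>z\<close> by a boundary.\<close>
  define \<rho> where "\<rho> z = coset i j a ` {u + z | u. u \<in> boundaries i j a}" for z
  have H: "gr_homology D A leq g i j a = quotient_space (gr D A leq g i j a \<lparr>carrier := K\<rparr>) Im"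
    unfolding gr_homology_def K_def Im_def ..
  have plus: "coset i j a x \<oplus>\<^bsub>gr D A leq g i j a\<^esub> coset i j a y = coset i j a (x + y)" for x y
    unfolding gr_sel(3) by (rule coset_add)
  have mult: "r \<odot>\<^bsub>gr D A leq g i j a\<^esub> coset i j a x = coset i j a (scale r x)" for r x
  proof -
    note s = subspace_chains_on[of "below i j a"]
    have "h + scale r (h' + x) \<in> coset i j a (scale r x)" if "h \<in> chains_on (below i j a)" "h' \<in> chains_on (below i j a)" for h h'
      unfolding coset_def using scale.subspace_add[OF s that(1) scale.subspace_scale[OF s that(2), of r]]
      by (intro CollectI exI[of _ "h + scale r h'"]) (simp add: scale.scale_right_distrib add.assoc)
    moreover have "\<exists>h y. u = h + y \<and> h \<in> chains_on (below i j a) \<and> y \<in> scale r ` coset i j a x" if u: "u \<in> coset i j a (scale r x)" for u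
    proof -
      have "x \<in> coset i j a x" unfolding coset_def using scale.subspace_0[OF s] by force
      then show ?thesis using u unfolding coset_def[of i j a "scale r x"] by blast
    qed
    ultimately show ?thesis unfolding gr_sel(4) coset_def[of i j a x] by blast
  qed
  have Hsel: "carrier (gr_homology D A leq g i j a) = {{Y \<oplus>\<^bsub>gr D A leq g i j a\<^esub> X | Y. Y \<in> Im} | X. X \<in> K}"
    "\<zero>\<^bsub>gr_homology D A leq g i j a\<^esub> = Im"
    "X \<oplus>\<^bsub>gr_homology D A leq g i j a\<^esub> Y = {x \<oplus>\<^bsub>gr D A leq g i j a\<^esub> y | x y. x \<in> X \<and> y \<in> Y}"
    "r \<odot>\<^bsub>gr_homology D A leq g i j a\<^esub> X = {x \<oplus>\<^bsub>gr D A leq g i j a\<^esub> y | x y. x \<in> Im \<and> y \<in> (\<lambda>z. r \<odot>\<^bsub>gr D A leq g i j a\<^esub> z) ` X}" for X Y r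
    unfolding H quotient_space_def
    by (auto simp: A_RCOSETS_def RCOSETS_def r_coset_def set_add_def set_mult_def)
  have \<rho>_alt: "\<rho> z = {Y \<oplus>\<^bsub>gr D A leq g i j a\<^esub> coset i j a z | Y. Y \<in> Im}" for z
    unfolding \<rho>_def Im using plus by auto
  have q1: "finite ((\<lambda>x. Poly_Mapping.single x (1::rat)) ` level i j a)" using finite_level by simp
  have q2: "cycles i j a \<subseteq> scale.span ((\<lambda>x. Poly_Mapping.single x 1) ` level i j a)"
    unfolding span_singles cycles_def by blast
  have q3: "carrier (gr_homology D A leq g i j a) = \<rho> ` cycles i j a"
    unfolding Hsel K \<rho>_alt by blast
  have q4: "\<rho> 0 = \<zero>\<^bsub>gr_homology D A leq g i j a\<^esub>"
    unfolding Hsel Im \<rho>_def by auto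
  have q5: "\<rho> (x + y) = \<rho> x \<oplus>\<^bsub>gr_homology D A leq g i j a\<^esub> \<rho> y" for x y
  proof -
    have "\<rho> x \<oplus>\<^bsub>gr_homology D A leq g i j a\<^esub> \<rho> y = {coset i j a ((u + x) + (u' + y)) | u u'. u \<in> boundaries i j a \<and> u' \<in> boundaries i j a}"
    proof -
      have "\<rho> x \<oplus>\<^bsub>gr_homology D A leq g i j a\<^esub> \<rho> y = {coset i j a (u + x) \<oplus>\<^bsub>gr D A leq g i j a\<^esub> coset i j a (u' + y) | u u'. u \<in> boundaries i j a \<and> u' \<in> boundaries i j a}"
        unfolding Hsel(3) \<rho>_def by blast
      then show ?thesis unfolding plus .
    qed
    also have "\<dots> = \<rho> (x + y)"
    proof -
      have "\<exists>u\<in>boundaries i j a. (v + x) + (v' + y) = u + (x + y)" if "v \<in> boundaries i j a" "v' \<in> boundaries i j a" for v v'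
        using scale.subspace_add[OF Us that] by (intro bexI[of _ "v + v'"]) (simp_all add: algebra_simps)
      moreover have "\<exists>v\<in>boundaries i j a. \<exists>v'\<in>boundaries i j a. u + (x + y) = (v + x) + (v' + y)" if "u \<in> boundaries i j a" for u
        using scale.subspace_0[OF Us] that by (intro bexI[of _ u] bexI[of _ 0]) (simp_all add: algebra_simps)
      ultimately show ?thesis unfolding \<rho>_def image_def by (auto; metis)
    qed
    finally show ?thesis by simp
  qed
  have q6: "\<rho> (scale r x) = r \<odot>\<^bsub>gr_homology D A leq g i j a\<^esub> \<rho> x" for r x
  proof -
    have "r \<odot>\<^bsub>gr_homology D A leq g i j a\<^esub> \<rho> x = {coset i j a (u + scale r (u' + x)) | u u'. u \<in> boundaries i j a \<and> u' \<in> boundaries i j a}"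
    proof -
      have "r \<odot>\<^bsub>gr_homology D A leq g i j a\<^esub> \<rho> x = {coset i j a u \<oplus>\<^bsub>gr D A leq g i j a\<^esub> (r \<odot>\<^bsub>gr D A leq g i j a\<^esub> coset i j a (u' + x)) | u u'. u \<in> boundaries i j a \<and> u' \<in> boundaries i j a}"
        unfolding Hsel(4) \<rho>_def Im by blast
      then show ?thesis unfolding mult plus .
    qed
    also have "\<dots> = \<rho> (scale r x)"
    proof -
      have "\<exists>u\<in>boundaries i j a. v + scale r (v' + x) = u + scale r x" if "v \<in> boundaries i j a" "v' \<in> boundaries i j a" for v v'
        using scale.subspace_add[OF Us that(1) scale.subspace_scale[OF Us that(2), of r]]
        by (intro bexI[of _ "v + scale r v'"]) (simp_all add: scale.scale_right_distrib add.assoc)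
      moreover have "\<exists>v\<in>boundaries i j a. \<exists>v'\<in>boundaries i j a. u + scale r x = v + scale r (v' + x)" if "u \<in> boundaries i j a" for u
        using scale.subspace_0[OF Us] that by (intro bexI[of _ u] bexI[of _ 0]) simp_all
      ultimately show ?thesis unfolding \<rho>_def image_def by (auto; metis)
    qed
    finally show ?thesis by simp
  qed
  have q7: "(\<rho> x = \<rho> y) = (x - y \<in> boundaries i j a)" if x: "x \<in> cycles i j a" and y: "y \<in> cycles i j a" for x y
  proof
    assume "\<rho> x = \<rho> y"
    moreover have "coset i j a x \<in> \<rho> x" unfolding \<rho>_def using scale.subspace_0[OF Us] by force
    ultimately obtain u where u: "u \<in> boundaries i j a" "coset i j a x = coset i j a (u + y)" unfolding \<rho>_def by blast
    then have "x - (u + y) \<in> chains_on (below i j a)" unfolding coset_eq_iff by blast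
    moreover have "x - (u + y) \<in> chains_on (level i j a)"
      using x y u(1) UZ scale.subspace_diff[OF Zs] scale.subspace_add[OF Zs] unfolding cycles_def by blast
    ultimately have "x - (u + y) = 0" using chains_level_below by blast
    then have "x - y = u" by (simp add: algebra_simps)
    then show "x - y \<in> boundaries i j a" using u by simp
  next
    assume d: "x - y \<in> boundaries i j a"
    have "\<exists>v\<in>boundaries i j a. u + x = v + y" if "u \<in> boundaries i j a" for u
      using scale.subspace_add[OF Us that d] by (intro bexI[of _ "u + (x - y)"]) simp_all
    moreover have "\<exists>v\<in>boundaries i j a. u + y = v + x" if "u \<in> boundaries i j a" for u
      using scale.subspace_diff[OF Us that d] by (intro bexI[of _ "u - (x - y)"]) simp_all
    ultimately show "\<rho> x = \<rho> y" unfolding \<rho>_def image_def by (auto; metis)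
  qed
  show ?thesis
    using dimension_of_quotient[OF Zs Us UZ q1 q2 q3 q5 q6 q4 q7] by simp
qed

text \<open>\<open>boundaries (i + 1) j a\<close> is the image of the differential leaving degree
  \<open>i\<close>, and \<open>boundaries i j a\<close> that of the one entering it. Rank and
  nullity of the former give the dimension of the cycles.\<close>

lemma dimension_gr_homology:
  "int (dimension_of (gr_homology D A leq g i j a)) =
     int (card (level i j a)) - int (scale.dim (boundaries (i + 1) j a)) - int (scale.dim (boundaries i j a))"
proof -
  have "scale.dim (chains_on (level i j a)) = scale.dim (gr_diff i j a ` chains_on (level i j a))
       + scale.dim {z \<in> chains_on (level i j a). gr_diff i j a z = 0}"
    by (rule rank_nullity[OF linear_gr_diff subspace_chains_on, of "(\<lambda>x. Poly_Mapping.single x 1) ` level i j a"])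
       (simp_all add: finite_level span_singles)
  then have "card (level i j a) = scale.dim (boundaries (i + 1) j a) + scale.dim (cycles i j a)"
    unfolding dim_chains_on[OF finite_level] boundaries_def cycles_def by simp
  then show ?thesis using gr_homology_dim[of i j a] by simp
qed

end

section \<open>Homotopies between the circles at a crossing\<close>

lemma homotopic_loops_reversepath:
  fixes X :: "complex set"
  assumes "homotopic_loops X f g"
  shows "homotopic_loops X (reversepath f) (reversepath g)"
proof -
  obtain h :: "real \<times> real \<Rightarrow> complex" where h: "continuous_on ({0..1} \<times> {0..1}) h" "h \<in> ({0..1} \<times> {0..1}) \<rightarrow> X"
      "\<forall>x\<in>{0..1}. h (0, x) = f x" "\<forall>x\<in>{0..1}. h (1, x) = g x"
      "\<forall>t\<in>{0..1}. pathfinish (h \<circ> Pair t) = pathstart (h \<circ> Pair t)"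
    using assms unfolding homotopic_loops by blast
  have c: "continuous_on ({0..1::real} \<times> {0..1::real}) (h \<circ> (\<lambda>y. (fst y, 1 - snd y)))"
    by (rule continuous_on_compose; (rule continuous_on_subset[OF h(1)])?) (auto intro!: continuous_intros)
  show ?thesis unfolding homotopic_loops
    by (rule exI[of _ "h \<circ> (\<lambda>y. (fst y, 1 - snd y))"])
       (use c h in \<open>auto simp: reversepath_def pathstart_def pathfinish_def\<close>)
qed

lemma parametrizesD:
  assumes "parametrizes \<gamma> C"
  shows "simple_path \<gamma>" "path \<gamma>" "pathfinish \<gamma> = pathstart \<gamma>" "path_image \<gamma> = C"
  using assms simple_path_imp_path unfolding parametrizes_def by auto

lemma parametrizes_reversepath: "parametrizes \<gamma> C \<Longrightarrow> parametrizes (reversepath \<gamma>) C"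
  unfolding parametrizes_def by (simp add: simple_path_reversepath)

text \<open>Equal winding numbers make the loops homotopic in the plane without 0; the radial
  retraction pushes this homotopy into the circle.\<close>

lemma sphere_loops_homotopic:
  fixes f g :: "real \<Rightarrow> complex"
  assumes "path f" "path_image f = sphere 0 (1::real)" "pathfinish f = pathstart f"
    and "path g" "path_image g = sphere 0 (1::real)" "pathfinish g = pathstart g"
    and w: "winding_number f 0 = winding_number g 0"
  shows "homotopic_loops (sphere 0 1) f g"
proof -
  have "homotopic_loops (- {0}) f g"
    using winding_number_homotopic_loops_eq[of f 0 g] assms by auto
  then have "homotopic_loops (sphere 0 1) ((\<lambda>z. z / of_real (norm z)) \<circ> f) ((\<lambda>z. z / of_real (norm z)) \<circ> g)"
    by (rule homotopic_loops_continuous_image) (auto intro!: continuous_intros simp: norm_divide)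
  moreover have "homotopic_loops (sphere 0 1) h ((\<lambda>z. z / of_real (norm z)) \<circ> h)"
    if h: "path h" "path_image h = sphere 0 (1::real)" "pathfinish h = pathstart h" for h :: "real \<Rightarrow> complex"
  proof (rule homotopic_loops_eq[OF h(1) _ h(3)])
    fix t :: real assume "t \<in> {0..1}"
    then have "norm (h t) = 1" using h(2) unfolding path_image_def by (metis image_eqI mem_sphere_0)
    then show "h t = ((\<lambda>z. z / of_real (norm z)) \<circ> h) t" by simp
  qed (simp add: h(2))
  note this[OF assms(1-3)] this[OF assms(4-6)]
  ultimately show ?thesis by (meson homotopic_loops_sym homotopic_loops_trans)
qed

text \<open>The curve is homeomorphic to the circle, where a simple closed parametrization has
  winding number 1 or -1 about 0. After reversing one of the two if necessary, the winding numbers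
  agree.\<close>

lemma parametrizations_homotopic:
  assumes f: "parametrizes f C" and g: "parametrizes g C"
  shows "homotopic_loops C f g \<or> homotopic_loops C f (reversepath g)"
proof -
  note f' = parametrizesD[OF f] and g' = parametrizesD[OF g]
  obtain h k where hk: "homeomorphism C (sphere 0 1) h (k :: complex \<Rightarrow> complex)"
    using homeomorphic_simple_path_image_circle[OF f'(1,3), of 1 0] f'(4) unfolding homeomorphic_def by auto
  have hc: "continuous_on C h" "h ` C = sphere 0 1" "inj_on h C" "continuous_on (sphere 0 1) k" "k ` sphere 0 1 = C"
    using hk unfolding homeomorphism_def by (auto simp: inj_on_def)
  have kh: "k (h x) = x" if "x \<in> C" for x using hk that unfolding homeomorphism_def by blast
  have p: "path (h \<circ> e)" "path_image (h \<circ> e) = sphere 0 1" "pathfinish (h \<circ> e) = pathstart (h \<circ> e)" "simple_path (h \<circ> e)"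
    if "parametrizes e C" for e
  proof -
    note e = parametrizesD[OF that]
    show "path (h \<circ> e)" using path_continuous_image[OF e(2)] e(4) hc(1) by simp
    show "path_image (h \<circ> e) = sphere 0 1" using e(4) hc(2) by (simp add: path_image_compose)
    show "pathfinish (h \<circ> e) = pathstart (h \<circ> e)" using e(3) by (simp add: pathfinish_compose pathstart_compose)
    show "simple_path (h \<circ> e)" using simple_path_continuous_image[OF e(1)] e(4) hc by simp
  qed
  have w: "winding_number (h \<circ> e) 0 = 1 \<or> winding_number (h \<circ> e) 0 = -1" if "parametrizes e C" for e
  proof -
    have "0 \<in> inside (path_image (h \<circ> e))" unfolding p(2)[OF that] using inside_frontier_eq_interior[of "cball (0::complex) 1"] by simp
    then show ?thesis using simple_closed_path_winding_number_inside[OF p(4)[OF that]] by metis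
  qed
  have bk: "homotopic_loops C f e" if e: "parametrizes e C" and eq: "winding_number (h \<circ> f) 0 = winding_number (h \<circ> e) 0" for e
  proof -
    have "homotopic_loops (sphere 0 1) (h \<circ> f) (h \<circ> e)"
      by (rule sphere_loops_homotopic[OF p(1-3)[OF f] p(1-3)[OF e] eq])
    then have "homotopic_loops C (k \<circ> (h \<circ> f)) (k \<circ> (h \<circ> e))"
      by (rule homotopic_loops_continuous_image) (use hc in auto)
    moreover have "homotopic_loops C d (k \<circ> (h \<circ> d))" if "parametrizes d C" for d
    proof (rule homotopic_loops_eq)
      note d = parametrizesD[OF that]
      show "path d" "path_image d \<subseteq> C" "pathfinish d = pathstart d" using d by auto
      fix t :: real assume "t \<in> {0..1}"
      then have "d t \<in> C" using d(4) unfolding path_image_def by blast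
      then show "d t = (k \<circ> (h \<circ> d)) t" using kh by simp
    qed
    ultimately show ?thesis using f e homotopic_loops_trans homotopic_loops_sym by metis
  qed
  have "winding_number (h \<circ> reversepath g) 0 = - winding_number (h \<circ> g) 0"
    unfolding path_compose_reversepath using winding_number_reversepath[OF p(1)[OF g], of 0] p(2)[OF g] by auto
  then show ?thesis
    using bk[OF g] bk[OF parametrizes_reversepath[OF g]] w[OF f] w[OF g] by auto
qed

text \<open>Triviality is defined through some parametrization. Any other one is homotopic to it or
  to its reverse, and reversing a null homotopy leaves the constant loop as it is.\<close>

lemma trivial_curve_any:
  assumes "trivial_curve X C" "C \<subseteq> X" "parametrizes \<gamma> C"
  shows "\<exists>z. homotopic_loops X \<gamma> (\<lambda>_. z)"
proof -
  obtain e z where e: "parametrizes e C" "homotopic_loops X e (\<lambda>_. z)" using assms(1) unfolding trivial_curve_def by blast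
  have "homotopic_loops X (reversepath e) (\<lambda>_. z)"
    using homotopic_loops_reversepath[OF e(2)] by (simp add: reversepath_def)
  then show ?thesis
    using parametrizations_homotopic[OF assms(3) e(1)] homotopic_loops_subset[OF _ assms(2)] homotopic_loops_trans e(2) by metis
qed

lemma homotopic_up_to_reversal_trans:
  fixes X :: "complex set"
  assumes "homotopic_loops X f g \<or> homotopic_loops X f (reversepath g)"
    "homotopic_loops X g h \<or> homotopic_loops X g (reversepath h)"
  shows "homotopic_loops X f h \<or> homotopic_loops X f (reversepath h)"
  using assms(1)
proof
  assume "homotopic_loops X f g"
  then show ?thesis using assms(2) homotopic_loops_trans by blast
next
  assume fg: "homotopic_loops X f (reversepath g)"
  from assms(2) show ?thesis
  proof
    assume "homotopic_loops X g h"
    then show ?thesis using fg homotopic_loops_trans homotopic_loops_reversepath by blast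
  next
    assume "homotopic_loops X g (reversepath h)"
    then have "homotopic_loops X (reversepath g) h" using homotopic_loops_reversepath by fastforce
    then show ?thesis using fg homotopic_loops_trans by blast
  qed
qed

text \<open>The parametrizations in the definition of a class are free, so a homotopy up to reversal
  between one pair of them can be composed with the homotopies that define membership.\<close>

lemma curve_class_eqI:
  assumes C: "C \<subseteq> X" "C' \<subseteq> X" and par: "parametrizes f C" "parametrizes g C'"
    and h: "homotopic_loops X f g \<or> homotopic_loops X f (reversepath g)"
  shows "curve_class X C = curve_class X C'"
proof -
  have sub: "curve_class X C \<subseteq> curve_class X C'"
    if C: "C \<subseteq> X" "C' \<subseteq> X" and par: "parametrizes f C" "parametrizes g C'"
      and h: "homotopic_loops X f g \<or> homotopic_loops X f (reversepath g)" for f g C C'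
  proof
    fix B assume "B \<in> curve_class X C"
    then obtain d e where de: "scc X B" "parametrizes d C" "parametrizes e B" "homotopic_loops X d e"
      unfolding curve_class_def by blast
    have gf: "homotopic_loops X g f \<or> homotopic_loops X g (reversepath f)"
      using h homotopic_loops_sym homotopic_loops_reversepath reversepath_reversepath by metis
    have "homotopic_loops X f d \<or> homotopic_loops X f (reversepath d)"
      using parametrizations_homotopic[OF par(1) de(2)] homotopic_loops_subset[OF _ C(1)] by blast
    then have "homotopic_loops X g d \<or> homotopic_loops X g (reversepath d)"
      using homotopic_up_to_reversal_trans[OF gf] by blast
    then have "homotopic_loops X g e \<or> homotopic_loops X g (reversepath e)"
      using homotopic_up_to_reversal_trans de(4) by blast
    then show "B \<in> curve_class X C'"
      using de(1,3) par(2) parametrizes_reversepath[OF de(3)] unfolding curve_class_def by blast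
  qed
  have "homotopic_loops X g f \<or> homotopic_loops X g (reversepath f)"
    using h homotopic_loops_sym homotopic_loops_reversepath reversepath_reversepath by metis
  then show ?thesis using sub[OF C par h] sub[OF C(2,1) par(2,1)] by blast
qed

text \<open>A straight-line homotopy in the convex set, carried over by the map. It is used for
  chords of a crossing disk and for the sides of a singular triangle.\<close>

lemma homotopic_paths_via:
  fixes \<phi> :: "'a::real_normed_vector \<Rightarrow> 'b::real_normed_vector"
  assumes S: "convex S" and c: "continuous_on S \<phi>" and sub: "\<phi> ` S \<subseteq> X" and u: "u \<in> S" "v \<in> S" "x \<in> S"
  shows "homotopic_paths X (\<phi> \<circ> linepath u v) ((\<phi> \<circ> linepath u x) +++ (\<phi> \<circ> linepath x v))"
proof -
  have s: "closed_segment y z \<subseteq> S" if "y \<in> S" "z \<in> S" for y z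
    using that S by (simp add: closed_segment_subset)
  have "homotopic_paths S (linepath u v) (linepath u x +++ linepath x v)"
  proof (rule homotopic_paths_linear)
    fix t :: real assume t: "t \<in> {0..1}"
    have "linepath u v t \<in> S" using t s[OF u(1,2)] linepath_image_01 by blast
    moreover have "path_image (linepath u x +++ linepath x v) \<subseteq> S"
      using path_image_join_subset[of "linepath u x" "linepath x v"] s[OF u(1,3)] s[OF u(3,2)] by auto
    then have "(linepath u x +++ linepath x v) t \<in> S" using t unfolding path_image_def by blast
    ultimately show "closed_segment (linepath u v t) ((linepath u x +++ linepath x v) t) \<subseteq> S"
      by (rule s)
  qed auto
  then have "homotopic_paths X (\<phi> \<circ> linepath u v) (\<phi> \<circ> (linepath u x +++ linepath x v))"
    by (rule homotopic_paths_continuous_image) (use c sub in auto)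
  then show ?thesis unfolding path_compose_join .
qed

text \<open>In the fundamental group, \<open>g = a b\<close> up to conjugation of \<open>b\<close>.\<close>

lemma loops_product:
  fixes a b d g :: "real \<Rightarrow> complex"
  assumes ab: "path a" "path_image a \<subseteq> X" "pathfinish a = pathstart a"
    "path b" "path_image b \<subseteq> X" "pathfinish b = pathstart b"
    and d: "path d" "path_image d \<subseteq> X" "pathstart d = pathstart a" "pathfinish d = pathstart b"
    and g: "homotopic_paths X g (a +++ (d +++ b +++ reversepath d))"
  shows "(\<exists>z. homotopic_loops X a (\<lambda>_. z)) \<Longrightarrow> homotopic_loops X g b"
    "(\<exists>z. homotopic_loops X b (\<lambda>_. z)) \<Longrightarrow> homotopic_loops X g a"
    "(\<exists>z. homotopic_loops X g (\<lambda>_. z)) \<Longrightarrow> homotopic_loops X a (reversepath b)"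
    "z \<notin> X \<Longrightarrow> winding_number g z = winding_number a z + winding_number b z"
proof -
  define b' where "b' = d +++ b +++ reversepath d"
  define e where "e = linepath (pathstart a) (pathstart a)"
  have aX: "pathstart a \<in> X" using ab(2) by (meson pathstart_in_path_image subsetD)
  have b': "path b'" "path_image b' \<subseteq> X" "pathstart b' = pathstart a" "pathfinish b' = pathstart a"
    unfolding b'_def using ab d by (auto simp: path_image_join)
  have gab: "homotopic_paths X g (a +++ b')" using g unfolding b'_def .
  have gp: "pathstart g = pathstart a" "pathfinish g = pathstart a"
    using homotopic_paths_imp_pathstart[OF gab] homotopic_paths_imp_pathfinish[OF gab] b' by auto
  have bb: "homotopic_loops X b' b"
    unfolding b'_def using ab d by (intro homotopic_loops_conjugate) auto
  have null: "homotopic_paths X f (linepath (pathstart f) (pathstart f))" if "\<exists>z. homotopic_loops X f (\<lambda>_. z)" for f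
  proof -
    obtain z where "homotopic_loops X f (linepath z z)" using \<open>\<exists>z. homotopic_loops X f (\<lambda>_. z)\<close> by (auto simp: linepath_refl)
    then show ?thesis by (rule homotopic_loops_imp_homotopic_paths_null)
  qed
  have loops: "homotopic_loops X f h" if "homotopic_paths X f h" "pathfinish f = pathstart f" for f h
    using homotopic_paths_imp_homotopic_loops[OF that(1)] that(2) homotopic_paths_imp_pathfinish[OF that(1)] by metis
  show "homotopic_loops X g b" if "\<exists>z. homotopic_loops X a (\<lambda>_. z)"
  proof -
    have "homotopic_paths X (a +++ b') (e +++ b')"
      using null[OF that] b' ab unfolding e_def by (intro homotopic_paths_join) auto
    moreover have "homotopic_paths X (e +++ b') b'"
      using homotopic_paths_lid[OF b'(1,2)] b'(3) unfolding e_def by simp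
    ultimately have "homotopic_paths X g b'" using gab homotopic_paths_trans by blast
    then show ?thesis using loops gp bb homotopic_loops_trans by metis
  qed
  show "homotopic_loops X g a" if "\<exists>z. homotopic_loops X b (\<lambda>_. z)"
  proof -
    have "\<exists>z. homotopic_loops X b' (\<lambda>_. z)" using that bb homotopic_loops_trans by blast
    then have "homotopic_paths X b' e" using null b'(3) unfolding e_def by metis
    then have "homotopic_paths X (a +++ b') (a +++ e)"
      using b' ab by (intro homotopic_paths_join) auto
    moreover have "homotopic_paths X (a +++ e) a"
      using homotopic_paths_rid[OF ab(1,2)] ab(3) unfolding e_def by simp
    ultimately have "homotopic_paths X g a" using gab homotopic_paths_trans by blast
    then show ?thesis using loops gp by metis
  qed
  show "homotopic_loops X a (reversepath b)" if "\<exists>z. homotopic_loops X g (\<lambda>_. z)"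
  proof -
    have "homotopic_paths X g e" using null[OF that] gp unfolding e_def by simp
    then have 1: "homotopic_paths X (a +++ b') e" using gab homotopic_paths_sym homotopic_paths_trans by blast
    have "homotopic_paths X (a +++ e) a"
      using homotopic_paths_rid[OF ab(1,2)] ab(3) unfolding e_def by simp
    \<comment> \<open>Inserting \<open>b'\<close> and its reverse after \<open>a\<close>, and then
      contracting \<open>a\<close> followed by \<open>b'\<close>, leaves the reverse of
      \<open>b'\<close>.\<close>
    moreover have "homotopic_paths X (a +++ (b' +++ reversepath b')) (a +++ e)"
      using homotopic_paths_rinv[OF b'(1,2)] b'(3,4) ab unfolding e_def by (intro homotopic_paths_join) auto
    moreover have "homotopic_paths X (a +++ (b' +++ reversepath b')) ((a +++ b') +++ reversepath b')"
      using b' ab by (intro homotopic_paths_assoc) auto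
    moreover have "homotopic_paths X ((a +++ b') +++ reversepath b') (e +++ reversepath b')"
      using 1 b' by (intro homotopic_paths_join) auto
    moreover have "homotopic_paths X (e +++ reversepath b') (reversepath b')"
      using homotopic_paths_lid[of "reversepath b'" X] b' unfolding e_def by simp
    ultimately have "homotopic_paths X a (reversepath b')"
      using homotopic_paths_sym homotopic_paths_trans by meson
    then have "homotopic_loops X a (reversepath b')" using loops ab(3) by blast
    then show ?thesis using homotopic_loops_reversepath[OF bb] homotopic_loops_trans by blast
  qed
  show "winding_number g z = winding_number a z + winding_number b z" if z: "z \<notin> X"
  proof -
    have Xz: "X \<subseteq> - {z}" using z by auto
    have s: "homotopic_paths (- {z}) g (a +++ b')" by (rule homotopic_paths_subset[OF gab Xz])
    have s2: "homotopic_loops (- {z}) b' b" by (rule homotopic_loops_subset[OF bb Xz])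
    have "winding_number g z = winding_number (a +++ b') z" by (rule winding_number_homotopic_paths[OF s])
    also have "\<dots> = winding_number a z + winding_number b' z"
      using ab b' z by (intro winding_number_join) auto
    also have "winding_number b' z = winding_number b z" by (rule winding_number_homotopic_loops[OF s2])
    finally show ?thesis .
  qed
qed

context link_diagram
begin

text \<open>\<open>a\<close> runs through \<open>K\<close> and back inside the crossing disk,
  \<open>b\<close> does the same with \<open>K'\<close>, and \<open>g\<close> runs through both.
  Inside the disk the connecting chords of \<open>g\<close> can be pushed over the corners 1 and -1
  and the diameter \<open>d\<close> between them. So \<open>g\<close> becomes the product of
  \<open>a\<close> with the conjugate of \<open>b\<close> by \<open>d\<close>.\<close>

lemma pants_loops:
  assumes P: "pants c K K' w" and sub: "leg1 c K w \<subseteq> Sig n p" "leg2 c K' w \<subseteq> Sig n p"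
  obtains a b g where "parametrizes a (leg1 c K w)" "parametrizes b (leg2 c K' w)" "parametrizes g (waist c K K' w)"
    "(\<exists>z. homotopic_loops (Sig n p) a (\<lambda>_. z)) \<Longrightarrow> homotopic_loops (Sig n p) g b"
    "(\<exists>z. homotopic_loops (Sig n p) b (\<lambda>_. z)) \<Longrightarrow> homotopic_loops (Sig n p) g a"
    "(\<exists>z. homotopic_loops (Sig n p) g (\<lambda>_. z)) \<Longrightarrow> homotopic_loops (Sig n p) a (reversepath b)"
    "\<And>z. z \<notin> Sig n p \<Longrightarrow> winding_number g z = winding_number a z + winding_number b z"
proof -
  note P' = pantsD[OF P]
  define \<phi> where "\<phi> = cdisk D c"
  define X where "X = Sig n p"
  note dk = disk(1,2,3)[OF P'(1), folded \<phi>_def X_def]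
  obtain k where k: "arc k" "path_image k = K" "pathstart k = \<phi> 1" "pathfinish k = \<phi> w"
    using P'(5) unfolding arc_between_def \<phi>_def by blast
  obtain k' where k': "arc k'" "path_image k' = K'" "pathstart k' = \<phi> (-1)" "pathfinish k' = \<phi> (-w)"
    using P'(6) unfolding arc_between_def \<phi>_def by blast
  have kX: "path k" "path k'" "path_image k \<subseteq> X" "path_image k' \<subseteq> X"
    using k k' sub unfolding leg1_def leg2_def X_def by (auto simp: arc_imp_path)
  have cb: "1 \<in> cball (0::complex) 1" "-1 \<in> cball (0::complex) 1" "w \<in> cball 0 1" "-w \<in> cball 0 1" "(1::complex) \<in> cball 0 1" "(-1::complex) \<in> cball 0 1" using P'(2) by auto
  have seg: "closed_segment u v \<subseteq> cball 0 1" if "u \<in> cball 0 1" "v \<in> cball 0 1" for u v :: complex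
    using that by (simp add: closed_segment_subset)
  define m where "m u v = \<phi> \<circ> linepath u v" for u v
  have m: "path (m u v)" "path_image (m u v) = \<phi> ` closed_segment u v" "pathstart (m u v) = \<phi> u" "pathfinish (m u v) = \<phi> v"
      "path_image (m u v) \<subseteq> X" "reversepath (m u v) = m v u"
    if "u \<in> cball 0 1" "v \<in> cball 0 1" for u v
  proof -
    show "path (m u v)" unfolding m_def
      using seg[OF that] dk(1) by (intro path_continuous_image) (auto intro: continuous_on_subset)
    show i: "path_image (m u v) = \<phi> ` closed_segment u v" unfolding m_def by (simp add: path_image_compose)
    show "pathstart (m u v) = \<phi> u" "pathfinish (m u v) = \<phi> v" unfolding m_def by (simp_all add: pathstart_compose pathfinish_compose)
    show "path_image (m u v) \<subseteq> X" unfolding i using seg[OF that] dk(3) by blast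
    show "reversepath (m u v) = m v u" unfolding m_def path_compose_reversepath[symmetric] by simp
  qed
  have arcm: "arc (m u v)" if "u \<in> cball 0 1" "v \<in> cball 0 1" "u \<noteq> v" for u v
  proof -
    have "inj_on \<phi> (path_image (linepath u v))" using dk(2) seg[OF that(1,2)] by (simp add: inj_on_subset)
    then show ?thesis unfolding m_def arc_def using m(1)[OF that(1,2)] arc_linepath[OF that(3)]
      unfolding m_def arc_def path_image_def by (simp add: comp_inj_on)
  qed
  have nz: "w \<noteq> 1" "w \<noteq> -1" "-w \<noteq> 1" "-w \<noteq> -1" using P'(2) by (auto simp: complex_eq_iff)
  define a where "a = k +++ m w 1"
  define b where "b = k' +++ m (-w) (-1)"
  define g where "g = (k +++ m w (-1)) +++ (k' +++ m (-w) 1)"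
  note in1 = inner_arc[OF P'(1), folded \<phi>_def]
  have cs: "closed_segment w 1 = closed_segment 1 w" "closed_segment (-w) (-1) = closed_segment (-1) (-w)"
    "closed_segment w (-1) = closed_segment (-1) w" "closed_segment (-w) 1 = closed_segment 1 (-w)"
    by (auto simp: closed_segment_commute)
  have E: "K \<inter> \<phi> ` cball 0 1 = {\<phi> 1, \<phi> w}" "K' \<inter> \<phi> ` cball 0 1 = {\<phi> (-1), \<phi> (-w)}"
    using P'(7,8) unfolding \<phi>_def .
  have cor: "\<phi> ` cball 0 1 \<inter> \<phi> ` closed_segment u v = \<phi> ` closed_segment u v" if "u \<in> cball 0 1" "v \<in> cball 0 1" for u v
    using seg[OF that] by blast
  have "simple_path a" unfolding a_def
  proof (rule simple_path_join_loop[OF k(1) arcm[OF cb(3,5)]])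
    show "path_image k \<inter> path_image (m w 1) \<subseteq> {pathstart k, pathstart (m w 1)}"
      using E(1) seg[OF cb(3,5)] unfolding k(2,3) m(2,3)[OF cb(3,5)] by blast
  qed (use nz k m(3,4)[OF cb(3,5)] in auto)
  then have A: "parametrizes a (leg1 c K w)"
    unfolding parametrizes_def leg1_def a_def using k m(2,3,4)[OF cb(3,5)] cs(1)
    by (auto simp: path_image_join \<phi>_def)
  have "simple_path b" unfolding b_def
  proof (rule simple_path_join_loop[OF k'(1) arcm[OF cb(4,6)]])
    show "path_image k' \<inter> path_image (m (-w) (-1)) \<subseteq> {pathstart k', pathstart (m (-w) (-1))}"
      using E(2) seg[OF cb(4,6)] unfolding k'(2,3) m(2,3)[OF cb(4,6)] by blast
  qed (use nz k' m(3,4)[OF cb(4,6)] in auto)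
  then have B: "parametrizes b (leg2 c K' w)"
    unfolding parametrizes_def leg2_def b_def using k' m(2,3,4)[OF cb(4,6)] cs(2)
    by (auto simp: path_image_join \<phi>_def)
  define p1 pm pw pn where pp: "p1 = \<phi> 1" "pm = \<phi> (-1)" "pw = \<phi> w" "pn = \<phi> (-w)"
  have dist: "p1 \<noteq> pm" "p1 \<noteq> pw" "p1 \<noteq> pn" "pm \<noteq> pw" "pm \<noteq> pn" "pw \<noteq> pn"
    unfolding pp \<phi>_def using arc_between_props(4,5,6)[OF P'(5)] arc_between_props(4,5,6)[OF P'(6)] P'(4) by auto
  have i1: "\<phi> ` closed_segment w (-1) \<inter> corners c = {pm, pw}" "\<phi> ` closed_segment (-w) 1 \<inter> corners c = {p1, pn}"
    using in1(3)[of "-1" w, OF _ P'(2)] in1(3)[of 1 "-w", OF _ P'(3)] unfolding cs pp by auto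
  have Kc: "K \<inter> \<phi> ` closed_segment w (-1) \<subseteq> {p1, pw} \<inter> {pm, pw}" "K' \<inter> \<phi> ` closed_segment w (-1) \<subseteq> {pm, pn} \<inter> {pm, pw}"
    "K \<inter> \<phi> ` closed_segment (-w) 1 \<subseteq> {p1, pw} \<inter> {p1, pn}" "K' \<inter> \<phi> ` closed_segment (-w) 1 \<subseteq> {pm, pn} \<inter> {p1, pn}"
  proof -
    have KK: "K \<inter> \<phi> ` cball 0 1 \<subseteq> corners c \<inter> {p1, pw}" "K' \<inter> \<phi> ` cball 0 1 \<subseteq> corners c \<inter> {pm, pn}"
      unfolding E unfolding P'(9) pp \<phi>_def by auto
    have s1: "\<phi> ` closed_segment w (-1) \<subseteq> \<phi> ` cball 0 1" "\<phi> ` closed_segment (-w) 1 \<subseteq> \<phi> ` cball 0 1"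
      using seg[OF cb(3,6)] seg[OF cb(4,5)] by auto
    show "K \<inter> \<phi> ` closed_segment w (-1) \<subseteq> {p1, pw} \<inter> {pm, pw}" "K' \<inter> \<phi> ` closed_segment w (-1) \<subseteq> {pm, pn} \<inter> {pm, pw}"
      "K \<inter> \<phi> ` closed_segment (-w) 1 \<subseteq> {p1, pw} \<inter> {p1, pn}" "K' \<inter> \<phi> ` closed_segment (-w) 1 \<subseteq> {pm, pn} \<inter> {p1, pn}"
      using KK(1) s1(1) i1(1) apply blast
      using KK(2) s1(1) i1(1) apply blast
      using KK(1) s1(2) i1(2) apply blast
      using KK(2) s1(2) i1(2) by blast
  qed
  have arc1: "arc (k +++ m w (-1))"
  proof (rule arc_join[OF k(1) arcm[OF cb(3,6)]])
    show "path_image k \<inter> path_image (m w (-1)) \<subseteq> {pathstart (m w (-1))}"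
      unfolding k(2) m(2,3)[OF cb(3,6)] using Kc(1) dist unfolding pp by auto
  qed (use nz k m(3)[OF cb(3,6)] in auto)
  have arc2: "arc (k' +++ m (-w) 1)"
  proof (rule arc_join[OF k'(1) arcm[OF cb(4,5)]])
    show "path_image k' \<inter> path_image (m (-w) 1) \<subseteq> {pathstart (m (-w) 1)}"
      unfolding k'(2) m(2,3)[OF cb(4,5)] using Kc(4) dist unfolding pp by auto
  qed (use nz k' m(3)[OF cb(4,5)] in auto)
  have im1: "path_image (k +++ m w (-1)) = K \<union> \<phi> ` closed_segment (-1) w"
    using k m(2,3)[OF cb(3,6)] cs(3) by (simp add: path_image_join)
  have im2: "path_image (k' +++ m (-w) 1) = K' \<union> \<phi> ` closed_segment 1 (-w)"
    using k' m(2,3)[OF cb(4,5)] cs(4) by (simp add: path_image_join)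
  have "simple_path g" unfolding g_def
  proof (rule simple_path_join_loop[OF arc1 arc2])
    have "\<phi> ` closed_segment 1 (-w) \<inter> \<phi> ` closed_segment (-1) w = {}"
      using inner_arcs_disjoint[OF P'(1,3)] unfolding \<phi>_def by simp
    then show "path_image (k +++ m w (-1)) \<inter> path_image (k' +++ m (-w) 1) \<subseteq> {pathstart (k +++ m w (-1)), pathstart (k' +++ m (-w) 1)}"
      unfolding im1 im2 using Kc P'(4) dist k(3) k'(3) unfolding cs pp by auto
  qed (use k k' m(3,4)[OF cb(3,6)] m(3,4)[OF cb(4,5)] in auto)
  moreover have "path_image g = waist c K K' w"
  proof -
    have "path_image g = path_image (k +++ m w (-1)) \<union> path_image (k' +++ m (-w) 1)"
      unfolding g_def using k' m(4)[OF cb(3,6)] by (intro path_image_join) simp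
    then show ?thesis unfolding im1 im2 waist_def \<phi>_def by blast
  qed
  ultimately have G: "parametrizes g (waist c K K' w)"
    unfolding parametrizes_def using k(3) m(4)[OF cb(4,5)] unfolding g_def by simp
  define d where "d = m 1 (-1)"
  have pth: "path a" "path b" "path_image a \<subseteq> X" "path_image b \<subseteq> X" "pathfinish a = pathstart a" "pathfinish b = pathstart b"
    "pathstart a = \<phi> 1" "pathstart b = \<phi> (-1)"
    using parametrizesD[OF A] parametrizesD[OF B] sub k(3) k'(3) unfolding X_def a_def b_def by auto
  have e: "pathfinish k = pathstart (m w 1)" "pathfinish k = pathstart (m w (-1))"
    "pathfinish k' = pathstart (m (-w) (-1))" "pathfinish k' = pathstart (m (-w) 1)"
    using k k' m(3) cb by auto
  \<comment> \<open>The chord by which the waist leaves \<open>K\<close> is replaced by the chord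
    that closes the leg, followed by the diameter.\<close>
  have h1: "homotopic_paths X (m w (-1)) (m w 1 +++ d)"
    unfolding m_def d_def by (rule homotopic_paths_via[OF convex_cball dk(1,3)]) (use cb in auto)
  have h2: "homotopic_paths X (m (-w) 1) (m (-w) (-1) +++ m (-1) 1)"
    unfolding m_def by (rule homotopic_paths_via[OF convex_cball dk(1,3)]) (use cb in auto)
  have rd: "reversepath d = m (-1) 1" unfolding d_def using m(6) cb by simp
  have mm: "path (m w 1)" "path (m (-w) (-1))" "path d" "path (m (-1) 1)" "path_image (m w 1) \<subseteq> X" "path_image (m (-w) (-1)) \<subseteq> X"
    "path_image d \<subseteq> X" "path_image (m (-1) 1) \<subseteq> X" "pathstart d = \<phi> 1" "pathfinish d = \<phi> (-1)" "pathstart (m (-1) 1) = \<phi> (-1)"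
    "pathfinish (m (-1) 1) = \<phi> 1" "pathfinish (m w 1) = \<phi> 1" "pathfinish (m (-w) (-1)) = \<phi> (-1)"
    unfolding d_def using m cb by auto
  have s1: "homotopic_paths X (k +++ m w (-1)) (a +++ d)"
  proof -
    have "homotopic_paths X (k +++ m w (-1)) (k +++ (m w 1 +++ d))"
      using h1 kX e by (intro homotopic_paths_join homotopic_paths_refl[THEN iffD2]) auto
    moreover have "homotopic_paths X (k +++ (m w 1 +++ d)) ((k +++ m w 1) +++ d)"
      using kX e mm by (intro homotopic_paths_assoc) auto
    ultimately show ?thesis unfolding a_def using homotopic_paths_trans by blast
  qed
  have s2: "homotopic_paths X (k' +++ m (-w) 1) (b +++ reversepath d)"
  proof -
    have "homotopic_paths X (k' +++ m (-w) 1) (k' +++ (m (-w) (-1) +++ m (-1) 1))"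
      using h2 kX e by (intro homotopic_paths_join homotopic_paths_refl[THEN iffD2]) auto
    moreover have "homotopic_paths X (k' +++ (m (-w) (-1) +++ m (-1) 1)) ((k' +++ m (-w) (-1)) +++ m (-1) 1)"
      using kX e mm by (intro homotopic_paths_assoc) auto
    ultimately show ?thesis unfolding b_def rd using homotopic_paths_trans by blast
  qed
  have "homotopic_paths X g ((a +++ d) +++ (b +++ reversepath d))"
    unfolding g_def using k' m(4)[OF cb(3,6)] by (intro homotopic_paths_join[OF s1 s2]) simp
  moreover have "homotopic_paths X (a +++ (d +++ (b +++ reversepath d))) ((a +++ d) +++ (b +++ reversepath d))"
    using pth mm rd by (intro homotopic_paths_assoc) (auto simp: path_image_join)
  ultimately have hom: "homotopic_paths X g (a +++ (d +++ b +++ reversepath d))"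
    using homotopic_paths_sym homotopic_paths_trans by blast
  have dd: "pathstart d = pathstart a" "pathfinish d = pathstart b" using mm pth by auto
  note lp = loops_product[OF pth(1,3,5,2,4,6) mm(3,7) dd hom]
  show ?thesis using that[OF A B G] lp unfolding X_def by blast
qed

end

section \<open>The first homology of the punctured disk\<close>

text \<open>The values are complex because the winding number of a path that is not closed is in
  general not an integer.\<close>

definition frag_sum :: "('a \<Rightarrow> complex) \<Rightarrow> ('a \<Rightarrow>\<^sub>0 int) \<Rightarrow> complex" where
  "frag_sum f c = (\<Sum>x\<in>Poly_Mapping.keys c. of_int (Poly_Mapping.lookup c x) * f x)"

lemma frag_sum_superset:
  assumes "finite F" "Poly_Mapping.keys c \<subseteq> F"
  shows "frag_sum f c = (\<Sum>x\<in>F. of_int (Poly_Mapping.lookup c x) * f x)"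
  unfolding frag_sum_def using assms by (intro sum.mono_neutral_left) (auto simp: in_keys_iff)

lemma frag_sum_0 [simp]: "frag_sum f 0 = 0" by (simp add: frag_sum_def)

lemma frag_sum_of [simp]: "frag_sum f (frag_of x) = f x" by (simp add: frag_sum_def)

lemma frag_sum_diff: "frag_sum f (a - b) = frag_sum f a - frag_sum f b"
proof -
  let ?F = "Poly_Mapping.keys a \<union> Poly_Mapping.keys b \<union> Poly_Mapping.keys (a - b)"
  have F: "finite ?F" by simp
  have "frag_sum f (a - b) = (\<Sum>x\<in>?F. of_int (Poly_Mapping.lookup (a - b) x) * f x)" by (rule frag_sum_superset[OF F]) blast
  moreover have "frag_sum f a = (\<Sum>x\<in>?F. of_int (Poly_Mapping.lookup a x) * f x)" by (rule frag_sum_superset[OF F]) blast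
  moreover have "frag_sum f b = (\<Sum>x\<in>?F. of_int (Poly_Mapping.lookup b x) * f x)" by (rule frag_sum_superset[OF F]) blast
  ultimately show ?thesis by (simp add: lookup_minus left_diff_distrib sum_subtractf)
qed

lemma frag_sum_minus: "frag_sum f (- a) = - frag_sum f a"
  using frag_sum_diff[of f 0 a] by simp

lemma frag_sum_add: "frag_sum f (a + b) = frag_sum f a + frag_sum f b"
  using frag_sum_diff[of f a "- b"] by (simp add: frag_sum_minus)

lemma frag_sum_cmul: "frag_sum f (frag_cmul k a) = of_int k * frag_sum f a"
proof -
  have "frag_sum f (frag_cmul k a) = (\<Sum>x\<in>Poly_Mapping.keys a. of_int (Poly_Mapping.lookup (frag_cmul k a) x) * f x)"
    by (rule frag_sum_superset) (auto simp: in_keys_iff)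
  then show ?thesis unfolding frag_sum_def by (simp add: sum_distrib_left mult.assoc)
qed

lemma frag_sum_sum: "frag_sum f (sum g I) = (\<Sum>i\<in>I. frag_sum f (g i))"
  by (induction I rule: infinite_finite_induct) (simp_all add: frag_sum_add)

text \<open>The path traced out by a singular 1-simplex; \<open>path_simplex\<close> goes back.
  Vertex 0 is the start, so the boundary of a 1-simplex is its end minus its start.\<close>

definition simplex_edge :: "((nat \<Rightarrow> real) \<Rightarrow> complex) \<Rightarrow> real \<Rightarrow> complex" where
  "simplex_edge \<sigma> t = \<sigma> (\<lambda>i. if i = 0 then 1 - t else if i = 1 then t else 0)"

definition path_simplex :: "(real \<Rightarrow> complex) \<Rightarrow> (nat \<Rightarrow> real) \<Rightarrow> complex" where
  "path_simplex \<gamma> = (\<lambda>x\<in>standard_simplex 1. \<gamma> (x 1))"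

definition simplex_point :: "((nat \<Rightarrow> real) \<Rightarrow> complex) \<Rightarrow> complex" where
  "simplex_point \<sigma> = \<sigma> (\<lambda>j. if j = 0 then 1 else 0)"

abbreviation "edge_coord \<equiv> \<lambda>(t::real) (i::nat). if i = 0 then 1 - t else if i = 1 then t else 0"

lemma edge_coord_in: "t \<in> {0..1} \<Longrightarrow> edge_coord t \<in> standard_simplex 1"
  unfolding standard_simplex_def by (auto simp: numeral_2_eq_2)

lemma simplex_edge_path_simplex: "t \<in> {0..1} \<Longrightarrow> simplex_edge (path_simplex \<gamma>) t = \<gamma> t"
  using edge_coord_in[of t] unfolding simplex_edge_def path_simplex_def by simp

lemma path_simplex_edge:
  assumes "singular_simplex 1 (top_of_set X) \<sigma>"
  shows "path (simplex_edge \<sigma>)" "path_image (simplex_edge \<sigma>) \<subseteq> X"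
proof -
  have "continuous_map (top_of_set {0..1}) (powertop_real UNIV) edge_coord"
  proof -
    have "continuous_on {0..1} (\<lambda>t. edge_coord t k)" for k
      by (cases "k = 0"; cases "k = 1") (auto intro!: continuous_intros)
    then show ?thesis by (simp only: continuous_map_componentwise_UNIV continuous_map_iff_continuous simp_thms)
  qed
  then have "continuous_map (top_of_set {0..1}) (subtopology (powertop_real UNIV) (standard_simplex 1)) edge_coord"
    unfolding continuous_map_in_subtopology using edge_coord_in by auto
  then have "continuous_map (top_of_set {0..1}) (top_of_set X) (\<sigma> \<circ> edge_coord)"
    using assms continuous_map_compose unfolding singular_simplex_def by blast
  then have "continuous_on {0..1} (simplex_edge \<sigma>)" "simplex_edge \<sigma> ` {0..1} \<subseteq> X"
    unfolding simplex_edge_def[abs_def] o_def by (auto simp: continuous_map_in_subtopology)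
  then show "path (simplex_edge \<sigma>)" "path_image (simplex_edge \<sigma>) \<subseteq> X" unfolding path_def path_image_def by auto
qed

lemma singular_simplex_path:
  assumes "path \<gamma>" "path_image \<gamma> \<subseteq> X"
  shows "singular_simplex 1 (top_of_set X) (path_simplex \<gamma>)"
proof -
  have "continuous_map (subtopology (powertop_real UNIV) (standard_simplex 1)) (top_of_set {0..1}) (\<lambda>x. x 1)"
    unfolding continuous_map_in_subtopology
    by (auto simp: standard_simplex_def intro!: continuous_map_from_subtopology continuous_map_product_projection[of _ UNIV "\<lambda>_. euclideanreal", simplified])
  moreover have "continuous_map (top_of_set {0..1}) (top_of_set X) \<gamma>"
    using assms unfolding path_def path_image_def by (auto simp: continuous_map_in_subtopology)
  ultimately have "continuous_map (subtopology (powertop_real UNIV) (standard_simplex 1)) (top_of_set X) (\<gamma> \<circ> (\<lambda>x. x 1))"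
    by (rule continuous_map_compose)
  then have "continuous_map (subtopology (powertop_real UNIV) (standard_simplex 1)) (top_of_set X) (path_simplex \<gamma>)"
    by (rule continuous_map_eq) (auto simp: path_simplex_def)
  then show ?thesis unfolding singular_simplex_def path_simplex_def by simp
qed

lemma simplex_point_faces:
  "simplex_point (singular_face 1 0 \<sigma>) = simplex_edge \<sigma> 1"
  "simplex_point (singular_face 1 1 \<sigma>) = simplex_edge \<sigma> 0"
proof -
  have e: "(\<lambda>j. if j = 0 then 1 else 0) \<in> standard_simplex 0" unfolding standard_simplex_0 by simp
  have "simplical_face 0 (\<lambda>j. if j = 0 then 1 else (0::real)) = edge_coord 1" "simplical_face 1 (\<lambda>j. if j = 0 then 1 else (0::real)) = edge_coord 0"
    by (auto simp: simplical_face_def fun_eq_iff)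
  then show "simplex_point (singular_face 1 0 \<sigma>) = simplex_edge \<sigma> 1" "simplex_point (singular_face 1 1 \<sigma>) = simplex_edge \<sigma> 0"
    using e unfolding simplex_point_def singular_face_def simplex_edge_def by simp_all
qed

lemma singular_cycle_path:
  assumes "path \<gamma>" "path_image \<gamma> \<subseteq> X" "pathfinish \<gamma> = pathstart \<gamma>"
  shows "singular_relcycle 1 (top_of_set X) {} (frag_of (path_simplex \<gamma>))"
proof -
  have "singular_face 1 0 (path_simplex \<gamma>) = singular_face 1 1 (path_simplex \<gamma>)"
  proof
    fix x :: "nat \<Rightarrow> real"
    show "singular_face 1 0 (path_simplex \<gamma>) x = singular_face 1 1 (path_simplex \<gamma>) x"
    proof (cases "x \<in> standard_simplex 0")
      case True
      then have x: "x = (\<lambda>j. if j = 0 then 1 else 0)" unfolding standard_simplex_0 by simp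
      show ?thesis using simplex_point_faces[of "path_simplex \<gamma>"] simplex_edge_path_simplex[of 0 \<gamma>] simplex_edge_path_simplex[of 1 \<gamma>] assms(3)
        unfolding x simplex_point_def pathstart_def pathfinish_def by simp
    next
      case False
      then show ?thesis unfolding singular_face_def by simp
    qed
  qed
  then have "chain_boundary 1 (frag_of (path_simplex \<gamma>)) = 0"
    unfolding chain_boundary_of by simp
  then show ?thesis unfolding singular_cycle using singular_simplex_path[OF assms(1,2)] by (simp add: singular_chain_of)
qed

text \<open>An additive functional on 1-chains which vanishes on boundaries in any set missing
  \<open>z\<close>. It detects the coefficient of the loop around the puncture
  \<open>z\<close>.\<close>

definition chain_winding :: "complex \<Rightarrow> complex chain \<Rightarrow> complex" where
  "chain_winding z = frag_sum (\<lambda>\<sigma>. winding_number (simplex_edge \<sigma>) z)"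

lemma chain_winding_path:
  assumes "path \<gamma>"
  shows "chain_winding z (frag_of (path_simplex \<gamma>)) = winding_number \<gamma> z"
  unfolding chain_winding_def
  using winding_number_cong[of "simplex_edge (path_simplex \<gamma>)" \<gamma> z] simplex_edge_path_simplex by simp

text \<open>The 2-simplex is read as a map on the triangle with vertices 0, 1 and
  \<open>\<i>\<close>, whose sides give the three faces. The way from 0 over 1 to
  \<open>\<i>\<close> is homotopic to the direct side within \<open>X\<close>, which misses
  \<open>z\<close>.\<close>

lemma chain_winding_triangle:
  assumes \<tau>: "singular_simplex 2 (top_of_set X) \<tau>" and z: "z \<notin> X"
  shows "chain_winding z (chain_boundary 2 (frag_of \<tau>)) = 0"
proof -
  \<comment> \<open>Barycentric coordinates of \<open>u\<close> with respect to the vertices 0, 1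
    and \<open>\<i>\<close>.\<close>
  define q where "q = (\<lambda>(u::complex) (i::nat). if i = 0 then 1 - Re u - Im u else if i = 1 then Re u else if i = 2 then Im u else 0)"
  define T where "T = {u::complex. 0 \<le> Re u} \<inter> {u. 0 \<le> Im u} \<inter> {u. Re u + Im u \<le> 1}"
  have T: "convex T" unfolding T_def
  proof (intro convex_Int)
    show "convex {u. 0 \<le> Re u}" "convex {u. 0 \<le> Im u}" using convex_halfspace_Re_ge[of 0] convex_halfspace_Im_ge[of 0] by auto
    have "convex {u::complex. (1 + \<i>) \<bullet> u \<le> 1}" by (rule convex_halfspace_le)
    then show "convex {u. Re u + Im u \<le> 1}" by (simp add: inner_complex_def)
  qed
  have qT: "q u \<in> standard_simplex 2" if "u \<in> T" for u
  proof -
    have "{..2::nat} = {0, 1, 2}" by auto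
    then show ?thesis using that unfolding standard_simplex_def T_def q_def by auto
  qed
  define \<phi> where "\<phi> = \<tau> \<circ> q"
  have "continuous_map (top_of_set T) (powertop_real UNIV) q"
  proof -
    have "continuous_on T (\<lambda>u. q u k)" for k
      unfolding q_def by (cases "k = 0"; cases "k = 1"; cases "k = 2") (auto intro!: continuous_intros)
    then show ?thesis by (simp only: continuous_map_componentwise_UNIV continuous_map_iff_continuous simp_thms)
  qed
  then have "continuous_map (top_of_set T) (subtopology (powertop_real UNIV) (standard_simplex 2)) q"
    unfolding continuous_map_in_subtopology using qT by auto
  then have "continuous_map (top_of_set T) (top_of_set X) \<phi>"
    using \<tau> continuous_map_compose unfolding singular_simplex_def \<phi>_def by blast
  then have \<phi>: "continuous_on T \<phi>" "\<phi> ` T \<subseteq> X" by (auto simp: continuous_map_in_subtopology)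
  have verts: "0 \<in> T" "1 \<in> T" "\<i> \<in> T" unfolding T_def by auto
  have seg: "closed_segment u v \<subseteq> T" if "u \<in> T" "v \<in> T" for u v using that T by (simp add: closed_segment_subset)
  have hom: "homotopic_paths X (\<phi> \<circ> linepath 0 \<i>) ((\<phi> \<circ> linepath 0 1) +++ (\<phi> \<circ> linepath 1 \<i>))"
    by (rule homotopic_paths_via[OF T \<phi> verts(1,3,2)])
  have pth: "path (\<phi> \<circ> linepath u v)" "z \<notin> path_image (\<phi> \<circ> linepath u v)" if "u \<in> T" "v \<in> T" for u v
    using seg[OF that] \<phi> z by (auto simp: path_image_compose intro!: path_continuous_image intro: continuous_on_subset)
  have "X \<subseteq> - {z}" using z by auto
  then have "winding_number (\<phi> \<circ> linepath 0 \<i>) z = winding_number ((\<phi> \<circ> linepath 0 1) +++ (\<phi> \<circ> linepath 1 \<i>)) z"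
    using homotopic_paths_subset[OF hom] winding_number_homotopic_paths by blast
  also have "\<dots> = winding_number (\<phi> \<circ> linepath 0 1) z + winding_number (\<phi> \<circ> linepath 1 \<i>) z"
    using pth verts by (intro winding_number_join) (auto simp: pathstart_compose pathfinish_compose)
  finally have w: "winding_number (\<phi> \<circ> linepath 0 \<i>) z = winding_number (\<phi> \<circ> linepath 0 1) z + winding_number (\<phi> \<circ> linepath 1 \<i>) z" .
  have face: "winding_number (simplex_edge (singular_face 2 k \<tau>)) z = winding_number (\<phi> \<circ> linepath u v) z"
    if kuv: "\<And>t. t \<in> {0..1} \<Longrightarrow> simplical_face k (edge_coord t) = q (linepath u v t)" for k u v
  proof (rule winding_number_cong)
    fix t :: real assume t: "0 \<le> t" "t \<le> 1"
    then show "simplex_edge (singular_face 2 k \<tau>) t = (\<phi> \<circ> linepath u v) t"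
      using edge_coord_in[of t] kuv[of t] unfolding simplex_edge_def singular_face_def \<phi>_def by simp
  qed
  have "simplical_face 0 (edge_coord t) = q (linepath 1 \<i> t)" "simplical_face 1 (edge_coord t) = q (linepath 0 \<i> t)"
    "simplical_face 2 (edge_coord t) = q (linepath 0 1 t)" for t
    by (auto simp: simplical_face_def q_def linepath_def fun_eq_iff)
  then have f: "winding_number (simplex_edge (singular_face 2 0 \<tau>)) z = winding_number (\<phi> \<circ> linepath 1 \<i>) z"
    "winding_number (simplex_edge (singular_face 2 1 \<tau>)) z = winding_number (\<phi> \<circ> linepath 0 \<i>) z"
    "winding_number (simplex_edge (singular_face 2 2 \<tau>)) z = winding_number (\<phi> \<circ> linepath 0 1) z"
    using face by auto
  have "{..2::nat} = {0, 1, 2}" by auto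
  then have "chain_boundary 2 (frag_of \<tau>) = frag_of (singular_face 2 0 \<tau>) - frag_of (singular_face 2 1 \<tau>) + frag_of (singular_face 2 2 \<tau>)"
    unfolding chain_boundary_of by simp
  then show ?thesis unfolding chain_winding_def by (simp add: frag_sum_add frag_sum_diff f f[unfolded One_nat_def] w)
qed

lemma chain_winding_boundary:
  assumes "singular_chain 2 (top_of_set X) d" "z \<notin> X"
  shows "chain_winding z (chain_boundary 2 d) = 0"
  using assms(1) unfolding singular_chain_def
proof (induction rule: frag_induction)
  case zero then show ?case by (simp add: chain_winding_def)
next
  case (one x) then show ?case using chain_winding_triangle assms(2) by simp
next
  case (diff a b) then show ?case by (simp add: chain_boundary_diff chain_winding_def frag_sum_diff)
qed

lemma chain_winding_homologous:
  assumes "homologous_rel 1 (top_of_set X) {} a b" "z \<notin> X"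
  shows "chain_winding z a = chain_winding z b"
proof -
  obtain d where d: "singular_chain (Suc 1) (top_of_set X) d" "chain_boundary (Suc 1) d = a - b"
    using assms(1) unfolding homologous_rel_def singular_boundary by blast
  then have "singular_chain 2 (top_of_set X) d" "chain_boundary 2 d = a - b" by (simp_all add: numeral_2_eq_2)
  then have "chain_winding z (a - b) = 0" using chain_winding_boundary[of X d z] assms(2) by simp
  then show ?thesis unfolding chain_winding_def by (simp add: frag_sum_diff)
qed

text \<open>Up to an integer, the winding number of a path is the difference of the values of a
  logarithm \<open>lg\<close> at its ends, whatever the branch. Summed over a cycle these
  differences cancel, being the value of \<open>pt0\<close> on the boundary.\<close>

lemma chain_winding_integer:
  assumes c: "singular_relcycle 1 (top_of_set X) {} c" and z: "z \<notin> X"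
  shows "chain_winding z c \<in> \<int>"
proof -
  define lg where "lg x = Ln (x - z) / (2 * of_real pi * \<i>)" for x
  have lg: "exp (2 * of_real pi * \<i> * lg x) = x - z" if "x \<noteq> z" for x using that unfolding lg_def by simp
  define pt0 where "pt0 = frag_sum (\<lambda>\<sigma>. lg (simplex_point \<sigma>))"
  have "chain_winding z d - pt0 (chain_boundary 1 d) \<in> \<int>" if "Poly_Mapping.keys d \<subseteq> singular_simplex_set 1 (top_of_set X)" for d
    using that
  proof (induction rule: frag_induction)
    case zero then show ?case by (simp add: chain_winding_def pt0_def)
  next
    case (diff a b)
    have "chain_winding z (a - b) - pt0 (chain_boundary 1 (a - b)) = (chain_winding z a - pt0 (chain_boundary 1 a)) - (chain_winding z b - pt0 (chain_boundary 1 b))"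
      unfolding chain_winding_def pt0_def chain_boundary_diff frag_sum_diff by simp
    then show ?case using diff Ints_diff by metis
  next
    case (one \<sigma>)
    then have s: "singular_simplex 1 (top_of_set X) \<sigma>" by simp
    define w where "w = winding_number (simplex_edge \<sigma>) z"
    define a b where "a = simplex_edge \<sigma> 0" and "b = simplex_edge \<sigma> 1"
    note e = path_simplex_edge[OF s]
    have "simplex_edge \<sigma> t \<in> X" if "t \<in> {0..1}" for t using e(2) that unfolding path_image_def by blast
    then have ab: "a \<noteq> z" "b \<noteq> z" using z unfolding a_def b_def by fastforce+
    have zz: "z \<notin> path_image (simplex_edge \<sigma>)" using e(2) z by blast
    have "b - z = exp (2 * of_real pi * \<i> * w) * (a - z)"
      using winding_number_exp_2pi[OF e(1) zz] unfolding w_def a_def b_def pathstart_def pathfinish_def by simp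
    then have "exp (2 * of_real pi * \<i> * lg b) = exp (2 * of_real pi * \<i> * w) * exp (2 * of_real pi * \<i> * lg a)"
      unfolding lg[OF ab(1)] lg[OF ab(2)] .
    then have "exp (2 * of_real pi * \<i> * lg b) = exp (2 * of_real pi * \<i> * (w + lg a))"
      by (simp add: exp_add distrib_left)
    then obtain k :: int where k: "2 * of_real pi * \<i> * lg b = 2 * of_real pi * \<i> * (w + lg a) + (of_int (2 * k) * of_real pi) * \<i>"
      unfolding exp_eq by auto
    have "2 * of_real pi * \<i> * (w - (lg b - lg a)) = 2 * of_real pi * \<i> * of_int (- k)"
      using k by (simp add: algebra_simps)
    moreover have "2 * of_real pi * \<i> \<noteq> (0::complex)" by simp
    ultimately have "w - (lg b - lg a) = of_int (- k)" using mult_left_cancel by blast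
    moreover have "pt0 (chain_boundary 1 (frag_of \<sigma>)) = lg b - lg a"
      unfolding chain_boundary_of pt0_def a_def b_def simplex_point_faces[symmetric]
      by (simp add: frag_sum_diff)
    ultimately show ?case unfolding chain_winding_def w_def by simp
  qed
  then have "chain_winding z c - pt0 (chain_boundary 1 c) \<in> \<int>"
    using c unfolding singular_cycle singular_chain_def by blast
  then show ?thesis using c unfolding singular_cycle pt0_def by simp
qed

section \<open>The first homology group in terms of cycles\<close>

abbreviation "H1 X \<equiv> homology_group 1 (top_of_set (X :: complex set))"
abbreviation "hclass X \<equiv> homologous_rel_set 1 (top_of_set (X :: complex set)) {}"

lemma H1_carrier: "carrier (H1 X) = hclass X ` singular_relcycle_set 1 (top_of_set X) {}"
  using carrier_relative_homology_group[of 1 "top_of_set X" "{}"] by simp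

lemma H1_mult:
  assumes "singular_relcycle 1 (top_of_set X) {} a" "singular_relcycle 1 (top_of_set X) {} b"
  shows "hclass X a \<otimes>\<^bsub>H1 X\<^esub> hclass X b = hclass X (a + b)"
proof -
  have "hclass X a \<otimes>\<^bsub>H1 X\<^esub> hclass X b = (\<Union>r\<in>hclass X a. \<Union>s\<in>hclass X b. {r + s})"
    using mult_relative_homology_group[of 1 "top_of_set X" "{}"] by simp
  also have "\<dots> = hclass X (a + b)"
  proof (intro equalityI subsetI)
    fix x assume "x \<in> (\<Union>r\<in>hclass X a. \<Union>s\<in>hclass X b. {r + s})"
    then show "x \<in> hclass X (a + b)" using homologous_rel_add by auto
  next
    fix x assume x: "x \<in> hclass X (a + b)"
    then have "homologous_rel 1 (top_of_set X) {} b (x - a)"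
      unfolding homologous_rel_def by (simp add: algebra_simps)
    moreover have "x = a + (x - a)" by simp
    ultimately show "x \<in> (\<Union>r\<in>hclass X a. \<Union>s\<in>hclass X b. {r + s})" using homologous_rel_refl by blast
  qed
  finally show ?thesis .
qed

lemma H1_one: "\<one>\<^bsub>H1 X\<^esub> = hclass X 0"
  using one_relative_homology_group[of 1 "top_of_set X" "{}"] homologous_rel_set_eq_relboundary[of 1 "top_of_set X" "{}" 0] by simp

lemma H1_int_pow:
  assumes a: "singular_relcycle 1 (top_of_set X) {} a"
  shows "hclass X a [^]\<^bsub>H1 X\<^esub> (k::int) = hclass X (frag_cmul k a)"
proof -
  interpret G: comm_group "H1 X" by (rule abelian_homology_group)
  have ac: "hclass X a \<in> carrier (H1 X)" using a unfolding H1_carrier by blast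
  have n: "hclass X a [^]\<^bsub>H1 X\<^esub> (m::nat) = hclass X (frag_cmul (int m) a)" for m
  proof (induction m)
    case 0 then show ?case by (simp add: H1_one)
  next
    case (Suc m)
    then show ?case using H1_mult[OF singular_relcycle_cmul[OF a] a, of "int m"] frag_cmul_distrib[of "int m" 1 a]
      by (simp add: add.commute)
  qed
  show ?thesis
  proof (cases "k \<ge> 0")
    case True
    then have "k = int (nat k)" by simp
    then show ?thesis using n[of "nat k"] by (metis int_pow_int)
  next
    case False
    then have k: "k = - int (nat (- k))" by simp
    have "hclass X (frag_cmul k a) \<otimes>\<^bsub>H1 X\<^esub> hclass X (frag_cmul (- k) a) = \<one>\<^bsub>H1 X\<^esub>"
      using H1_mult[OF singular_relcycle_cmul[OF a, of k] singular_relcycle_cmul[OF a, of "- k"]] frag_cmul_distrib[of k "- k" a]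
      by (simp add: H1_one)
    moreover have "hclass X (frag_cmul j a) \<in> carrier (H1 X)" for j using singular_relcycle_cmul[OF a] unfolding H1_carrier by blast
    ultimately have "inv\<^bsub>H1 X\<^esub> (hclass X (frag_cmul (- k) a)) = hclass X (frag_cmul k a)"
      using G.inv_equality by blast
    moreover have "hclass X a [^]\<^bsub>H1 X\<^esub> k = inv\<^bsub>H1 X\<^esub> (hclass X a [^]\<^bsub>H1 X\<^esub> nat (- k))"
      by (subst int_pow_def2) (use False in simp)
    ultimately show ?thesis unfolding n using False by simp
  qed
qed

lemma H1_finprod:
  assumes "finite I" "\<And>i. i \<in> I \<Longrightarrow> singular_relcycle 1 (top_of_set X) {} (c i)"
  shows "finprod (H1 X) (\<lambda>i. hclass X (c i) [^]\<^bsub>H1 X\<^esub> (k i :: int)) I = hclass X (\<Sum>i\<in>I. frag_cmul (k i) (c i))"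
  using assms
proof (induction I rule: finite_induct)
  case empty
  interpret G: comm_group "H1 X" by (rule abelian_homology_group)
  show ?case by (simp add: H1_one)
next
  case (insert x F)
  interpret G: comm_group "H1 X" by (rule abelian_homology_group)
  have c: "hclass X (c i) [^]\<^bsub>H1 X\<^esub> (k i) \<in> carrier (H1 X)" if "i \<in> insert x F" for i
    using insert(4)[OF that] H1_carrier by (intro G.int_pow_closed) blast
  have cy: "singular_relcycle 1 (top_of_set X) {} (frag_cmul (k i) (c i))" if "i \<in> insert x F" for i
    using insert(4)[OF that] by (rule singular_relcycle_cmul)
  have "finprod (H1 X) (\<lambda>i. hclass X (c i) [^]\<^bsub>H1 X\<^esub> (k i)) (insert x F) =
      hclass X (c x) [^]\<^bsub>H1 X\<^esub> (k x) \<otimes>\<^bsub>H1 X\<^esub> finprod (H1 X) (\<lambda>i. hclass X (c i) [^]\<^bsub>H1 X\<^esub> (k i)) F"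
    using insert(1,2) c by (intro G.finprod_insert) auto
  also have "\<dots> = hclass X (frag_cmul (k x) (c x)) \<otimes>\<^bsub>H1 X\<^esub> hclass X (\<Sum>i\<in>F. frag_cmul (k i) (c i))"
    using insert H1_int_pow[of X "c x" "k x"] by simp
  also have "\<dots> = hclass X (frag_cmul (k x) (c x) + (\<Sum>i\<in>F. frag_cmul (k i) (c i)))"
    using cy by (intro H1_mult singular_relcycle_sum) auto
  finally show ?case using insert(1,2) by simp
qed

lemma hom_induced_H1:
  assumes "X \<subseteq> Y" "singular_relcycle 1 (top_of_set X) {} c"
  shows "hom_induced 1 (top_of_set X) {} (top_of_set Y) {} id (hclass X c) = hclass Y c"
    "singular_relcycle 1 (top_of_set Y) {} c"
proof -
  have "continuous_map (top_of_set X) (top_of_set Y) id" using assms(1) by (auto simp: continuous_map_in_subtopology)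
  then have "hom_induced (int 1) (top_of_set X) {} (top_of_set Y) {} id (hclass X c) = hclass Y (chain_map 1 id c)"
    using hom_induced_chain_map[of "top_of_set X" "top_of_set Y" id "{}" "{}" 1 c] assms(2) by simp
  moreover have "chain_map 1 id c = c"
    using assms(2) chain_map_id_gen[of 1 "top_of_set X" c id] unfolding singular_cycle by simp
  ultimately show "hom_induced 1 (top_of_set X) {} (top_of_set Y) {} id (hclass X c) = hclass Y c" by simp
  show "singular_relcycle 1 (top_of_set Y) {} c" by (rule singular_cycle_mono[OF assms(2,1)])
qed

section \<open>Homology of the circle and of a disk with one puncture\<close>

lemma circle_homeomorphic_nsphere:
  "homeomorphic_map (top_of_set (sphere (0::complex) 1)) (nsphere 1) (\<lambda>z i. if i = 0 then Re z else if i = 1 then Im z else 0)"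
proof -
  define f where "f = (\<lambda>(z::complex) (i::nat). if i = 0 then Re z else if i = 1 then Im z else 0)"
  define g where "g = (\<lambda>x::nat \<Rightarrow> real. Complex (x 0) (x 1))"
  have tn: "topspace (nsphere 1) = {x. (\<Sum>i\<le>1. (x i)\<^sup>2) = 1 \<and> (\<forall>i>1. x i = 0)}"
    unfolding nsphere by auto
  have f: "continuous_map (top_of_set (sphere 0 1)) (nsphere 1) f"
    unfolding nsphere continuous_map_in_subtopology
  proof
    have "continuous_on (sphere 0 1) (\<lambda>z. f z k)" for k
      unfolding f_def by (cases "k = 0"; cases "k = 1") (auto intro!: continuous_intros)
    then show "continuous_map (top_of_set (sphere 0 1)) (powertop_real UNIV) f"
      by (simp only: continuous_map_componentwise_UNIV continuous_map_iff_continuous simp_thms)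
    show "f \<in> topspace (top_of_set (sphere 0 1)) \<rightarrow> {x. (\<Sum>i\<le>1. (x i)\<^sup>2) = 1 \<and> (\<forall>i>1. x i = 0)}"
      unfolding f_def by (auto simp: cmod_def)
  qed
  have g: "continuous_map (nsphere 1) (top_of_set (sphere 0 1)) g"
    unfolding continuous_map_in_subtopology
  proof
    have "continuous_map (nsphere 1) (prod_topology euclideanreal euclideanreal) (\<lambda>x. (x 0, x 1))"
      by (intro continuous_map_pairedI continuous_map_nsphere_projection)
    moreover have "continuous_map (euclidean :: (real \<times> real) topology) euclidean (\<lambda>y. Complex (fst y) (snd y))"
      by (auto intro!: continuous_intros simp: continuous_map_iff_continuous2)
    ultimately have "continuous_map (nsphere 1) euclidean ((\<lambda>y. Complex (fst y) (snd y)) \<circ> (\<lambda>x. (x 0, x 1)))"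
      using continuous_map_compose[of "nsphere 1" "prod_topology euclideanreal euclideanreal" "\<lambda>x. (x 0, x 1)" euclidean "\<lambda>y. Complex (fst y) (snd y)"]
      by (simp add: prod_topology_euclidean)
    then show "continuous_map (nsphere 1) euclidean g" unfolding g_def o_def by simp
    show "g \<in> topspace (nsphere 1) \<rightarrow> sphere 0 1" unfolding tn g_def by (auto simp: cmod_def)
  qed
  have "homeomorphic_maps (top_of_set (sphere 0 1)) (nsphere 1) f g"
    unfolding homeomorphic_maps_def
  proof (intro conjI ballI f g)
    fix y assume "y \<in> topspace (nsphere 1)"
    then have "y i = 0" if "i \<noteq> 0" "i \<noteq> 1" for i using that unfolding tn by auto
    then show "f (g y) = y" unfolding f_def g_def by (auto simp: fun_eq_iff)
  qed (simp add: f_def g_def complex_eq_iff)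
  then show ?thesis unfolding f_def homeomorphic_map_maps by blast
qed

lemma H1_circle_cyclic:
  assumes "0 < r"
  shows "cyclic_group (H1 (sphere c r))"
proof -
  have "top_of_set (sphere c r) homeomorphic_space top_of_set (sphere (0::complex) 1)"
    using homeomorphic_spheres[OF assms, of 1 c 0] by (simp add: homeomorphic_space_iff_homeomorphic)
  moreover have "top_of_set (sphere (0::complex) 1) homeomorphic_space nsphere 1"
    using circle_homeomorphic_nsphere homeomorphic_map_imp_homeomorphic_space by blast
  ultimately have "H1 (sphere c r) \<cong> homology_group 1 (nsphere 1)"
    using homeomorphic_space_imp_isomorphic_homology_groups homeomorphic_space_trans by blast
  moreover have "cyclic_group (homology_group 1 (nsphere 1))"
    using cyclic_reduced_homology_group_nsphere[of 1 1] un_reduced_homology_group[of 1 "nsphere 1"] by simp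
  ultimately show ?thesis
    using isomorphic_group_cyclicity[OF _ group_relative_homology_group group_relative_homology_group] by blast
qed

text \<open>The group is cyclic with some generator \<open>e\<close>, of which the circle is a
  multiple by an integer \<open>m\<close>. The circle has winding number 1 and \<open>e\<close> an
  integral one, so \<open>m\<close> divides 1 and the circle is a generator, too.\<close>

lemma H1_circle:
  assumes r: "0 < r" and c: "singular_relcycle 1 (top_of_set (sphere z r)) {} c"
  shows "\<exists>k. hclass (sphere z r) c = hclass (sphere z r) (frag_cmul k (frag_of (path_simplex (circlepath z r))))"
proof -
  define X where "X = sphere z r"
  define l where "l = frag_of (path_simplex (circlepath z r))"
  interpret G: comm_group "H1 X" by (rule abelian_homology_group)
  have zX: "z \<notin> X" using r unfolding X_def by simp
  have l: "singular_relcycle 1 (top_of_set X) {} l"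
    unfolding l_def by (rule singular_cycle_path) (use r in \<open>auto simp: X_def\<close>)
  have wl: "chain_winding z l = 1"
    unfolding l_def by (simp add: chain_winding_path winding_number_circlepath_centre r)
  obtain g where g: "g \<in> carrier (H1 X)" "carrier (H1 X) = range (\<lambda>k::int. g [^]\<^bsub>H1 X\<^esub> k)"
    using H1_circle_cyclic[OF r, of z] G.cyclic_group unfolding X_def[symmetric] by blast
  obtain e where e: "g = hclass X e" "singular_relcycle 1 (top_of_set X) {} e" using g(1) unfolding H1_carrier by blast
  have pw: "\<exists>k. hclass X d = hclass X (frag_cmul k e)" if d: "singular_relcycle 1 (top_of_set X) {} d" for d
  proof -
    have "hclass X d \<in> carrier (H1 X)" using d unfolding H1_carrier by blast
    then obtain k :: int where "hclass X d = g [^]\<^bsub>H1 X\<^esub> k" using g(2) by blast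
    then show ?thesis using H1_int_pow[OF e(2)] e(1) by auto
  qed
  obtain m where m: "hclass X l = hclass X (frag_cmul m e)" using pw[OF l] by blast
  then have "homologous_rel 1 (top_of_set X) {} l (frag_cmul m e)" unfolding homologous_rel_set_eq .
  then have "1 = of_int m * chain_winding z e"
    using chain_winding_homologous[OF _ zX, of l "frag_cmul m e"] wl unfolding chain_winding_def frag_sum_cmul by simp
  moreover obtain j :: int where j: "chain_winding z e = of_int j"
    using chain_winding_integer[OF e(2) zX] by (elim Ints_cases)
  ultimately have "of_int (m * j) = (1::complex)" by simp
  then have mj: "m * j = 1" by (metis of_int_eq_1_iff)
  obtain k where k: "hclass X c = hclass X (frag_cmul k e)" using pw c unfolding X_def by blast
  have "hclass X (frag_cmul (k * j) l) = hclass X (frag_cmul (k * j) (frag_cmul m e))"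
    using H1_int_pow[OF l, of "k * j"] H1_int_pow[OF singular_relcycle_cmul[OF e(2)], of m "k * j"] m by simp
  also have "frag_cmul (k * j) (frag_cmul m e) = frag_cmul (k * (m * j)) e" by (simp add: mult_ac)
  also have "\<dots> = frag_cmul k e" unfolding mj by simp
  finally have "hclass X c = hclass X (frag_cmul (k * j) l)" using k by simp
  then show ?thesis unfolding X_def l_def by blast
qed

text \<open>The radial projection \<open>f\<close> to the boundary circle is homotopic to the
  identity along segments that avoid \<open>z\<close>, so every class comes from the circle.\<close>

lemma H1_punctured_disk:
  assumes r: "0 < r" and c: "singular_relcycle 1 (top_of_set (cball z r - {z})) {} c"
  shows "\<exists>k. hclass (cball z r - {z}) c = hclass (cball z r - {z}) (frag_cmul k (frag_of (path_simplex (circlepath z r))))"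
proof -
  define X where "X = cball z r - {z}"
  define S where "S = sphere z r"
  have SX: "S \<subseteq> X" unfolding S_def X_def using r by auto
  define f where "f = (\<lambda>u. z + of_real (r / norm (u - z)) * (u - z))"
  have f: "continuous_on X f" "f ` X \<subseteq> S"
  proof -
    show "continuous_on X f" unfolding f_def X_def by (intro continuous_intros) auto
    have "dist z (f u) = r" if "u \<noteq> z" for u
      using that r unfolding f_def by (simp add: dist_norm norm_mult norm_divide)
    then have "f u \<in> S" if "u \<in> X" for u using that unfolding X_def S_def by (simp del: dist_commute add: dist_norm)
    then show "f ` X \<subseteq> S" by blast
  qed
  have fm: "continuous_map (top_of_set X) (top_of_set S) f" using f by (auto simp: continuous_map_in_subtopology)
  have im: "continuous_map (top_of_set S) (top_of_set X) id" using SX by (auto simp: continuous_map_in_subtopology)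
  have "homotopic_with_canon (\<lambda>h. True) X X (id \<circ> f) id"
  proof (rule homotopic_with_linear)
    fix u assume u: "u \<in> X"
    have "z + of_real s * (u - z) \<in> X" if s: "0 < s" "s * norm (u - z) \<le> r" for s
      using u s unfolding X_def by (auto simp: dist_norm norm_mult)
    moreover have "\<exists>s. v = z + of_real s * (u - z) \<and> 0 < s \<and> s * norm (u - z) \<le> r" if v: "v \<in> closed_segment ((id \<circ> f) u) (id u)" for v
    proof -
      obtain t where t: "0 \<le> t" "t \<le> 1" "v = (1 - t) *\<^sub>R f u + t *\<^sub>R u" using v unfolding closed_segment_def by auto
      \<comment> \<open>The point of the segment is \<open>z\<close> plus the positive multiple
        \<open>s\<close> of \<open>u - z\<close>; the factor interpolates between
        \<open>r / norm (u - z)\<close> and 1.\<close>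
      define s where "s = (1 - t) * (r / norm (u - z)) + t"
      have n: "norm (u - z) > 0" "norm (u - z) \<le> r" using u unfolding X_def by (auto simp: dist_norm norm_minus_commute)
      have "v = z + of_real s * (u - z)"
        unfolding t(3) f_def s_def by (simp add: scaleR_conv_of_real algebra_simps)
      moreover have "s > 0"
      proof (cases "t = 0")
        case True then show ?thesis unfolding s_def using n r by simp
      next
        case False
        then show ?thesis unfolding s_def using t n r by (intro add_nonneg_pos mult_nonneg_nonneg) auto
      qed
      moreover have "s * norm (u - z) = (1 - t) * r + t * norm (u - z)"
        unfolding s_def using n by (simp add: field_simps)
      moreover have "(1 - t) * r + t * norm (u - z) \<le> (1 - t) * r + t * r"
        using t n by (intro add_left_mono mult_left_mono) auto
      ultimately show ?thesis by (intro exI[of _ s]) (simp add: algebra_simps)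
    qed
    ultimately show "closed_segment ((id \<circ> f) u) (id u) \<subseteq> X" by blast
  next
    show "continuous_on X (id \<circ> f)" using f by simp
  qed simp
  then have hi: "hom_induced 1 (top_of_set X) {} (top_of_set X) {} (id \<circ> f) = hom_induced 1 (top_of_set X) {} (top_of_set X) {} id"
    using homology_homotopy_empty by blast
  have cX: "singular_relcycle 1 (top_of_set X) {} c" using c unfolding X_def .
  then have hc: "hclass X c \<in> carrier (H1 X)" unfolding H1_carrier by blast
  have "hclass X c = hom_induced 1 (top_of_set X) {} (top_of_set X) {} id (hclass X c)"
    using hom_induced_id[OF hc] by simp
  also have "\<dots> = hom_induced 1 (top_of_set S) {} (top_of_set X) {} id (hom_induced 1 (top_of_set X) {} (top_of_set S) {} f (hclass X c))"
    unfolding hi[symmetric] using hom_induced_compose_empty[OF fm im, of 1] by simp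
  finally have 1: "hclass X c = hom_induced 1 (top_of_set S) {} (top_of_set X) {} id (hom_induced 1 (top_of_set X) {} (top_of_set S) {} f (hclass X c))" .
  have "hom_induced 1 (top_of_set X) {} (top_of_set S) {} f (hclass X c) \<in> carrier (H1 S)"
    using hom_induced_carrier by blast
  then obtain e where e: "hom_induced 1 (top_of_set X) {} (top_of_set S) {} f (hclass X c) = hclass S e" "singular_relcycle 1 (top_of_set S) {} e"
    unfolding H1_carrier by blast
  obtain k where k: "hclass S e = hclass S (frag_cmul k (frag_of (path_simplex (circlepath z r))))"
    using H1_circle[OF r e(2)[unfolded S_def]] unfolding S_def by blast
  have l: "singular_relcycle 1 (top_of_set S) {} (frag_of (path_simplex (circlepath z r)))"
    by (rule singular_cycle_path) (use r in \<open>auto simp: S_def\<close>)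
  have "hclass X c = hclass X (frag_cmul k (frag_of (path_simplex (circlepath z r))))"
    using 1 unfolding e(1) k hom_induced_H1(1)[OF SX singular_relcycle_cmul[OF l]] .
  then show ?thesis unfolding X_def by blast
qed

lemma puncture_radius:
  assumes "punctures n p"
  shows "0 < puncture_radius n p"
    "i < n \<Longrightarrow> cball (p i) (puncture_radius n p) \<subseteq> ball 0 1"
    "i < n \<Longrightarrow> cball (p i) (puncture_radius n p) \<inter> p ` {..<n} = {p i}"
proof -
  define P where "P i r \<longleftrightarrow> cball (p i) r \<subseteq> ball 0 1 \<and> cball (p i) r \<inter> p ` {..<n} = {p i}" for i and r :: real
  have "\<exists>r>0. P i r" if i: "i < n" for i
  proof -
    have "p i \<in> ball 0 1" using assms i unfolding punctures_def by blast
    then obtain e where e: "e > 0" "cball (p i) e \<subseteq> ball 0 1" using open_contains_cball open_ball by metis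
    obtain d where d: "d > 0" "\<forall>x\<in>p ` {..<n}. x \<noteq> p i \<longrightarrow> d \<le> dist (p i) x"
      using finite_set_avoid[of "p ` {..<n}" "p i"] by blast
    define r where "r = min e (d / 2)"
    have "cball (p i) r \<subseteq> ball 0 1" using e(2) unfolding r_def by auto
    moreover have "x = p i" if "x \<in> cball (p i) r" "x \<in> p ` {..<n}" for x
      using d that unfolding r_def by fastforce
    moreover have "p i \<in> cball (p i) r" "r > 0" using e d unfolding r_def by auto
    ultimately show ?thesis using i unfolding P_def by blast
  qed
  then obtain f where f: "\<And>i. i < n \<Longrightarrow> f i > 0 \<and> P i (f i)" by metis
  \<comment> \<open>The inserted 1 makes the minimum meaningful for \<open>n = 0\<close>.\<close>
  define r where "r = Min (insert 1 (f ` {..<n}))"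
  have r: "0 < r" "\<And>i. i < n \<Longrightarrow> r \<le> f i" using f unfolding r_def by auto
  have "P i r" if i: "i < n" for i
  proof -
    have "cball (p i) r \<subseteq> cball (p i) (f i)" "p i \<in> cball (p i) r" using r(1) r(2)[OF i] by auto
    then show ?thesis using f[OF i] i unfolding P_def by blast
  qed
  then have "0 < r \<and> (\<forall>i<n. cball (p i) r \<subseteq> ball 0 1 \<and> cball (p i) r \<inter> p ` {..<n} = {p i})"
    using r unfolding P_def by blast
  then have "0 < puncture_radius n p \<and> (\<forall>i<n. cball (p i) (puncture_radius n p) \<subseteq> ball 0 1 \<and> cball (p i) (puncture_radius n p) \<inter> p ` {..<n} = {p i})"
    unfolding puncture_radius_def by (rule someI)
  then show "0 < puncture_radius n p"
    "i < n \<Longrightarrow> cball (p i) (puncture_radius n p) \<subseteq> ball 0 1"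
    "i < n \<Longrightarrow> cball (p i) (puncture_radius n p) \<inter> p ` {..<n} = {p i}"
    by blast+
qed

section \<open>Generators for the homology of the punctured disk\<close>

text \<open>A class that dies when \<open>q\<close> is filled in comes, by the exact sequence, from
  the relative second homology of the pair of \<open>X\<close> and \<open>X - {q}\<close>. Excision
  moves it to a disk around \<open>q\<close>, and naturality of the boundary map shows that the
  class comes from the punctured disk there.\<close>

lemma H1_remove_point:
  assumes r: "0 < r" "cball q r \<subseteq> X" and c: "singular_relcycle 1 (top_of_set (X - {q})) {} c"
    and null: "hclass X c = hclass X 0"
  shows "\<exists>k. hclass (X - {q}) c = hclass (X - {q}) (frag_cmul k (frag_of (path_simplex (circlepath q r))))"
proof -
  define Y where "Y = X - {q}"
  define B where "B = cball q r"
  have YX: "Y \<subseteq> X" "B \<subseteq> X" "B - {q} \<subseteq> Y" unfolding Y_def B_def using r by auto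
  have sub: "subtopology (top_of_set X) Y = top_of_set Y" "subtopology (top_of_set B) (B - {q}) = top_of_set (B - {q})"
    using YX by (auto simp: subtopology_subtopology intro!: arg_cong[of _ _ top_of_set])
  have cY: "singular_relcycle 1 (top_of_set Y) {} c" using c unfolding Y_def .
  then have "hclass Y c \<in> carrier (H1 Y)" unfolding H1_carrier by blast
  moreover have "hom_induced 1 (top_of_set Y) {} (top_of_set X) {} id (hclass Y c) = \<one>\<^bsub>H1 X\<^esub>"
    using hom_induced_H1(1)[OF YX(1) cY] null H1_one by simp
  ultimately have "hclass Y c \<in> kernel (H1 Y) (H1 X) (hom_induced 1 (top_of_set Y) {} (top_of_set X) {} id)"
    unfolding kernel_def by blast
  also have "\<dots> = hom_boundary 2 (top_of_set X) Y ` carrier (relative_homology_group 2 (top_of_set X) Y)"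
    using homology_exactness_axiom_2[of 2 "top_of_set X" Y] unfolding sub(1) by simp
  finally obtain \<zeta> where \<zeta>: "\<zeta> \<in> carrier (relative_homology_group 2 (top_of_set X) Y)" "hclass Y c = hom_boundary 2 (top_of_set X) Y \<zeta>"
    by blast
  \<comment> \<open>The condition for excising \<open>X - B\<close>: its closure stays in
    \<open>X - ball q r\<close>, which is part of the open set \<open>Y\<close>.\<close>
  have "(top_of_set X) closure_of (X - B) \<subseteq> (top_of_set X) interior_of Y"
  proof -
    have "closed (- ball q r)" "open (- {q})" by (auto simp: closed_Compl open_Compl)
    note co = closedin_closed_Int[OF this(1), of X] openin_open_Int[OF this(2), of X]
    have "closedin (top_of_set X) (X - ball q r)" using co(1) by (simp add: Diff_eq)
    then have "(top_of_set X) closure_of (X - B) \<subseteq> X - ball q r"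
      by (rule closure_of_minimal[rotated]) (auto simp: B_def)
    moreover have "openin (top_of_set X) Y" using co(2) unfolding Y_def by (simp add: Diff_eq)
    then have "(top_of_set X) interior_of Y = Y" by (simp add: interior_of_eq)
    moreover have "X - ball q r \<subseteq> Y" unfolding Y_def using r by auto
    ultimately show ?thesis by blast
  qed
  from homology_excision_axiom[OF this YX(1), of 2]
  have "hom_induced 2 (subtopology (top_of_set X) (X - (X - B))) (Y - (X - B)) (subtopology (top_of_set X) X) Y id
      \<in> iso (relative_homology_group 2 (subtopology (top_of_set X) (X - (X - B))) (Y - (X - B))) (relative_homology_group 2 (subtopology (top_of_set X) X) Y)" .
  moreover have "X - (X - B) = B" "Y - (X - B) = B - {q}" using YX unfolding Y_def by auto
  moreover have "subtopology (top_of_set X) B = top_of_set B" "subtopology (top_of_set X) X = top_of_set X"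
    using YX by (auto simp: subtopology_subtopology intro!: arg_cong[of _ _ top_of_set])
  ultimately have "hom_induced 2 (top_of_set B) (B - {q}) (top_of_set X) Y id
      \<in> iso (relative_homology_group 2 (top_of_set B) (B - {q})) (relative_homology_group 2 (top_of_set X) Y)"
    by simp
  then have "hom_induced 2 (top_of_set B) (B - {q}) (top_of_set X) Y id ` carrier (relative_homology_group 2 (top_of_set B) (B - {q}))
      = carrier (relative_homology_group 2 (top_of_set X) Y)"
    unfolding iso_def bij_betw_def by simp
  then obtain \<eta> where \<eta>: "hom_induced 2 (top_of_set B) (B - {q}) (top_of_set X) Y id \<eta> = \<zeta>"
    using \<zeta>(1) by (metis imageE)
  have bx: "continuous_map (top_of_set B) (top_of_set X) id" using YX by (auto simp: continuous_map_in_subtopology)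
  have "hom_boundary 2 (top_of_set X) Y (hom_induced 2 (top_of_set B) (B - {q}) (top_of_set X) Y id \<eta>)
     = hom_induced 1 (top_of_set (B - {q})) {} (top_of_set Y) {} id (hom_boundary 2 (top_of_set B) (B - {q}) \<eta>)"
    using fun_cong[OF naturality_hom_induced[OF bx, of "B - {q}" Y 2], of \<eta>] YX(3) unfolding sub by (simp add: Pi_iff subset_iff)
  then have hc: "hclass Y c = hom_induced 1 (top_of_set (B - {q})) {} (top_of_set Y) {} id (hom_boundary 2 (top_of_set B) (B - {q}) \<eta>)"
    unfolding \<eta> \<zeta>(2)[symmetric] .
  have "hom_boundary 2 (top_of_set B) (B - {q}) \<eta> \<in> carrier (H1 (B - {q}))"
    using hom_boundary_carrier[of 2 "top_of_set B" "B - {q}" \<eta>] unfolding sub by simp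
  then obtain e where e: "hom_boundary 2 (top_of_set B) (B - {q}) \<eta> = hclass (B - {q}) e" "singular_relcycle 1 (top_of_set (B - {q})) {} e"
    unfolding H1_carrier by blast
  obtain k where k: "hclass (B - {q}) e = hclass (B - {q}) (frag_cmul k (frag_of (path_simplex (circlepath q r))))"
    using H1_punctured_disk[OF r(1), of q e] e(2) unfolding B_def by blast
  have l: "singular_relcycle 1 (top_of_set (B - {q})) {} (frag_of (path_simplex (circlepath q r)))"
    by (rule singular_cycle_path) (use r in \<open>auto simp: B_def\<close>)
  have "hclass Y c = hclass Y (frag_cmul k (frag_of (path_simplex (circlepath q r))))"
    unfolding hc e(1) k by (rule hom_induced_H1(1)[OF YX(3) singular_relcycle_cmul[OF l]])
  then show ?thesis unfolding Y_def by blast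
qed

text \<open>When \<open>p m\<close> is filled in, a cycle becomes homologous to a combination of the
  earlier circles, by induction. The difference dies in the larger space and is thus a multiple of
  the circle around \<open>p m\<close>. The radius is fixed for all \<open>n\<close> punctures, so
  the circles also avoid those punctures that are removed later.\<close>

lemma H1_disk_generated:
  assumes r: "0 < r" and p: "inj_on p {..<n}" "\<And>i. i < n \<Longrightarrow> cball (p i) r \<subseteq> ball 0 1"
    "\<And>i. i < n \<Longrightarrow> cball (p i) r \<inter> p ` {..<n} = {p i}"
  shows "m \<le> n \<Longrightarrow> singular_relcycle 1 (top_of_set (Sig m p)) {} c \<Longrightarrow>
    \<exists>a. hclass (Sig m p) c = hclass (Sig m p) (\<Sum>i<m. frag_cmul (a i) (frag_of (path_simplex (circlepath (p i) r))))"
proof (induction m arbitrary: c)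
  case 0
  have "contractible (cball (0::complex) 1)" by (simp add: convex_imp_contractible)
  then have "contractible_space (top_of_set (cball (0::complex) 1))" by (simp add: contractible_space_top_of_set)
  then have "trivial_group (H1 (cball 0 1))"
    using trivial_reduced_homology_group_contractible_space[of "top_of_set (cball (0::complex) 1)" 1] un_reduced_homology_group[of 1 "top_of_set (cball (0::complex) 1)"] by simp
  moreover have "Sig 0 p = cball 0 1" unfolding Sig_def by simp
  moreover have "hclass (Sig 0 p) c \<in> carrier (H1 (Sig 0 p))" using 0 unfolding H1_carrier by blast
  ultimately have "hclass (Sig 0 p) c = hclass (Sig 0 p) 0" unfolding trivial_group_def H1_one by simp
  then show ?case by simp
next
  case (Suc m)
  define l where "l i = frag_of (path_simplex (circlepath (p i) r))" for i
  define X where "X = Sig m p"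
  have Y: "Sig (Suc m) p = X - {p m}" unfolding X_def Sig_def by (auto simp: less_Suc_eq)
  have mn: "m < n" using Suc.prems by simp
  have lY: "singular_relcycle 1 (top_of_set (X - {p m})) {} (l i)" if i: "i < n" for i
  proof -
    have "sphere (p i) r \<subseteq> cball (p i) r - {p i}" using r by auto
    moreover have "cball (p i) r - {p i} \<subseteq> Sig n p" using p(2,3)[OF i] unfolding Sig_def by auto
    moreover have "Sig n p \<subseteq> X - {p m}" using mn unfolding X_def Sig_def by auto
    ultimately show ?thesis unfolding l_def using r by (intro singular_cycle_path) (auto simp: path_image_circlepath_nonneg)
  qed
  have c: "singular_relcycle 1 (top_of_set (X - {p m})) {} c" using Suc.prems(2) unfolding Y .
  then have cX: "singular_relcycle 1 (top_of_set X) {} c" using singular_cycle_mono[OF c] by auto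
  obtain a where a: "hclass X c = hclass X (\<Sum>i<m. frag_cmul (a i) (l i))"
    using Suc.IH[of c] cX mn unfolding X_def l_def by auto
  define s where "s = (\<Sum>i<m. frag_cmul (a i) (l i))"
  have s: "singular_relcycle 1 (top_of_set (X - {p m})) {} s"
    unfolding s_def using lY mn by (intro singular_relcycle_sum singular_relcycle_cmul) auto
  have d: "singular_relcycle 1 (top_of_set (X - {p m})) {} (c - s)" using c s by (rule singular_relcycle_diff)
  have "homologous_rel 1 (top_of_set X) {} c s" using a unfolding s_def homologous_rel_set_eq .
  then have "hclass X (c - s) = hclass X 0" unfolding homologous_rel_set_eq by (simp add: homologous_rel_def)
  moreover have "cball (p m) r \<subseteq> X"
  proof -
    have "cball (p m) r \<inter> p ` {..<m} = {}"
    proof -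
      have "False" if "x \<in> cball (p m) r" "i < m" "x = p i" for x i
      proof -
        have "x \<in> cball (p m) r \<inter> p ` {..<n}" using that mn by simp
        then have "p i = p m" unfolding p(3)[OF mn] using that(3) by simp
        then show False using p(1) mn that(2) unfolding inj_on_def by fastforce
      qed
      then show ?thesis by fastforce
    qed
    moreover have "cball (p m) r \<subseteq> cball 0 1" using p(2)[OF mn] ball_subset_cball by (rule subset_trans)
    ultimately show ?thesis unfolding X_def Sig_def by blast
  qed
  ultimately obtain k where k: "hclass (X - {p m}) (c - s) = hclass (X - {p m}) (frag_cmul k (l m))"
    using H1_remove_point[OF r _ d] unfolding l_def by blast
  then have "homologous_rel 1 (top_of_set (X - {p m})) {} (c - s) (frag_cmul k (l m))" unfolding homologous_rel_set_eq .
  then have "homologous_rel 1 (top_of_set (X - {p m})) {} c (s + frag_cmul k (l m))"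
    unfolding homologous_rel_def by (simp add: algebra_simps)
  moreover have "s + frag_cmul k (l m) = (\<Sum>i<Suc m. frag_cmul ((a(m := k)) i) (l i))" unfolding s_def by simp
  ultimately have "hclass (X - {p m}) c = hclass (X - {p m}) (\<Sum>i<Suc m. frag_cmul ((a(m := k)) i) (l i))"
    unfolding homologous_rel_set_eq by simp
  then show ?case unfolding Y l_def by blast
qed

text \<open>Coordinates exist because the puncture loops generate. They are unique because the
  winding number about \<open>p j\<close> is 1 on the loop around \<open>p j\<close> and 0 on the
  others, and so reads off the coefficient with index \<open>j\<close>.\<close>

lemma H1_coords_loop:
  assumes pn: "punctures n p" and \<gamma>: "path \<gamma>" "pathfinish \<gamma> = pathstart \<gamma>" "path_image \<gamma> \<subseteq> Sig n p"
  shows "Poly_Mapping.keys (H1_coords n p (loop_class (Sig n p) \<gamma>)) \<subseteq> {..<n}"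
    "j < n \<Longrightarrow> of_int (Poly_Mapping.lookup (H1_coords n p (loop_class (Sig n p) \<gamma>)) j) = winding_number \<gamma> (p j)"
proof -
  define r where "r = puncture_radius n p"
  define X where "X = Sig n p"
  define l where "l i = frag_of (path_simplex (circlepath (p i) r))" for i
  define c where "c = frag_of (path_simplex \<gamma>)"
  note r = puncture_radius[OF pn, folded r_def]
  have inj: "inj_on p {..<n}" using pn unfolding punctures_def by blast
  have pX: "p j \<notin> X" if "j < n" for j using that unfolding X_def Sig_def by blast
  have l: "singular_relcycle 1 (top_of_set X) {} (l i)" if i: "i < n" for i
  proof -
    have "sphere (p i) r \<subseteq> cball (p i) r - {p i}" using r(1) by auto
    moreover have "cball (p i) r - {p i} \<subseteq> X" using r(2,3)[OF i] unfolding X_def Sig_def by auto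
    ultimately show ?thesis unfolding l_def using r(1) by (intro singular_cycle_path) (auto simp: path_image_circlepath_nonneg)
  qed
  have c: "singular_relcycle 1 (top_of_set X) {} c" unfolding c_def X_def by (rule singular_cycle_path[OF \<gamma>(1,3,2)])
  have w: "chain_winding (p j) (l i) = (if i = j then 1 else 0)" if ij: "i < n" "j < n" for i j
  proof -
    have "winding_number (circlepath (p i) r) (p j) = 0" if "i \<noteq> j"
    proof -
      have "p j \<noteq> p i" using inj ij that by (auto simp: inj_on_def)
      then have "p j \<notin> cball (p i) r" using r(3)[OF ij(1)] ij(2) by blast
      then show ?thesis using r(1) by (intro winding_number_zero_outside[where s = "cball (p i) r"]) auto
    qed
    then show ?thesis unfolding l_def using r(1) by (auto simp: chain_winding_path winding_number_circlepath_centre)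
  qed
  have fin: "finprod (H1 X) (\<lambda>i. loop_class X (puncture_loop n p i) [^]\<^bsub>H1 X\<^esub> (a i :: int)) {..<n} = hclass X (\<Sum>i<n. frag_cmul (a i) (l i))" for a :: "nat \<Rightarrow> int"
    using H1_finprod[of "{..<n}" X l a] l unfolding loop_class_def puncture_loop_def l_def path_simplex_def r_def by simp
  have lc: "loop_class X \<gamma> = hclass X c" unfolding loop_class_def c_def path_simplex_def ..
  define Q where "Q a \<longleftrightarrow> Poly_Mapping.keys a \<subseteq> {..<n} \<and> loop_class X \<gamma> = finprod (H1 X)
             (\<lambda>i. loop_class X (puncture_loop n p i) [^]\<^bsub>H1 X\<^esub> Poly_Mapping.lookup a i) {..<n}" for a :: "nat \<Rightarrow>\<^sub>0 int"
  have wind: "of_int (Poly_Mapping.lookup a j) = winding_number \<gamma> (p j)" if a: "Q a" and j: "j < n" for a j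
  proof -
    have "hclass X c = hclass X (\<Sum>i<n. frag_cmul (Poly_Mapping.lookup a i) (l i))" using a unfolding Q_def fin lc by blast
    then have "homologous_rel 1 (top_of_set X) {} c (\<Sum>i<n. frag_cmul (Poly_Mapping.lookup a i) (l i))" unfolding homologous_rel_set_eq .
    from chain_winding_homologous[OF this pX[OF j]]
    have "chain_winding (p j) c = (\<Sum>i<n. of_int (Poly_Mapping.lookup a i) * chain_winding (p j) (l i))"
      unfolding chain_winding_def frag_sum_sum frag_sum_cmul .
    also have "\<dots> = (\<Sum>i<n. if i = j then of_int (Poly_Mapping.lookup a i) else 0)" using w j by (intro sum.cong) auto
    also have "\<dots> = of_int (Poly_Mapping.lookup a j)" using j by simp
    finally show ?thesis unfolding c_def using chain_winding_path[OF \<gamma>(1)] by simp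
  qed
  have uniq: "a = b" if "Q a" "Q b" for a b
  proof (rule poly_mapping_eqI)
    fix j
    show "Poly_Mapping.lookup a j = Poly_Mapping.lookup b j"
    proof (cases "j < n")
      case True
      then have "(of_int (Poly_Mapping.lookup a j) :: complex) = of_int (Poly_Mapping.lookup b j)" using wind that by simp
      then show ?thesis by simp
    next
      case False
      then have "j \<notin> Poly_Mapping.keys a" "j \<notin> Poly_Mapping.keys b" using that unfolding Q_def by auto
      then show ?thesis by (simp add: in_keys_iff)
    qed
  qed
  obtain a where a: "hclass X c = hclass X (\<Sum>i<n. frag_cmul (a i) (l i))"
    using H1_disk_generated[of r p n n c] r inj c unfolding X_def l_def by blast
  define b where "b = (\<Sum>i<n. frag_cmul (a i) (frag_of i))"
  have lb: "Poly_Mapping.lookup b i = (if i < n then a i else 0)" for i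
    unfolding b_def by (simp add: lookup_sum lookup_single when_def if_distrib[of "\<lambda>x. _ * x"] cong: if_cong)
  have "Q b" unfolding Q_def fin lc a using lb by (auto simp: in_keys_iff split: if_splits)
  then have "Q (THE a. Q a)" using uniq by (metis theI)
  then have "Q (H1_coords n p (loop_class X \<gamma>))" unfolding H1_coords_def Q_def X_def Let_def .
  then show "Poly_Mapping.keys (H1_coords n p (loop_class (Sig n p) \<gamma>)) \<subseteq> {..<n}"
    "j < n \<Longrightarrow> of_int (Poly_Mapping.lookup (H1_coords n p (loop_class (Sig n p) \<gamma>)) j) = winding_number \<gamma> (p j)"
    using wind unfolding X_def Q_def by blast+
qed

section \<open>Euler characteristics\<close>

lemma frag_cmul_sum_left:
  "frag_cmul (sum c I) m = (\<Sum>i\<in>I. frag_cmul (c i) m)"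
  by (induction I rule: infinite_finite_induct) (simp_all add: frag_cmul_distrib)

text \<open>Each value \<open>b i\<close> strictly between the ends is counted once in degree
  \<open>i\<close> and once in degree \<open>i - 1\<close>, with opposite signs.\<close>

lemma alternating_sum_telescope:
  fixes b :: "int \<Rightarrow> int"
  assumes "b lo = 0" "b (hi + 1) = 0" "lo \<le> hi"
  shows "(\<Sum>i=lo..hi. (if even i then 1 else -1) * (b (i + 1) + b i)) = 0"
proof -
  have "(\<Sum>i=lo..hi. (if even i then 1 else -1) * b (i + 1)) = (\<Sum>i=lo+1..hi+1. - ((if even i then 1 else -1) * b i))"
    by (rule sum.reindex_bij_witness[of _ "\<lambda>i. i - 1" "\<lambda>i. i + 1"]) auto
  also have "\<dots> = (\<Sum>i=lo..hi. - ((if even i then 1 else -1) * b i))"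
  proof -
    have "{lo+1..hi+1} = insert (hi + 1) {lo+1..hi}" "{lo..hi} = insert lo {lo+1..hi}" using assms(3) by auto
    then show ?thesis using assms by simp
  qed
  finally have "(\<Sum>i=lo..hi. (if even i then 1 else -1) * b (i + 1)) = - (\<Sum>i=lo..hi. (if even i then 1 else -1) * b i)"
    by (simp add: sum_negf)
  then show ?thesis by (simp add: distrib_left sum.distrib)
qed

text \<open>A homology dimension is a number of generators minus the ranks of two neighbouring
  differentials, and for fixed \<open>j\<close> and \<open>v\<close> the ranks telescope in the
  alternating sum over \<open>i\<close>. The count is then regrouped by generators.\<close>

lemma euler_char_gr_homology:
  fixes g :: "state \<Rightarrow> ('c \<Rightarrow>\<^sub>0 int)"
  assumes "graded_filtration D {v. Poly_Mapping.keys v \<subseteq> V} leq g"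
  shows "euler_char V (gr_homology D {v. Poly_Mapping.keys v \<subseteq> V} leq g) =
    (\<Sum>x\<in>states D. frag_cmul (if even (hdeg D x) then 1 else -1) (lmonom (qdeg D x) (g x)))"
proof -
  interpret F: graded_filtration D "{v. Poly_Mapping.keys v \<subseteq> V}" leq g by (rule assms)
  define dm where "dm i j v = int (dimension_of (gr_homology D {v. Poly_Mapping.keys v \<subseteq> V} leq g i j v))" for i j v
  define b where "b i j v = int (scale.dim (F.boundaries i j v))" for i j v
  define \<sigma> :: "int \<Rightarrow> int" where "\<sigma> i = (if even i then 1 else -1)" for i
  have dm: "dm i j v = int (card (F.level i j v)) - b (i + 1) j v - b i j v" for i j v
    unfolding dm_def b_def by (rule F.dimension_gr_homology)
  have nn: "dm i j v \<ge> 0" "b i j v \<ge> 0" for i j v unfolding dm_def b_def by simp_all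
  have empty: "dm i j v = 0" "b i j v = 0" "b (i + 1) j v = 0" if "F.level i j v = {}" for i j v
    using dm[of i j v] nn(1)[of i j v] nn(2)[of i j v] nn(2)[of "i + 1" j v] that by auto
  \<comment> \<open>The bounds are strict: there are no generators in degrees \<open>lo\<close> and
    \<open>hi\<close>, hence the ranks at \<open>lo\<close> and \<open>hi + 1\<close> are 0, as the
    telescoping requires. The inserted 0 keeps minimum and maximum meaningful in any case.\<close>
  obtain lo hi where lh: "\<And>x. x \<in> states D \<Longrightarrow> lo < hdeg D x \<and> hdeg D x < hi" "lo \<le> hi"
  proof -
    have fin: "finite (insert 0 (hdeg D ` states D))" using F.finite_states by simp
    show thesis
    proof (rule that[of "Min (insert 0 (hdeg D ` states D)) - 1" "Max (insert 0 (hdeg D ` states D)) + 1"])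
      fix x assume "x \<in> states D"
      then show "Min (insert 0 (hdeg D ` states D)) - 1 < hdeg D x \<and> hdeg D x < Max (insert 0 (hdeg D ` states D)) + 1"
        using Min_le[OF fin, of "hdeg D x"] Max_ge[OF fin, of "hdeg D x"] by simp
    next
      show "Min (insert 0 (hdeg D ` states D)) - 1 \<le> Max (insert 0 (hdeg D ` states D)) + 1"
        using Min_le[OF fin, of 0] Max_ge[OF fin, of 0] by simp
    qed
  qed
  define K where "K = (\<lambda>x. (qdeg D x, g x)) ` states D"
  define B where "B = {lo..hi} \<times> K"
  define dg where "dg x = (hdeg D x, qdeg D x, g x)" for x
  have fB: "finite B" "finite K" unfolding B_def K_def using F.finite_states by auto
  have dgB: "dg ` states D \<subseteq> B" unfolding dg_def B_def K_def using lh(1) by force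
  have lev: "F.level i j v = {x \<in> states D. dg x = (i, j, v)}" for i j v unfolding F.level_def dg_def by auto
  have "euler_char V (gr_homology D {v. Poly_Mapping.keys v \<subseteq> V} leq g) =
      (\<Sum>(i, j, v)\<in>B. frag_cmul (\<sigma> i * dm i j v) (lmonom j v))"
    unfolding euler_char_def \<sigma>_def[symmetric] dm_def[symmetric]
  proof (rule sum.mono_neutral_left[OF fB(1)])
    show "{(i, j, v). Poly_Mapping.keys v \<subseteq> V \<and> dimension_of (gr_homology D {v. Poly_Mapping.keys v \<subseteq> V} leq g i j v) \<noteq> 0} \<subseteq> B"
    proof clarify
      fix i j v assume "dimension_of (gr_homology D {v. Poly_Mapping.keys v \<subseteq> V} leq g i j v) > 0"
      then have "F.level i j v \<noteq> {}" using empty(1)[of i j v] unfolding dm_def by auto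
      then show "(i, j, v) \<in> B" unfolding lev using dgB by auto
    qed
    show "\<forall>x\<in>B - {(i, j, v). Poly_Mapping.keys v \<subseteq> V \<and> dimension_of (gr_homology D {v. Poly_Mapping.keys v \<subseteq> V} leq g i j v) \<noteq> 0}.
       (case x of (i, j, v) \<Rightarrow> frag_cmul (\<sigma> i * dm i j v) (lmonom j v)) = 0"
    proof
      fix t assume t: "t \<in> B - {(i, j, v). Poly_Mapping.keys v \<subseteq> V \<and> dimension_of (gr_homology D {v. Poly_Mapping.keys v \<subseteq> V} leq g i j v) \<noteq> 0}"
      obtain i j v where ijv: "t = (i, j, v)" by (cases t)
      have "Poly_Mapping.keys v \<subseteq> V" using t F.index unfolding ijv B_def K_def by auto
      then have "dm i j v = 0" using t unfolding ijv dm_def by simp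
      then show "(case t of (i, j, v) \<Rightarrow> frag_cmul (\<sigma> i * dm i j v) (lmonom j v)) = 0" unfolding ijv by simp
    qed
  qed
  also have "\<dots> = (\<Sum>(j, v)\<in>K. \<Sum>i=lo..hi. frag_cmul (\<sigma> i * dm i j v) (lmonom j v))"
    unfolding B_def sum.cartesian_product[symmetric] by (subst sum.swap) (simp add: case_prod_beta)
  also have "\<dots> = (\<Sum>(j, v)\<in>K. \<Sum>i=lo..hi. frag_cmul (\<sigma> i * int (card (F.level i j v))) (lmonom j v))"
  proof (rule sum.cong[OF HOL.refl], clarify)
    fix j v
    have "F.level lo j v = {}" "F.level hi j v = {}" unfolding F.level_def using lh(1) by fastforce+
    then have "(\<Sum>i=lo..hi. \<sigma> i * (b (i + 1) j v + b i j v)) = 0"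
      unfolding \<sigma>_def using lh(2) empty by (intro alternating_sum_telescope) auto
    then have "(\<Sum>i=lo..hi. \<sigma> i * dm i j v) = (\<Sum>i=lo..hi. \<sigma> i * int (card (F.level i j v)))"
      unfolding dm by (simp add: sum.distrib sum_subtractf algebra_simps)
    then show "(\<Sum>i=lo..hi. frag_cmul (\<sigma> i * dm i j v) (lmonom j v)) = (\<Sum>i=lo..hi. frag_cmul (\<sigma> i * int (card (F.level i j v))) (lmonom j v))"
      unfolding frag_cmul_sum_left[symmetric] by simp
  qed
  also have "\<dots> = (\<Sum>(i, j, v)\<in>B. frag_cmul (\<sigma> i * int (card (F.level i j v))) (lmonom j v))"
    unfolding B_def sum.cartesian_product[symmetric] by (subst sum.swap) (simp add: case_prod_beta)
  also have "\<dots> = (\<Sum>t\<in>B. \<Sum>x\<in>{x \<in> states D. dg x = t}. frag_cmul (\<sigma> (hdeg D x)) (lmonom (qdeg D x) (g x)))"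
  proof (rule sum.cong[OF HOL.refl], clarify)
    fix i j v
    have "(\<Sum>x\<in>{x \<in> states D. dg x = (i, j, v)}. frag_cmul (\<sigma> (hdeg D x)) (lmonom (qdeg D x) (g x))) =
        (\<Sum>x\<in>{x \<in> states D. dg x = (i, j, v)}. frag_cmul (\<sigma> i) (lmonom j v))"
      by (rule sum.cong) (auto simp: dg_def)
    also have "\<dots> = frag_cmul (\<sigma> i * int (card (F.level i j v))) (lmonom j v)"
      unfolding frag_cmul_sum_left[symmetric] lev by (simp add: mult.commute)
    finally show "frag_cmul (\<sigma> i * int (card (F.level i j v))) (lmonom j v) =
        (\<Sum>x\<in>{x \<in> states D. dg x = (i, j, v)}. frag_cmul (\<sigma> (hdeg D x)) (lmonom (qdeg D x) (g x)))" by simp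
  qed
  also have "\<dots> = (\<Sum>x\<in>states D. frag_cmul (\<sigma> (hdeg D x)) (lmonom (qdeg D x) (g x)))"
    by (rule sum.group[OF F.finite_states fB(1) dgB])
  finally show ?thesis unfolding \<sigma>_def .
qed

section \<open>Substituting monomials in Laurent polynomials\<close>

lemma lmonom_mult: "lmonom j v * lmonom k w = lmonom (j + k) (v + w)"
  unfolding lmonom_def by (simp add: mult_single plus_prod_def)

lemma lmonom_one: "lmonom 0 0 = 1"
  unfolding lmonom_def by (metis single_one zero_prod_def)

text \<open>The Laurent ring is a group ring, so an additive map between exponents extends linearly,
  and multiplicativity needs to be checked on monomials only.\<close>

lemma monomial_substitution_ring_hom:
  fixes \<eta> :: "('c \<Rightarrow>\<^sub>0 int) \<Rightarrow> ('d \<Rightarrow>\<^sub>0 int)"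
  assumes add: "\<And>v w. \<eta> (v + w) = \<eta> v + \<eta> w" and keys: "\<And>v. Poly_Mapping.keys v \<subseteq> V \<Longrightarrow> Poly_Mapping.keys (\<eta> v) \<subseteq> W"
  shows "frag_extend (\<lambda>(j, v). lmonom j (\<eta> v)) \<in> ring_hom (laurent_ring V) (laurent_ring W)"
proof -
  define f where "f = frag_extend (\<lambda>(j, v). lmonom j (\<eta> v))"
  have e0: "\<eta> 0 = 0" using add[of 0 0] by simp
  have ff: "f (frag_of (j, v)) = lmonom j (\<eta> v)" for j v unfolding f_def by simp
  have fd: "f (x - y) = f x - f y" for x y unfolding f_def by (rule frag_extend_diff)
  have m1: "f (frag_of a * y) = f (frag_of a) * f y" for a y
    using subset_UNIV[of "Poly_Mapping.keys y"]
  proof (induction y rule: frag_induction)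
    case zero then show ?case by (simp add: f_def)
  next
    case (one b)
    obtain j v k w where ab: "a = (j, v)" "b = (k, w)" by (cases a; cases b)
    have "frag_of a * frag_of b = frag_of (j + k, v + w)" unfolding ab by (simp add: mult_single plus_prod_def)
    then show ?case unfolding ab ff lmonom_mult by (simp add: ff add)
  next
    case (diff c d) then show ?case by (simp add: right_diff_distrib fd)
  qed
  have m: "f (x * y) = f x * f y" for x y
    using subset_UNIV[of "Poly_Mapping.keys x"]
  proof (induction x rule: frag_induction)
    case zero then show ?case by (simp add: f_def)
  next
    case (one b) show ?case by (rule m1)
  next
    case (diff c d) then show ?case by (simp add: left_diff_distrib fd)
  qed
  have "f 1 = 1"
    using ff[of 0 0] e0 lmonom_one unfolding lmonom_def by metis
  moreover have "f x \<in> carrier (laurent_ring W)" if x: "x \<in> carrier (laurent_ring V)" for x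
  proof -
    have "Poly_Mapping.keys (f x) \<subseteq> (\<Union>t\<in>Poly_Mapping.keys x. Poly_Mapping.keys (case t of (j, v) \<Rightarrow> lmonom j (\<eta> v)))"
      unfolding f_def by (rule keys_frag_extend)
    also have "\<dots> \<subseteq> {(j, v). Poly_Mapping.keys v \<subseteq> W}"
    proof (intro UN_least)
      fix t assume t: "t \<in> Poly_Mapping.keys x"
      obtain j v where jv: "t = (j, v)" by (cases t)
      have "Poly_Mapping.keys v \<subseteq> V" using x t unfolding jv laurent_ring_def by auto
      from keys[OF this] show "Poly_Mapping.keys (case t of (j, v) \<Rightarrow> lmonom j (\<eta> v)) \<subseteq> {(j, v). Poly_Mapping.keys v \<subseteq> W}"
        unfolding jv lmonom_def by simp
    qed
    finally show ?thesis unfolding laurent_ring_def by auto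
  qed
  moreover have "f (x + y) = f x + f y" for x y unfolding f_def by (rule frag_extend_add)
  ultimately have "f \<in> ring_hom (laurent_ring V) (laurent_ring W)"
    using m unfolding ring_hom_def by (auto simp: laurent_ring_def)
  then show ?thesis unfolding f_def .
qed

section \<open>Homology classes and weights of circles\<close>

text \<open>One sign serves all points inside the curve; it records the direction of the
  parametrization.\<close>

lemma winding_number_simple_curve:
  assumes "parametrizes \<gamma> C"
  obtains \<epsilon> :: int where "\<bar>\<epsilon>\<bar> = 1" "\<And>z. z \<notin> C \<Longrightarrow> winding_number \<gamma> z = of_int (if z \<in> inside C then \<epsilon> else 0)"
proof -
  note \<gamma> = assms[unfolded parametrizes_def]
  have out: "winding_number \<gamma> z = 0" if "z \<notin> C" "z \<notin> inside C" for z
  proof -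
    have "z \<in> outside C" using that inside_Un_outside[of C] by blast
    then show ?thesis using \<gamma> winding_number_zero_in_outside[of \<gamma> z] simple_path_imp_path by blast
  qed
  have "simple_path \<gamma>" using \<gamma> by blast
  then show thesis
  proof (cases rule: simple_closed_path_winding_number_inside)
    case 1 then show thesis using that[of 1] out \<gamma> by simp
  next
    case 2 then show thesis using that[of "-1"] out \<gamma> by simp
  qed
qed

text \<open>The chosen parametrization is counterclockwise, so its winding number about a puncture
  is 1 inside and 0 outside. The homology class of a circle is the indicator vector of the punctures
  it encloses.\<close>

lemma circle_H1:
  assumes pn: "punctures n p" and C: "scc (Sig n p) C"
  shows "Poly_Mapping.keys (circle_H1 n p C) \<subseteq> {..<n}"
    "Poly_Mapping.lookup (circle_H1 n p C) j = (if j < n \<and> p j \<in> inside C then 1 else 0)"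
proof -
  obtain \<gamma> where \<gamma>: "parametrizes \<gamma> C" and CX: "C \<subseteq> Sig n p" using C unfolding scc_def by blast
  note g = \<gamma>[unfolded parametrizes_def]
  have nin: "z \<notin> C" if "z \<in> inside C" for z using that inside_no_overlap[of C] by blast
  have "\<exists>\<delta>. parametrizes \<delta> C \<and> counterclockwise \<delta>"
  proof -
    have "simple_path \<gamma>" using g by blast
    then show ?thesis
    proof (cases rule: simple_closed_path_winding_number_inside)
      case 1 then show ?thesis using \<gamma> unfolding counterclockwise_def by blast
    next
      case 2
      have "winding_number (reversepath \<gamma>) z = 1" if "z \<in> inside C" for z
      proof -
        have z: "path \<gamma>" "z \<notin> path_image \<gamma>" "winding_number \<gamma> z = -1" using 2[of z] nin[OF that] that g simple_path_imp_path by auto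
        show ?thesis unfolding winding_number_reversepath[OF z(1,2)] z(3) by simp
      qed
      then show ?thesis using parametrizes_reversepath[OF \<gamma>] g unfolding counterclockwise_def by (intro exI[of _ "reversepath \<gamma>"]) simp
    qed
  qed
  then have "parametrizes (SOME \<delta>. parametrizes \<delta> C \<and> counterclockwise \<delta>) C \<and> counterclockwise (SOME \<delta>. parametrizes \<delta> C \<and> counterclockwise \<delta>)"
    by (rule someI_ex)
  then obtain \<delta> where \<delta>: "\<delta> = (SOME \<delta>. parametrizes \<delta> C \<and> counterclockwise \<delta>)" "parametrizes \<delta> C" "counterclockwise \<delta>" by blast
  note d = \<delta>(2)[unfolded parametrizes_def]
  have cH: "circle_H1 n p C = H1_coords n p (loop_class (Sig n p) \<delta>)" unfolding circle_H1_def \<delta>(1) ..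
  have dp: "path \<delta>" "pathfinish \<delta> = pathstart \<delta>" "path_image \<delta> \<subseteq> Sig n p" using d CX simple_path_imp_path by auto
  note co = H1_coords_loop[OF pn dp, folded cH]
  show keys: "Poly_Mapping.keys (circle_H1 n p C) \<subseteq> {..<n}" by (rule co(1))
  show "Poly_Mapping.lookup (circle_H1 n p C) j = (if j < n \<and> p j \<in> inside C then 1 else 0)"
  proof (cases "j < n")
    case False
    then have "j \<notin> Poly_Mapping.keys (circle_H1 n p C)" using keys by auto
    then show ?thesis using False by (simp add: in_keys_iff)
  next
    case True
    have "p j \<notin> C" using CX True unfolding Sig_def by blast
    then have "winding_number \<delta> (p j) = of_int (if p j \<in> inside C then 1 else 0)"
    proof (cases "p j \<in> inside C")
      case True then show ?thesis using \<delta>(3) d unfolding counterclockwise_def by simp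
    next
      case False
      then show ?thesis using winding_number_simple_curve[OF \<delta>(2)] \<open>p j \<notin> C\<close> by (metis of_int_0)
    qed
    then have "(of_int (Poly_Mapping.lookup (circle_H1 n p C) j) :: complex) = of_int (if p j \<in> inside C then 1 else 0)"
      using co(2)[OF True] by (rule trans[rotated])
    then have "Poly_Mapping.lookup (circle_H1 n p C) j = (if p j \<in> inside C then 1 else 0)" unfolding of_int_eq_iff .
    then show ?thesis using True by simp
  qed
qed

text \<open>The parametrizations \<open>f\<close> and \<open>g\<close> may run either way. Their
  winding numbers agree, and whether these vanish determines which punctures are enclosed.\<close>

lemma circle_H1_homotopic:
  assumes pn: "punctures n p" and C: "scc (Sig n p) C" "scc (Sig n p) C'"
    and par: "parametrizes f C" "parametrizes g C'" and h: "homotopic_loops (Sig n p) f g"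
  shows "circle_H1 n p C = circle_H1 n p C'"
proof (rule poly_mapping_eqI)
  fix j
  show "Poly_Mapping.lookup (circle_H1 n p C) j = Poly_Mapping.lookup (circle_H1 n p C') j"
  proof (cases "j < n")
    case True
    then have pj: "p j \<notin> Sig n p" unfolding Sig_def by blast
    then have "homotopic_loops (- {p j}) f g" using h by (intro homotopic_loops_subset[OF h]) auto
    then have w: "winding_number f (p j) = winding_number g (p j)" by (rule winding_number_homotopic_loops)
    have nC: "p j \<notin> C" "p j \<notin> C'" using pj C unfolding scc_def by auto
    obtain e where e: "\<bar>e\<bar> = 1" "winding_number f (p j) = of_int (if p j \<in> inside C then e else 0)"
      using winding_number_simple_curve[OF par(1)] nC by metis
    obtain e' where e': "\<bar>e'\<bar> = 1" "winding_number g (p j) = of_int (if p j \<in> inside C' then e' else 0)"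
      using winding_number_simple_curve[OF par(2)] nC by metis
    have "(of_int (if p j \<in> inside C then e else 0) :: complex) = of_int (if p j \<in> inside C' then e' else 0)"
      using w unfolding e(2) e'(2) .
    then have "(if p j \<in> inside C then e else 0) = (if p j \<in> inside C' then e' else 0)" unfolding of_int_eq_iff .
    then have "p j \<in> inside C \<longleftrightarrow> p j \<in> inside C'" using e(1) e'(1) by (auto split: if_splits)
    then show ?thesis using circle_H1(2)[OF pn] C by simp
  next
    case False then show ?thesis using circle_H1(2)[OF pn] C by simp
  qed
qed

lemma circle_H1_trivial:
  assumes pn: "punctures n p" and C: "scc (Sig n p) C" "trivial_curve (Sig n p) C"
  shows "circle_H1 n p C = 0"
proof (rule poly_mapping_eqI)
  fix j
  show "Poly_Mapping.lookup (circle_H1 n p C) j = Poly_Mapping.lookup 0 j"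
  proof (cases "j < n")
    case True
    then have pj: "p j \<notin> Sig n p" unfolding Sig_def by blast
    obtain f z where f: "parametrizes f C" "homotopic_loops (Sig n p) f (\<lambda>_. z)" using C(2) unfolding trivial_curve_def by blast
    then have "homotopic_loops (- {p j}) f (\<lambda>_. z)" using pj by (intro homotopic_loops_subset[OF f(2)]) auto
    then have "winding_number f (p j) = winding_number (\<lambda>_. z) (p j)" by (rule winding_number_homotopic_loops)
    moreover have "z \<noteq> p j" using homotopic_loops_imp_subset[OF f(2)] pj by (auto simp: path_image_def)
    then have "winding_number (\<lambda>_. z) (p j) = 0" using winding_number_zero_const by blast
    moreover have nC: "p j \<notin> C" using pj C unfolding scc_def by auto
    obtain e where e: "\<bar>e\<bar> = 1" "winding_number f (p j) = of_int (if p j \<in> inside C then e else 0)"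
      using winding_number_simple_curve[OF f(1)] nC by metis
    ultimately have "(if p j \<in> inside C then e else 0) = 0" by (metis of_int_eq_0_iff)
    then have "p j \<notin> inside C" using e(1) by auto
    then show ?thesis using circle_H1(2)[OF pn] C by simp
  next
    case False then show ?thesis using circle_H1(2)[OF pn] C by simp
  qed
qed

lemma curve_class_self:
  assumes "scc X C" shows "C \<in> curve_class X C"
proof -
  obtain \<gamma> where "parametrizes \<gamma> C" "C \<subseteq> X" using assms unfolding scc_def by blast
  then have "homotopic_loops X \<gamma> \<gamma>" unfolding parametrizes_def by (simp add: homotopic_loops_refl simple_path_imp_path)
  then show ?thesis using assms \<open>parametrizes \<gamma> C\<close> unfolding curve_class_def by blast
qed

lemma class_H1_curve_class:
  assumes pn: "punctures n p" and C: "scc (Sig n p) C"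
  shows "class_H1 n p (curve_class (Sig n p) C) = circle_H1 n p C"
proof -
  have "(SOME C'. C' \<in> curve_class (Sig n p) C) \<in> curve_class (Sig n p) C"
    using curve_class_self[OF C] by (rule someI)
  then show ?thesis unfolding class_H1_def
    using circle_H1_homotopic[OF pn C] unfolding curve_class_def by force
qed

text \<open>Trivial circles get weight 0, so that \<open>Phi\<close>, a sum over the nontrivial
  circles, becomes a \<open>weighted_state\<close> over all circles. For trivial and nontrivial
  circles alike, \<open>h_map\<close> sends this weight to \<open>circle_H1\<close>.\<close>

definition curve_weight :: "complex set \<Rightarrow> complex set \<Rightarrow> (complex set set \<Rightarrow>\<^sub>0 int)" where
  "curve_weight X C = (if trivial_curve X C then 0 else frag_of (curve_class X C))"

lemma h_map_curve_weight:
  assumes "punctures n p" "scc (Sig n p) C"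
  shows "h_map n p (curve_weight (Sig n p) C) = circle_H1 n p C"
  using class_H1_curve_class[OF assms] circle_H1_trivial[OF assms] unfolding h_map_def curve_weight_def by simp

lemma curve_weight_eqI:
  assumes C: "C \<subseteq> X" "C' \<subseteq> X" and par: "parametrizes f C" "parametrizes g C'"
    and h: "homotopic_loops X f g \<or> homotopic_loops X f (reversepath g)"
  shows "curve_weight X C = curve_weight X C'"
proof -
  obtain k where k: "parametrizes k C'" "homotopic_loops X f k" using h par(2) parametrizes_reversepath by blast
  have "trivial_curve X C \<longleftrightarrow> trivial_curve X C'"
    using trivial_curve_any[OF _ C(1) par(1)] trivial_curve_any[OF _ C(2) k(1)] k par(1) homotopic_loops_trans homotopic_loops_sym
    unfolding trivial_curve_def by metis
  then show ?thesis using curve_class_eqI[OF C par h] unfolding curve_weight_def by simp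
qed

lemma coeff_sum_superset:
  assumes "finite K" "Poly_Mapping.keys v \<subseteq> K"
  shows "coeff_sum v = (\<Sum>c\<in>K. Poly_Mapping.lookup v c)"
  unfolding coeff_sum_def using assms by (intro sum.mono_neutral_left) (auto simp: in_keys_iff)

lemma coeff_sum_add: "coeff_sum (v + w) = coeff_sum v + coeff_sum w"
proof -
  let ?K = "Poly_Mapping.keys v \<union> Poly_Mapping.keys w"
  show ?thesis
    using coeff_sum_superset[of ?K v] coeff_sum_superset[of ?K w] coeff_sum_superset[of ?K "v + w"] keys_add[of v w]
    by (simp add: lookup_add sum.distrib)
qed

lemma coeff_sum_diff: "coeff_sum (v - w) = coeff_sum v - coeff_sum w"
  using coeff_sum_add[of "v - w" w] by simp

lemma coeff_sum_le_order:
  "coeff_sum_le a a" "coeff_sum_le a b \<Longrightarrow> coeff_sum_le b c \<Longrightarrow> coeff_sum_le a c"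
  "coeff_sum_le a b \<Longrightarrow> coeff_sum_le b a \<Longrightarrow> a = b" "coeff_sum_le a b \<Longrightarrow> coeff_sum_le (a + d) (b + d)"
  unfolding coeff_sum_le_def by (auto simp: coeff_sum_add)

lemma product_le_order:
  "product_le a a" "product_le a b \<Longrightarrow> product_le b c \<Longrightarrow> product_le a c"
  "product_le a b \<Longrightarrow> product_le b a \<Longrightarrow> a = b" "product_le a b \<Longrightarrow> product_le (a + d) (b + d)"
  unfolding product_le_def using order_trans poly_mapping_eqI[of a b]
  by (blast, blast, metis order_antisym, simp add: lookup_add)

lemma coeff_sum_curve_weight: "coeff_sum (curve_weight X C) = (if trivial_curve X C then 0 else 1)"
  unfolding curve_weight_def coeff_sum_def by simp

context link_diagram
begin

lemma circle_scc:
  assumes "C \<in> circles D S" shows "scc (Sig n p) C"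
  using circles_props(2,3)[OF assms] unfolding scc_def closed_curve_def parametrizes_def by blast

lemma Phi_weighted: "Phi n p D = weighted_state (curve_weight (Sig n p))"
proof (rule ext, clarify)
  fix S s
  have "(\<Sum>C\<in>{C \<in> circles D S. \<not> trivial_curve (Sig n p) C}. frag_cmul (s C) (frag_of (curve_class (Sig n p) C)))
      = (\<Sum>C\<in>circles D S. frag_cmul (s C) (curve_weight (Sig n p) C))"
    using circles_props(1) by (intro sum.mono_neutral_cong_left) (auto simp: curve_weight_def)
  then show "Phi n p D (S, s) = weighted_state (curve_weight (Sig n p)) (S, s)" unfolding Phi_def weighted_state_def by simp
qed

lemma g_Sigma_weighted: "g_Sigma n p D = weighted_state (circle_H1 n p)"
  unfolding g_Sigma_def weighted_state_def ..

text \<open>At each puncture the winding number of a circle is its coefficient up to an unknown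
  sign, and the three winding numbers add up. For nonnegative integers a signed relation of this
  kind implies all three triangle inequalities.\<close>

lemma pants_product_le:
  assumes P: "pants c K K' w" and sub: "leg1 c K w \<subseteq> Sig n p" "leg2 c K' w \<subseteq> Sig n p" "waist c K K' w \<subseteq> Sig n p"
  shows "product_le (circle_H1 n p (waist c K K' w)) (circle_H1 n p (leg1 c K w) + circle_H1 n p (leg2 c K' w))
      \<and> product_le (circle_H1 n p (leg1 c K w) - circle_H1 n p (leg2 c K' w)) (circle_H1 n p (waist c K K' w))
      \<and> product_le (circle_H1 n p (leg2 c K' w) - circle_H1 n p (leg1 c K w)) (circle_H1 n p (waist c K K' w))"
proof -
  define A B C where "A = leg1 c K w" and "B = leg2 c K' w" and "C = waist c K K' w"
  obtain a b g where par: "parametrizes a A" "parametrizes b B" "parametrizes g C"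
    and w: "\<And>z. z \<notin> Sig n p \<Longrightarrow> winding_number g z = winding_number a z + winding_number b z"
    unfolding A_def B_def C_def by (rule pants_loops[OF P sub(1,2)]) blast
  have s: "scc (Sig n p) A" "scc (Sig n p) B" "scc (Sig n p) C" using par sub unfolding A_def B_def C_def scc_def by blast+
  define I where "I E j = Poly_Mapping.lookup (circle_H1 n p E) j" for E j
  have I: "0 \<le> I A j \<and> 0 \<le> I B j \<and> 0 \<le> I C j \<and> I C j \<le> I A j + I B j \<and> I A j \<le> I C j + I B j \<and> I B j \<le> I C j + I A j" for j
  proof (cases "j < n")
    case True
    then have pj: "p j \<notin> Sig n p" unfolding Sig_def by blast
    then have nin: "p j \<notin> A" "p j \<notin> B" "p j \<notin> C" using s unfolding scc_def by auto
    have wn: "\<exists>e. \<bar>e\<bar> = 1 \<and> winding_number f (p j) = of_int (e * I E j)" if E: "parametrizes f E" "scc (Sig n p) E" "p j \<notin> E" for f E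
    proof -
      obtain e where "\<bar>e\<bar> = 1" "winding_number f (p j) = of_int (if p j \<in> inside E then e else 0)"
        using winding_number_simple_curve[OF E(1)] E(3) by metis
      moreover have "I E j = (if p j \<in> inside E then 1 else 0)" unfolding I_def circle_H1(2)[OF punct E(2)] using True by simp
      ultimately show ?thesis by (intro exI[of _ e]) simp
    qed
    obtain e1 where e1: "\<bar>e1\<bar> = 1" "winding_number a (p j) = of_int (e1 * I A j)" using wn[OF par(1) s(1) nin(1)] by blast
    obtain e2 where e2: "\<bar>e2\<bar> = 1" "winding_number b (p j) = of_int (e2 * I B j)" using wn[OF par(2) s(2) nin(2)] by blast
    obtain e3 where e3: "\<bar>e3\<bar> = 1" "winding_number g (p j) = of_int (e3 * I C j)" using wn[OF par(3) s(3) nin(3)] by blast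
    have "(of_int (e3 * I C j) :: complex) = of_int (e1 * I A j + e2 * I B j)"
      using w[OF pj] unfolding e1(2) e2(2) e3(2) by simp
    then have "e3 * I C j = e1 * I A j + e2 * I B j" by (metis of_int_eq_iff)
    moreover have "I A j \<ge> 0" "I B j \<ge> 0" "I C j \<ge> 0" unfolding I_def circle_H1(2)[OF punct s(1)] circle_H1(2)[OF punct s(2)] circle_H1(2)[OF punct s(3)] by simp_all
    moreover have "e1 = 1 \<or> e1 = -1" "e2 = 1 \<or> e2 = -1" "e3 = 1 \<or> e3 = -1" using e1(1) e2(1) e3(1) by arith+
    ultimately show ?thesis by (elim disjE; simp; linarith)
  next
    case False
    then show ?thesis unfolding I_def circle_H1(2)[OF punct s(1)] circle_H1(2)[OF punct s(2)] circle_H1(2)[OF punct s(3)] by simp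
  qed
  then show ?thesis
    unfolding A_def[symmetric] B_def[symmetric] C_def[symmetric] product_le_def lookup_add lookup_minus I_def
    by (auto simp: algebra_simps)
qed

text \<open>The coefficient sum of a weight is 0 or 1. If all three circles are nontrivial, the
  inequalities are strict: 1 < 2 and 0 < 1. If one circle is trivial, its weight is 0 and the other
  two weights are equal, which gives equality or a strict inequality in each case.\<close>

lemma pants_coeff_sum_le:
  assumes P: "pants c K K' w" and sub: "leg1 c K w \<subseteq> Sig n p" "leg2 c K' w \<subseteq> Sig n p" "waist c K K' w \<subseteq> Sig n p"
  defines "\<kappa> \<equiv> curve_weight (Sig n p)"
  shows "coeff_sum_le (\<kappa> (waist c K K' w)) (\<kappa> (leg1 c K w) + \<kappa> (leg2 c K' w))
      \<and> coeff_sum_le (\<kappa> (leg1 c K w) - \<kappa> (leg2 c K' w)) (\<kappa> (waist c K K' w))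
      \<and> coeff_sum_le (\<kappa> (leg2 c K' w) - \<kappa> (leg1 c K w)) (\<kappa> (waist c K K' w))"
proof -
  define A B C where "A = leg1 c K w" and "B = leg2 c K' w" and "C = waist c K K' w"
  define T where "T = trivial_curve (Sig n p)"
  obtain a b g where par: "parametrizes a A" "parametrizes b B" "parametrizes g C"
    and h: "(\<exists>z. homotopic_loops (Sig n p) a (\<lambda>_. z)) \<Longrightarrow> homotopic_loops (Sig n p) g b"
    "(\<exists>z. homotopic_loops (Sig n p) b (\<lambda>_. z)) \<Longrightarrow> homotopic_loops (Sig n p) g a"
    "(\<exists>z. homotopic_loops (Sig n p) g (\<lambda>_. z)) \<Longrightarrow> homotopic_loops (Sig n p) a (reversepath b)"
    unfolding A_def B_def C_def by (rule pants_loops[OF P sub(1,2)]) blast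
  note sub' = sub[folded A_def B_def C_def]
  have t: "T A \<Longrightarrow> \<kappa> C = \<kappa> B" "T B \<Longrightarrow> \<kappa> C = \<kappa> A" "T C \<Longrightarrow> \<kappa> A = \<kappa> B"
    using h trivial_curve_any[OF _ sub'(1) par(1)] trivial_curve_any[OF _ sub'(2) par(2)] trivial_curve_any[OF _ sub'(3) par(3)]
      curve_weight_eqI[OF sub'(3,2) par(3,2)] curve_weight_eqI[OF sub'(3,1) par(3,1)] curve_weight_eqI[OF sub'(1,2) par(1,2)]
    unfolding T_def \<kappa>_def by blast+
  have z: "\<kappa> E = 0" if "T E" for E using that unfolding \<kappa>_def T_def curve_weight_def by simp
  have cs: "coeff_sum (\<kappa> E) = (if T E then 0 else 1)" for E unfolding \<kappa>_def T_def by (rule coeff_sum_curve_weight)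
  show ?thesis
    unfolding A_def[symmetric] B_def[symmetric] C_def[symmetric] coeff_sum_le_def coeff_sum_add coeff_sum_diff cs
    using t z by (cases "T A"; cases "T B"; cases "T C") auto
qed

text \<open>A filtration enters only through its order, the inequalities at a single pair of pants
  and the range of the weights; the rest of the complex is common to both theories.\<close>

lemma graded_filtration_weighted:
  fixes \<kappa> :: "complex set \<Rightarrow> ('c \<Rightarrow>\<^sub>0 int)" and le :: "('c \<Rightarrow>\<^sub>0 int) \<Rightarrow> ('c \<Rightarrow>\<^sub>0 int) \<Rightarrow> bool"
  assumes order: "\<And>a. le a a" "\<And>a b c. le a b \<Longrightarrow> le b c \<Longrightarrow> le a c" "\<And>a b. le a b \<Longrightarrow> le b a \<Longrightarrow> a = b"
      "\<And>a b d. le a b \<Longrightarrow> le (a + d) (b + d)"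
    and loc: "\<And>c K K' w. pants c K K' w \<Longrightarrow> leg1 c K w \<subseteq> Sig n p \<Longrightarrow> leg2 c K' w \<subseteq> Sig n p \<Longrightarrow> waist c K K' w \<subseteq> Sig n p \<Longrightarrow>
      le (\<kappa> (waist c K K' w)) (\<kappa> (leg1 c K w) + \<kappa> (leg2 c K' w)) \<and> le (\<kappa> (leg1 c K w) - \<kappa> (leg2 c K' w)) (\<kappa> (waist c K K' w))
      \<and> le (\<kappa> (leg2 c K' w) - \<kappa> (leg1 c K w)) (\<kappa> (waist c K K' w))"
    and keys: "\<And>C. scc (Sig n p) C \<Longrightarrow> Poly_Mapping.keys (\<kappa> C) \<subseteq> V"
  shows "graded_filtration D {v. Poly_Mapping.keys v \<subseteq> V} le (weighted_state \<kappa>)"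
proof
  show "finite (states D)" by (rule finite_states)
next
  fix x y assume x: "x \<in> states D" and y: "y \<in> Poly_Mapping.keys (bd_state D x)"
  show "y \<in> states D \<and> hdeg D y = hdeg D x + 1 \<and> qdeg D y = qdeg D x \<and> le (weighted_state \<kappa> y) (weighted_state \<kappa> x)"
    using bd_state_graded[OF x y] bd_state_filtered[where le = le and \<kappa> = \<kappa>, OF x y order(4) loc] by blast
next
  fix x assume "x \<in> states D"
  then show "bd D (bd_state D x) = 0" using bd_bd_state unfolding states_def by auto
next
  fix x assume "x \<in> states D"
  obtain S s where Ss: "x = (S, s)" by fastforce
  have "Poly_Mapping.keys (frag_cmul (s C) (\<kappa> C)) \<subseteq> V" if "C \<in> circles D S" for C
    using keys[OF circle_scc[OF that]] keys_cmul[of "s C" "\<kappa> C"] by blast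
  then have "(\<Union>C\<in>circles D S. Poly_Mapping.keys (frag_cmul (s C) (\<kappa> C))) \<subseteq> V" by blast
  with keys_sum[of "\<lambda>C. frag_cmul (s C) (\<kappa> C)" "circles D S"]
  have "Poly_Mapping.keys (\<Sum>C\<in>circles D S. frag_cmul (s C) (\<kappa> C)) \<subseteq> V" by (rule subset_trans)
  then show "weighted_state \<kappa> x \<in> {v. Poly_Mapping.keys v \<subseteq> V}" unfolding Ss weighted_state_def by simp
qed (use order(1-3) in blast)+

lemma h_map_Phi: "h_map n p (Phi n p D x) = g_Sigma n p D x"
proof -
  obtain S s where Ss: "x = (S, s)" by fastforce
  have "h_map n p (Phi n p D x) = (\<Sum>C\<in>circles D S. frag_cmul (s C) (h_map n p (curve_weight (Sig n p) C)))"
    unfolding Phi_weighted Ss weighted_state_def h_map_def using circles_props(1) by (simp add: frag_extend_sum frag_extend_cmul o_def)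
  also have "\<dots> = g_Sigma n p D x"
    unfolding g_Sigma_def Ss using h_map_curve_weight[OF punct circle_scc] by simp
  finally show ?thesis .
qed

lemma euler_char_MKh:
  "euler_char {..<n} (MKh n p D) = (\<Sum>x\<in>states D. frag_cmul (if even (hdeg D x) then 1 else -1) (lmonom (qdeg D x) (g_Sigma n p D x)))"
  unfolding MKh_def int_vectors_def g_Sigma_weighted
  by (rule euler_char_gr_homology, rule graded_filtration_weighted)
     (fact product_le_order pants_product_le circle_H1(1)[OF punct])+

lemma euler_char_APS:
  "euler_char (curve_classes (Sig n p)) (APS n p D) =
    (\<Sum>x\<in>states D. frag_cmul (if even (hdeg D x) then 1 else -1) (lmonom (qdeg D x) (Phi n p D x)))"
  unfolding APS_def curve_group_def Phi_weighted
proof (rule euler_char_gr_homology, rule graded_filtration_weighted)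
  fix C assume "scc (Sig n p) C"
  then show "Poly_Mapping.keys (curve_weight (Sig n p) C) \<subseteq> curve_classes (Sig n p)"
    unfolding curve_weight_def curve_classes_def by auto
qed (fact coeff_sum_le_order pants_coeff_sum_le)+

end

theorem theorem1p2:
  fixes n :: nat and p :: "nat \<Rightarrow> complex" and L :: link and D :: diagram
  assumes "punctures n p"
    and "is_link n p L"
    and "is_diagram_of n p L D"
  shows "\<exists>\<chi>h \<in> ring_hom (laurent_ring (curve_classes (Sig n p))) (laurent_ring {..<n}).
           \<chi>h qvar = qvar \<and>
           (\<forall>c\<in>curve_classes (Sig n p). \<chi>h (lvar c) = lmonom 0 (h_map n p (frag_of c))) \<and>
           \<chi>h (euler_char (curve_classes (Sig n p)) (APS n p D)) = euler_char {..<n} (MKh n p D)"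
proof -
  interpret link_diagram n p L D by standard (use assms in auto)
  \<comment> \<open>The map is prescribed on whole monomials instead of on the variables, so that
    inverse variables require no separate treatment.\<close>
  define \<chi>h where "\<chi>h = frag_extend (\<lambda>(j, v). lmonom j (h_map n p v))"
  have mono: "\<chi>h (lmonom j v) = lmonom j (h_map n p v)" for j v unfolding \<chi>h_def lmonom_def by simp
  have "Poly_Mapping.keys (h_map n p v) \<subseteq> {..<n}" if "Poly_Mapping.keys v \<subseteq> curve_classes (Sig n p)" for v
  proof -
    have "Poly_Mapping.keys (class_H1 n p c) \<subseteq> {..<n}" if c: "c \<in> curve_classes (Sig n p)" for c
    proof -
      obtain C where "c = curve_class (Sig n p) C" "scc (Sig n p) C" using c unfolding curve_classes_def by blast
      then show ?thesis using circle_H1(1)[OF assms(1)] class_H1_curve_class[OF assms(1)] by simp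
    qed
    then show ?thesis using keys_frag_extend[of "class_H1 n p" v] that unfolding h_map_def by blast
  qed
  then have "\<chi>h \<in> ring_hom (laurent_ring (curve_classes (Sig n p))) (laurent_ring {..<n})"
    unfolding \<chi>h_def by (intro monomial_substitution_ring_hom) (simp_all add: h_map_def frag_extend_add)
  moreover have "\<chi>h qvar = qvar" unfolding qvar_def mono by (simp add: h_map_def)
  moreover have "\<chi>h (lvar c) = lmonom 0 (h_map n p (frag_of c))" for c unfolding lvar_def mono ..
  moreover have "\<chi>h (euler_char (curve_classes (Sig n p)) (APS n p D)) = euler_char {..<n} (MKh n p D)"
  proof -
    have "\<chi>h (euler_char (curve_classes (Sig n p)) (APS n p D)) =
        (\<Sum>x\<in>states D. frag_cmul (if even (hdeg D x) then 1 else -1) (\<chi>h (lmonom (qdeg D x) (Phi n p D x))))"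
      unfolding euler_char_APS \<chi>h_def frag_extend_sum[OF finite_states] o_def frag_extend_cmul ..
    then show ?thesis unfolding mono h_map_Phi euler_char_MKh .
  qed
  ultimately show ?thesis by blast
qed

end
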